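(* Let $n\ge2$, let $\omega(k)=\sum_{j=2}^n\omega_jk^j$ be a polynomial with real coefficients and $\omega_n\neq0$, and let $m\ge-1$ be an integer. With the notation of the context ($I_{\omega,m}$, $K_t$, $\sigma$, $X$, $\Phi_{|x|/t}$, $z_j$, $\theta_j$, $N(n)$), for $t>0$, as $|x/t|\to\infty$, $$I_{\omega,m}(x,t)=-i\operatorname*{Res}_{k=0}\left(\frac{e^{ikx-i\omega(k)t}}{(ik)^{m+1}}\right)\chi_{(-\infty,0)}(x)+\frac{\sigma^{m}|x|^{-1/2}}{\sqrt{2\pi}}\left(\frac{|x|}t\right)^{-\frac{m+1/2}{n-1}}\sum_{j=1}^{N(n)}\frac{e^{X\Phi_{|x|/t}(z_j)+i\theta_j}}{(iz_j)^{m+1}}\,\frac1{|\Phi''_{|x|/t}(z_j)|^{1/2}}\left(1+\mathcal O\!\left(|x|^{-1}\left(\frac{|x|}t\right)^{-1/(n-1)}\right)\right).$$ Hence: (a) For fixed $t>0$, as $|x|\to\infty$, the $m$-th derivative ($m\ge0$) of $K_t$ satisfies $$|K_t^{(m)}(x)|\le c\begin{cases}|x|^{\frac{2m-n+2}{2(n-1)}},& n\text{ even},\\ |x|^{\frac{2m-n+2}{2(n-1)}},&n\text{ odd},\ \omega_nx>0,\\ |x|^{-M}\ \text{for all }M>0,& n\text{ odd},\ \omega_nx<0,\end{cases}$$ where $c$ depends on $m$, $t$ and $n$. (b) For $|x|\ge\delta>0$ and $m\ge0$, as $t\to0^+$, $$I_{\omega,m}(x,t)=-i\operatorname*{Res}_{k=0}\left(\frac{e^{ikx-i\omega(k)t}}{(ik)^{m+1}}\right)\chi_{(-\infty,0)}(x)+\mathcal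 O\!\left(t^{\frac{m+1/2}{n-1}}|x|^{-\frac{2m+2n}{2(n-1)}}\right).$$
   Context: $I_{\omega,m}(x,t)=\frac1{2\pi}\int_C\frac{e^{ikx-i\omega(k)t}}{(ik)^{m+1}}\,dk$, where $C$ is a contour in the closed upper half-plane running from $-\infty$ to $+\infty$ along the real axis except that it avoids $k=0$ by a semicircle of radius less than 1 in the upper half-plane ($C$ is replaced by $\mathbb R$ if $m=-1$). The kernel $K_t(x)=I_{\omega,-1}(x,t)=\frac1{2\pi}\int_{\mathbb R}e^{ikx-i\omega(k)t}dk$ is the convolution kernel of the solution operator of $iq_t-\omega(-i\partial_x)q=0$. $\chi_A$ is the characteristic function of $A$. For $x\ne0$, $t>0$: $\sigma=\operatorname{sign}(x)$, $X=|x|\,(|x|/t)^{1/(n-1)}$, $R_{|x|/t}(z)=\sum_{j=2}^{n-1}\omega_j(|x|/t)^{\frac{j-n}{n-1}}(\sigma z)^j$, and $\Phi_{|x|/t}(z)=iz-i\omega_n\sigma^nz^n-iR_{|x|/t}(z)$; these arise from the substitution $k=\sigma(|x|/t)^{1/(n-1)}z$, under which $ikx-i\omega(k)t=X\Phi_{|x|/t}(z)$. The points $z_1,\dots,z_{N(n)}$ are the solutions of $\Phi'_{|x|/t}(z)=0$ in the closed upper half-plane (for $|x|/t$ sufficiently large, $\Phi'_{|x|/t}$ has $n-1$ distinct roots), and $N(n)$ is their number. $\theta_j$ is the direction (angle) at which the path of steepest descent through $z_j$ leaves $z_j$ with increasing real part.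
   Formalization: In (b) the exponent of |x| is corrected to -(2m+n)/(2(n-1)), the printed one being false uniformly on |x|≥δ; the printed exponent is proved for δ≤|x|≤L. θ_j is taken with increasing real part of k (not z), without which the factor σ^m has the wrong sign for x<0. *)

theory Defs
  imports "HOL-Complex_Analysis.Complex_Analysis"
begin

text \<open>
  Throughout, \<open>w j\<close> is the real coefficient of \<open>k ^ j\<close> in the dispersion relation of degree \<open>n\<close>.
\<close>

definition dispersion :: "(nat \<Rightarrow> real) \<Rightarrow> nat \<Rightarrow> complex \<Rightarrow> complex" where
  "dispersion w n k = (\<Sum>j=2..n. of_real (w j) * k ^ j)"

definition integrand :: "(nat \<Rightarrow> real) \<Rightarrow> nat \<Rightarrow> int \<Rightarrow> real \<Rightarrow> real \<Rightarrow> complex \<Rightarrow> complex" where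
  "integrand w n m x t k =
     exp (\<i> * k * of_real x - \<i> * dispersion w n k * of_real t) / (\<i> * k) powi (m + 1)"

text \<open>
  The part of the contour \<open>C\<close> between the real points \<open>- a\<close> and \<open>b\<close> (for \<open>a, b > r\<close>); the
  middle piece is the semicircle of radius \<open>r\<close> in the upper half-plane, traversed clockwise.
\<close>

definition contour :: "real \<Rightarrow> int \<Rightarrow> real \<Rightarrow> real \<Rightarrow> real \<Rightarrow> complex" where
  "contour r m a b =
     (if m = -1 then linepath (of_real (- a)) (of_real b)
      else linepath (of_real (- a)) (of_real (- r)) +++ part_circlepath 0 r pi 0
             +++ linepath (of_real r) (of_real b))"

text \<open>
  The integrals over \<open>C\<close> and over the real line are in general only conditionally convergent, so
  they are improper integrals, with both end points tending to infinity independently.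
\<close>

definition osc_integral :: "(nat \<Rightarrow> real) \<Rightarrow> nat \<Rightarrow> real \<Rightarrow> int \<Rightarrow> real \<Rightarrow> real \<Rightarrow> complex" where
  "osc_integral w n r m x t =
     1 / (2 * of_real pi) *
     Lim (at_top \<times>\<^sub>F at_top)
       (\<lambda>(a, b). contour_integral (contour r m a b) (integrand w n m x t))"

definition solution_kernel :: "(nat \<Rightarrow> real) \<Rightarrow> nat \<Rightarrow> real \<Rightarrow> real \<Rightarrow> complex" where
  "solution_kernel w n t x =
     1 / (2 * of_real pi) *
     Lim (at_top \<times>\<^sub>F at_top)
       (\<lambda>(a, b). contour_integral (linepath (of_real (- a)) (of_real b))
          (\<lambda>k. exp (\<i> * k * of_real x - \<i> * dispersion w n k * of_real t)))"

definition iterated_vderiv :: "nat \<Rightarrow> (real \<Rightarrow> complex) \<Rightarrow> real \<Rightarrow> complex" where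
  "iterated_vderiv m f = ((\<lambda>g y. vector_derivative g (at y)) ^^ m) f"

definition residue_term :: "(nat \<Rightarrow> real) \<Rightarrow> nat \<Rightarrow> int \<Rightarrow> real \<Rightarrow> real \<Rightarrow> complex" where
  "residue_term w n m x t = - \<i> * residue (integrand w n m x t) 0 * indicator {..<0} x"

definition large_param :: "nat \<Rightarrow> real \<Rightarrow> real \<Rightarrow> real" where
  "large_param n x t = \<bar>x\<bar> * (\<bar>x\<bar> / t) powr (1 / (real n - 1))"

definition phase_rest :: "(nat \<Rightarrow> real) \<Rightarrow> nat \<Rightarrow> real \<Rightarrow> real \<Rightarrow> complex \<Rightarrow> complex" where
  "phase_rest w n x t z =
     (\<Sum>j=2..n-1. of_real (w j * (\<bar>x\<bar> / t) powr ((real j - real n) / (real n - 1)))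
                     * (of_real (sgn x) * z) ^ j)"

definition phase :: "(nat \<Rightarrow> real) \<Rightarrow> nat \<Rightarrow> real \<Rightarrow> real \<Rightarrow> complex \<Rightarrow> complex" where
  "phase w n x t z =
     \<i> * z - \<i> * of_real (w n) * of_real (sgn x) ^ n * z ^ n - \<i> * phase_rest w n x t z"

definition stationary_points :: "(nat \<Rightarrow> real) \<Rightarrow> nat \<Rightarrow> real \<Rightarrow> real \<Rightarrow> complex set" where
  "stationary_points w n x t = {z. deriv (phase w n x t) z = 0 \<and> Im z \<ge> 0}"

text \<open>
  A path of steepest descent is a level curve of \<open>Im \<Phi>\<close> along which \<open>Re \<Phi>\<close> decreases; it
  leaves \<open>z0\<close> at the angle \<open>\<theta>\<close> if its one-sided unit tangent at \<open>z0\<close> is \<open>cis \<theta>\<close>.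
\<close>

definition leaves_at_angle :: "(complex \<Rightarrow> complex) \<Rightarrow> complex \<Rightarrow> real \<Rightarrow> bool" where
  "leaves_at_angle \<Phi> z0 \<theta> \<longleftrightarrow>
     (\<exists>\<gamma> \<epsilon>. 0 < \<epsilon> \<and> \<gamma> 0 = z0 \<and> continuous_on {0..\<epsilon>} \<gamma> \<and>
        (\<gamma> has_vector_derivative cis \<theta>) (at 0 within {0..\<epsilon>}) \<and>
        (\<forall>u\<in>{0..\<epsilon>}. Im (\<Phi> (\<gamma> u)) = Im (\<Phi> z0)) \<and>
        strict_antimono_on {0..\<epsilon>} (\<lambda>u. Re (\<Phi> (\<gamma> u))))"

text \<open>
  Of the two opposite directions in which the path leaves a stationary point, the relevant one is
  that of the orientation of \<open>C\<close>, i.e. of increasing real part of the integration variable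
  \<open>k = \<sigma> (\<bar>x\<bar>/t) powr (1/(n-1)) * z\<close>. In the \<open>z\<close>-plane this means \<open>\<sigma> * cos \<theta> > 0\<close>, so that
  for \<open>x < 0\<close> the substitution reverses the direction. The angle is determined up to multiples
  of \<open>2 * pi\<close>, and only \<open>cis \<theta>\<close> is used.
\<close>

definition descent_angle :: "(nat \<Rightarrow> real) \<Rightarrow> nat \<Rightarrow> real \<Rightarrow> real \<Rightarrow> complex \<Rightarrow> real" where
  "descent_angle w n x t z =
     (SOME \<theta>. leaves_at_angle (phase w n x t) z \<theta> \<and> sgn x * cos \<theta> > 0)"

end

theory Submission
  imports Defs "HOL-Probability.Distributions" "HOL-Real_Asymp.Real_Asymp"
begin

text \<open>
  After the substitution \<open>k = \<sigma> \<kappa> z\<close> with \<open>\<kappa> = (\<bar>x\<bar>/t) powr (1/(n-1))\<close> the exponent is \<open>X\<close> times a phase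
  \<open>\<Phi>\<close> depending on the small parameter \<open>\<epsilon> = 1/\<kappa>\<close> only, and at \<open>\<epsilon> = 0\<close> it is \<open>i (z - b z^n)\<close>. The integrand
  has a primitive \<open>H\<close> on the plane slit along the lower imaginary axis, so the contour integral is
  the difference of the limits of \<open>H\<close> at the two ends of the contour, and no contour has to be
  deformed: \<open>H\<close> changes by \<open>O(X powr (-3/2) exp (X M))\<close> along any path on which \<open>Re \<Phi>\<close> stays below its
  largest value \<open>M\<close> at the stationary points, and by a Gaussian integral across a dominating
  stationary point. It therefore suffices to join the ends, the dominating stationary points and
  their neighbourhoods inside the region where \<open>Re \<Phi> < M\<close> for \<open>\<epsilon> = 0\<close>. Stationary points of lower
  height contribute less than the error. For \<open>x < 0\<close> the substitution turns the contour
  upside down, so that it passes below \<open>0\<close>: this is the residue.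

  The bounds (a) and (b) follow by estimating the same difference \<open>J\<close>; when \<open>n\<close> is odd and
  \<open>\<omega>\<^sub>n x < 0\<close> all stationary points in the closed upper half-plane are off the real axis and \<open>M < 0\<close>.
\<close>

text \<open>Letting |x|/t grow does not make the large parameter large: for small |x| the number X
  may be anything positive while e tends to 0. Hence e and X are independent parameters, each error
  constant has to serve all e near 0 and all admissible X at once, and the estimates need a form
  that survives X -> 0. Errors are compared with the level M at the actual e, since X times the
  change of M is not controlled. For the same reason real stationary points must be shown to stay
  exactly real, where the phase is purely imaginary. For derivatives of the kernel, whose amplitude
  grows at infinity, X >= 1 is imposed.

  The integrals converge only conditionally, so both ends of the contour are moved to horizontal
  lines with exponential decay. The side of the real axis on which such a line lies depends on the
  end and on the sign of the leading coefficient. If there is a real stationary point towards an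
  end, the line lies below the axis while 0 is passed above, so the path must cross the axis at that
  point. This is the reason for the case distinction in the choice of path.\<close>

section \<open>Taylor, Gaussian and Laplace estimates\<close>

text \<open>Cauchy's inequality on discs of radius \<open>R / 2\<close> about the points of
  \<open>cball z (R / 4)\<close>, all inside \<open>ball z R\<close>, bounds the derivative in the
  Taylor remainder. The constant depends on \<open>R\<close>, \<open>B\<close> and \<open>N\<close>
  alone, which makes the saddle point estimate uniform over a family of phases.\<close>

lemma holomorphic_Taylor_bound:
  assumes f: "f holomorphic_on ball z R" and B: "\<And>u. u \<in> ball z R \<Longrightarrow> cmod (f u) \<le> B"
    and R: "0 < R" and h: "cmod h \<le> R / 4"
  shows "cmod (f (z + h) - (\<Sum>i\<le>N. (deriv ^^ i) f z * h ^ i / fact i))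
           \<le> (fact (Suc N) * B / (R / 2) ^ Suc N) * cmod h ^ Suc N / fact N"
proof -
  have sub: "cball u (R / 2) \<subseteq> ball z R" if "u \<in> cball z (R / 4)" for u
  proof
    fix v assume "v \<in> cball u (R / 2)"
    then have "dist z v \<le> R / 4 + R / 2"
      using that dist_triangle[of z v u] by simp
    then show "v \<in> ball z R" using R by simp
  qed
  have "cmod ((deriv ^^ 0) f (z + h) - (\<Sum>i\<le>N. (deriv ^^ i) f z * ((z + h) - z) ^ i / fact i))
          \<le> (fact (Suc N) * B / (R / 2) ^ Suc N) * cmod ((z + h) - z) ^ Suc N / fact N"
  proof (rule complex_Taylor[where S = "cball z (R / 4)"])
    fix i u assume u: "u \<in> cball z (R / 4)"
    have "u \<in> ball z R" using u R by simp
    then have "((deriv ^^ i) f has_field_derivative deriv ((deriv ^^ i) f) u) (at u)"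
      using holomorphic_higher_deriv[OF f open_ball, of i] by (metis holomorphic_derivI open_ball)
    then show "((deriv ^^ i) f has_field_derivative (deriv ^^ Suc i) f u) (at u within cball z (R / 4))"
      by (simp add: has_field_derivative_at_within)
  next
    fix u assume u: "u \<in> cball z (R / 4)"
    show "cmod ((deriv ^^ Suc N) f u) \<le> fact (Suc N) * B / (R / 2) ^ Suc N"
    proof (rule Cauchy_inequality)
      show "f holomorphic_on ball u (R / 2)"
        using sub[OF u] f by (meson ball_subset_cball holomorphic_on_subset order_trans)
      show "continuous_on (cball u (R / 2)) f"
        using sub[OF u] f by (meson holomorphic_on_subset holomorphic_on_imp_continuous_on)
      fix v assume "cmod (u - v) = R / 2"
      then show "cmod (f v) \<le> B" using sub[OF u] B by (auto simp: dist_norm subset_iff)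
    qed (use R in auto)
  qed (use R h in \<open>auto simp: dist_norm\<close>)
  then show ?thesis by simp
qed

text \<open>The substitution \<open>sqrt c * s\<close> reduces both integrals to even moments of the
  standard Gaussian; \<open>st\<close> below is the general moment, used for \<open>k = 0\<close>
  and \<open>k = 1\<close>.\<close>

lemma has_integral_gaussian:
  fixes c :: real
  assumes c: "c > 0"
  shows "((\<lambda>s. exp (- (c * s\<^sup>2))) has_integral sqrt (pi / c)) UNIV"
    and "((\<lambda>s. s\<^sup>2 * exp (- (c * s\<^sup>2))) has_integral sqrt pi / 2 * c powr (- 3 / 2)) UNIV"
proof -
  have st: "((\<lambda>s. exp (- (c * s\<^sup>2)) * (c * s\<^sup>2) ^ k) has_integral
      1 / sqrt c * (sqrt pi * (fact (2 * k) / (2 ^ (2 * k) * fact k)))) UNIV" for k :: nat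
  proof -
    define I where "I = sqrt pi * (fact (2 * k) / (2 ^ (2 * k) * fact k))"
    have "has_bochner_integral lborel (\<lambda>x::real. exp (-x\<^sup>2) * x ^ (2 * k)) I"
      using has_bochner_integral_even_function[OF gaussian_moment_even_pos[where k = k]]
      by (simp add: I_def)
    then have "has_bochner_integral lborel (\<lambda>x. exp (-(0 + sqrt c * x)\<^sup>2) * (0 + sqrt c * x) ^ (2 * k))
        (I /\<^sub>R \<bar>sqrt c\<bar>)"
      by (subst (asm) lborel_has_bochner_integral_real_affine_iff[where c = "sqrt c" and t = 0])
         (use c in auto)
    then have "((\<lambda>x. exp (-(sqrt c * x)\<^sup>2) * (sqrt c * x) ^ (2 * k)) has_integral (I /\<^sub>R \<bar>sqrt c\<bar>)) UNIV"
      using has_integral_integral_lborel[of "\<lambda>x. exp (-(0 + sqrt c * x)\<^sup>2) * (0 + sqrt c * x) ^ (2 * k)"]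
      by (simp add: has_bochner_integral_iff)
    moreover have "exp (-(sqrt c * x)\<^sup>2) * (sqrt c * x) ^ (2 * k) = exp (- (c * x\<^sup>2)) * (c * x\<^sup>2) ^ k" for x
      using c by (simp only: power_mult power_mult_distrib) simp
    moreover have "I /\<^sub>R \<bar>sqrt c\<bar> = 1 / sqrt c * I"
      using c by (simp add: divide_inverse)
    ultimately show ?thesis by (simp add: I_def)
  qed
  show "((\<lambda>s. exp (- (c * s\<^sup>2))) has_integral sqrt (pi / c)) UNIV"
    using st[of 0] c by (simp add: real_sqrt_divide)
  have "((\<lambda>s. (1 / c) * (exp (- (c * s\<^sup>2)) * (c * s\<^sup>2) ^ 1)) has_integral (1 / c) * (1 / sqrt c * (sqrt pi * (fact (2 * 1) / (2 ^ (2 * 1) * fact 1))))) UNIV"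
    by (rule has_integral_mult_right[OF st[of 1]])
  moreover have "c powr (- 3 / 2) = 1 / c * (1 / sqrt c)"
  proof -
    have "c powr (- 3 / 2) = c powr (- 1 + - (1 / 2))" by simp
    also have "\<dots> = c powr (- 1) * c powr (- (1 / 2))" by (rule powr_add)
    also have "\<dots> = 1 / c * (1 / sqrt c)"
      using c by (simp add: powr_minus_divide powr_half_sqrt)
    finally show ?thesis .
  qed
  ultimately show "((\<lambda>s. s\<^sup>2 * exp (- (c * s\<^sup>2))) has_integral sqrt pi / 2 * c powr (- 3 / 2)) UNIV"
    using c by (simp add: mult_ac fact_numeral)
qed

lemma integral_odd_eq_0:
  fixes f :: "real \<Rightarrow> 'a::euclidean_space"
  assumes "\<And>x. f (- x) = - f x"
  shows "integral {- a..a} f = 0"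
proof -
  have "integral {- a..a} f = integral {- a..a} (\<lambda>x. f (- x))"
    using Henstock_Kurzweil_Integration.integral_reflect_real[of a "- a" f] by simp
  also have "\<dots> = - integral {- a..a} f" by (simp add: assms)
  finally show ?thesis by (metis add.right_inverse scaleR_2 scaleR_eq_0_iff zero_neq_numeral)
qed

text \<open>Lets a small part of a Gaussian exponent absorb a polynomial in
  \<open>X * s\<^sup>2\<close>. With \<open>y = a * Y\<close> and \<open>p = 1 / a\<close> it
  follows from the quadratic Taylor bound for \<open>exp y\<close>.\<close>

lemma quadratic_le_exp:
  fixes a Y :: real
  assumes a: "a > 0" and Y: "Y \<ge> 0"
  shows "1 + Y + Y\<^sup>2 \<le> (1 + 1 / a + 2 / a\<^sup>2) * exp (a * Y)"
proof -
  define p y where "p = 1 / a" and "y = a * Y"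
  have py: "p > 0" "y \<ge> 0" "Y = p * y" "1 / a = p" "2 / a\<^sup>2 = 2 * p\<^sup>2"
    using assms by (auto simp: p_def y_def power_divide)
  \<comment> \<open>The bracket is the exact difference of the two sides and consists of nonnegative
    monomials.\<close>
  have "1 + p * y + (p * y)\<^sup>2 + (y + y\<^sup>2 / 2 + p + p * y\<^sup>2 / 2 + 2 * p\<^sup>2 + 2 * p\<^sup>2 * y)
      = (1 + p + 2 * p\<^sup>2) * (1 + y + y\<^sup>2 / 2)"
    by (simp add: algebra_simps power2_eq_square)
  moreover have "0 \<le> y + y\<^sup>2 / 2 + p + p * y\<^sup>2 / 2 + 2 * p\<^sup>2 + 2 * p\<^sup>2 * y"
    using py by (intro add_nonneg_nonneg) auto
  moreover have "(1 + p + 2 * p\<^sup>2) * (1 + y + y\<^sup>2 / 2) \<le> (1 + p + 2 * p\<^sup>2) * exp y"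
    using py by (intro mult_left_mono exp_lower_Taylor_quadratic add_nonneg_nonneg) auto
  ultimately have "1 + p * y + (p * y)\<^sup>2 \<le> (1 + p + 2 * p\<^sup>2) * exp y" by linarith
  then show ?thesis unfolding py(4,5) y_def[symmetric] unfolding py(3) .
qed

text \<open>Outside the window \<open>1 \<le> s\<^sup>2 / \<rho>\<^sup>2\<close>, so the tail is at
  most a multiple of the second moment. This is smaller by a factor \<open>1 / c\<close> than the
  full integral, which is the accuracy wanted in the saddle point estimate.\<close>

lemma gaussian_window:
  fixes c \<rho> :: real
  assumes c: "c > 0" and \<rho>: "\<rho> > 0"
  shows "\<bar>integral {- \<rho>..\<rho>} (\<lambda>s. exp (- (c * s\<^sup>2))) - sqrt (pi / c)\<bar>
      \<le> sqrt pi / (2 * \<rho>\<^sup>2) * c powr (- 3 / 2)"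
    and "integral {- \<rho>..\<rho>} (\<lambda>s. s\<^sup>2 * exp (- (c * s\<^sup>2))) \<le> sqrt pi / 2 * c powr (- 3 / 2)"
proof -
  let ?I = "{- \<rho>..\<rho>}" and ?e = "\<lambda>s. exp (- (c * s\<^sup>2))"
  have int: "?e integrable_on ?I" "(\<lambda>s. s\<^sup>2 * ?e s) integrable_on ?I"
    by (intro integrable_continuous_interval continuous_intros)+
  have "((\<lambda>s. if s \<in> ?I then ?e s else 0) has_integral integral ?I ?e) UNIV"
    by (rule has_integral_restrict_UNIV[THEN iffD2, OF integrable_integral[OF int(1)]])
  from has_integral_diff[OF has_integral_gaussian(1)[OF c] this]
  have d: "((\<lambda>s. ?e s - (if s \<in> ?I then ?e s else 0)) has_integral sqrt (pi / c) - integral ?I ?e) UNIV" .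
  have lo: "0 \<le> sqrt (pi / c) - integral ?I ?e"
    by (rule has_integral_nonneg[OF d]) auto
  have "sqrt (pi / c) - integral ?I ?e \<le> 1 / \<rho>\<^sup>2 * (sqrt pi / 2 * c powr (- 3 / 2))"
  proof (rule has_integral_le[OF d has_integral_mult_right[OF has_integral_gaussian(2)[OF c]]])
    fix s :: real
    show "?e s - (if s \<in> ?I then ?e s else 0) \<le> 1 / \<rho>\<^sup>2 * (s\<^sup>2 * ?e s)"
    proof (cases "s \<in> ?I")
      case False
      then have "\<rho> \<le> \<bar>s\<bar>" by auto
      then have "\<rho>\<^sup>2 \<le> s\<^sup>2" using \<rho> by (metis abs_le_square_iff abs_of_pos)
      then have "1 \<le> 1 / \<rho>\<^sup>2 * s\<^sup>2" using \<rho> by simp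
      from mult_right_mono[OF this, of "?e s"] show ?thesis using False by (simp add: mult_ac)
    qed auto
  qed
  then show "\<bar>integral ?I ?e - sqrt (pi / c)\<bar> \<le> sqrt pi / (2 * \<rho>\<^sup>2) * c powr (- 3 / 2)"
    using lo by (simp add: abs_if mult_ac)
  have i2: "((\<lambda>s. if s \<in> ?I then s\<^sup>2 * ?e s else 0) has_integral integral ?I (\<lambda>s. s\<^sup>2 * ?e s)) UNIV"
    by (rule has_integral_restrict_UNIV[THEN iffD2, OF integrable_integral[OF int(2)]])
  have le: "(if s \<in> ?I then s\<^sup>2 * ?e s else 0) \<le> s\<^sup>2 * ?e s" for s
    by (cases "s \<in> ?I")
      (simp_all only: if_True if_False order_refl zero_le_power2 exp_ge_zero mult_nonneg_nonneg)
  show "integral ?I (\<lambda>s. s\<^sup>2 * ?e s) \<le> sqrt pi / 2 * c powr (- 3 / 2)"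
    using has_integral_le[OF i2 has_integral_gaussian(2)[OF c] le] .
qed

text \<open>
  Expanding \<open>exp w\<close> to first order leaves the odd terms \<open>g1 s + g0 X b s^3\<close>, which integrate to
  zero; every other term is at most \<open>s^2\<close> times a polynomial in \<open>X s^2\<close>.
\<close>

lemma laplace_integrand_bound:
  fixes g u :: "real \<Rightarrow> complex" and g0 g1 b :: complex and X K a0 a \<rho> s :: real
  assumes K: "cmod g0 \<le> K" "cmod g1 \<le> K" "cmod b \<le> K"
    and g: "cmod (g s - g0 - g1 * s) \<le> K * s\<^sup>2"
    and u: "cmod (u s + of_real (a * s\<^sup>2) - b * s ^ 3) \<le> K * s ^ 4"
    and a: "0 < a0" "a0 \<le> a" and X: "X > 0"
    and s: "\<bar>s\<bar> \<le> 1" "2 * K * \<bar>s\<bar> \<le> a0 / 2"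
  shows "cmod (exp (of_real X * u s) * g s
            - of_real (exp (- (X * a * s\<^sup>2))) * (g0 + (g1 * s + g0 * X * b * s ^ 3)))
        \<le> (12 * K ^ 3 + 5 * K\<^sup>2 + K) * (1 + 4 / a0 + 32 / a0\<^sup>2) * (s\<^sup>2 * exp (- (X * a0 / 4 * s\<^sup>2)))"
proof -
  \<comment> \<open>\<open>w\<close> is \<open>X\<close> times the part of the exponent beyond the
    quadratic term.\<close>
  define w where "w = of_real X * (u s + of_real (a * s\<^sup>2))"
  define t where "t = \<bar>s\<bar>"
  have t: "0 \<le> t" "t \<le> 1" "2 * K * t \<le> a0 / 2" "s\<^sup>2 = t\<^sup>2" "cmod (of_real s) = t" using s by (auto simp: t_def)
  have K0: "0 \<le> K" using K(1) norm_ge_zero order_trans by blast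
  have s4: "s ^ 4 = t ^ 4" by (simp add: t_def power_even_abs)
  have wb: "cmod (w - of_real X * b * s ^ 3) \<le> X * (K * t ^ 4)"
  proof -
    have "w - of_real X * b * s ^ 3 = of_real X * (u s + of_real (a * s\<^sup>2) - b * s ^ 3)"
      by (simp add: w_def algebra_simps)
    then show ?thesis using u X by (simp add: norm_mult s4)
  qed
  have b3: "cmod (of_real X * b * s ^ 3) \<le> X * (K * t ^ 3)"
    using K(3) X t by (simp add: norm_mult norm_power t(5) mult_left_mono mult_right_mono)
  have t43: "t ^ 4 \<le> t ^ 3" using t by (intro power_decreasing) auto
  have w3: "cmod w \<le> X * (2 * K * t ^ 3)"
  proof -
    have "cmod w \<le> cmod (w - of_real X * b * s ^ 3) + cmod (of_real X * b * s ^ 3)"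
      by (metis add.commute diff_add_cancel norm_triangle_ineq)
    also have "\<dots> \<le> X * (K * t ^ 4) + X * (K * t ^ 3)" using wb b3 by simp
    also have "\<dots> \<le> X * (K * t ^ 3) + X * (K * t ^ 3)"
      using t43 K0 X by (simp add: mult_left_mono)
    finally show ?thesis by (simp add: algebra_simps)
  qed
  \<comment> \<open>The smallness of \<open>s\<close> keeps \<open>w\<close> below half of the
    Gaussian exponent. Another quarter is spent below on a polynomial in
    \<open>X * t\<^sup>2\<close>, which leaves the rate \<open>X * a0 / 4\<close> of the
    conclusion.\<close>
  have w2: "cmod w \<le> X * a0 * t\<^sup>2 / 2"
  proof -
    have "X * (2 * K * t ^ 3) = X * t\<^sup>2 * (2 * K * t)" by (simp add: power3_eq_cube power2_eq_square)
    also have "\<dots> \<le> X * t\<^sup>2 * (a0 / 2)" using t X by (intro mult_left_mono) auto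
    finally show ?thesis using w3 by (simp add: mult_ac)
  qed
  have ew: "cmod (exp w - 1 - w) \<le> exp (X * a0 * t\<^sup>2 / 2) * (4 * K\<^sup>2 * (X\<^sup>2 * t ^ 6))"
  proof -
    have "cmod (exp w - (\<Sum>k\<le>1. w ^ k / fact k)) \<le> exp \<bar>Re w\<bar> * cmod w ^ Suc 1 / fact 1"
      by (rule Taylor_exp)
    then have "cmod (exp w - 1 - w) \<le> exp \<bar>Re w\<bar> * cmod w ^ 2"
      by (simp add: numeral_2_eq_2 diff_diff_eq)
    also have "\<dots> \<le> exp (X * a0 * t\<^sup>2 / 2) * (X * (2 * K * t ^ 3)) ^ 2"
      using w2 abs_Re_le_cmod[of w] w3 by (intro mult_mono power_mono) auto
    finally show ?thesis by (simp add: power_mult_distrib mult_ac flip: power_mult)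
  qed
  have tt: "t\<^sup>2 \<le> t" "t\<^sup>2 \<le> 1" "t \<le> 1" using t by (auto simp: power2_eq_square mult_le_one mult_left_le)
  have gg0: "cmod (g s - g0) \<le> 2 * K * t"
  proof -
    have "cmod (g s - g0) \<le> cmod (g s - g0 - g1 * s) + cmod (g1 * s)"
      by (metis diff_add_cancel norm_triangle_ineq)
    also have "\<dots> \<le> K * t\<^sup>2 + K * t"
      using g K(2) t by (intro add_mono) (auto simp: norm_mult mult_right_mono)
    also have "\<dots> \<le> K * t + K * t" using tt K0 by (simp add: mult_left_mono)
    finally show ?thesis by simp
  qed
  have gs: "cmod (g s) \<le> 3 * K"
  proof -
    have "cmod (g s) \<le> cmod (g s - g0) + cmod g0" by (metis diff_add_cancel norm_triangle_ineq)
    also have "\<dots> \<le> 2 * K * 1 + K" using gg0 K(1) tt K0 mult_left_mono[of t 1 "2 * K"] by linarith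
    finally show ?thesis by simp
  qed
  define E where "E = exp (X * a0 * t\<^sup>2 / 2)"
  define Q where "Q = t\<^sup>2 * (1 + X * t\<^sup>2 + (X * t\<^sup>2)\<^sup>2)"
  have E1: "1 \<le> E" using X a by (simp add: E_def)
  have ex: "exp (of_real X * u s) = of_real (exp (- (X * a * s\<^sup>2))) * exp w"
    by (simp add: w_def exp_of_real[symmetric] mult_exp_exp algebra_simps)
  \<comment> \<open>The four remainders: of exp beyond first order, of the exponent beyond the cubic
    term, of \<open>g\<close> beyond its value (times the cubic term), and of \<open>g\<close>
    beyond first order.\<close>
  have alg: "g s * exp w - (g0 + (g1 * s + g0 * X * b * s ^ 3)) =
      g s * (exp w - 1 - w) + g s * (w - of_real X * b * s ^ 3)
      + (g s - g0) * (of_real X * b * s ^ 3) + (g s - g0 - g1 * s)"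
    by (simp add: algebra_simps)
  have "cmod (g s * exp w - (g0 + (g1 * s + g0 * X * b * s ^ 3)))
      \<le> 3 * K * (E * (4 * K\<^sup>2 * (X\<^sup>2 * t ^ 6))) + 3 * K * (X * (K * t ^ 4))
        + 2 * K * t * (X * (K * t ^ 3)) + K * t\<^sup>2"
  proof -
    have "cmod (g s * (exp w - 1 - w)) \<le> 3 * K * (E * (4 * K\<^sup>2 * (X\<^sup>2 * t ^ 6)))"
      unfolding norm_mult E_def by (rule mult_mono[OF gs ew]) (use K0 in auto)
    moreover have "cmod (g s * (w - of_real X * b * s ^ 3)) \<le> 3 * K * (X * (K * t ^ 4))"
      unfolding norm_mult[of "g s"] by (rule mult_mono[OF gs wb]) (use K0 in auto)
    moreover have "cmod ((g s - g0) * (of_real X * b * s ^ 3)) \<le> 2 * K * t * (X * (K * t ^ 3))"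
      unfolding norm_mult[of "g s - g0"] by (rule mult_mono[OF gg0 b3]) (use K0 t in auto)
    moreover have "cmod (g s - g0 - g1 * s) \<le> K * t\<^sup>2" using g by (simp add: t(4))
    ultimately show ?thesis
      unfolding alg by (rule norm_triangle_mono[OF norm_triangle_mono[OF norm_triangle_mono]])
  qed
  also have "\<dots> = 12 * K ^ 3 * (E * (t\<^sup>2 * (X * t\<^sup>2)\<^sup>2)) + 5 * K\<^sup>2 * (t\<^sup>2 * (X * t\<^sup>2)) + K * t\<^sup>2"
    by (simp add: eval_nat_numeral algebra_simps)
  also have "\<dots> \<le> 12 * K ^ 3 * (E * Q) + 5 * K\<^sup>2 * (E * Q) + K * (E * Q)"
  proof -
    have "t\<^sup>2 * (X * t\<^sup>2) \<le> Q" "t\<^sup>2 * 1 \<le> Q" "t\<^sup>2 * (X * t\<^sup>2)\<^sup>2 \<le> Q"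
      unfolding Q_def using X by (intro mult_left_mono; simp)+
    moreover have "0 \<le> Q" using X by (simp add: Q_def)
    then have "Q \<le> E * Q"
      using E1 mult_right_mono[of 1 E] by simp
    ultimately have "t\<^sup>2 * (X * t\<^sup>2) \<le> E * Q" "t\<^sup>2 \<le> E * Q" "t\<^sup>2 * (X * t\<^sup>2)\<^sup>2 \<le> Q"
      by linarith+
    then show ?thesis
      using K0 E1 by (intro add_mono mult_left_mono) simp_all
  qed
  also have "\<dots> = (12 * K ^ 3 + 5 * K\<^sup>2 + K) * (E * Q)"
    by (simp only: distrib_right)
  finally have main: "cmod (g s * exp w - (g0 + (g1 * s + g0 * X * b * s ^ 3))) \<le> \<dots>" .
  have "exp (- (X * a * t\<^sup>2)) * (E * Q)
      \<le> exp (- (X * a0 * t\<^sup>2)) * (E * (t\<^sup>2 * ((1 + 1 / (a0 / 4) + 2 / (a0 / 4)\<^sup>2) * exp (a0 / 4 * (X * t\<^sup>2)))))"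
    unfolding Q_def
  proof (intro mult_mono mult_left_mono)
    show "exp (- (X * a * t\<^sup>2)) \<le> exp (- (X * a0 * t\<^sup>2))"
      using a X by (simp add: mult_right_mono mult_left_mono)
    show "1 + X * t\<^sup>2 + (X * t\<^sup>2)\<^sup>2 \<le> (1 + 1 / (a0 / 4) + 2 / (a0 / 4)\<^sup>2) * exp (a0 / 4 * (X * t\<^sup>2))"
      by (rule quadratic_le_exp) (use a X in auto)
    show "0 \<le> E * (t\<^sup>2 * (1 + X * t\<^sup>2 + (X * t\<^sup>2)\<^sup>2))"
      using E1 X by (intro mult_nonneg_nonneg add_nonneg_nonneg) auto
  qed (use E1 X in auto)
  also have "\<dots> = (1 + 4 / a0 + 32 / a0\<^sup>2) * (t\<^sup>2 * (exp (- (X * a0 * t\<^sup>2)) * E * exp (a0 / 4 * (X * t\<^sup>2))))"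
    by (simp add: power_divide mult_ac)
  also have "exp (- (X * a0 * t\<^sup>2)) * E * exp (a0 / 4 * (X * t\<^sup>2)) = exp (- (X * a0 / 4 * t\<^sup>2))"
    by (simp add: E_def mult_exp_exp algebra_simps)
  finally have fin: "exp (- (X * a * t\<^sup>2)) * (E * Q)
      \<le> (1 + 4 / a0 + 32 / a0\<^sup>2) * (t\<^sup>2 * exp (- (X * a0 / 4 * t\<^sup>2)))" .
  have "exp (of_real X * u s) * g s - of_real (exp (- (X * a * s\<^sup>2))) * (g0 + (g1 * s + g0 * X * b * s ^ 3))
      = of_real (exp (- (X * a * s\<^sup>2))) * (g s * exp w - (g0 + (g1 * s + g0 * X * b * s ^ 3)))"
    by (simp add: ex algebra_simps)
  then have "cmod (exp (of_real X * u s) * g s - of_real (exp (- (X * a * s\<^sup>2))) * (g0 + (g1 * s + g0 * X * b * s ^ 3)))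
      = exp (- (X * a * t\<^sup>2)) * cmod (g s * exp w - (g0 + (g1 * s + g0 * X * b * s ^ 3)))"
    by (simp add: norm_mult t(4) del: of_real_exp of_real_power)
  also have "\<dots> \<le> exp (- (X * a * t\<^sup>2)) * ((12 * K ^ 3 + 5 * K\<^sup>2 + K) * (E * Q))"
    using main by (intro mult_left_mono) auto
  also have "\<dots> = (12 * K ^ 3 + 5 * K\<^sup>2 + K) * (exp (- (X * a * t\<^sup>2)) * (E * Q))"
    by simp
  also have "\<dots> \<le> (12 * K ^ 3 + 5 * K\<^sup>2 + K) * ((1 + 4 / a0 + 32 / a0\<^sup>2) * (t\<^sup>2 * exp (- (X * a0 / 4 * t\<^sup>2))))"
    using fin K0 by (intro mult_left_mono) auto
  finally show ?thesis by (simp add: t(4) mult.assoc)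
qed

text \<open>The order of the quantifiers is the point: \<open>C\<close> is fixed before the phase,
  the amplitude, the stationary point and \<open>X\<close>, so that it serves a phase that moves
  with a parameter and every \<open>X > 0\<close>. Along \<open>d\<close> the second-order term of
  the phase is \<open>- A * s\<^sup>2 / 2\<close>, with \<open>A\<close> bounded below by
  \<open>A0\<close>. A straight segment through \<zeta> replaces the curved path of steepest
  descent, and a primitive \<open>H\<close> replaces the integral.\<close>

lemma saddle_point_uniform:
  fixes R B A0 :: real
  assumes R: "R > 0" and A0: "A0 > 0" and B: "B \<ge> 0"
  obtains \<rho>0 where "\<rho>0 > 0"
    "\<And>\<rho>. 0 < \<rho> \<Longrightarrow> \<rho> \<le> \<rho>0 \<Longrightarrow> \<exists>C. \<forall>\<phi> g \<zeta> d X A H.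
       \<phi> holomorphic_on ball \<zeta> R \<and> g holomorphic_on ball \<zeta> R \<and>
       (\<forall>u\<in>ball \<zeta> R. cmod (\<phi> u) \<le> B \<and> cmod (g u) \<le> B \<and>
           (H has_field_derivative exp (of_real X * \<phi> u) * g u) (at u)) \<and>
       deriv \<phi> \<zeta> = 0 \<and> cmod d = 1 \<and> d\<^sup>2 * deriv (deriv \<phi>) \<zeta> = - of_real A \<and> A0 \<le> A \<and> X > 0
       \<longrightarrow> cmod (H (\<zeta> + of_real \<rho> * d) - H (\<zeta> - of_real \<rho> * d)
                - exp (of_real X * \<phi> \<zeta>) * d * g \<zeta> * of_real (sqrt (2 * pi / (X * A))))
            \<le> C * X powr (- 3 / 2) * exp (X * Re (\<phi> \<zeta>))"
proof -
  define a0 where "a0 = A0 / 2"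
  \<comment> \<open>One constant for all bounds that \<open>laplace_integrand_bound\<close> asks
    for. In this order the summands bound the amplitude, its derivative, the cubic coefficient of
    the phase, the quartic Taylor remainder of the phase and the quadratic one of the
    amplitude.\<close>
  define K where "K = B + B / (R / 2) + B / (R / 2) ^ 3 + 4 * B / (R / 2) ^ 4 + 2 * B / (R / 2)\<^sup>2"
  have a0: "a0 > 0" using A0 by (simp add: a0_def)
  have Kp: "0 \<le> B / (R / 2)" "0 \<le> B / (R / 2) ^ 3" "0 \<le> 4 * B / (R / 2) ^ 4" "0 \<le> 2 * B / (R / 2)\<^sup>2"
    using B R by auto
  have K0: "K \<ge> 0" unfolding K_def using Kp B by linarith
  \<comment> \<open>\<open>R / 8\<close> keeps the segment within the range of the Taylor bound, and
    the last entry gives \<open>2 * K * \<bar>s\<bar> \<le> a0 / 2\<close>; the \<open>+ 1\<close>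
    covers \<open>K = 0\<close>.\<close>
  define \<rho>0 where "\<rho>0 = min 1 (min (R / 8) (a0 / (4 * K + 1)))"
  have \<rho>0: "\<rho>0 > 0" "\<rho>0 \<le> 1" "\<rho>0 \<le> R / 8" "\<rho>0 \<le> a0 / (4 * K + 1)"
    unfolding \<rho>0_def using R a0 K0 by (simp, simp, linarith, linarith)
  define K' where "K' = (12 * K ^ 3 + 5 * K\<^sup>2 + K) * (1 + 4 / a0 + 32 / a0\<^sup>2)"
  have K'0: "K' \<ge> 0" using K0 a0 by (simp add: K'_def)
  show thesis
  proof (rule that[OF \<rho>0(1)])
    fix \<rho> :: real assume \<rho>: "0 < \<rho>" "\<rho> \<le> \<rho>0"
    \<comment> \<open>The first summand is the pointwise remainder integrated against a second
      moment, the second comes from cutting the Gaussian off at \<rho>. Both Gaussians have rate at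
      least \<open>X * a0 / 4\<close>, whence the last factor.\<close>
    define C where "C = (K' * (sqrt pi / 2) + K * (sqrt pi / (2 * \<rho>\<^sup>2))) * (a0 / 4) powr (- 3 / 2)"
    show "\<exists>C. \<forall>\<phi> g \<zeta> d X A H.
       \<phi> holomorphic_on ball \<zeta> R \<and> g holomorphic_on ball \<zeta> R \<and>
       (\<forall>u\<in>ball \<zeta> R. cmod (\<phi> u) \<le> B \<and> cmod (g u) \<le> B \<and>
           (H has_field_derivative exp (of_real X * \<phi> u) * g u) (at u)) \<and>
       deriv \<phi> \<zeta> = 0 \<and> cmod d = 1 \<and> d\<^sup>2 * deriv (deriv \<phi>) \<zeta> = - of_real A \<and> A0 \<le> A \<and> X > 0
       \<longrightarrow> cmod (H (\<zeta> + of_real \<rho> * d) - H (\<zeta> - of_real \<rho> * d)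
                - exp (of_real X * \<phi> \<zeta>) * d * g \<zeta> * of_real (sqrt (2 * pi / (X * A))))
            \<le> C * X powr (- 3 / 2) * exp (X * Re (\<phi> \<zeta>))"
    proof (rule exI[of _ C], intro allI impI, elim conjE)
      fix \<phi> g H :: "complex \<Rightarrow> complex" and \<zeta> d :: complex and X A :: real
      assume hol: "\<phi> holomorphic_on ball \<zeta> R" "g holomorphic_on ball \<zeta> R"
        and ball: "\<forall>u\<in>ball \<zeta> R. cmod (\<phi> u) \<le> B \<and> cmod (g u) \<le> B \<and>
           (H has_field_derivative exp (of_real X * \<phi> u) * g u) (at u)"
        and crit: "deriv \<phi> \<zeta> = 0" and d: "cmod d = 1"
        and dA: "d\<^sup>2 * deriv (deriv \<phi>) \<zeta> = - of_real A" and A: "A0 \<le> A" and X: "X > 0"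
      define a where "a = A / 2"
      have a: "a0 \<le> a" using A by (simp add: a_def a0_def)
      define u where "u = (\<lambda>s::real. \<phi> (\<zeta> + of_real s * d) - \<phi> \<zeta>)"
      define h where "h = (\<lambda>s::real. g (\<zeta> + of_real s * d))"
      define b where "b = deriv (deriv (deriv \<phi>)) \<zeta> * d ^ 3 / 6"
      define g1 where "g1 = deriv g \<zeta> * d"
      have B\<phi>: "cmod (\<phi> v) \<le> B" and Bg: "cmod (g v) \<le> B"
        and H: "(H has_field_derivative exp (of_real X * \<phi> v) * g v) (at v)" if "v \<in> ball \<zeta> R" for v
        using ball that by auto
      have sub: "cball \<zeta> (R / 2) \<subseteq> ball \<zeta> R" using R by auto
      have coef: "cmod ((deriv ^^ i) f \<zeta>) \<le> fact i * B / (R / 2) ^ i"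
        if "f holomorphic_on ball \<zeta> R" "\<And>v. v \<in> ball \<zeta> R \<Longrightarrow> cmod (f v) \<le> B" for f i
      proof (rule Cauchy_inequality)
        show "f holomorphic_on ball \<zeta> (R / 2)"
          using that(1) sub by (meson ball_subset_cball holomorphic_on_subset order_trans)
        show "continuous_on (cball \<zeta> (R / 2)) f"
          using that(1) sub by (meson holomorphic_on_subset holomorphic_on_imp_continuous_on)
        fix v assume "cmod (\<zeta> - v) = R / 2"
        then show "cmod (f v) \<le> B" using R by (intro that(2)) (simp add: dist_norm)
      qed (use R in auto)
      have kb: "cmod (g \<zeta>) \<le> K" "cmod g1 \<le> K" "cmod b \<le> K"
      proof -
        show "cmod (g \<zeta>) \<le> K" unfolding K_def using Bg[OF centre_in_ball[THEN iffD2, OF R]] Kp by linarith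
        have "cmod g1 \<le> B / (R / 2)" using coef[OF hol(2) Bg, of 1] d by (simp add: g1_def norm_mult)
        then show "cmod g1 \<le> K" unfolding K_def using Kp B by linarith
        have "cmod (deriv (deriv (deriv \<phi>)) \<zeta>) \<le> 6 * B / (R / 2) ^ 3"
          using coef[OF hol(1) B\<phi>, of 3] by (simp add: numeral_3_eq_3 fact_numeral)
        then have "cmod b \<le> B / (R / 2) ^ 3" using d by (simp add: b_def norm_mult norm_divide norm_power mult_ac)
        then show "cmod b \<le> K" unfolding K_def using Kp B by linarith
      qed
      have bnd: "cmod (exp (of_real X * u s) * h s
            - of_real (exp (- (X * a * s\<^sup>2))) * (g \<zeta> + (g1 * s + g \<zeta> * X * b * s ^ 3)))
          \<le> K' * (s\<^sup>2 * exp (- (X * a0 / 4 * s\<^sup>2)))" if s: "s \<in> {- \<rho>..\<rho>}" for s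
        unfolding K'_def
      proof (rule laplace_integrand_bound[OF kb])
        have sr: "\<bar>s\<bar> \<le> \<rho>" using s by auto
        then have "\<bar>s\<bar> \<le> R / 8" using \<rho> \<rho>0 by linarith
        then have sR: "cmod (of_real s * d) \<le> R / 4" using d R by (simp add: norm_mult)
        have "cmod (g (\<zeta> + of_real s * d) - (\<Sum>i\<le>1. (deriv ^^ i) g \<zeta> * (of_real s * d) ^ i / fact i))
            \<le> (fact (Suc 1) * B / (R / 2) ^ Suc 1) * cmod (of_real s * d) ^ Suc 1 / fact 1"
          by (rule holomorphic_Taylor_bound[OF hol(2) Bg R sR])
        then have "cmod (h s - g \<zeta> - g1 * s) \<le> 2 * B / (R / 2)\<^sup>2 * s\<^sup>2"
          using d by (simp add: h_def g1_def norm_mult power2_eq_square mult_ac diff_diff_eq)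
        also have "\<dots> \<le> K * s\<^sup>2" using Kp B by (intro mult_right_mono) (auto simp: K_def)
        finally show "cmod (h s - g \<zeta> - g1 * s) \<le> K * s\<^sup>2" .
        have "cmod (\<phi> (\<zeta> + of_real s * d) - (\<Sum>i\<le>3. (deriv ^^ i) \<phi> \<zeta> * (of_real s * d) ^ i / fact i))
            \<le> (fact (Suc 3) * B / (R / 2) ^ Suc 3) * cmod (of_real s * d) ^ Suc 3 / fact 3"
          by (rule holomorphic_Taylor_bound[OF hol(1) B\<phi> R sR])
        \<comment> \<open>There is no linear term because \<zeta> is critical, and \<open>d\<close>
          makes the quadratic one real and negative.\<close>
        moreover have "(\<Sum>i\<le>3. (deriv ^^ i) \<phi> \<zeta> * (of_real s * d) ^ i / fact i)
            = \<phi> \<zeta> - of_real (a * s\<^sup>2) + b * s ^ 3"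
        proof -
          have "(\<Sum>i\<le>3. (deriv ^^ i) \<phi> \<zeta> * (of_real s * d) ^ i / fact i)
            = \<phi> \<zeta> + (d\<^sup>2 * deriv (deriv \<phi>) \<zeta>) * s\<^sup>2 / 2 + b * s ^ 3"
            by (simp add: numeral_3_eq_3 crit b_def power_mult_distrib fact_numeral)
               (simp add: eval_nat_numeral fact_numeral algebra_simps)
          then show ?thesis by (simp add: dA a_def)
        qed
        moreover have "\<phi> (\<zeta> + of_real s * d) - (\<phi> \<zeta> - of_real (a * s\<^sup>2) + b * s ^ 3)
            = u s + of_real (a * s\<^sup>2) - b * s ^ 3"
          by (simp add: u_def)
        ultimately have "cmod (u s + of_real (a * s\<^sup>2) - b * s ^ 3)
            \<le> (fact (Suc 3) * B / (R / 2) ^ Suc 3) * cmod (of_real s * d) ^ Suc 3 / fact 3"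
          by (simp only:)
        also have "\<dots> = 4 * B / (R / 2) ^ 4 * s ^ 4"
          using d by (simp add: norm_mult fact_numeral power_even_abs)
        also have "\<dots> \<le> K * s ^ 4" using Kp B by (intro mult_right_mono) (auto simp: K_def)
        finally show "cmod (u s + of_real (a * s\<^sup>2) - b * s ^ 3) \<le> K * s ^ 4" .
        show "\<bar>s\<bar> \<le> 1" using sr \<rho> \<rho>0 by linarith
        have "(4 * K + 1) * \<bar>s\<bar> \<le> (4 * K + 1) * (a0 / (4 * K + 1))"
          using sr \<rho> \<rho>0 K0 by (intro mult_left_mono) auto
        also have "\<dots> = a0" using K0 by simp
        finally show "2 * K * \<bar>s\<bar> \<le> a0 / 2" using abs_ge_zero[of s] by (simp add: distrib_right)
      qed (use a0 a X in auto)
      have in_ball: "\<zeta> + of_real s * d \<in> ball \<zeta> R" if "s \<in> {- \<rho>..\<rho>}" for s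
        using that \<rho> \<rho>0 R d by (auto simp: dist_norm norm_mult)
      define F where "F = (\<lambda>s. exp (of_real X * u s) * h s)"
      define G where "G = (\<lambda>s. of_real (exp (- (X * a * s\<^sup>2))) * (g \<zeta> + (g1 * s + g \<zeta> * X * b * s ^ 3)))"
      have "((\<lambda>s. d * exp (of_real X * \<phi> \<zeta>) * F s) has_integral
          H (\<zeta> + of_real \<rho> * d) - H (\<zeta> + of_real (- \<rho>) * d)) {- \<rho>..\<rho>}"
      proof (rule fundamental_theorem_of_calculus)
        fix s assume s: "s \<in> {- \<rho>..\<rho>}"
        have "((\<lambda>s. \<zeta> + of_real s * d) has_vector_derivative d) (at s within {- \<rho>..\<rho>})"
          by (auto intro!: derivative_eq_intros simp: has_vector_derivative_def scaleR_conv_of_real)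
        from field_vector_diff_chain_within[OF this has_field_derivative_at_within[OF H[OF in_ball[OF s]]]]
        show "((\<lambda>s. H (\<zeta> + of_real s * d)) has_vector_derivative d * exp (of_real X * \<phi> \<zeta>) * F s)
            (at s within {- \<rho>..\<rho>})"
          by (simp add: o_def F_def u_def h_def algebra_simps mult_exp_exp)
      qed (use \<rho> in auto)
      then have HF: "H (\<zeta> + of_real \<rho> * d) - H (\<zeta> - of_real \<rho> * d)
          = d * exp (of_real X * \<phi> \<zeta>) * integral {- \<rho>..\<rho>} F"
        by (simp add: integral_unique flip: integral_mult_right)
      have cont: "continuous_on {- \<rho>..\<rho>} u" "continuous_on {- \<rho>..\<rho>} h"
        unfolding u_def h_def using in_ball
        by (intro continuous_intros continuous_on_compose2[OF holomorphic_on_imp_continuous_on[OF hol(1)]]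
            continuous_on_compose2[OF holomorphic_on_imp_continuous_on[OF hol(2)]]; force)+
      have Fi: "F integrable_on {- \<rho>..\<rho>}" unfolding F_def
        by (intro integrable_continuous_interval continuous_intros cont)
      have Gi: "G integrable_on {- \<rho>..\<rho>}" unfolding G_def
        by (intro integrable_continuous_interval continuous_intros)
      have IG: "integral {- \<rho>..\<rho>} G = g \<zeta> * of_real (integral {- \<rho>..\<rho>} (\<lambda>s. exp (- (X * a * s\<^sup>2))))"
      proof -
        have "integral {- \<rho>..\<rho>} G = integral {- \<rho>..\<rho>} (\<lambda>s. g \<zeta> * of_real (exp (- (X * a * s\<^sup>2))))
            + integral {- \<rho>..\<rho>} (\<lambda>s. of_real (exp (- (X * a * s\<^sup>2))) * (g1 * s + g \<zeta> * X * b * s ^ 3))"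
          unfolding G_def
          by (subst integral_add[symmetric])
             (auto intro!: integrable_continuous_interval continuous_intros simp: algebra_simps)
        also have "integral {- \<rho>..\<rho>} (\<lambda>s. of_real (exp (- (X * a * s\<^sup>2))) * (g1 * s + g \<zeta> * X * b * s ^ 3)) = 0"
          by (rule integral_odd_eq_0) (simp add: algebra_simps)
        also have "integral {- \<rho>..\<rho>} (\<lambda>s. g \<zeta> * complex_of_real (exp (- (X * a * s\<^sup>2))))
            = g \<zeta> * of_real (integral {- \<rho>..\<rho>} (\<lambda>s. exp (- (X * a * s\<^sup>2))))"
        proof -
          have "((\<lambda>s. complex_of_real (exp (- (X * a * s\<^sup>2)))) has_integral
              complex_of_real (integral {- \<rho>..\<rho>} (\<lambda>s. exp (- (X * a * s\<^sup>2))))) {- \<rho>..\<rho>}"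
            by (intro has_integral_of_real integrable_integral integrable_continuous_interval continuous_intros)
          from has_integral_mult_right[OF this] show ?thesis by (rule integral_unique)
        qed
        finally show ?thesis by simp
      qed
      have Xa: "X * a0 / 4 > 0" "X * a > 0" "X * a0 / 4 \<le> X * a" using X a0 a by auto
      have pw: "(X * a0 / 4) powr (- 3 / 2) = X powr (- 3 / 2) * (a0 / 4) powr (- 3 / 2)"
        using X a0 by (simp add: powr_mult flip: times_divide_eq_right)
      have "cmod (integral {- \<rho>..\<rho>} F - integral {- \<rho>..\<rho>} G) = cmod (integral {- \<rho>..\<rho>} (\<lambda>s. F s - G s))"
        using Fi Gi by (simp add: integral_diff)
      also have "\<dots> \<le> integral {- \<rho>..\<rho>} (\<lambda>s. K' * (s\<^sup>2 * exp (- (X * a0 / 4 * s\<^sup>2))))"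
      proof (rule integral_norm_bound_integral)
        show "(\<lambda>s. F s - G s) integrable_on {- \<rho>..\<rho>}" using Fi Gi by (rule integrable_diff)
        show "(\<lambda>s. K' * (s\<^sup>2 * exp (- (X * a0 / 4 * s\<^sup>2)))) integrable_on {- \<rho>..\<rho>}"
          by (intro integrable_continuous_interval continuous_intros)
      qed (use bnd in \<open>auto simp: F_def G_def\<close>)
      also have "\<dots> = K' * integral {- \<rho>..\<rho>} (\<lambda>s. s\<^sup>2 * exp (- (X * a0 / 4 * s\<^sup>2)))"
        by simp
      also have "\<dots> \<le> K' * (sqrt pi / 2 * (X * a0 / 4) powr (- 3 / 2))"
        by (rule mult_left_mono[OF gaussian_window(2)[OF Xa(1) \<rho>(1)] K'0])
      finally have FG: "cmod (integral {- \<rho>..\<rho>} F - integral {- \<rho>..\<rho>} G)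
          \<le> K' * (sqrt pi / 2 * (X * a0 / 4) powr (- 3 / 2))" .
      have "cmod (integral {- \<rho>..\<rho>} G - g \<zeta> * of_real (sqrt (pi / (X * a))))
          = cmod (g \<zeta>) * \<bar>integral {- \<rho>..\<rho>} (\<lambda>s. exp (- (X * a * s\<^sup>2))) - sqrt (pi / (X * a))\<bar>"
        unfolding IG right_diff_distrib[symmetric] norm_mult of_real_diff[symmetric] norm_of_real ..
      also have "\<dots> \<le> K * (sqrt pi / (2 * \<rho>\<^sup>2) * (X * a) powr (- 3 / 2))"
        by (rule mult_mono[OF kb(1) gaussian_window(1)[OF Xa(2) \<rho>(1)] K0 abs_ge_zero])
      also have "\<dots> \<le> K * (sqrt pi / (2 * \<rho>\<^sup>2) * (X * a0 / 4) powr (- 3 / 2))"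
        using Xa K0 by (intro mult_left_mono powr_mono2') auto
      finally have GM: "cmod (integral {- \<rho>..\<rho>} G - g \<zeta> * of_real (sqrt (pi / (X * a))))
          \<le> K * (sqrt pi / (2 * \<rho>\<^sup>2) * (X * a0 / 4) powr (- 3 / 2))" .
      have "cmod (integral {- \<rho>..\<rho>} F - g \<zeta> * of_real (sqrt (pi / (X * a))))
          \<le> cmod (integral {- \<rho>..\<rho>} F - integral {- \<rho>..\<rho>} G)
            + cmod (integral {- \<rho>..\<rho>} G - g \<zeta> * of_real (sqrt (pi / (X * a))))"
        using norm_triangle_ineq[of "integral {- \<rho>..\<rho>} F - integral {- \<rho>..\<rho>} G"
            "integral {- \<rho>..\<rho>} G - g \<zeta> * of_real (sqrt (pi / (X * a)))"] by simp
      also have "\<dots> \<le> C * X powr (- 3 / 2)"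
        using FG GM unfolding pw by (simp add: C_def algebra_simps)
      finally have FM: "cmod (integral {- \<rho>..\<rho>} F - g \<zeta> * of_real (sqrt (pi / (X * a)))) \<le> C * X powr (- 3 / 2)" .
      have "pi / (X * a) = 2 * pi / (X * A)" by (simp add: a_def)
      then have "H (\<zeta> + of_real \<rho> * d) - H (\<zeta> - of_real \<rho> * d)
            - exp (of_real X * \<phi> \<zeta>) * d * g \<zeta> * of_real (sqrt (2 * pi / (X * A)))
          = d * exp (of_real X * \<phi> \<zeta>) * (integral {- \<rho>..\<rho>} F - g \<zeta> * of_real (sqrt (pi / (X * a))))"
        unfolding HF by (simp add: algebra_simps)
      then have "cmod (H (\<zeta> + of_real \<rho> * d) - H (\<zeta> - of_real \<rho> * d)
            - exp (of_real X * \<phi> \<zeta>) * d * g \<zeta> * of_real (sqrt (2 * pi / (X * A))))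
          = exp (X * Re (\<phi> \<zeta>)) * cmod (integral {- \<rho>..\<rho>} F - g \<zeta> * of_real (sqrt (pi / (X * a))))"
        using d by (simp add: norm_mult)
      also have "\<dots> \<le> exp (X * Re (\<phi> \<zeta>)) * (C * X powr (- 3 / 2))"
        using FM by (rule mult_left_mono) simp
      finally show "cmod (H (\<zeta> + of_real \<rho> * d) - H (\<zeta> - of_real \<rho> * d)
            - exp (of_real X * \<phi> \<zeta>) * d * g \<zeta> * of_real (sqrt (2 * pi / (X * A))))
          \<le> C * X powr (- 3 / 2) * exp (X * Re (\<phi> \<zeta>))"
        by (simp add: mult_ac)
    qed
  qed
qed

section \<open>Limits at infinity and growth of polynomials on horizontal lines\<close>

text \<open>Stands in for the convergence of an improper integral: comparison with the primitive of
  \<open>K * exp (- (c * s))\<close> gives the Cauchy property and bounds the distance from the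
  limit.\<close>

lemma primitive_decay:
  fixes h h' :: "real \<Rightarrow> complex"
  assumes der: "\<And>s. s \<ge> S \<Longrightarrow> (h has_vector_derivative h' s) (at s)"
    and bnd: "\<And>s. s \<ge> S \<Longrightarrow> cmod (h' s) \<le> K * exp (- (c * s))" and c: "c > 0"
  obtains L where "(h \<longlongrightarrow> L) at_top" "\<And>s. s \<ge> S \<Longrightarrow> cmod (L - h s) \<le> K / c * exp (- (c * s))"
proof -
  have K: "K \<ge> 0"
    using bnd[of S] norm_ge_zero[of "h' S"] zero_le_mult_iff[of K "exp (- (c * S))"]
    by (metis exp_ge_zero exp_not_eq_zero linorder_not_less mult_le_0_iff order.order_iff_strict order_refl order_trans)
  have main: "cmod (h s' - h s) \<le> K / c * exp (- (c * s))" if "S \<le> s" "s < s'" for s s'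
  proof -
    have "cmod (h s' - h s) \<le> (- K / c * exp (- (c * s'))) - (- K / c * exp (- (c * s)))"
    proof (rule differentiable_bound_general[where f' = h' and \<phi>' = "\<lambda>s. K * exp (- (c * s))"])
      show "continuous_on {s..s'} h"
        using that by (auto intro!: continuous_at_imp_continuous_on has_vector_derivative_continuous[OF der])
      show "continuous_on {s..s'} (\<lambda>s. - K / c * exp (- (c * s)))" by (intro continuous_intros)
      fix x assume "s < x" "x < s'"
      show "((\<lambda>s. - K / c * exp (- (c * s))) has_vector_derivative K * exp (- (c * x))) (at x)"
        using c by (auto intro!: derivative_eq_intros simp flip: has_real_derivative_iff_has_vector_derivative)
      show "(h has_vector_derivative h' x) (at x)" using \<open>s < x\<close> that by (intro der) auto
      show "cmod (h' x) \<le> K * exp (- (c * x))" using \<open>s < x\<close> that by (intro bnd) auto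
    qed (use that in auto)
    also have "\<dots> \<le> K / c * exp (- (c * s))" using K c by simp
    finally show ?thesis .
  qed
  have lim0: "((\<lambda>s. K / c * exp (- (c * s))) \<longlongrightarrow> 0) at_top"
    using c by real_asymp
  have "\<exists>L. (\<lambda>m. h (S + real m)) \<longlonglongrightarrow> L"
  proof (rule Cauchy_convergent[unfolded convergent_def], rule CauchyI)
    fix e :: real assume e: "e > 0"
    have "(\<lambda>m. K / c * exp (- (c * (S + real m)))) \<longlonglongrightarrow> 0"
      by (rule filterlim_compose[OF lim0]) real_asymp
    then have "eventually (\<lambda>m. K / c * exp (- (c * (S + real m))) < e / 2) sequentially"
      using e by (intro order_tendstoD) auto
    then obtain M where M: "K / c * exp (- (c * (S + real m))) < e / 2" if "m \<ge> M" for m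
      by (auto simp: eventually_sequentially)
    have b: "cmod (h (S + real m) - h (S + real M)) < e / 2" if "m \<ge> M" for m
    proof (cases "m = M")
      case False
      then show ?thesis using main[of "S + real M" "S + real m"] M[OF order_refl] that by linarith
    qed (use e in simp)
    have "cmod (h (S + real m) - h (S + real k)) < e" if "m \<ge> M" "k \<ge> M" for m k
      using norm_triangle_ineq4[of "h (S + real m) - h (S + real M)" "h (S + real k) - h (S + real M)"]
        b[OF that(1)] b[OF that(2)] by simp
    then show "\<exists>M. \<forall>m\<ge>M. \<forall>k\<ge>M. cmod (h (S + real m) - h (S + real k)) < e" by blast
  qed
  then obtain L where L: "(\<lambda>m. h (S + real m)) \<longlonglongrightarrow> L" by blast
  have bL: "cmod (L - h s) \<le> K / c * exp (- (c * s))" if "s \<ge> S" for s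
  proof (rule tendsto_upperbound)
    show "(\<lambda>m. cmod (h (S + real m) - h s)) \<longlonglongrightarrow> cmod (L - h s)"
      by (intro tendsto_intros L)
    show "eventually (\<lambda>m. cmod (h (S + real m) - h s) \<le> K / c * exp (- (c * s))) sequentially"
      using eventually_gt_at_top[of "nat \<lceil>s - S\<rceil>"]
    proof eventually_elim
      case (elim m)
      then show ?case using that by (intro main) linarith+
    qed
  qed simp
  have "((\<lambda>s. L - h s) \<longlongrightarrow> 0) at_top"
    by (rule Lim_null_comparison[OF eventually_mono[OF eventually_ge_at_top[of S] bL] lim0])
  from tendsto_diff[OF tendsto_const[of L] this] have "(h \<longlongrightarrow> L) at_top" by simp
  then show thesis using bL that by blast
qed

text \<open>Powers are real on the real axis, so the imaginary part is an increment along a vertical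
  segment, and \<open>Y \<le> s\<close> keeps that segment in the disc of radius
  \<open>2 * s\<close>. The factor \<open>\<bar>y\<bar>\<close> in both bounds matters: they have to
  stay sharp as \<open>y\<close> tends to 0.\<close>

lemma Im_power_strip_bound:
  assumes s: "1 \<le> s" "Y \<le> s" and y: "\<bar>y\<bar> \<le> Y"
  shows "\<bar>Im ((of_real s + \<i> * of_real y) ^ j)\<bar> \<le> \<bar>y\<bar> * (real j * (2 * s) ^ (j - 1))"
    and "\<bar>Im ((of_real s + \<i> * of_real y) ^ Suc j) - y * (real (Suc j) * s ^ j)\<bar>
           \<le> \<bar>y\<bar> * (real (Suc j) * (real j * (2 * s) ^ (j - 1) * Y))"
proof -
  define z where "z = complex_of_real s + \<i> * of_real y"
  have nz: "cmod (of_real s + \<i> * of_real v) \<le> 2 * s" if "\<bar>v\<bar> \<le> Y" for v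
  proof -
    have "cmod (of_real s + \<i> * of_real v) \<le> \<bar>s\<bar> + \<bar>v\<bar>"
      by (metis norm_triangle_ineq norm_mult norm_ii mult_1 norm_of_real)
    then show ?thesis using that s by linarith
  qed
  have pd: "cmod (z ^ j - of_real s ^ j) \<le> real j * (2 * s) ^ (j - 1) * \<bar>y\<bar>" for j
  proof -
    have "cmod (z ^ j - of_real s ^ j) \<le> (real j * (2 * s) ^ (j - 1)) * cmod (z - of_real s)"
    proof (rule field_differentiable_bound[where S = "closed_segment (of_real s) z"
          and f' = "\<lambda>u. of_nat j * u ^ (j - 1)"])
      fix u assume "u \<in> closed_segment (of_real s) z"
      then obtain t where t: "0 \<le> t" "t \<le> 1" "u = of_real s + \<i> * of_real (t * y)"
        by (auto simp: closed_segment_def z_def algebra_simps scaleR_conv_of_real)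
      have "\<bar>t * y\<bar> \<le> 1 * Y" using t y unfolding abs_mult by (intro mult_mono) auto
      then have "cmod u \<le> 2 * s" using nz[of "t * y"] t by simp
      then show "cmod (of_nat j * u ^ (j - 1)) \<le> real j * (2 * s) ^ (j - 1)"
        unfolding norm_mult norm_power norm_of_nat by (intro mult_left_mono power_mono) auto
    qed (auto intro!: derivative_eq_intros)
    then show ?thesis by (simp add: z_def norm_mult)
  qed
  have "\<bar>Im (z ^ j)\<bar> = \<bar>Im (z ^ j - of_real s ^ j)\<bar>" by (simp flip: of_real_power)
  also have "\<dots> \<le> real j * (2 * s) ^ (j - 1) * \<bar>y\<bar>" using abs_Im_le_cmod pd order_trans by blast
  finally show "\<bar>Im ((of_real s + \<i> * of_real y) ^ j)\<bar> \<le> \<bar>y\<bar> * (real j * (2 * s) ^ (j - 1))"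
    by (simp add: z_def mult_ac)
  \<comment> \<open>With its linear part at \<open>s\<close> subtracted, the power has derivative
    \<open>Suc j * (u ^ j - s ^ j)\<close>, which is itself an increment; this gains the second
    order.\<close>
  define F :: "complex \<Rightarrow> complex" where "F = (\<lambda>u. u ^ Suc j - of_nat (Suc j) * of_real s ^ j * (u - of_real s))"
  have "cmod (F z - F (of_real s)) \<le> (real (Suc j) * (real j * (2 * s) ^ (j - 1) * Y)) * cmod (z - of_real s)"
  proof (rule field_differentiable_bound[where S = "closed_segment (of_real s) z"
        and f' = "\<lambda>u. of_nat (Suc j) * (u ^ j - of_real s ^ j)"])
    fix u assume "u \<in> closed_segment (of_real s) z"
    then obtain t where t: "0 \<le> t" "t \<le> 1" "u = of_real s + \<i> * of_real (t * y)"
      by (auto simp: closed_segment_def z_def algebra_simps scaleR_conv_of_real)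
    show "(F has_field_derivative of_nat (Suc j) * (u ^ j - of_real s ^ j))
        (at u within closed_segment (of_real s) z)"
      unfolding F_def by (auto intro!: derivative_eq_intros simp: algebra_simps power_eq_if[of u j])
    have uy: "\<bar>t * y\<bar> \<le> Y" using t y unfolding abs_mult by (metis abs_ge_zero abs_of_nonneg mult_left_le_one_le order_trans)
    have "cmod (u ^ j - of_real s ^ j) \<le> (real j * (2 * s) ^ (j - 1)) * cmod (u - of_real s)"
    proof (rule field_differentiable_bound[where S = "closed_segment (of_real s) u"
          and f' = "\<lambda>u. of_nat j * u ^ (j - 1)"])
      fix v assume "v \<in> closed_segment (of_real s) u"
      then obtain t' where t': "0 \<le> t'" "t' \<le> 1" "v = of_real s + \<i> * of_real (t' * (t * y))"
        by (auto simp: closed_segment_def t(3) algebra_simps scaleR_conv_of_real)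
      have "\<bar>t' * (t * y)\<bar> \<le> 1 * Y" using t' uy unfolding abs_mult[of t'] by (intro mult_mono) auto
      then have "cmod v \<le> 2 * s" using nz[of "t' * (t * y)"] t' by simp
      then show "cmod (of_nat j * v ^ (j - 1)) \<le> real j * (2 * s) ^ (j - 1)"
        unfolding norm_mult norm_power norm_of_nat by (intro mult_left_mono power_mono) auto
    qed (auto intro!: derivative_eq_intros)
    also have "\<dots> \<le> (real j * (2 * s) ^ (j - 1)) * Y"
      using uy s by (intro mult_left_mono) (auto simp: t(3) norm_mult)
    finally show "cmod (of_nat (Suc j) * (u ^ j - of_real s ^ j)) \<le> real (Suc j) * (real j * (2 * s) ^ (j - 1) * Y)"
      unfolding norm_mult norm_of_nat by (intro mult_left_mono) auto
  qed auto
  moreover have "cmod (z - of_real s) = \<bar>y\<bar>" by (simp add: z_def norm_mult)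
  moreover have "\<bar>Im (F z - F (of_real s))\<bar> = \<bar>Im (z ^ Suc j) - y * (real (Suc j) * s ^ j)\<bar>"
  proof -
    have "F z - F (of_real s) = z ^ Suc j - of_real (s ^ Suc j) - of_real (real (Suc j) * s ^ j) * (z - of_real s)"
      by (simp add: F_def)
    also have "Im \<dots> = Im (z ^ Suc j) - (real (Suc j) * s ^ j) * y"
      by (simp only: minus_complex.sel Im_complex_of_real) (simp add: z_def del: of_real_mult of_real_power of_nat_Suc)
    finally show ?thesis by (simp add: mult_ac)
  qed
  ultimately have "\<bar>Im (z ^ Suc j) - y * (real (Suc j) * s ^ j)\<bar>
      \<le> (real (Suc j) * (real j * (2 * s) ^ (j - 1) * Y)) * \<bar>y\<bar>"
    using abs_Im_le_cmod[of "F z - F (of_real s)"] by simp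
  then show "\<bar>Im ((of_real s + \<i> * of_real y) ^ Suc j) - y * (real (Suc j) * s ^ j)\<bar>
           \<le> \<bar>y\<bar> * (real (Suc j) * (real j * (2 * s) ^ (j - 1) * Y))"
    by (simp add: z_def mult_ac)
qed

text \<open>To first order in \<open>y\<close> the top power contributes
  \<open>d n * y * n * s ^ (n - 1)\<close>; everything else is at most a constant times
  \<open>\<bar>y\<bar> * s ^ (n - 2)\<close>. \<open>S\<close> sees the coefficients only through
  \<open>B\<close> and \<eta>, so it serves a whole family, and the bound holds down to the real
  axis, where both sides vanish.\<close>

lemma Im_real_poly_growth:
  fixes B \<eta> Y :: real and n :: nat
  assumes n: "n \<ge> 2" and \<eta>: "\<eta> > 0" and B: "B \<ge> 0" and Y: "Y \<ge> 0"
  obtains S where "S \<ge> 1" "S \<ge> Y" "\<And>d s y. \<lbrakk>\<And>j. j \<le> n \<Longrightarrow> \<bar>d j\<bar> \<le> B; \<eta> \<le> \<bar>d n\<bar>; s \<ge> S; \<bar>y\<bar> \<le> Y; 0 \<le> d n * y\<rbrakk>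
    \<Longrightarrow> Im (\<Sum>j\<le>n. of_real (d j) * (of_real s + \<i> * of_real y) ^ j) \<ge> \<eta> * \<bar>y\<bar> * s"
proof -
  \<comment> \<open>First summand: the error of linearising the top power. Second: the lower powers.
    For \<open>s \<ge> L / \<eta>\<close> their sum is at most \<open>\<eta> * s\<close>.\<close>
  define L where "L = B * real n * (real (n - 1) * 2 ^ (n - 2) * Y) + (\<Sum>j<n. B * (real j * 2 ^ (j - 1)))"
  define S where "S = max 1 (max Y (L / \<eta>))"
  show thesis
  proof (rule that[of S])
    fix d :: "nat \<Rightarrow> real" and s y :: real
    assume d: "\<And>j. j \<le> n \<Longrightarrow> \<bar>d j\<bar> \<le> B" and dn: "\<eta> \<le> \<bar>d n\<bar>" and s: "s \<ge> S" and y: "\<bar>y\<bar> \<le> Y" and sg: "0 \<le> d n * y"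
    have s1: "1 \<le> s" "Y \<le> s" "L / \<eta> \<le> s" using s by (auto simp: S_def)
    have sL: "L \<le> \<eta> * s" using s1(3) \<eta> by (simp add: field_simps)
    define z where "z = complex_of_real s + \<i> * of_real y"
    obtain m where m: "n = Suc (Suc m)" using n by (metis add_2_eq_Suc le_Suc_ex)
    have low: "\<bar>\<Sum>j<n. d j * Im (z ^ j)\<bar> \<le> \<bar>y\<bar> * s ^ m * (\<Sum>j<n. B * (real j * 2 ^ (j - 1)))"
    proof -
      have "\<bar>\<Sum>j<n. d j * Im (z ^ j)\<bar> \<le> (\<Sum>j<n. \<bar>d j * Im (z ^ j)\<bar>)" by (rule sum_abs)
      also have "\<dots> \<le> (\<Sum>j<n. \<bar>y\<bar> * s ^ m * (B * (real j * 2 ^ (j - 1))))"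
      proof (rule sum_mono)
        fix j assume j: "j \<in> {..<n}"
        have "\<bar>d j * Im (z ^ j)\<bar> \<le> B * (\<bar>y\<bar> * (real j * (2 * s) ^ (j - 1)))"
          unfolding abs_mult z_def using d[of j] j B
          by (intro mult_mono Im_power_strip_bound(1)[OF s1(1,2) y]) simp_all
        also have "\<dots> = \<bar>y\<bar> * s ^ (j - 1) * (B * (real j * 2 ^ (j - 1)))"
          by (simp add: power_mult_distrib mult_ac)
        also have "\<dots> \<le> \<bar>y\<bar> * s ^ m * (B * (real j * 2 ^ (j - 1)))"
          using s1 j B m by (intro mult_right_mono mult_left_mono power_increasing) auto
        finally show "\<bar>d j * Im (z ^ j)\<bar> \<le> \<bar>y\<bar> * s ^ m * (B * (real j * 2 ^ (j - 1)))" .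
      qed
      also have "\<dots> = \<bar>y\<bar> * s ^ m * (\<Sum>j<n. B * (real j * 2 ^ (j - 1)))" by (simp add: sum_distrib_left)
      finally show ?thesis .
    qed
    have top: "\<bar>d n * Im (z ^ n) - d n * y * (real n * s ^ Suc m)\<bar>
        \<le> \<bar>y\<bar> * s ^ m * (B * real n * (real (n - 1) * 2 ^ (n - 2) * Y))"
    proof -
      have "\<bar>d n * Im (z ^ n) - d n * y * (real n * s ^ Suc m)\<bar> = \<bar>d n\<bar> * \<bar>Im (z ^ n) - y * (real n * s ^ Suc m)\<bar>"
        by (simp add: abs_mult[symmetric] algebra_simps)
      also have "\<dots> \<le> B * (\<bar>y\<bar> * (real n * (real (Suc m) * (2 * s) ^ (Suc m - 1) * Y)))"
        using d[of n] B Im_power_strip_bound(2)[OF s1(1,2) y, of "Suc m"] unfolding z_def m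
        by (intro mult_mono) auto
      also have "\<dots> = \<bar>y\<bar> * s ^ m * (B * real n * (real (n - 1) * 2 ^ (n - 2) * Y))"
        by (simp add: m power_mult_distrib mult_ac)
      finally show ?thesis .
    qed
    have "\<eta> * \<bar>y\<bar> * s \<le> \<eta> * \<bar>y\<bar> * s ^ Suc m"
    proof -
      have "s ^ 1 \<le> s ^ Suc m" using s1 by (intro power_increasing) auto
      then show ?thesis using \<eta> by (intro mult_left_mono) auto
    qed
    \<comment> \<open>Since \<open>n \<ge> 2\<close>, the top power yields
      \<open>\<eta> * \<bar>y\<bar> * s ^ Suc m\<close> twice; one copy pays for the errors
      collected in \<open>L\<close>.\<close>
    also have "\<dots> \<le> 2 * (\<eta> * \<bar>y\<bar> * s ^ Suc m) - \<bar>y\<bar> * s ^ m * L"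
    proof -
      have "\<bar>y\<bar> * s ^ m * L \<le> \<bar>y\<bar> * s ^ m * (\<eta> * s)" using sL s1 by (intro mult_left_mono) auto
      then show ?thesis by (simp add: mult_ac)
    qed
    also have "\<dots> \<le> d n * y * (real n * s ^ Suc m) - \<bar>y\<bar> * s ^ m * L"
    proof -
      have "\<eta> * \<bar>y\<bar> \<le> \<bar>d n\<bar> * \<bar>y\<bar>" using dn by (rule mult_right_mono) simp
      also have "\<dots> = d n * y" using sg by (simp flip: abs_mult)
      finally have "(\<eta> * \<bar>y\<bar>) * (2 * s ^ Suc m) \<le> (d n * y) * (real n * s ^ Suc m)"
        by (rule mult_mono) (use n s1 sg in simp_all)
      then show ?thesis by (simp add: mult_ac)
    qed
    also have "\<dots> \<le> d n * Im (z ^ n) + (\<Sum>j<n. d j * Im (z ^ j))"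
      using low top unfolding L_def distrib_left by linarith
    also have "\<dots> = Im (\<Sum>j\<le>n. of_real (d j) * z ^ j)"
      by (simp add: lessThan_Suc_atMost[symmetric])
    finally show "Im (\<Sum>j\<le>n. of_real (d j) * (of_real s + \<i> * of_real y) ^ j) \<ge> \<eta> * \<bar>y\<bar> * s"
      by (simp add: z_def)
  qed (auto simp: S_def)
qed

section \<open>Directions of steepest descent at a stationary point\<close>

text \<open>The Morse lemma in one complex variable: \<open>(w - \<zeta>) * g w\<close> is a local
  coordinate at \<zeta> in which \<open>f - f \<zeta>\<close> is a square. Differentiating twice
  determines \<open>g \<zeta>\<close> up to sign, hence the directions of descent.\<close>

lemma second_order_zero_factor:
  assumes f: "f holomorphic_on UNIV" and crit: "deriv f \<zeta> = 0" and nz: "deriv (deriv f) \<zeta> \<noteq> 0"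
  obtains g r where "r > 0" "g holomorphic_on ball \<zeta> r"
    "\<And>w. w \<in> ball \<zeta> r \<Longrightarrow> f w - f \<zeta> = ((w - \<zeta>) * g w)\<^sup>2" "2 * (g \<zeta>)\<^sup>2 = deriv (deriv f) \<zeta>"
proof -
  obtain g r where r: "r > 0" and g: "g holomorphic_on ball \<zeta> r"
    and eq: "\<And>w. w \<in> ball \<zeta> r \<Longrightarrow> f w - f \<zeta> = ((w - \<zeta>) * g w)\<^sup>2"
  proof (rule holomorphic_factor_order_of_zero_strong[OF f open_UNIV UNIV_I, of 2 \<zeta>])
    show "(deriv ^^ 2) f \<zeta> \<noteq> 0" using nz by (simp add: numeral_2_eq_2)
    fix i :: nat assume "0 < i" "i < 2"
    then have "i = 1" by simp
    then show "(deriv ^^ i) f \<zeta> = 0" using crit by simp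
  qed (auto intro: that)
  have gd: "(g has_field_derivative deriv g w) (at w)" if "w \<in> ball \<zeta> r" for w
    using g that by (rule holomorphic_derivI[OF _ open_ball])
  have d1: "deriv f w = 2 * ((w - \<zeta>) * g w) * (g w + (w - \<zeta>) * deriv g w)" if w: "w \<in> ball \<zeta> r" for w
  proof -
    have "((\<lambda>w. f \<zeta> + ((w - \<zeta>) * g w)\<^sup>2) has_field_derivative
        2 * ((w - \<zeta>) * g w) * (g w + (w - \<zeta>) * deriv g w)) (at w)"
      by (auto intro!: derivative_eq_intros gd[OF w] simp: algebra_simps)
    note D = this
    have "eventually (\<lambda>w. f \<zeta> + ((w - \<zeta>) * g w)\<^sup>2 = f w) (nhds w)"
      using eventually_nhds_in_open[OF open_ball w] by eventually_elim (simp flip: eq)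
    then show ?thesis
      using DERIV_imp_deriv[OF DERIV_cong_ev[OF refl _ refl, THEN iffD1, OF _ D]] by blast
  qed
  have "deriv (deriv f) \<zeta> = 2 * (g \<zeta>)\<^sup>2"
  proof -
    have c: "\<zeta> \<in> ball \<zeta> r" using r by simp
    have "((\<lambda>w. deriv g w) has_field_derivative deriv (deriv g) \<zeta>) (at \<zeta>)"
      using holomorphic_deriv[OF g open_ball] c by (rule holomorphic_derivI[OF _ open_ball])
    then have "((\<lambda>w. 2 * ((w - \<zeta>) * g w) * (g w + (w - \<zeta>) * deriv g w)) has_field_derivative 2 * (g \<zeta>)\<^sup>2) (at \<zeta>)"
      by (auto intro!: derivative_eq_intros gd[OF c] simp: power2_eq_square)
    note D = this
    have "eventually (\<lambda>w. 2 * ((w - \<zeta>) * g w) * (g w + (w - \<zeta>) * deriv g w) = deriv f w) (nhds \<zeta>)"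
      using eventually_nhds_in_open[OF open_ball c] by eventually_elim (simp add: d1)
    then show ?thesis
      using DERIV_imp_deriv[OF DERIV_cong_ev[OF refl _ refl, THEN iffD1, OF _ D]] by blast
  qed
  then show thesis using that r g eq by metis
qed

text \<open>\<open>(f (\<gamma> u) - f \<zeta>) / u\<^sup>2\<close> tends to the square of
  \<open>cis \<theta> * g \<zeta>\<close>. The quotient is real because the imaginary part of
  \<open>f\<close> is constant along the curve, and nonpositive because the real part decreases.
  Every admissible curve has to be covered, as \<open>descent_angle\<close> is only known to be some
  choice.\<close>

lemma leaves_at_angle_imp_descent:
  assumes f: "f holomorphic_on UNIV" and crit: "deriv f \<zeta> = 0" and nz: "deriv (deriv f) \<zeta> \<noteq> 0"
    and l: "leaves_at_angle f \<zeta> \<theta>"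
  shows "(cis \<theta>)\<^sup>2 * deriv (deriv f) \<zeta> = - of_real (cmod (deriv (deriv f) \<zeta>))"
proof -
  obtain g r where r: "r > 0" and g: "g holomorphic_on ball \<zeta> r"
    and eq: "\<And>w. w \<in> ball \<zeta> r \<Longrightarrow> f w - f \<zeta> = ((w - \<zeta>) * g w)\<^sup>2"
    and q: "2 * (g \<zeta>)\<^sup>2 = deriv (deriv f) \<zeta>"
    using second_order_zero_factor[OF f crit nz] by metis
  obtain \<gamma> \<epsilon> where \<epsilon>: "0 < \<epsilon>" and \<gamma>0: "\<gamma> 0 = \<zeta>" and cont: "continuous_on {0..\<epsilon>} \<gamma>"
    and vd: "(\<gamma> has_vector_derivative cis \<theta>) (at 0 within {0..\<epsilon>})"
    and Im: "\<forall>u\<in>{0..\<epsilon>}. Im (f (\<gamma> u)) = Im (f \<zeta>)"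
    and Re: "strict_antimono_on {0..\<epsilon>} (\<lambda>u. Re (f (\<gamma> u)))"
    using l unfolding leaves_at_angle_def by blast
  let ?F = "at (0::real) within {0..\<epsilon>}"
  have nb: "?F \<noteq> bot" using \<epsilon> by (simp add: trivial_limit_within islimpt_Icc)
  have lim: "(\<gamma> \<longlongrightarrow> \<zeta>) ?F" using cont \<epsilon> \<gamma>0 by (auto simp: continuous_on_def)
  have quot: "((\<lambda>u. (\<gamma> u - \<zeta>) / of_real u) \<longlongrightarrow> cis \<theta>) ?F"
  proof -
    have "((\<lambda>u. (1 / norm (u - 0)) *\<^sub>R (\<gamma> u - (\<gamma> 0 + (u - 0) *\<^sub>R cis \<theta>))) \<longlongrightarrow> 0) ?F"
      using vd unfolding has_vector_derivative_def has_derivative_within by blast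
    then have "((\<lambda>u. norm ((1 / norm (u - 0)) *\<^sub>R (\<gamma> u - (\<gamma> 0 + (u - 0) *\<^sub>R cis \<theta>)))) \<longlongrightarrow> 0) ?F"
      by (rule tendsto_norm_zero)
    moreover have "eventually (\<lambda>u. norm ((1 / norm (u - 0)) *\<^sub>R (\<gamma> u - (\<gamma> 0 + (u - 0) *\<^sub>R cis \<theta>)))
        = norm ((\<gamma> u - \<zeta>) / of_real u - cis \<theta>)) ?F"
    proof -
      have "eventually (\<lambda>u::real. u \<noteq> 0) ?F" by (simp add: eventually_at_filter)
      then show ?thesis
      proof eventually_elim
        case (elim u)
        have "(\<gamma> u - \<zeta>) / of_real u - cis \<theta> = (\<gamma> u - (\<zeta> + u *\<^sub>R cis \<theta>)) / of_real u"
          using elim by (simp add: field_simps scaleR_conv_of_real)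
        then show ?case by (simp add: norm_divide \<gamma>0)
      qed
    qed
    ultimately have "((\<lambda>u. norm ((\<gamma> u - \<zeta>) / of_real u - cis \<theta>)) \<longlongrightarrow> 0) ?F"
      by (rule Lim_transform_eventually)
    then show ?thesis by (simp add: tendsto_norm_zero_iff LIM_zero_iff)
  qed
  have c: "isCont g \<zeta>"
    using g r by (intro continuous_on_interior[OF holomorphic_on_imp_continuous_on]) auto
  have "((\<lambda>u. ((\<gamma> u - \<zeta>) / of_real u * g (\<gamma> u))\<^sup>2) \<longlongrightarrow> (cis \<theta> * g \<zeta>)\<^sup>2) ?F"
    by (intro tendsto_intros quot isCont_tendsto_compose[OF c lim])
  moreover have "eventually (\<lambda>u. ((\<gamma> u - \<zeta>) / of_real u * g (\<gamma> u))\<^sup>2 = (f (\<gamma> u) - f \<zeta>) / of_real (u\<^sup>2)) ?F"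
  proof -
    have "eventually (\<lambda>u. \<gamma> u \<in> ball \<zeta> r) ?F"
      using lim r by (intro topological_tendstoD) auto
    then show ?thesis
      by eventually_elim (simp add: eq power_mult_distrib power_divide)
  qed
  ultimately have L: "((\<lambda>u. (f (\<gamma> u) - f \<zeta>) / of_real (u\<^sup>2)) \<longlongrightarrow> (cis \<theta> * g \<zeta>)\<^sup>2) ?F"
    by (rule Lim_transform_eventually)
  have inn: "eventually (\<lambda>u. u \<in> {0..\<epsilon>} \<and> u \<noteq> 0) ?F" by (simp add: eventually_at_filter)
  have "Im ((cis \<theta> * g \<zeta>)\<^sup>2) = 0"
  proof (rule tendsto_unique[OF nb tendsto_Im[OF L]])
    show "((\<lambda>u. Im ((f (\<gamma> u) - f \<zeta>) / of_real (u\<^sup>2))) \<longlongrightarrow> 0) ?F"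
      by (rule tendsto_eventually, use inn in eventually_elim) (use Im in \<open>simp del: of_real_power\<close>)
  qed
  moreover have "Re ((cis \<theta> * g \<zeta>)\<^sup>2) \<le> 0"
  proof (rule tendsto_upperbound[OF tendsto_Re[OF L] _ nb], use inn in eventually_elim)
    case (elim u)
    then have "Re (f (\<gamma> u)) < Re (f (\<gamma> 0))"
      using Re \<epsilon> unfolding monotone_on_def by auto
    then show ?case using \<gamma>0 by (simp add: divide_nonpos_nonneg del: of_real_power)
  qed
  moreover have "(cis \<theta>)\<^sup>2 * deriv (deriv f) \<zeta> = 2 * (cis \<theta> * g \<zeta>)\<^sup>2"
    by (simp add: q[symmetric] power_mult_distrib)
  ultimately have "(cis \<theta>)\<^sup>2 * deriv (deriv f) \<zeta> = of_real (Re ((cis \<theta>)\<^sup>2 * deriv (deriv f) \<zeta>))"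
    "Re ((cis \<theta>)\<^sup>2 * deriv (deriv f) \<zeta>) \<le> 0"
    by (auto simp: complex_eq_iff)
  moreover have "cmod ((cis \<theta>)\<^sup>2 * deriv (deriv f) \<zeta>) = cmod (deriv (deriv f) \<zeta>)"
    by (simp add: norm_mult norm_power)
  ultimately show ?thesis
    by (metis abs_of_nonpos minus_minus norm_of_real of_real_minus)
qed

text \<open>In the Morse coordinate \<open>k\<close> the path of steepest descent is a segment of
  the imaginary axis; its preimage is the required curve, along which \<open>f\<close> equals
  \<open>f \<zeta> - a\<^sup>2 * u\<^sup>2\<close>.\<close>

lemma descent_imp_leaves_at_angle:
  assumes f: "f holomorphic_on UNIV" and crit: "deriv f \<zeta> = 0"
    and d: "(cis \<theta>)\<^sup>2 * deriv (deriv f) \<zeta> = - of_real A" and A: "A > 0"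
  shows "leaves_at_angle f \<zeta> \<theta>"
proof -
  have nz: "deriv (deriv f) \<zeta> \<noteq> 0" using d A by auto
  obtain g r where r: "r > 0" and g: "g holomorphic_on ball \<zeta> r"
    and eq: "\<And>w. w \<in> ball \<zeta> r \<Longrightarrow> f w - f \<zeta> = ((w - \<zeta>) * g w)\<^sup>2"
    and q: "2 * (g \<zeta>)\<^sup>2 = deriv (deriv f) \<zeta>"
    using second_order_zero_factor[OF f crit nz] by metis
  define k where "k = (\<lambda>w. (w - \<zeta>) * g w)"
  have kh: "k holomorphic_on ball \<zeta> r" unfolding k_def by (intro holomorphic_intros g)
  have c: "\<zeta> \<in> ball \<zeta> r" using r by simp
  have "(k has_field_derivative g \<zeta>) (at \<zeta>)"
    unfolding k_def using holomorphic_derivI[OF g open_ball c]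
    by (auto intro!: derivative_eq_intros)
  then have dk: "deriv k \<zeta> = g \<zeta>" by (rule DERIV_imp_deriv)
  have g0: "g \<zeta> \<noteq> 0" using q nz by auto
  obtain r1 where r1: "r1 > 0" "ball \<zeta> r1 \<subseteq> ball \<zeta> r" "open (k ` ball \<zeta> r1)" "inj_on k (ball \<zeta> r1)"
    using has_complex_derivative_locally_invertible[OF kh c open_ball] dk g0 by metis
  obtain l where l: "l holomorphic_on (k ` ball \<zeta> r1)"
    and dl: "\<And>z. z \<in> ball \<zeta> r1 \<Longrightarrow> deriv k z * deriv l (k z) = 1"
    and li: "\<And>z. z \<in> ball \<zeta> r1 \<Longrightarrow> l (k z) = z"
    using holomorphic_has_inverse[OF holomorphic_on_subset[OF kh r1(2)] open_ball r1(4)] by metis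
  have k0: "k \<zeta> = 0" by (simp add: k_def)
  have "0 \<in> k ` ball \<zeta> r1" using k0 r1(1) by (metis centre_in_ball imageI)
  then obtain e where e: "e > 0" "ball 0 e \<subseteq> k ` ball \<zeta> r1" using r1(3) by (meson open_contains_ball)
  define a where "a = Im (cis \<theta> * g \<zeta>)"
  have sq: "(cis \<theta> * g \<zeta>)\<^sup>2 = - of_real (A / 2)"
  proof -
    have "2 * (cis \<theta> * g \<zeta>)\<^sup>2 = - of_real A" unfolding d[symmetric] q[symmetric] by (simp add: power_mult_distrib)
    then show ?thesis by (simp add: field_simps)
  qed
  have re0: "Re (cis \<theta> * g \<zeta>) = 0"
  proof (rule ccontr)
    assume ne: "Re (cis \<theta> * g \<zeta>) \<noteq> 0"
    have "Im ((cis \<theta> * g \<zeta>)\<^sup>2) = 0" "Re ((cis \<theta> * g \<zeta>)\<^sup>2) < 0" using sq A by simp_all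
    then have "Im (cis \<theta> * g \<zeta>) = 0" using ne by (simp add: Im_power2 del: times_complex.sel cis.sel)
    then show False using \<open>Re ((cis \<theta> * g \<zeta>)\<^sup>2) < 0\<close>
      by (simp add: Re_power2 del: times_complex.sel cis.sel)
  qed
  have ia: "cis \<theta> * g \<zeta> = \<i> * of_real a" using re0 by (simp add: a_def complex_eq_iff)
  have a0: "a \<noteq> 0" using ia g0 by auto
  define \<epsilon> where "\<epsilon> = e / (2 * \<bar>a\<bar>)"
  have \<epsilon>: "\<epsilon> > 0" using e a0 by (simp add: \<epsilon>_def)
  \<comment> \<open>The square of \<open>cis \<theta> * g \<zeta>\<close> is negative, so this
    number is \<open>\<i> * a\<close>. The coordinate has derivative \<open>g \<zeta>\<close> at
    \<zeta>, so speed \<open>\<i> * a\<close> on the segment becomes the unit tangent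
    \<open>cis \<theta>\<close> of the preimage.\<close>
  define \<gamma> where "\<gamma> = (\<lambda>u::real. l (\<i> * of_real a * of_real u))"
  have inb: "\<i> * of_real a * of_real u \<in> ball 0 e" if "u \<in> {0..\<epsilon>}" for u
  proof -
    have "\<bar>a\<bar> * \<bar>u\<bar> \<le> \<bar>a\<bar> * \<epsilon>" using that by (intro mult_left_mono) auto
    also have "\<dots> < e" using e a0 by (simp add: \<epsilon>_def)
    finally show ?thesis by (simp add: norm_mult)
  qed
  have fg: "f (\<gamma> u) = f \<zeta> - of_real (a\<^sup>2 * u\<^sup>2)" if u: "u \<in> {0..\<epsilon>}" for u
  proof -
    obtain z where z: "z \<in> ball \<zeta> r1" "k z = \<i> * of_real a * of_real u" using inb[OF u] e(2) by auto
    then have "\<gamma> u = z" unfolding \<gamma>_def using li by metis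
    moreover have "f z - f \<zeta> = (k z)\<^sup>2" using eq[of z] z(1) r1(2) by (auto simp: k_def)
    ultimately show ?thesis using z(2) by (simp add: power_mult_distrib algebra_simps)
  qed
  have ld: "(l has_field_derivative deriv l w) (at w)" if "w \<in> ball 0 e" for w
    using l that e(2) r1(3) holomorphic_derivI by blast
  have gd: "(\<gamma> has_vector_derivative \<i> * of_real a * deriv l (\<i> * of_real a * of_real u)) (at u within {0..\<epsilon>})"
    if u: "u \<in> {0..\<epsilon>}" for u
  proof -
    have "((\<lambda>u. \<i> * of_real a * of_real u) has_vector_derivative \<i> * of_real a) (at u within {0..\<epsilon>})"
      by (auto intro!: derivative_eq_intros simp: has_vector_derivative_def scaleR_conv_of_real mult_ac)
    from field_vector_diff_chain_within[OF this has_field_derivative_at_within[OF ld[OF inb[OF u]]]]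
    show ?thesis by (simp add: \<gamma>_def o_def)
  qed
  show ?thesis
    unfolding leaves_at_angle_def
  proof (intro exI[of _ \<gamma>] exI[of _ \<epsilon>] conjI ballI)
    show "\<gamma> 0 = \<zeta>" using li[of \<zeta>] r1(1) by (simp add: \<gamma>_def k0)
    show "continuous_on {0..\<epsilon>} \<gamma>"
      using gd by (meson continuous_on_eq_continuous_within has_vector_derivative_continuous)
    have "g \<zeta> * deriv l 0 = 1" using dl[of \<zeta>] r1(1) by (simp add: k0 dk)
    then have "\<i> * of_real a * deriv l 0 = cis \<theta>" unfolding ia[symmetric] by (simp add: mult.assoc)
    then show "(\<gamma> has_vector_derivative cis \<theta>) (at 0 within {0..\<epsilon>})" using gd[of 0] \<epsilon> by simp
    show "Im (f (\<gamma> u)) = Im (f \<zeta>)" if "u \<in> {0..\<epsilon>}" for u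
      unfolding fg[OF that] by (simp del: of_real_mult of_real_power)
    show "strict_antimono_on {0..\<epsilon>} (\<lambda>u. Re (f (\<gamma> u)))"
    proof (rule monotone_onI)
      fix u v assume u: "u \<in> {0..\<epsilon>}" "v \<in> {0..\<epsilon>}" "u < v"
      then have "a\<^sup>2 * u\<^sup>2 < a\<^sup>2 * v\<^sup>2" using a0 by (intro mult_strict_left_mono power_strict_mono) auto
      then show "Re (f (\<gamma> v)) < Re (f (\<gamma> u))"
        unfolding fg[OF u(1)] fg[OF u(2)] by (simp del: of_real_mult of_real_power)
    qed
  qed (rule \<epsilon>)
qed

section \<open>The scaled phase and its stationary points for small e\<close>

text \<open>
  In the scaled variable the phase is \<open>Phi e\<close> with \<open>e = (\<bar>x\<bar>/t) powr (-1/(n-1))\<close> and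
  \<open>b j = w j * (sgn x)^j\<close>; the exponent of the denominator is \<open>p = m + 1\<close>, and \<open>p = -q\<close>
  belongs to the \<open>q\<close>-th derivative of the kernel.
\<close>

locale phase_family =
  fixes n :: nat and b :: "nat \<Rightarrow> real" and p :: int
  assumes n: "2 \<le> n" and bn: "b n \<noteq> 0"
begin

definition Phi :: "real \<Rightarrow> complex \<Rightarrow> complex" where
  "Phi e z = \<i> * (z - (\<Sum>j=2..n. of_real (b j * e ^ (n - j)) * z ^ j))"

definition dPhi :: "real \<Rightarrow> complex \<Rightarrow> complex" where
  "dPhi e z = \<i> * (1 - (\<Sum>j=2..n. of_real (b j * e ^ (n - j)) * (of_nat j * z ^ (j - 1))))"

definition ddPhi :: "real \<Rightarrow> complex \<Rightarrow> complex" where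
  "ddPhi e z = - \<i> * (\<Sum>j=2..n. of_real (b j * e ^ (n - j)) * (of_nat j * (of_nat (j - 1) * z ^ (j - 2))))"

text \<open>For \<open>p > 0\<close> the pole at 0 may have a residue, and then there is no
  primitive on the punctured plane. The slit is on the lower side because the contour passes above
  0; 0 itself belongs to it.\<close>

definition cut :: "complex set" where
  "cut = (if p \<le> 0 then UNIV else {z. \<not> (Re z = 0 \<and> Im z \<le> 0)})"

definition F :: "real \<Rightarrow> real \<Rightarrow> complex \<Rightarrow> complex" where
  "F e X z = exp (of_real X * Phi e z) / (\<i> * z) powi p"

definition H :: "real \<Rightarrow> real \<Rightarrow> complex \<Rightarrow> complex" where
  "H e X = (SOME h. \<forall>z\<in>cut. (h has_field_derivative F e X z) (at z))"

lemma Phi_deriv: "(Phi e has_field_derivative dPhi e z) (at z within A)"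
  unfolding Phi_def dPhi_def
  by (auto intro!: derivative_eq_intros sum.cong simp: algebra_simps)

lemma dPhi_deriv: "(dPhi e has_field_derivative ddPhi e z) (at z within A)"
proof -
  have "((\<lambda>z. \<Sum>j=2..n. of_real (b j * e ^ (n - j)) * (of_nat j * z ^ (j - 1))) has_field_derivative
      (\<Sum>j=2..n. of_real (b j * e ^ (n - j)) * (of_nat j * (of_nat (j - 1) * z ^ (j - 2))))) (at z within A)"
  proof (rule DERIV_sum)
    fix j assume "j \<in> {2..n}"
    have "((\<lambda>z. z ^ (j - 1)) has_field_derivative of_nat (j - 1) * z ^ (j - 2)) (at z within A)"
      by (rule DERIV_cong, rule DERIV_power[OF DERIV_ident]) (simp add: diff_diff_left numeral_2_eq_2)
    from DERIV_cmult[OF DERIV_cmult[OF this, of "of_nat j"], of "of_real (b j * e ^ (n - j))"]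
    show "((\<lambda>z. of_real (b j * e ^ (n - j)) * (of_nat j * z ^ (j - 1))) has_field_derivative
      of_real (b j * e ^ (n - j)) * (of_nat j * (of_nat (j - 1) * z ^ (j - 2)))) (at z within A)" .
  qed
  from DERIV_cmult[OF DERIV_diff[OF DERIV_const[of 1] this], of \<i>]
  show ?thesis unfolding dPhi_def ddPhi_def by simp
qed

lemma deriv_Phi: "deriv (Phi e) = dPhi e" "deriv (dPhi e) = ddPhi e"
  by (auto intro!: DERIV_imp_deriv Phi_deriv dPhi_deriv)

lemma holomorphic_Phi: "Phi e holomorphic_on A" "dPhi e holomorphic_on A" "ddPhi e holomorphic_on A"
  unfolding Phi_def dPhi_def ddPhi_def by (intro holomorphic_intros)+

lemma continuous_Phi:
  "continuous_on A (Phi e)" "continuous_on A (dPhi e)" "continuous_on A (ddPhi e)"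
  by (intro holomorphic_on_imp_continuous_on holomorphic_Phi)+

lemma open_cut: "open cut"
proof -
  have "{z. \<not> (Re z = 0 \<and> Im z \<le> 0)} = - ({z. Re z = 0} \<inter> {z. Im z \<le> 0})" by auto
  moreover have "closed ({z. Re z = 0} \<inter> {z. Im z \<le> 0})"
    by (intro closed_Int closed_Collect_eq closed_Collect_le continuous_intros)
  ultimately show ?thesis by (simp add: cut_def open_closed)
qed

text \<open>The centre is \<i>: a segment from there meets the imaginary axis again only if its end
  point lies on that axis, and such an end point of the slit plane is above 0.\<close>

lemma starlike_cut: "starlike cut"
proof (cases "p \<le> 0")
  case False
  have "closed_segment \<i> x \<subseteq> cut" if x: "x \<in> cut" for x
  proof
    fix z assume "z \<in> closed_segment \<i> x"
    then obtain u where u: "0 \<le> u" "u \<le> 1" "z = (1 - u) *\<^sub>R \<i> + u *\<^sub>R x"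
      by (auto simp: closed_segment_def)
    show "z \<in> cut"
    proof (cases "Re x = 0 \<or> u = 0")
      case True
      have "0 < (1 - u) + u * Im x"
      proof (cases "u = 0")
        case False
        then have "Im x > 0" using True x \<open>\<not> p \<le> 0\<close> by (auto simp: cut_def)
        then have "0 < u * Im x" using False u by simp
        then show ?thesis using u by linarith
      qed simp
      then show ?thesis by (simp add: cut_def u(3))
    qed (use False in \<open>auto simp: cut_def u(3)\<close>)
  qed
  moreover have "\<i> \<in> cut" by (simp add: cut_def)
  ultimately show ?thesis unfolding starlike_def by blast
qed (auto simp: cut_def starlike_def)

lemma cutI: "p \<le> 0 \<or> Re z \<noteq> 0 \<or> Im z > 0 \<Longrightarrow> z \<in> cut"
  by (auto simp: cut_def)

lemma cut_nonzero: "z \<in> cut \<Longrightarrow> p > 0 \<Longrightarrow> z \<noteq> 0"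
  by (auto simp: cut_def)

lemma holomorphic_weight: "(\<lambda>z. 1 / (\<i> * z) powi p) holomorphic_on cut"
proof (cases "p \<le> 0")
  case True
  have "1 / (\<i> * z) powi p = (\<i> * z) ^ nat (- p)" for z
    using True by (cases "p = 0") (auto simp: power_int_def field_simps)
  then show ?thesis by (simp, intro holomorphic_intros)
next
  case False
  have "1 / (\<i> * z) powi p = 1 / (\<i> * z) ^ nat p" for z
    using False by (simp add: power_int_def)
  then show ?thesis using cut_nonzero False by (simp, intro holomorphic_intros) auto
qed

lemma F_alt: "F e X z = exp (of_real X * Phi e z) * (1 / (\<i> * z) powi p)"
  by (simp add: F_def)

lemma holomorphic_F: "F e X holomorphic_on cut"
  unfolding F_alt by (intro holomorphic_intros holomorphic_Phi holomorphic_weight)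

lemma H_deriv: "z \<in> cut \<Longrightarrow> (H e X has_field_derivative F e X z) (at z)"
proof -
  assume z: "z \<in> cut"
  have "\<exists>h. \<forall>z\<in>cut. (h has_field_derivative F e X z) (at z)"
    by (rule holomorphic_starlike_primitive[OF _ starlike_cut open_cut finite.emptyI])
      (use holomorphic_F open_cut in \<open>auto intro: holomorphic_on_imp_continuous_on holomorphic_on_imp_differentiable_at\<close>)
  from someI_ex[OF this] show ?thesis using z unfolding H_def by blast
qed

lemma norm_F: "cmod (F e X z) = exp (X * Re (Phi e z)) * (1 / cmod z powi p)"
  by (simp add: F_def norm_divide norm_power_int norm_mult)

lemma H_segment_bound:
  assumes "closed_segment u v \<subseteq> cut" "\<And>z. z \<in> closed_segment u v \<Longrightarrow> cmod (F e X z) \<le> B"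
  shows "cmod (H e X v - H e X u) \<le> B * cmod (v - u)"
proof -
  have "(H e X has_field_derivative F e X z) (at z within closed_segment u v)"
    if "z \<in> closed_segment u v" for z
    using that assms(1) H_deriv has_field_derivative_at_within by blast
  from field_differentiable_bound[OF convex_closed_segment this assms(2), of v u]
  show ?thesis by simp
qed

text \<open>Made to serve the phase and its first two derivatives at once:
  \<open>(real j)\<^sup>2\<close> dominates the factors 1, \<open>j\<close> and
  \<open>j * (j - 1)\<close>, and \<open>(1 + R) ^ j\<close> dominates all powers of
  \<open>cmod z\<close> up to the j-th.\<close>

definition perturb_const :: "real \<Rightarrow> real" where
  "perturb_const R = (\<Sum>j=2..n. \<bar>b j\<bar> * (real j)\<^sup>2 * (1 + R) ^ j)"

lemma perturb_const_nonneg: "R \<ge> 0 \<Longrightarrow> perturb_const R \<ge> 0"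
  unfolding perturb_const_def by (intro sum_nonneg) auto

text \<open>Only the coefficients below the top one depend on \<open>e\<close>, and they carry at
  least one factor \<open>e\<close>; it remains to bound the monomials on the disc of radius
  \<open>R\<close>.\<close>

lemma Phi_perturb:
  assumes e: "0 \<le> e" "e \<le> 1" and z: "cmod z \<le> R"
  shows "cmod (Phi e z - Phi 0 z) \<le> e * perturb_const R"
    and "cmod (dPhi e z - dPhi 0 z) \<le> e * perturb_const R"
    and "cmod (ddPhi e z - ddPhi 0 z) \<le> e * perturb_const R"
proof -
  have R: "R \<ge> 0" using z norm_ge_zero order_trans by blast
  have gen: "cmod ((\<Sum>j=2..n. of_real (b j * e ^ (n - j)) * f j) - (\<Sum>j=2..n. of_real (b j * 0 ^ (n - j)) * f j))
      \<le> e * perturb_const R" if f: "\<And>j. j \<in> {2..n} \<Longrightarrow> cmod (f j) \<le> (real j)\<^sup>2 * (1 + R) ^ j" for f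
  proof -
    have "cmod ((\<Sum>j=2..n. of_real (b j * e ^ (n - j)) * f j) - (\<Sum>j=2..n. of_real (b j * 0 ^ (n - j)) * f j))
        \<le> (\<Sum>j=2..n. cmod (of_real (b j * (e ^ (n - j) - 0 ^ (n - j))) * f j))"
      unfolding sum_subtractf[symmetric]
      by (rule order_trans[OF norm_sum]) (simp add: algebra_simps)
    also have "\<dots> \<le> (\<Sum>j=2..n. e * (\<bar>b j\<bar> * ((real j)\<^sup>2 * (1 + R) ^ j)))"
    proof (rule sum_mono)
      fix j assume j: "j \<in> {2..n}"
      have "\<bar>e ^ (n - j) - 0 ^ (n - j)\<bar> \<le> e"
      proof (cases "j = n")
        case False
        then have "e ^ (n - j) \<le> e ^ 1" using j e by (intro power_decreasing) auto
        then show ?thesis using False j e by (simp add: zero_power)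
      qed (use e in simp)
      then have "\<bar>b j\<bar> * \<bar>e ^ (n - j) - 0 ^ (n - j)\<bar> * cmod (f j) \<le> \<bar>b j\<bar> * e * ((real j)\<^sup>2 * (1 + R) ^ j)"
        using f[OF j] e by (intro mult_mono) auto
      then show "cmod (of_real (b j * (e ^ (n - j) - 0 ^ (n - j))) * f j) \<le> e * (\<bar>b j\<bar> * ((real j)\<^sup>2 * (1 + R) ^ j))"
        by (simp only: norm_mult norm_of_real abs_mult) (simp add: mult_ac)
    qed
    also have "\<dots> = e * perturb_const R" by (simp add: perturb_const_def sum_distrib_left mult_ac)
    finally show ?thesis .
  qed
  have pw: "cmod (z ^ k) \<le> (1 + R) ^ j" if "k \<le> j" for k j
  proof -
    have "cmod (z ^ k) \<le> (1 + R) ^ k" unfolding norm_power using z R by (intro power_mono) auto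
    also have "\<dots> \<le> (1 + R) ^ j" using that R by (intro power_increasing) auto
    finally show ?thesis .
  qed
  have "cmod (Phi e z - Phi 0 z) = cmod ((\<Sum>j=2..n. of_real (b j * e ^ (n - j)) * z ^ j)
        - (\<Sum>j=2..n. of_real (b j * 0 ^ (n - j)) * z ^ j))"
    unfolding Phi_def right_diff_distrib[symmetric] norm_mult by (simp add: norm_minus_commute)
  also have "\<dots> \<le> e * perturb_const R"
  proof (rule gen)
    fix j assume j: "j \<in> {2..n}"
    have "1 * cmod (z ^ j) \<le> (real j)\<^sup>2 * (1 + R) ^ j" using j R pw[of j j] by (intro mult_mono) (auto simp: one_le_power)
    then show "cmod (z ^ j) \<le> (real j)\<^sup>2 * (1 + R) ^ j" by simp
  qed
  finally show "cmod (Phi e z - Phi 0 z) \<le> e * perturb_const R" .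
  have "cmod (dPhi e z - dPhi 0 z) = cmod ((\<Sum>j=2..n. of_real (b j * e ^ (n - j)) * (of_nat j * z ^ (j - 1)))
        - (\<Sum>j=2..n. of_real (b j * 0 ^ (n - j)) * (of_nat j * z ^ (j - 1))))"
    unfolding dPhi_def right_diff_distrib[symmetric] norm_mult by (simp add: norm_minus_commute)
  also have "\<dots> \<le> e * perturb_const R"
  proof (rule gen)
    fix j assume j: "j \<in> {2..n}"
    have "real j * cmod (z ^ (j - 1)) \<le> (real j)\<^sup>2 * (1 + R) ^ j"
      using j R pw[of "j - 1" j] by (intro mult_mono) (auto simp: power2_eq_square)
    then show "cmod (of_nat j * z ^ (j - 1)) \<le> (real j)\<^sup>2 * (1 + R) ^ j" by (simp add: norm_mult)
  qed
  finally show "cmod (dPhi e z - dPhi 0 z) \<le> e * perturb_const R" .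
  have "cmod (ddPhi e z - ddPhi 0 z) = cmod ((\<Sum>j=2..n. of_real (b j * e ^ (n - j)) * (of_nat j * (of_nat (j - 1) * z ^ (j - 2))))
        - (\<Sum>j=2..n. of_real (b j * 0 ^ (n - j)) * (of_nat j * (of_nat (j - 1) * z ^ (j - 2)))))"
    unfolding ddPhi_def right_diff_distrib[symmetric] norm_mult by simp
  also have "\<dots> \<le> e * perturb_const R"
  proof (rule gen)
    fix j assume j: "j \<in> {2..n}"
    have "real j * (real (j - 1) * cmod (z ^ (j - 2))) \<le> real j * (real j * (1 + R) ^ j)"
      using j R pw[of "j - 2" j] by (intro mult_left_mono mult_mono) auto
    then show "cmod (of_nat j * (of_nat (j - 1) * z ^ (j - 2))) \<le> (real j)\<^sup>2 * (1 + R) ^ j"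
      by (simp add: norm_mult power2_eq_square mult.assoc del: of_nat_diff)
  qed
  finally show "cmod (ddPhi e z - ddPhi 0 z) \<le> e * perturb_const R" .
qed

lemma zero_power_sum: "(\<Sum>j=2..n. of_real (b j * 0 ^ (n - j)) * f j) = (of_real (b n) * f n :: complex)"
proof -
  have "(\<Sum>j=2..n. of_real (b j * 0 ^ (n - j)) * f j) = (\<Sum>j\<in>{n}. of_real (b j * 0 ^ (n - j)) * f j)"
    by (rule sum.mono_neutral_right) (use n in auto)
  then show ?thesis by simp
qed

lemma Phi_0: "Phi 0 z = \<i> * (z - of_real (b n) * z ^ n)"
  and dPhi_0: "dPhi 0 z = \<i> * (1 - of_real (b n) * (of_nat n * z ^ (n - 1)))"
  and ddPhi_0: "ddPhi 0 z = - \<i> * (of_real (b n) * (of_nat n * (of_nat (n - 1) * z ^ (n - 2))))"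
  unfolding Phi_def dPhi_def ddPhi_def zero_power_sum by simp_all

definition hline :: "real \<Rightarrow> real \<Rightarrow> real \<Rightarrow> complex" where
  "hline \<tau> y s = of_real (\<tau> * s) + \<i> * of_real y"

text \<open>For large \<open>s\<close> the real part of the phase on \<open>hline \<tau> y s\<close>
  behaves like \<open>lead \<tau> * n * y * s ^ (n - 1)\<close>, so towards the end \<tau> the
  integrand decays on the side \<open>lead \<tau> * y < 0\<close>. The same sign decides whether an
  unperturbed stationary point lies on the real half-axis towards \<tau>: this needs
  \<open>lead \<tau> > 0\<close>.\<close>

definition lead :: "real \<Rightarrow> real" where
  "lead \<tau> = b n * \<tau> ^ (n - 1)"

lemma Im_hline_power:
  assumes "\<tau> = 1 \<or> \<tau> = -1"
  shows "Im (hline \<tau> y s ^ j) = \<tau> ^ (Suc j) * Im ((of_real s + \<i> * of_real y) ^ j)"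
proof (cases "\<tau> = 1")
  case False
  then have \<tau>: "\<tau> = -1" using assms by simp
  define w where "w = complex_of_real s + \<i> * of_real y"
  have "hline \<tau> y s = - cnj w" by (simp add: hline_def \<tau> w_def)
  then have "hline \<tau> y s ^ j = of_real ((- 1) ^ j) * cnj (w ^ j)"
    by (simp add: power_minus[of "cnj w"])
  then show ?thesis unfolding w_def[symmetric] \<tau> by (simp del: of_real_power complex_cnj_power)
qed (simp add: hline_def)

text \<open>Reflection in the imaginary axis turns the left end into the right one, and the
  resulting signs go into the coefficients \<open>d\<close>. For \<open>0 \<le> e \<le> 1\<close>
  these have a common bound and the top one does not depend on \<open>e\<close>, so neither does
  \<open>S\<close>.\<close>

lemma hline_growth:
  assumes \<tau>: "\<tau> = 1 \<or> \<tau> = -1" and Y: "Y \<ge> 0"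
  obtains S where "S \<ge> 1" "S \<ge> Y"
    "\<And>e s y. \<lbrakk>0 \<le> e; e \<le> 1; s \<ge> S; \<bar>y\<bar> \<le> Y; lead \<tau> * y \<le> 0\<rbrakk>
       \<Longrightarrow> Re (Phi e (hline \<tau> y s)) \<le> - (\<bar>b n\<bar> * \<bar>y\<bar> * s)"
proof -
  define B where "B = 1 + (\<Sum>j=2..n. \<bar>b j\<bar>)"
  have B: "B \<ge> 0" by (simp add: B_def sum_nonneg add_nonneg_nonneg)
  have absp: "\<bar>\<tau> ^ j\<bar> = 1" for j using \<tau> by (auto simp: power_abs)
  obtain S where S: "S \<ge> 1" "S \<ge> Y" "\<And>d s y. \<lbrakk>\<And>j. j \<le> n \<Longrightarrow> \<bar>d j\<bar> \<le> B; \<bar>b n\<bar> \<le> \<bar>d n\<bar>; s \<ge> S; \<bar>y\<bar> \<le> Y; 0 \<le> d n * y\<rbrakk>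
    \<Longrightarrow> Im (\<Sum>j\<le>n. of_real (d j) * (of_real s + \<i> * of_real y) ^ j) \<ge> \<bar>b n\<bar> * \<bar>y\<bar> * s"
    using Im_real_poly_growth[OF n _ B Y, of "\<bar>b n\<bar>"] bn by auto
  show thesis
  proof (rule that[OF S(1,2)])
    fix e s y :: real assume e: "0 \<le> e" "e \<le> 1" and s: "s \<ge> S" and y: "\<bar>y\<bar> \<le> Y" and sg: "lead \<tau> * y \<le> 0"
    define d where "d = (\<lambda>j. if j = 0 then 0 else if j = 1 then 1 else - (b j * e ^ (n - j) * \<tau> ^ Suc j))"
    have dn: "d n = - lead \<tau>"
    proof -
      have "\<tau> ^ Suc n = \<tau> ^ 2 * \<tau> ^ (n - 1)" using n by (simp flip: power_add)
      then show ?thesis using n \<tau> by (auto simp: d_def lead_def)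
    qed
    have db: "\<bar>d j\<bar> \<le> B" if "j \<le> n" for j
    proof -
      have "j = 0 \<or> j = 1 \<or> j \<in> {2..n}" using that by auto
      then consider "j = 0" | "j = 1" | "j \<in> {2..n}" by blast
      then show ?thesis
      proof cases
        case 3
        have "\<bar>d j\<bar> = \<bar>b j\<bar> * \<bar>e ^ (n - j)\<bar>" using 3 absp[of "Suc j"] by (simp add: d_def abs_mult del: power_Suc)
        also have "\<dots> \<le> \<bar>b j\<bar> * 1" using e by (intro mult_left_mono) (auto simp: power_le_one)
        also have "\<dots> \<le> (\<Sum>j=2..n. \<bar>b j\<bar>)" using 3 member_le_sum[of j "{2..n}" "\<lambda>j. \<bar>b j\<bar>"] by simp
        finally show ?thesis by (simp add: B_def)
      qed (use sum_nonneg[of "{2..n}" "\<lambda>j. \<bar>b j\<bar>"] in \<open>auto simp: d_def B_def\<close>)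
    qed
    have "\<bar>b n\<bar> * \<bar>y\<bar> * s \<le> Im (\<Sum>j\<le>n. of_real (d j) * (of_real s + \<i> * of_real y) ^ j)"
    proof (rule S(3)[OF db _ s y])
      show "\<bar>b n\<bar> \<le> \<bar>d n\<bar>" using absp[of "n - 1"] by (simp add: dn lead_def abs_mult)
      show "0 \<le> d n * y" using sg unfolding dn by simp
    qed
    also have "\<dots> = (\<Sum>j\<le>n. d j * Im ((of_real s + \<i> * of_real y) ^ j))" by simp
    also have "\<dots> = y + (\<Sum>j=2..n. d j * Im ((of_real s + \<i> * of_real y) ^ j))"
    proof -
      have "{..n} = insert 0 (insert 1 {2..n})" using n by auto
      then show ?thesis by (simp add: d_def)
    qed
    also have "\<dots> = y - (\<Sum>j=2..n. b j * e ^ (n - j) * Im (hline \<tau> y s ^ j))"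
      by (simp add: d_def Im_hline_power[OF \<tau>] sum_negf[symmetric] mult_ac)
    also have "\<dots> = - Re (Phi e (hline \<tau> y s))"
      by (simp add: Phi_def hline_def)
    finally show "Re (Phi e (hline \<tau> y s)) \<le> - (\<bar>b n\<bar> * \<bar>y\<bar> * s)" by simp
  qed
qed

definition Stat :: "real \<Rightarrow> complex set" where
  "Stat e = {z. dPhi e z = 0 \<and> Im z \<ge> 0}"

text \<open>The modulus shared by all unperturbed stationary points.\<close>

definition varrho :: real where
  "varrho = root (n - 1) (1 / (real n * \<bar>b n\<bar>))"

lemma varrho_pos: "varrho > 0"
  using n bn by (simp add: varrho_def)

lemma varrho_power: "varrho ^ (n - 1) = 1 / (real n * \<bar>b n\<bar>)"
  unfolding varrho_def using n bn by (intro real_root_pow_pos) auto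

lemma dPhi_0_zero_iff: "dPhi 0 z = 0 \<longleftrightarrow> of_real (b n) * (of_nat n * z ^ (n - 1)) = 1"
  unfolding dPhi_0 by auto

lemma power_pred:
  fixes z :: "'a::monoid_mult"
  shows "z ^ n = z * z ^ (n - 1)" "z ^ (n - 1) = z * z ^ (n - 2)"
proof -
  obtain k where "n = Suc (Suc k)" using n by (metis add_2_eq_Suc le_Suc_ex)
  then show "z ^ n = z * z ^ (n - 1)" "z ^ (n - 1) = z * z ^ (n - 2)" by simp_all
qed

text \<open>The equation \<open>b n * n * z ^ (n - 1) = 1\<close> eliminates \<open>z ^ n\<close>
  from the phase, which becomes linear in \<open>z\<close> at stationary points. The height of such
  a point is therefore a negative multiple of its imaginary part, and in the closed upper half-plane
  the dominating points are those closest to the real axis.\<close>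

lemma root_0:
  assumes "dPhi 0 z = 0"
  shows "z \<noteq> 0" "cmod z = varrho" "z * (of_real (b n) * z ^ (n - 1)) = z / of_nat n"
    "Phi 0 z = \<i> * of_real (1 - 1 / real n) * z" "ddPhi 0 z = - \<i> * of_real (real n - 1) / z" "ddPhi 0 z \<noteq> 0"
proof -
  have eq: "of_real (b n) * (of_nat n * z ^ (n - 1)) = 1" using assms by (simp add: dPhi_0_zero_iff)
  show z0: "z \<noteq> 0" using eq n by (cases "z = 0") (auto simp: zero_power)
  have "cmod (of_real (b n) * (of_nat n * z ^ (n - 1))) = 1" using eq by simp
  then have "cmod z ^ (n - 1) = varrho ^ (n - 1)"
    unfolding varrho_power norm_mult norm_power norm_of_real norm_of_nat using n bn by (simp add: field_simps)
  then show "cmod z = varrho" using varrho_pos n by (subst (asm) power_eq_iff_eq_base) auto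
  show e2: "z * (of_real (b n) * z ^ (n - 1)) = z / of_nat n" using eq n by (simp add: field_simps)
  have "of_real (b n) * z ^ n = z / of_nat n" unfolding power_pred(1) using e2 by (simp add: mult_ac)
  then show "Phi 0 z = \<i> * of_real (1 - 1 / real n) * z" by (simp add: Phi_0 algebra_simps)
  have "of_real (b n) * (of_nat n * z ^ (n - 2)) = 1 / z"
    using eq z0 unfolding power_pred(2) by (simp add: field_simps)
  then have "ddPhi 0 z = - \<i> * (of_nat (n - 1) * (1 / z))"
    unfolding ddPhi_0 by (metis mult.left_commute)
  also have "of_nat (n - 1) = complex_of_real (real n - 1)" using n by (simp add: of_nat_diff)
  finally show "ddPhi 0 z = - \<i> * of_real (real n - 1) / z" by simp
  then show "ddPhi 0 z \<noteq> 0" using n z0 by (auto simp: of_real_eq_1_iff simp del: of_real_diff)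
qed

lemma finite_roots_0: "finite {z. dPhi 0 z = 0}"
proof (rule finite_subset)
  show "{z. dPhi 0 z = 0} \<subseteq> {z. z ^ (n - 1) = 1 / (of_real (b n) * of_nat n)}"
    using n bn by (auto simp: dPhi_0_zero_iff field_simps)
  show "finite {z. z ^ (n - 1) = 1 / (complex_of_real (b n) * of_nat n)}"
    using n by (intro finite_nth_roots) auto
qed

lemma finite_Stat_0: "finite (Stat 0)"
  by (rule finite_subset[OF _ finite_roots_0]) (auto simp: Stat_def)

lemma Stat_0_nonempty: "Stat 0 \<noteq> {}"
proof (cases "b n > 0")
  case True
  have "of_real varrho \<in> Stat 0"
    using True n unfolding Stat_def mem_Collect_eq dPhi_0_zero_iff of_real_power[symmetric] varrho_power by simp
  then show ?thesis by auto
next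
  case False
  \<comment> \<open>With argument \<open>pi / (n - 1)\<close> the power \<open>z ^ (n - 1)\<close>
    is negative, which matches \<open>b n < 0\<close>.\<close>
  define z where "z = of_real varrho * cis (pi / (real n - 1))"
  have "z ^ (n - 1) = of_real (varrho ^ (n - 1)) * cis (real (n - 1) * (pi / (real n - 1)))"
    by (simp only: z_def power_mult_distrib Complex.DeMoivre of_real_power)
  also have "real (n - 1) * (pi / (real n - 1)) = pi" using n by (simp add: of_nat_diff)
  finally have "z ^ (n - 1) = - of_real (varrho ^ (n - 1))" by simp
  then have "dPhi 0 z = 0" unfolding dPhi_0_zero_iff varrho_power using False bn n by simp
  moreover have "Im z \<ge> 0"
  proof -
    have "0 \<le> pi / (real n - 1)" "pi / (real n - 1) \<le> pi" using n by (auto simp: field_simps)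
    then show ?thesis using varrho_pos by (simp add: z_def sin_ge_zero)
  qed
  ultimately show ?thesis by (auto simp: Stat_def)
qed

lemma dPhi_cnj: "dPhi e (cnj z) = - cnj (dPhi e z)"
  by (simp add: dPhi_def)

lemma eventually_small:
  assumes "c > 0"
  shows "eventually (\<lambda>e. 0 < e \<and> e \<le> 1 \<and> e * C < c) (at_right (0::real))"
proof -
  have "((\<lambda>e. e * C) \<longlongrightarrow> 0 * C) (at_right 0)" by (intro tendsto_intros)
  then have "eventually (\<lambda>e. e * C < c) (at_right 0)" using assms by (intro order_tendstoD) auto
  moreover have "eventually (\<lambda>e::real. e \<in> {0<..<1}) (at_right 0)"
    by (rule eventually_at_right_real) simp
  ultimately show ?thesis by eventually_elim auto
qed

text \<open>Newton's iteration with the derivative frozen at \<open>z0\<close> is a contraction of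
  \<open>cball z0 r\<close>. Admitting every \<open>r \<le> r0\<close> yields both uniqueness in a
  fixed disc and convergence of the root to \<open>z0\<close>.\<close>

lemma root_unique_near:
  assumes z0: "dPhi 0 z0 = 0"
  obtains r0 where "r0 > 0"
    "\<And>r. 0 < r \<Longrightarrow> r \<le> r0 \<Longrightarrow> eventually (\<lambda>e. \<exists>!z. z \<in> cball z0 r \<and> dPhi e z = 0) (at_right 0)"
proof -
  define a where "a = ddPhi 0 z0"
  have a: "a \<noteq> 0" using root_0(6)[OF z0] by (simp add: a_def)
  have "continuous (at z0) (ddPhi 0)"
    using continuous_Phi(3)[of UNIV] by (simp add: continuous_on_eq_continuous_at)
  then obtain r1 where r1: "r1 > 0" "\<And>z. dist z z0 < r1 \<Longrightarrow> dist (ddPhi 0 z) a < cmod a / 4"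
    using a unfolding continuous_at_eps_delta a_def[symmetric] by (meson divide_pos_pos zero_less_norm_iff zero_less_numeral)
  define r0 where "r0 = r1 / 2"
  have r0: "r0 > 0" "r0 < r1" using r1 by (auto simp: r0_def)
  show thesis
  proof (rule that[OF r0(1)])
    fix r :: real assume r: "0 < r" "r \<le> r0"
    define P where "P = perturb_const (cmod z0 + r0)"
    \<comment> \<open>The first threshold makes the contraction factor 1/2, the second moves the
      centre by at most \<open>r / 2\<close>, so that the disc is mapped into itself.\<close>
    have "min (cmod a / 4) (cmod a * r / 2) > 0" using a r by simp
    from eventually_small[OF this, of P]
    show "eventually (\<lambda>e. \<exists>!z. z \<in> cball z0 r \<and> dPhi e z = 0) (at_right 0)"
    proof eventually_elim
      case (elim e)
      define T where "T = (\<lambda>z. z - dPhi e z / a)"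
      have dT: "(T has_field_derivative (1 - ddPhi e z / a)) (at z within cball z0 r)" for z
        unfolding T_def by (intro DERIV_diff DERIV_ident DERIV_cdivide dPhi_deriv)
      have nz: "cmod z \<le> cmod z0 + r0" if "z \<in> cball z0 r" for z
        using that r norm_triangle_ineq2[of z z0] by (simp add: dist_norm norm_minus_commute)
      have bd: "cmod (1 - ddPhi e z / a) \<le> 1 / 2" if z: "z \<in> cball z0 r" for z
      proof -
        have "cmod (ddPhi e z - ddPhi 0 z) \<le> e * P"
          unfolding P_def using elim by (intro Phi_perturb(3) nz[OF z]) auto
        moreover have "cmod (ddPhi 0 z - a) < cmod a / 4"
          using r1(2)[of z] z r r0 by (simp add: dist_norm norm_minus_commute)
        ultimately have "cmod (ddPhi e z - a) \<le> cmod a / 2"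
          using elim norm_triangle_ineq[of "ddPhi e z - ddPhi 0 z" "ddPhi 0 z - a"] by simp
        moreover have "1 - ddPhi e z / a = (a - ddPhi e z) / a" using a by (simp add: field_simps)
        ultimately show ?thesis using a by (simp add: norm_divide norm_minus_commute field_simps)
      qed
      have lip: "dist (T x) (T y) \<le> 1 / 2 * dist x y" if "x \<in> cball z0 r" "y \<in> cball z0 r" for x y
        using field_differentiable_bound[OF convex_cball dT bd that(2) that(1)]
        by (simp add: dist_norm norm_minus_commute)
      have "\<exists>!z\<in>cball z0 r. T z = z"
      proof (rule Banach_fix)
        show "T ` cball z0 r \<subseteq> cball z0 r"
        proof safe
          fix z assume z: "z \<in> cball z0 r"
          have "dist z0 (T z0) = cmod (dPhi e z0 - dPhi 0 z0) / cmod a" by (simp add: T_def dist_norm z0 norm_divide)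
          also have "\<dots> \<le> e * P / cmod a"
            unfolding P_def using elim r0 by (intro divide_right_mono Phi_perturb(2)) auto
          also have "\<dots> \<le> r / 2" using elim a by (simp add: field_simps)
          finally have "dist z0 (T z0) \<le> r / 2" .
          moreover have "dist (T z0) (T z) \<le> 1 / 2 * dist z0 z" using lip[of z0 z] z r by simp
          moreover have "dist z0 z \<le> r" using z by simp
          ultimately show "T z \<in> cball z0 r" using dist_triangle[of z0 "T z" "T z0"] by simp
        qed
        show "dist (T x) (T y) \<le> 1 / 2 * dist x y" if "x \<in> cball z0 r" "y \<in> cball z0 r" for x y
          using lip that .
      qed (use r in \<open>auto simp: complete_eq_closed\<close>)
      moreover have "T z = z \<longleftrightarrow> dPhi e z = 0" for z using a by (simp add: T_def)
      ultimately show ?case by simp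
    qed
  qed
qed

text \<open>The top coefficient is independent of \<open>e\<close>, so the roots stay bounded; on
  the compact rest of that disc, away from the unperturbed roots, \<open>dPhi 0\<close> is bounded
  below.\<close>

lemma roots_near:
  assumes r: "r > 0"
  shows "eventually (\<lambda>e. \<forall>z. dPhi e z = 0 \<longrightarrow> (\<exists>z0. dPhi 0 z0 = 0 \<and> z \<in> ball z0 r)) (at_right 0)"
proof -
  define Q where "Q = 1 + (\<Sum>j=2..n. \<bar>b j\<bar> * real j)"
  have Q: "Q \<ge> 1" by (simp add: Q_def sum_nonneg)
  \<comment> \<open>At a root with \<open>cmod z \<ge> 1\<close> the lower terms are at most
    \<open>Q * cmod z ^ (n - 2)\<close>, so \<open>\<bar>b n\<bar> * n * cmod z \<le> Q\<close>;
    this fails outside radius \<open>R\<close>.\<close>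
  define R where "R = 1 + Q / (real n * \<bar>b n\<bar>)"
  have R: "R \<ge> 1" using Q by (simp add: R_def)
  have bounded: "cmod z \<le> R" if e: "0 \<le> e" "e \<le> 1" and z: "dPhi e z = 0" for e z
  proof (rule ccontr)
    assume "\<not> cmod z \<le> R"
    then have zR: "cmod z > R" by simp
    then have z1: "cmod z \<ge> 1" using R by linarith
    have "(\<Sum>j=2..n. of_real (b j * e ^ (n - j)) * (of_nat j * z ^ (j - 1))) = 1"
      using z by (simp add: dPhi_def)
    moreover have "{2..n} = insert n {2..<n}" using n by auto
    ultimately have "of_real (b n) * (of_nat n * z ^ (n - 1)) =
        1 - (\<Sum>j=2..<n. of_real (b j * e ^ (n - j)) * (of_nat j * z ^ (j - 1)))"
      by (simp add: algebra_simps)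
    then have "\<bar>b n\<bar> * (real n * cmod z ^ (n - 1))
        = cmod (1 - (\<Sum>j=2..<n. of_real (b j * e ^ (n - j)) * (of_nat j * z ^ (j - 1))))"
      by (metis norm_mult norm_of_nat norm_of_real norm_power)
    also have "\<dots> \<le> 1 + (\<Sum>j=2..<n. cmod (of_real (b j * e ^ (n - j)) * (of_nat j * z ^ (j - 1))))"
      by (rule order_trans[OF norm_triangle_ineq4]) (simp add: norm_sum)
    also have "\<dots> \<le> cmod z ^ (n - 2) + (\<Sum>j=2..<n. \<bar>b j\<bar> * real j * cmod z ^ (n - 2))"
    proof (intro add_mono sum_mono)
      fix j assume j: "j \<in> {2..<n}"
      have "\<bar>b j\<bar> * e ^ (n - j) * (real j * cmod z ^ (j - 1)) \<le> \<bar>b j\<bar> * 1 * (real j * cmod z ^ (n - 2))"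
        using e z1 j by (intro mult_mono power_increasing power_le_one) auto
      then show "cmod (of_real (b j * e ^ (n - j)) * (of_nat j * z ^ (j - 1))) \<le> \<bar>b j\<bar> * real j * cmod z ^ (n - 2)"
        using e by (simp add: norm_mult norm_power abs_mult mult_ac)
    qed (use z1 in \<open>simp add: one_le_power\<close>)
    also have "\<dots> \<le> Q * cmod z ^ (n - 2)"
    proof -
      have "(\<Sum>j=2..<n. \<bar>b j\<bar> * real j) \<le> (\<Sum>j=2..n. \<bar>b j\<bar> * real j)" by (rule sum_mono2) auto
      then have "(1 + (\<Sum>j=2..<n. \<bar>b j\<bar> * real j)) * cmod z ^ (n - 2) \<le> Q * cmod z ^ (n - 2)"
        by (intro mult_right_mono) (auto simp: Q_def)
      then show ?thesis by (simp add: algebra_simps sum_distrib_left)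
    qed
    finally have "(\<bar>b n\<bar> * real n * cmod z) * cmod z ^ (n - 2) \<le> Q * cmod z ^ (n - 2)"
      unfolding power_pred(2) by (simp add: mult_ac)
    moreover have "0 < cmod z ^ (n - 2)" using z1 by (intro zero_less_power) linarith
    ultimately have "\<bar>b n\<bar> * real n * cmod z \<le> Q" by (metis mult_le_cancel_right_pos)
    moreover have "Q < \<bar>b n\<bar> * real n * R"
    proof -
      have "\<bar>b n\<bar> * real n * R = \<bar>b n\<bar> * real n + Q" using n bn by (simp add: R_def distrib_left)
      then show ?thesis using n bn by simp
    qed
    moreover have "\<bar>b n\<bar> * real n * R \<le> \<bar>b n\<bar> * real n * cmod z" using zR by (intro mult_left_mono) auto
    ultimately show False by linarith
  qed
  define K where "K = cball 0 R - (\<Union>z0\<in>{z. dPhi 0 z = 0}. ball z0 r)"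
  have K: "compact K" unfolding K_def by (intro compact_diff compact_cball open_UN) auto
  obtain m where m: "m > 0" "\<And>z. z \<in> K \<Longrightarrow> m \<le> cmod (dPhi 0 z)"
  proof (cases "K = {}")
    case False
    obtain w where w: "w \<in> K" "\<And>z. z \<in> K \<Longrightarrow> cmod (dPhi 0 w) \<le> cmod (dPhi 0 z)"
      using continuous_attains_inf[OF K False continuous_on_norm[OF continuous_Phi(2)]] by metis
    have "dPhi 0 w \<noteq> 0" using w(1) r by (auto simp: K_def)
    then show thesis using that[of "cmod (dPhi 0 w)"] w(2) by simp
  qed (use that[of 1] in auto)
  from eventually_small[OF m(1), of "perturb_const R"]
  show ?thesis
  proof eventually_elim
    case (elim e)
    show ?case
    proof (intro allI impI)
      fix z assume z: "dPhi e z = 0"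
      have zR: "cmod z \<le> R" using bounded[of e z] elim z by simp
      have "cmod (dPhi 0 z) < m"
        using Phi_perturb(2)[of e z R] elim z zR by simp
      then have "z \<notin> K" using m(2) by force
      then show "\<exists>z0. dPhi 0 z0 = 0 \<and> z \<in> ball z0 r" using zR by (auto simp: K_def)
    qed
  qed
qed

text \<open>Labels the perturbed stationary points by the unperturbed ones, which turns sums over
  \<open>Stat e\<close> into sums over a fixed finite set. The last clause is stronger than
  convergence; it keeps the height of a real point at exactly 0.\<close>

definition tracks_roots :: "(real \<Rightarrow> complex \<Rightarrow> complex) \<Rightarrow> bool" where
  "tracks_roots \<zeta> \<longleftrightarrow> (\<forall>z0\<in>Stat 0. ((\<lambda>e. \<zeta> e z0) \<longlongrightarrow> z0) (at_right 0)) \<and>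
     eventually (\<lambda>e. Stat e = \<zeta> e ` Stat 0 \<and> inj_on (\<zeta> e) (Stat 0)) (at_right 0) \<and>
     (\<forall>z0\<in>Stat 0. Im z0 = 0 \<longrightarrow> eventually (\<lambda>e. Im (\<zeta> e z0) = 0) (at_right 0))"

text \<open>The discs around the unperturbed roots are disjoint and avoid the real axis unless
  centred on it. A real root lies on the boundary of the half-plane and might leave it; it cannot,
  because the conjugate of the perturbed root is again a root in the same disc.\<close>

lemma tracks_roots_exists: "\<exists>\<zeta>. tracks_roots \<zeta>"
proof -
  let ?Z = "{z. dPhi 0 z = 0}"
  obtain r0 where r0: "\<And>z0. z0 \<in> ?Z \<Longrightarrow> r0 z0 > 0"
    "\<And>z0 r. z0 \<in> ?Z \<Longrightarrow> 0 < r \<Longrightarrow> r \<le> r0 z0 \<Longrightarrow>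
        eventually (\<lambda>e. \<exists>!z. z \<in> cball z0 r \<and> dPhi e z = 0) (at_right 0)"
  proof -
    have "\<exists>r0. \<forall>z0\<in>?Z. r0 z0 > 0 \<and> (\<forall>r. 0 < r \<longrightarrow> r \<le> r0 z0 \<longrightarrow>
        eventually (\<lambda>e. \<exists>!z. z \<in> cball z0 r \<and> dPhi e z = 0) (at_right 0))"
      by (rule bchoice) (use root_unique_near in \<open>blast\<close>)
    then show thesis using that by blast
  qed
  define S where "S = insert 1 (r0 ` ?Z \<union> (\<lambda>z. \<bar>Im z\<bar> / 2) ` {z\<in>?Z. Im z \<noteq> 0}
      \<union> (\<lambda>(z, w). dist z w / 4) ` {(z, w). z \<in> ?Z \<and> w \<in> ?Z \<and> z \<noteq> w})"
  have fS: "finite S"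
  proof -
    have "finite {(z, w). z \<in> ?Z \<and> w \<in> ?Z \<and> z \<noteq> w}"
      by (rule finite_subset[OF _ finite_cartesian_product[OF finite_roots_0 finite_roots_0]]) auto
    then show ?thesis using finite_roots_0 by (simp add: S_def)
  qed
  define r where "r = Min S"
  have "S \<noteq> {}" by (simp add: S_def)
  then have "r \<in> S" using fS by (simp add: r_def)
  then have rpos: "r > 0" using r0(1) by (auto simp: S_def)
  have rle: "r \<le> x" if "x \<in> S" for x using fS that by (simp add: r_def)
  have r1: "r \<le> r0 z" if "z \<in> ?Z" for z using that by (intro rle) (auto simp: S_def)
  have r2: "2 * r \<le> \<bar>Im z\<bar>" if "z \<in> ?Z" "Im z \<noteq> 0" for z
    using rle[of "\<bar>Im z\<bar> / 2"] that by (auto simp: S_def)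
  have r3: "4 * r \<le> dist z w" if "z \<in> ?Z" "w \<in> ?Z" "z \<noteq> w" for z w
  proof -
    have "dist z w / 4 \<in> S" unfolding S_def using that by force
    from rle[OF this] show ?thesis by simp
  qed
  define \<zeta> where "\<zeta> = (\<lambda>e z0. THE z. z \<in> cball z0 r \<and> dPhi e z = 0)"
  have uni: "eventually (\<lambda>e. \<forall>z0\<in>?Z. \<exists>!z. z \<in> cball z0 r \<and> dPhi e z = 0) (at_right 0)"
    by (rule eventually_ball_finite[OF finite_roots_0]) (use r0(2) rpos r1 in blast)
  have \<zeta>1: "\<zeta> e z0 \<in> cball z0 r \<and> dPhi e (\<zeta> e z0) = 0"
    if "\<forall>z0\<in>?Z. \<exists>!z. z \<in> cball z0 r \<and> dPhi e z = 0" "z0 \<in> ?Z" for e z0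
    unfolding \<zeta>_def by (rule theI') (use that in blast)
  have \<zeta>2: "z = \<zeta> e z0"
    if "\<forall>z0\<in>?Z. \<exists>!z. z \<in> cball z0 r \<and> dPhi e z = 0" "z0 \<in> ?Z" "z \<in> cball z0 r" "dPhi e z = 0" for e z0 z
    using that \<zeta>1[OF that(1,2)] by blast
  have re: "Im (\<zeta> e z0) = 0"
    if u: "\<forall>z0\<in>?Z. \<exists>!z. z \<in> cball z0 r \<and> dPhi e z = 0" and z0: "z0 \<in> ?Z" "Im z0 = 0" for e z0
  proof -
    have "cnj z0 = z0" using z0(2) by (simp add: complex_eq_iff)
    then have "dist z0 (cnj (\<zeta> e z0)) = dist z0 (\<zeta> e z0)"
      by (metis complex_cnj_diff complex_mod_cnj dist_norm)
    then have "cnj (\<zeta> e z0) = \<zeta> e z0"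
      using \<zeta>1[OF u z0(1)] by (intro \<zeta>2[OF u z0(1)]) (auto simp: dPhi_cnj)
    then show ?thesis by (simp add: complex_eq_iff)
  qed
  have SZ: "Stat 0 \<subseteq> ?Z" by (auto simp: Stat_def)
  have "tracks_roots \<zeta>"
    unfolding tracks_roots_def
  proof (intro conjI ballI impI)
    fix z0 assume "z0 \<in> Stat 0"
    then have z0: "z0 \<in> ?Z" using SZ by auto
    show "((\<lambda>e. \<zeta> e z0) \<longlongrightarrow> z0) (at_right 0)"
    proof (rule tendstoI)
      fix d :: real assume d: "d > 0"
      \<comment> \<open>The root found in the smaller disc is the unique one in the larger disc;
        hence the tracked root converges.\<close>
      define r' where "r' = min r (d / 2)"
      have r': "0 < r'" "r' \<le> r" "r' < d" using rpos d by (auto simp: r'_def)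
      have "eventually (\<lambda>e. \<exists>!z. z \<in> cball z0 r' \<and> dPhi e z = 0) (at_right 0)"
        using r' r1[OF z0] by (intro r0(2)[OF z0]) auto
      then show "eventually (\<lambda>e. dist (\<zeta> e z0) z0 < d) (at_right 0)"
        using uni
      proof eventually_elim
        case (elim e)
        then obtain z where z: "z \<in> cball z0 r'" "dPhi e z = 0" by blast
        then have "z = \<zeta> e z0" using r' by (intro \<zeta>2[OF elim(2) z0]) auto
        then show ?case using z r' by (simp add: dist_commute)
      qed
    qed
    show "eventually (\<lambda>e. Im (\<zeta> e z0) = 0) (at_right 0)" if "Im z0 = 0"
      using uni by eventually_elim (use re z0 that in blast)
  next
    show "eventually (\<lambda>e. Stat e = \<zeta> e ` Stat 0 \<and> inj_on (\<zeta> e) (Stat 0)) (at_right 0)"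
      using uni roots_near[OF rpos]
    proof eventually_elim
      case (elim e)
      note u = elim(1)
      have "\<zeta> e z0 \<in> Stat e" if z0: "z0 \<in> Stat 0" for z0
      proof -
        have zZ: "z0 \<in> ?Z" using SZ z0 by auto
        have "Im (\<zeta> e z0) \<ge> 0"
        proof (cases "Im z0 = 0")
          case False
          have "\<bar>Im (\<zeta> e z0) - Im z0\<bar> \<le> r"
            using \<zeta>1[OF u zZ] abs_Im_le_cmod[of "\<zeta> e z0 - z0"] by (simp add: dist_norm norm_minus_commute)
          then show ?thesis using r2[OF zZ False] z0 rpos by (simp add: Stat_def)
        qed (use re[OF u zZ] in simp)
        then show ?thesis using \<zeta>1[OF u zZ] by (simp add: Stat_def)
      qed
      moreover have "z \<in> \<zeta> e ` Stat 0" if z: "z \<in> Stat e" for z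
      proof -
        obtain z0 where z0: "z0 \<in> ?Z" "z \<in> ball z0 r" using elim(2) z by (auto simp: Stat_def)
        have "Im z0 \<ge> 0"
        proof (rule ccontr)
          assume neg: "\<not> 0 \<le> Im z0"
          have "\<bar>Im z - Im z0\<bar> < r" using z0(2) abs_Im_le_cmod[of "z - z0"] by (simp add: dist_norm norm_minus_commute)
          then show False using r2[OF z0(1)] neg z rpos by (simp add: Stat_def)
        qed
        then have "z0 \<in> Stat 0" using z0 by (simp add: Stat_def)
        moreover have "z = \<zeta> e z0" using z z0 by (intro \<zeta>2[OF u z0(1)]) (auto simp: Stat_def)
        ultimately show ?thesis by blast
      qed
      moreover have "inj_on (\<zeta> e) (Stat 0)"
      proof (rule inj_onI, rule ccontr)
        fix z w assume zw: "z \<in> Stat 0" "w \<in> Stat 0" "\<zeta> e z = \<zeta> e w" "z \<noteq> w"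
        have "dist z w \<le> r + r"
          using \<zeta>1[OF u subsetD[OF SZ zw(1)]] \<zeta>1[OF u subsetD[OF SZ zw(2)]] zw(3)
            dist_triangle[of z w "\<zeta> e z"] by (simp add: dist_commute[of w])
        then show False using r3[of z w] zw SZ rpos by auto
      qed
      ultimately show ?case by blast
    qed
  qed
  then show ?thesis by blast
qed

definition zeta :: "real \<Rightarrow> complex \<Rightarrow> complex" where
  "zeta = (SOME \<zeta>. tracks_roots \<zeta>)"

lemma tracks_roots_zeta: "tracks_roots zeta"
  unfolding zeta_def by (rule someI_ex[OF tracks_roots_exists])

lemma zeta_tendsto: "z0 \<in> Stat 0 \<Longrightarrow> ((\<lambda>e. zeta e z0) \<longlongrightarrow> z0) (at_right 0)"
  and zeta_Stat: "eventually (\<lambda>e. Stat e = zeta e ` Stat 0 \<and> inj_on (zeta e) (Stat 0)) (at_right 0)"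
  and zeta_real: "z0 \<in> Stat 0 \<Longrightarrow> Im z0 = 0 \<Longrightarrow> eventually (\<lambda>e. Im (zeta e z0) = 0) (at_right 0)"
  using tracks_roots_zeta unfolding tracks_roots_def by blast+

end

section \<open>Decay at the ends of the contour\<close>

lemma power_le_fact_exp:
  fixes x :: real
  assumes "x \<ge> 0"
  shows "x ^ q \<le> fact q * exp x"
proof -
  have "(\<Sum>k\<in>{q}. x ^ k /\<^sub>R fact k) \<le> (\<Sum>k. x ^ k /\<^sub>R fact k)"
    by (intro sum_le_suminf summable_exp_generic) (use assms in auto)
  then show ?thesis by (simp add: exp_def field_simps)
qed

text \<open>Converts an exponentially smaller contribution into an error term. It has to hold also
  as \<open>X\<close> tends to 0, where the unbounded ends of the path are only bounded by a
  multiple of \<open>1 / X\<close>; this is still below \<open>X powr (- 3 / 2)\<close>.\<close>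

lemma exp_decay_le_powr:
  fixes a :: real
  assumes a: "a > 0"
  obtains C where "C > 0" "\<And>X. X > 0 \<Longrightarrow> (1 + 1 / X) * exp (- (a * X)) \<le> C * X powr (- 3 / 2)"
proof -
  define C where "C = 1 + 2 / a\<^sup>2 + 2 / a + 1"
  show thesis
  proof (rule that[of C])
    show "C > 0" using a by (simp add: C_def add_pos_nonneg)
    fix X :: real assume X: "X > 0"
    have s: "sqrt X \<le> 1 + X"
      using X by (intro real_le_lsqrt) (auto simp: power2_eq_square algebra_simps)
    have e1: "X \<le> 1 / a * exp (a * X)"
      using power_le_fact_exp[of "a * X" 1] a X by (simp add: field_simps)
    have e2: "X\<^sup>2 \<le> 2 / a\<^sup>2 * exp (a * X)"
      using power_le_fact_exp[of "a * X" 2] a X by (simp add: field_simps power_mult_distrib)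
    have "(1 + 1 / X) * X powr (3 / 2) = (X + 1) * sqrt X"
    proof -
      have "X powr (3 / 2) = X powr (1 + 1 / 2)" by simp
      also have "\<dots> = X * sqrt X" using X unfolding powr_add by (simp add: powr_half_sqrt)
      finally show ?thesis using X by (simp add: field_simps)
    qed
    also have "\<dots> \<le> (X + 1) * (1 + X)" using s X by (intro mult_left_mono) auto
    also have "\<dots> = 1 + 2 * X + X\<^sup>2" by (simp add: power2_eq_square algebra_simps)
    also have "\<dots> \<le> exp (a * X) + 2 * (1 / a * exp (a * X)) + 2 / a\<^sup>2 * exp (a * X)"
      using e1 e2 a X by (intro add_mono mult_left_mono) auto
    also have "\<dots> \<le> C * exp (a * X)" by (simp add: C_def algebra_simps)
    finally have "(1 + 1 / X) * X powr (3 / 2) \<le> C * exp (a * X)" .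
    then have "(1 + 1 / X) * X powr (3 / 2) * (X powr (- 3 / 2) * exp (- (a * X)))
        \<le> C * exp (a * X) * (X powr (- 3 / 2) * exp (- (a * X)))"
      by (intro mult_right_mono) auto
    then have "(1 + 1 / X) * (X powr (3 / 2) * X powr (- 3 / 2)) * exp (- (a * X))
        \<le> C * (exp (a * X) * exp (- (a * X))) * X powr (- 3 / 2)"
      by (simp only: mult_ac)
    moreover have "X powr (3 / 2) * X powr (- 3 / 2) = 1" using X by (simp flip: powr_add)
    moreover have "exp (a * X) * exp (- (a * X)) = 1" by (simp flip: exp_add)
    ultimately show "(1 + 1 / X) * exp (- (a * X)) \<le> C * X powr (- 3 / 2)"
      by (simp only: mult_1_right)
  qed
qed

context phase_family
begin

text \<open>For \<open>p < 0\<close> the amplitude grows like a power of \<open>cmod z\<close>. It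
  is absorbed by an exponential whose rate is proportional to \<open>X\<close>, and this has a
  common constant only if \<open>X\<close> is bounded below.\<close>

definition adm :: "real \<Rightarrow> bool" where
  "adm X \<longleftrightarrow> 0 < X \<and> (p < 0 \<longrightarrow> 1 \<le> X)"

lemma hline_cut: "\<tau> = 1 \<or> \<tau> = -1 \<Longrightarrow> s \<ge> 1 \<Longrightarrow> hline \<tau> y s \<in> cut"
  by (rule cutI) (auto simp: hline_def)

lemma norm_hline:
  assumes "\<tau> = 1 \<or> \<tau> = -1" "s \<ge> 1" "\<bar>y\<bar> \<le> s"
  shows "1 \<le> cmod (hline \<tau> y s)" "cmod (hline \<tau> y s) \<le> 2 * s"
proof -
  have "\<bar>Re (hline \<tau> y s)\<bar> = s" using assms by (auto simp: hline_def)
  then show "1 \<le> cmod (hline \<tau> y s)" using abs_Re_le_cmod[of "hline \<tau> y s"] assms by linarith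
  have "cmod (hline \<tau> y s) \<le> \<bar>Re (hline \<tau> y s)\<bar> + \<bar>Im (hline \<tau> y s)\<bar>" by (rule cmod_le)
  then show "cmod (hline \<tau> y s) \<le> 2 * s" using assms by (auto simp: hline_def)
qed

text \<open>The exponential is split into two equal factors: one absorbs the amplitude, the other is
  the stated bound.\<close>

lemma F_hline_decay:
  assumes \<tau>: "\<tau> = 1 \<or> \<tau> = -1" and \<eta>: "0 < \<eta>" and Y: "0 \<le> Y"
  obtains S K where "S \<ge> 1" "K \<ge> 0"
    "\<And>e X s y. \<lbrakk>0 \<le> e; e \<le> 1; adm X; s \<ge> S; \<eta> \<le> \<bar>y\<bar>; \<bar>y\<bar> \<le> Y; lead \<tau> * y \<le> 0\<rbrakk>
       \<Longrightarrow> cmod (F e X (hline \<tau> y s)) \<le> K * exp (- (X * (\<bar>b n\<bar> * \<eta> / 2) * s))"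
proof -
  obtain S where S: "S \<ge> 1" "S \<ge> Y" "\<And>e s y. \<lbrakk>0 \<le> e; e \<le> 1; s \<ge> S; \<bar>y\<bar> \<le> Y; lead \<tau> * y \<le> 0\<rbrakk>
       \<Longrightarrow> Re (Phi e (hline \<tau> y s)) \<le> - (\<bar>b n\<bar> * \<bar>y\<bar> * s)"
    using hline_growth[OF \<tau> Y] by metis
  define c where "c = \<bar>b n\<bar> * \<eta> / 2"
  have c: "c > 0" using bn \<eta> by (simp add: c_def)
  define q where "q = nat (- p)"
  define K where "K = max 1 ((2 / c) ^ q * fact q)"
  show thesis
  proof (rule that[OF S(1), of K])
    show "K \<ge> 0" by (simp add: K_def)
    fix e X s y :: real assume e: "0 \<le> e" "e \<le> 1" and X: "adm X" and s: "s \<ge> S" and y: "\<eta> \<le> \<bar>y\<bar>" "\<bar>y\<bar> \<le> Y"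
      and sg: "lead \<tau> * y \<le> 0"
    have X0: "X > 0" using X by (simp add: adm_def)
    have "Re (Phi e (hline \<tau> y s)) \<le> - (\<bar>b n\<bar> * \<bar>y\<bar> * s)" by (rule S(3)[OF e s y(2) sg])
    also have "\<dots> \<le> - (2 * c * s)"
      using y(1) s S(1) bn by (simp add: c_def mult_right_mono mult_left_mono)
    finally have "X * Re (Phi e (hline \<tau> y s)) \<le> X * - (2 * c * s)" using X0 by (intro mult_left_mono) auto
    then have ex: "exp (X * Re (Phi e (hline \<tau> y s))) \<le> exp (- (X * c * s)) * exp (- (X * c * s))"
      unfolding exp_add[symmetric] by (simp add: algebra_simps)
    have nl: "1 \<le> cmod (hline \<tau> y s)" "cmod (hline \<tau> y s) \<le> 2 * s"
      using norm_hline[OF \<tau>, of s y] S s y by auto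
    have wt: "exp (- (X * c * s)) * (1 / cmod (hline \<tau> y s) powi p) \<le> K"
    proof (cases "p \<ge> 0")
      case True
      have "exp (- (X * c * s)) * (1 / cmod (hline \<tau> y s) powi p) \<le> 1 * 1"
      proof (rule mult_mono)
        have "1 \<le> cmod (hline \<tau> y s) powi p" using True nl by (simp add: power_int_def one_le_power)
        then show "1 / cmod (hline \<tau> y s) powi p \<le> 1" by simp
        show "exp (- (X * c * s)) \<le> 1" using X0 c s S by simp
      qed (use nl in \<open>auto simp: power_int_def\<close>)
      then show ?thesis by (simp add: K_def)
    next
      case False
      have "1 / cmod (hline \<tau> y s) powi p = cmod (hline \<tau> y s) ^ q"
        using False by (simp add: power_int_def q_def power_inverse divide_inverse)
      also have "\<dots> \<le> (2 * s) ^ q" using nl by (intro power_mono) auto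
      also have "\<dots> = (2 / c) ^ q * (c * s) ^ q" unfolding power_mult_distrib[symmetric] using c by simp
      also have "\<dots> \<le> (2 / c) ^ q * (fact q * exp (c * s))"
        using c s S by (intro mult_left_mono power_le_fact_exp) auto
      finally have "exp (- (X * c * s)) * (1 / cmod (hline \<tau> y s) powi p)
          \<le> exp (- (c * s)) * ((2 / c) ^ q * (fact q * exp (c * s)))"
        using X False c s S by (intro mult_mono) (auto simp: adm_def mult_right_mono)
      also have "\<dots> = (2 / c) ^ q * fact q * (exp (- (c * s)) * exp (c * s))" by simp
      also have "\<dots> = (2 / c) ^ q * fact q" by (simp flip: exp_add)
      finally show ?thesis by (simp add: K_def)
    qed
    have "cmod (F e X (hline \<tau> y s)) \<le> exp (- (X * c * s)) * exp (- (X * c * s)) * (1 / cmod (hline \<tau> y s) powi p)"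
      unfolding norm_F by (intro mult_right_mono ex) (auto simp: power_int_def)
    also have "\<dots> = (exp (- (X * c * s)) * (1 / cmod (hline \<tau> y s) powi p)) * exp (- (X * c * s))" by simp
    also have "\<dots> \<le> K * exp (- (X * c * s))" by (rule mult_right_mono[OF wt]) simp
    finally show "cmod (F e X (hline \<tau> y s)) \<le> K * exp (- (X * (\<bar>b n\<bar> * \<eta> / 2) * s))" by (simp add: c_def)
  qed
qed

lemma H_hline_deriv:
  assumes "\<tau> = 1 \<or> \<tau> = -1" "s \<ge> 1"
  shows "((\<lambda>s. H e X (hline \<tau> y s)) has_vector_derivative of_real \<tau> * F e X (hline \<tau> y s)) (at s)"
proof -
  have "((\<lambda>s. hline \<tau> y s) has_vector_derivative of_real \<tau>) (at s)"
    unfolding hline_def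
    by (auto intro!: derivative_eq_intros simp: has_vector_derivative_def scaleR_conv_of_real mult_ac)
  from field_vector_diff_chain_at[OF this H_deriv[OF hline_cut[OF assms]]]
  show ?thesis by (simp add: o_def)
qed

text \<open>The height is one representative: \<open>hline_limit\<close> shows that every height on
  the decaying side leads to the same value, and \<open>real_axis_limit\<close> that the real axis
  does so for \<open>p \<ge> 0\<close>.\<close>

definition Hlim :: "real \<Rightarrow> real \<Rightarrow> real \<Rightarrow> complex" where
  "Hlim \<tau> e X = Lim at_top (\<lambda>s. H e X (hline \<tau> (- sgn (lead \<tau>)) s))"

lemma lead_nonzero: "\<tau> = 1 \<or> \<tau> = -1 \<Longrightarrow> lead \<tau> \<noteq> 0"
  using bn by (auto simp: lead_def)

text \<open>Lines at two heights on the decaying side are joined by a vertical segment at abscissa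
  \<open>s\<close>, along which the primitive changes by an amount exponentially small in
  \<open>s\<close>.\<close>

lemma hline_limit:
  assumes \<tau>: "\<tau> = 1 \<or> \<tau> = -1" and y: "lead \<tau> * y < 0"
  obtains S K where "S \<ge> 1" "K \<ge> 0" "\<And>e X. \<lbrakk>0 \<le> e; e \<le> 1; adm X\<rbrakk> \<Longrightarrow>
      ((\<lambda>s. H e X (hline \<tau> y s)) \<longlongrightarrow> Hlim \<tau> e X) at_top"
    "\<And>e X s. \<lbrakk>0 \<le> e; e \<le> 1; adm X; s \<ge> S\<rbrakk> \<Longrightarrow>
      cmod (Hlim \<tau> e X - H e X (hline \<tau> y s)) \<le> K / X * exp (- (X * (\<bar>b n\<bar> * \<bar>y\<bar> / 2) * s))"
proof -
  define y0 where "y0 = - sgn (lead \<tau>)"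
  have y0: "lead \<tau> * y0 < 0" "\<bar>y0\<bar> = 1"
    using lead_nonzero[OF \<tau>] by (auto simp: y0_def sgn_if)
  \<comment> \<open>Both heights have the same sign, so no point between them is closer to the real
    axis than \<eta>.\<close>
  define \<eta> where "\<eta> = min \<bar>y\<bar> 1"
  have yn: "y \<noteq> 0" using y by auto
  have \<eta>: "\<eta> > 0" using yn by (simp add: \<eta>_def)
  define c where "c = (\<lambda>y. \<bar>b n\<bar> * \<bar>y\<bar> / 2)"
  have lim: "\<exists>S K. S \<ge> 1 \<and> K \<ge> 0 \<and> (\<forall>e X. 0 \<le> e \<and> e \<le> 1 \<and> adm X \<longrightarrow> (\<exists>L.
      ((\<lambda>s. H e X (hline \<tau> v s)) \<longlongrightarrow> L) at_top \<and>
      (\<forall>s\<ge>S. cmod (L - H e X (hline \<tau> v s)) \<le> K / X * exp (- (X * c v * s)))))"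
    if v: "lead \<tau> * v < 0" for v
  proof -
    have v0: "\<bar>v\<bar> > 0" using v by auto
    obtain S K where SK: "S \<ge> 1" "K \<ge> 0"
      "\<And>e X s y. \<lbrakk>0 \<le> e; e \<le> 1; adm X; s \<ge> S; \<bar>v\<bar> \<le> \<bar>y\<bar>; \<bar>y\<bar> \<le> \<bar>v\<bar>; lead \<tau> * y \<le> 0\<rbrakk>
       \<Longrightarrow> cmod (F e X (hline \<tau> y s)) \<le> K * exp (- (X * (\<bar>b n\<bar> * \<bar>v\<bar> / 2) * s))"
      using F_hline_decay[OF \<tau> v0, of "\<bar>v\<bar>"] by auto
    have c0: "c v > 0" using v0 bn by (simp add: c_def)
    show ?thesis
    proof (rule exI[of _ S], rule exI[of _ "K / c v"], intro conjI allI impI)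
      fix e X :: real assume eX: "0 \<le> e \<and> e \<le> 1 \<and> adm X"
      then have X: "X > 0" by (simp add: adm_def)
      obtain L where L: "((\<lambda>s. H e X (hline \<tau> v s)) \<longlongrightarrow> L) at_top"
        "\<And>s. s \<ge> S \<Longrightarrow> cmod (L - H e X (hline \<tau> v s)) \<le> K / (X * c v) * exp (- (X * c v * s))"
      proof (rule primitive_decay[where S = S and h = "\<lambda>s. H e X (hline \<tau> v s)" and c = "X * c v" and K = K])
        fix s assume s: "S \<le> s"
        show "((\<lambda>s. H e X (hline \<tau> v s)) has_vector_derivative of_real \<tau> * F e X (hline \<tau> v s)) (at s)"
          using H_hline_deriv[OF \<tau>] s SK(1) by simp
        have "cmod (complex_of_real \<tau>) = 1" using \<tau> by auto
        then show "cmod (of_real \<tau> * F e X (hline \<tau> v s)) \<le> K * exp (- (X * c v * s))"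
          using SK(3)[of e X s v] eX s v by (simp add: norm_mult c_def)
      qed (use X c0 in auto)
      then show "\<exists>L. ((\<lambda>s. H e X (hline \<tau> v s)) \<longlongrightarrow> L) at_top \<and>
          (\<forall>s\<ge>S. cmod (L - H e X (hline \<tau> v s)) \<le> K / c v / X * exp (- (X * c v * s)))"
        by (intro exI[of _ L]) (simp add: mult.commute)
    qed (use SK c0 in auto)
  qed
  obtain S K where SK: "S \<ge> 1" "K \<ge> 0" "\<And>e X. 0 \<le> e \<and> e \<le> 1 \<and> adm X \<Longrightarrow> \<exists>L.
      ((\<lambda>s. H e X (hline \<tau> y s)) \<longlongrightarrow> L) at_top \<and>
      (\<forall>s\<ge>S. cmod (L - H e X (hline \<tau> y s)) \<le> K / X * exp (- (X * c y * s)))"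
    using lim[OF y] by blast
  obtain S' K' where SK': "\<And>e X. 0 \<le> e \<and> e \<le> 1 \<and> adm X \<Longrightarrow> \<exists>L.
      ((\<lambda>s. H e X (hline \<tau> y0 s)) \<longlongrightarrow> L) at_top \<and>
      (\<forall>s\<ge>S'. cmod (L - H e X (hline \<tau> y0 s)) \<le> K' / X * exp (- (X * c y0 * s)))"
    using lim[OF y0(1)] by blast
  obtain S2 K2 where SK2: "S2 \<ge> 1" "K2 \<ge> 0"
    "\<And>e X s v. \<lbrakk>0 \<le> e; e \<le> 1; adm X; s \<ge> S2; \<eta> \<le> \<bar>v\<bar>; \<bar>v\<bar> \<le> \<bar>y\<bar> + 1; lead \<tau> * v \<le> 0\<rbrakk>
       \<Longrightarrow> cmod (F e X (hline \<tau> v s)) \<le> K2 * exp (- (X * (\<bar>b n\<bar> * \<eta> / 2) * s))"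
    using F_hline_decay[OF \<tau> \<eta>, of "\<bar>y\<bar> + 1"] by auto
  have limy: "((\<lambda>s. H e X (hline \<tau> y s)) \<longlongrightarrow> Hlim \<tau> e X) at_top" if eX: "0 \<le> e" "e \<le> 1" "adm X" for e X
  proof -
    have X: "X > 0" using eX by (simp add: adm_def)
    obtain L where L: "((\<lambda>s. H e X (hline \<tau> y0 s)) \<longlongrightarrow> L) at_top" using SK' eX by blast
    have HL: "Hlim \<tau> e X = L"
      unfolding Hlim_def y0_def[symmetric] by (rule tendsto_Lim[OF _ L]) simp
    have "((\<lambda>s. H e X (hline \<tau> y s) - H e X (hline \<tau> y0 s)) \<longlongrightarrow> 0) at_top"
    proof (rule Lim_null_comparison)
      show "eventually (\<lambda>s. cmod (H e X (hline \<tau> y s) - H e X (hline \<tau> y0 s))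
          \<le> K2 * exp (- (X * (\<bar>b n\<bar> * \<eta> / 2) * s)) * \<bar>y - y0\<bar>) at_top"
        using eventually_ge_at_top[of S2]
      proof eventually_elim
        case (elim s)
        have seg: "\<exists>v. z = hline \<tau> v s \<and> \<eta> \<le> \<bar>v\<bar> \<and> \<bar>v\<bar> \<le> \<bar>y\<bar> + 1 \<and> lead \<tau> * v \<le> 0"
          if "z \<in> closed_segment (hline \<tau> y0 s) (hline \<tau> y s)" for z
        proof -
          obtain u where u: "0 \<le> u" "u \<le> 1" "z = (1 - u) *\<^sub>R hline \<tau> y0 s + u *\<^sub>R hline \<tau> y s"
            using \<open>z \<in> _\<close> by (auto simp: closed_segment_def)
          define v where "v = (1 - u) * y0 + u * y"
          have "z = hline \<tau> v s" by (simp add: u(3) v_def hline_def complex_eq_iff algebra_simps)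
          moreover have same: "lead \<tau> * v \<le> 0" "\<bar>v\<bar> = (1 - u) * \<bar>y0\<bar> + u * \<bar>y\<bar>"
          proof -
            have "lead \<tau> * v = (1 - u) * (lead \<tau> * y0) + u * (lead \<tau> * y)" by (simp add: v_def algebra_simps)
            then show "lead \<tau> * v \<le> 0"
              using u y y0 by (simp add: add_nonpos_nonpos mult_nonneg_nonpos)
            show "\<bar>v\<bar> = (1 - u) * \<bar>y0\<bar> + u * \<bar>y\<bar>"
            proof (cases "lead \<tau> > 0")
              case True
              then have "y0 < 0" "y < 0" using y y0 by (auto simp: mult_less_0_iff)
              moreover have "(1 - u) * y0 \<le> 0" "u * y \<le> 0" using u \<open>y0 < 0\<close> \<open>y < 0\<close> by (auto simp: mult_nonneg_nonpos)
              ultimately show ?thesis by (simp add: v_def)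
            next
              case False
              then have "y0 > 0" "y > 0" using y y0 by (auto simp: mult_less_0_iff)
              moreover have "(1 - u) * y0 \<ge> 0" "u * y \<ge> 0" using u \<open>y0 > 0\<close> \<open>y > 0\<close> by auto
              ultimately show ?thesis by (simp add: v_def)
            qed
          qed
          moreover have "\<eta> \<le> \<bar>v\<bar>"
          proof -
            have "(1 - u) * \<eta> + u * \<eta> \<le> (1 - u) * \<bar>y0\<bar> + u * \<bar>y\<bar>"
              using u y0 by (intro add_mono mult_left_mono) (auto simp: \<eta>_def)
            then show ?thesis using same by (simp add: algebra_simps)
          qed
          moreover have "\<bar>v\<bar> \<le> \<bar>y\<bar> + 1"
          proof -
            have "(1 - u) * \<bar>y0\<bar> + u * \<bar>y\<bar> \<le> 1 * \<bar>y0\<bar> + 1 * \<bar>y\<bar>"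
              using u by (intro add_mono mult_right_mono) auto
            then show ?thesis using same y0 by simp
          qed
          ultimately show ?thesis by blast
        qed
        have "cmod (H e X (hline \<tau> y s) - H e X (hline \<tau> y0 s))
            \<le> K2 * exp (- (X * (\<bar>b n\<bar> * \<eta> / 2) * s)) * cmod (hline \<tau> y s - hline \<tau> y0 s)"
        proof (rule H_segment_bound)
          show "closed_segment (hline \<tau> y0 s) (hline \<tau> y s) \<subseteq> cut"
            using seg hline_cut[OF \<tau>, of s] elim SK2(1) by fastforce
          fix z assume "z \<in> closed_segment (hline \<tau> y0 s) (hline \<tau> y s)"
          from seg[OF this] show "cmod (F e X z) \<le> K2 * exp (- (X * (\<bar>b n\<bar> * \<eta> / 2) * s))"
            using SK2(3)[OF eX elim] by auto
        qed
        also have "hline \<tau> y s - hline \<tau> y0 s = \<i> * of_real (y - y0)" by (simp add: hline_def algebra_simps)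
        finally show ?case by (simp add: norm_mult del: of_real_diff)
      qed
      show "((\<lambda>s. K2 * exp (- (X * (\<bar>b n\<bar> * \<eta> / 2) * s)) * \<bar>y - y0\<bar>) \<longlongrightarrow> 0) at_top"
      proof -
        define k where "k = X * (\<bar>b n\<bar> * \<eta> / 2)"
        have "k > 0" using X bn \<eta> by (simp add: k_def)
        then have "((\<lambda>s. K2 * exp (- (k * s)) * \<bar>y - y0\<bar>) \<longlongrightarrow> 0) at_top" by real_asymp
        then show ?thesis by (simp only: k_def)
      qed
    qed
    from tendsto_add[OF this L] show ?thesis unfolding HL by simp
  qed
  show thesis
  proof (rule that[OF SK(1,2) limy])
    fix e X s :: real assume eX: "0 \<le> e" "e \<le> 1" "adm X" and s: "s \<ge> S"
    obtain L where L: "((\<lambda>s. H e X (hline \<tau> y s)) \<longlongrightarrow> L) at_top"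
      "\<forall>s\<ge>S. cmod (L - H e X (hline \<tau> y s)) \<le> K / X * exp (- (X * c y * s))"
      using SK(3) eX by blast
    have "L = Hlim \<tau> e X" by (rule tendsto_unique[OF _ L(1) limy[OF eX]]) simp
    then show "cmod (Hlim \<tau> e X - H e X (hline \<tau> y s)) \<le> K / X * exp (- (X * (\<bar>b n\<bar> * \<bar>y\<bar> / 2) * s))"
      using L(2) s by (simp add: c_def)
  qed
qed

text \<open>There is no exponential decay on the axis itself, but on the vertical segment from the
  axis to the line the integrand is at most \<open>exp (- (k * v))\<close> with \<open>k\<close>
  proportional to \<open>s\<close>. This integrates to at most \<open>1 / k\<close>, as in Jordan's
  lemma; \<open>p \<ge> 0\<close> keeps the amplitude bounded.\<close>

lemma real_axis_limit:
  assumes \<tau>: "\<tau> = 1 \<or> \<tau> = -1" and p: "p \<ge> 0" and e: "0 \<le> e" "e \<le> 1" and X: "X > 0"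
  shows "((\<lambda>s. H e X (of_real (\<tau> * s))) \<longlongrightarrow> Hlim \<tau> e X) at_top"
proof -
  define y0 where "y0 = - sgn (lead \<tau>)"
  have y0: "lead \<tau> * y0 < 0" "\<bar>y0\<bar> = 1"
    using lead_nonzero[OF \<tau>] by (auto simp: y0_def sgn_if)
  have adm: "adm X" using X p by (simp add: adm_def)
  obtain S where S: "S \<ge> 1" "S \<ge> 1" "\<And>e s y. \<lbrakk>0 \<le> e; e \<le> 1; s \<ge> S; \<bar>y\<bar> \<le> 1; lead \<tau> * y \<le> 0\<rbrakk>
       \<Longrightarrow> Re (Phi e (hline \<tau> y s)) \<le> - (\<bar>b n\<bar> * \<bar>y\<bar> * s)"
    using hline_growth[OF \<tau>, of 1] by auto
  have lim: "((\<lambda>s. H e X (hline \<tau> y0 s)) \<longlongrightarrow> Hlim \<tau> e X) at_top"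
    using hline_limit[OF \<tau> y0(1)] e adm by metis
  have "((\<lambda>s. H e X (hline \<tau> y0 s) - H e X (of_real (\<tau> * s))) \<longlongrightarrow> 0) at_top"
  proof (rule Lim_null_comparison)
    show "eventually (\<lambda>s. cmod (H e X (hline \<tau> y0 s) - H e X (of_real (\<tau> * s))) \<le> 1 / (X * \<bar>b n\<bar> * s)) at_top"
      using eventually_ge_at_top[of S]
    proof eventually_elim
      case (elim s)
      have s1: "s \<ge> 1" using elim S by simp
      define k where "k = X * \<bar>b n\<bar> * s"
      have k: "k > 0" using X bn s1 by (simp add: k_def)
      have der: "((\<lambda>v. H e X (hline \<tau> (v * y0) s)) has_vector_derivative \<i> * of_real y0 * F e X (hline \<tau> (v * y0) s)) (at v)" for v
      proof -
        have "((\<lambda>v. hline \<tau> (v * y0) s) has_vector_derivative \<i> * of_real y0) (at v)"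
          unfolding hline_def
          by (auto intro!: derivative_eq_intros simp: has_vector_derivative_def scaleR_conv_of_real mult_ac)
        from field_vector_diff_chain_at[OF this H_deriv[OF hline_cut[OF \<tau> s1]]]
        show ?thesis by (simp add: o_def)
      qed
      have "cmod (H e X (hline \<tau> (1 * y0) s) - H e X (hline \<tau> (0 * y0) s))
          \<le> (- exp (- (k * 1)) / k) - (- exp (- (k * 0)) / k)"
      proof (rule differentiable_bound_general[where f = "\<lambda>v. H e X (hline \<tau> (v * y0) s)"
            and \<phi>' = "\<lambda>v. exp (- (k * v))"])
        show "continuous_on {0..1} (\<lambda>v. H e X (hline \<tau> (v * y0) s))"
          by (intro continuous_at_imp_continuous_on ballI has_vector_derivative_continuous[OF der])
        show "continuous_on {0..1} (\<lambda>v. - exp (- (k * v)) / k)" using k by (intro continuous_intros) auto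
        fix v :: real assume v: "0 < v" "v < 1"
        show "((\<lambda>v. - exp (- (k * v)) / k) has_vector_derivative exp (- (k * v))) (at v)"
          using k by (auto intro!: derivative_eq_intros simp flip: has_real_derivative_iff_has_vector_derivative)
        show "((\<lambda>v. H e X (hline \<tau> (v * y0) s)) has_vector_derivative \<i> * of_real y0 * F e X (hline \<tau> (v * y0) s)) (at v)"
          by (rule der)
        have vy: "\<bar>v * y0\<bar> = v" using v y0 by (simp add: abs_mult)
        have "Re (Phi e (hline \<tau> (v * y0) s)) \<le> - (\<bar>b n\<bar> * \<bar>v * y0\<bar> * s)"
        proof (rule S(3)[OF e elim])
          have "lead \<tau> * (v * y0) = v * (lead \<tau> * y0)" by simp
          also have "\<dots> \<le> 0" by (rule mult_nonneg_nonpos) (use v(1) y0(1) in linarith)+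
          finally show "lead \<tau> * (v * y0) \<le> 0" .
        qed (use v vy in simp)
        then have "X * Re (Phi e (hline \<tau> (v * y0) s)) \<le> X * - (\<bar>b n\<bar> * v * s)"
          unfolding vy using X by (intro mult_left_mono) auto
        then have "exp (X * Re (Phi e (hline \<tau> (v * y0) s))) \<le> exp (- (k * v))" by (simp add: k_def mult_ac)
        moreover have "1 \<le> cmod (hline \<tau> (v * y0) s) powi p"
          using norm_hline(1)[OF \<tau> s1, of "v * y0"] vy v s1 p by (simp add: power_int_def one_le_power)
        ultimately have "cmod (F e X (hline \<tau> (v * y0) s)) \<le> exp (- (k * v)) * 1"
          unfolding norm_F by (intro mult_mono) auto
        then show "cmod (\<i> * of_real y0 * F e X (hline \<tau> (v * y0) s)) \<le> exp (- (k * v))"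
          using y0 by (simp add: norm_mult)
      qed auto
      also have "\<dots> \<le> 1 / k" using k by simp
      finally show ?case by (simp add: k_def hline_def)
    qed
    define k where "k = X * \<bar>b n\<bar>"
    have "k > 0" using X bn by (simp add: k_def)
    then have "((\<lambda>s. 1 / (k * s)) \<longlongrightarrow> 0) at_top" by real_asymp
    then show "((\<lambda>s. 1 / (X * \<bar>b n\<bar> * s)) \<longlongrightarrow> 0) at_top" by (simp only: k_def)
  qed
  from tendsto_diff[OF lim this] show ?thesis by simp
qed

section \<open>Negligible contributions\<close>

definition MM :: "real \<Rightarrow> real" where
  "MM e = Max ((\<lambda>z. Re (Phi e z)) ` Stat e)"

text \<open>The main term of a dominating stationary point has size
  \<open>X powr (- 1 / 2) * exp (X * MM e)\<close>; negligible means smaller by a factor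
  \<open>1 / X\<close>. The level is \<open>MM e\<close> and not \<open>MM 0\<close>, because
  \<open>X * (MM e - MM 0)\<close> is not controlled.\<close>

definition negl :: "(real \<Rightarrow> real \<Rightarrow> complex) \<Rightarrow> bool" where
  "negl h \<longleftrightarrow> (\<exists>C. eventually (\<lambda>e. \<forall>X. adm X \<longrightarrow>
     cmod (h e X) \<le> C * X powr (- 3 / 2) * exp (X * MM e)) (at_right 0))"

lemma negl_add: "negl f \<Longrightarrow> negl g \<Longrightarrow> negl (\<lambda>e X. f e X + g e X)"
proof -
  assume "negl f" "negl g"
  then obtain C C' where ev: "eventually (\<lambda>e. \<forall>X. adm X \<longrightarrow>
     cmod (f e X) \<le> C * X powr (- 3 / 2) * exp (X * MM e)) (at_right 0)"
    "eventually (\<lambda>e. \<forall>X. adm X \<longrightarrow>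
     cmod (g e X) \<le> C' * X powr (- 3 / 2) * exp (X * MM e)) (at_right 0)"
    unfolding negl_def by blast
  have "eventually (\<lambda>e. \<forall>X. adm X \<longrightarrow>
     cmod (f e X + g e X) \<le> (C + C') * X powr (- 3 / 2) * exp (X * MM e)) (at_right 0)"
    using ev
  proof eventually_elim
    case (elim e)
    show ?case
    proof (intro allI impI)
      fix X assume "adm X"
      then have "cmod (f e X) \<le> C * X powr (- 3 / 2) * exp (X * MM e)"
        "cmod (g e X) \<le> C' * X powr (- 3 / 2) * exp (X * MM e)" using elim by blast+
      then show "cmod (f e X + g e X) \<le> (C + C') * X powr (- 3 / 2) * exp (X * MM e)"
        using norm_triangle_ineq[of "f e X" "g e X"] by (simp add: distrib_right)
    qed
  qed
  then show ?thesis unfolding negl_def by blast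
qed

lemma negl_minus: "negl f \<Longrightarrow> negl (\<lambda>e X. - f e X)"
  by (simp add: negl_def)

lemma negl_diff: "negl f \<Longrightarrow> negl g \<Longrightarrow> negl (\<lambda>e X. f e X - g e X)"
  using negl_add[OF _ negl_minus] by simp

lemma negl_0: "negl (\<lambda>e X. 0)"
  unfolding negl_def by (intro exI[of _ 0]) simp

lemma negl_sum: "finite A \<Longrightarrow> (\<And>a. a \<in> A \<Longrightarrow> negl (f a)) \<Longrightarrow> negl (\<lambda>e X. \<Sum>a\<in>A. f a e X)"
  by (induction A rule: finite_induct) (auto intro: negl_0 negl_add)

lemma negl_cong: "eventually (\<lambda>e. \<forall>X. adm X \<longrightarrow> f e X = g e X) (at_right 0) \<Longrightarrow> negl f \<Longrightarrow> negl g"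
  unfolding negl_def
proof (elim exE)
  fix C assume ev: "eventually (\<lambda>e. \<forall>X. adm X \<longrightarrow> f e X = g e X) (at_right 0)"
    "eventually (\<lambda>e. \<forall>X. adm X \<longrightarrow> cmod (f e X) \<le> C * X powr (- 3 / 2) * exp (X * MM e)) (at_right 0)"
  show "\<exists>C. eventually (\<lambda>e. \<forall>X. adm X \<longrightarrow> cmod (g e X) \<le> C * X powr (- 3 / 2) * exp (X * MM e)) (at_right 0)"
    by (rule exI[of _ C], use ev in eventually_elim) simp
qed

lemma Phi_tendsto:
  assumes "(a \<longlongrightarrow> a0) (at_right 0)"
  shows "((\<lambda>e. Phi e (a e)) \<longlongrightarrow> Phi 0 a0) (at_right 0)"
    "((\<lambda>e. ddPhi e (a e)) \<longlongrightarrow> ddPhi 0 a0) (at_right 0)"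
  unfolding Phi_def ddPhi_def by (intro tendsto_intros assms)+

lemma Stat_0_cut: "z \<in> Stat 0 \<Longrightarrow> z \<in> cut"
  using root_0(1)[of z] by (intro cutI) (auto simp: Stat_def complex_eq_iff)

lemma MM_ge: "eventually (\<lambda>e. finite (Stat e) \<and> (\<forall>z\<in>Stat e. Re (Phi e z) \<le> MM e)) (at_right 0)"
  using zeta_Stat
proof eventually_elim
  case (elim e)
  then have "finite (Stat e)" using finite_Stat_0 by simp
  then show ?case by (simp add: MM_def)
qed

lemma MM_low:
  assumes \<delta>: "\<delta> > 0"
  shows "eventually (\<lambda>e. MM 0 - \<delta> \<le> MM e) (at_right 0)"
proof -
  have "MM 0 \<in> (\<lambda>z. Re (Phi 0 z)) ` Stat 0"
    unfolding MM_def using finite_Stat_0 Stat_0_nonempty by (intro Max_in) auto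
  then obtain z0 where z0: "z0 \<in> Stat 0" "MM 0 = Re (Phi 0 z0)" by auto
  have "((\<lambda>e. Re (Phi e (zeta e z0))) \<longlongrightarrow> MM 0) (at_right 0)"
    unfolding z0(2) by (intro tendsto_intros Phi_tendsto zeta_tendsto z0(1))
  then have "eventually (\<lambda>e. MM 0 - \<delta> < Re (Phi e (zeta e z0))) (at_right 0)"
    using \<delta> by (intro order_tendstoD) auto
  then show ?thesis using MM_ge zeta_Stat
  proof eventually_elim
    case (elim e)
    then have "zeta e z0 \<in> Stat e" using z0(1) by auto
    then show ?case using elim by force
  qed
qed

text \<open>Half of the gap \<delta> covers a possible drop from \<open>MM 0\<close> to
  \<open>MM e\<close>, the other half yields the decay that \<open>exp_decay_le_powr\<close> turns
  into a power of \<open>X\<close>.\<close>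

lemma negl_exp:
  assumes \<delta>: "\<delta> > 0" and C: "C \<ge> 0" and ev: "eventually (\<lambda>e. \<forall>X. adm X \<longrightarrow>
      cmod (h e X) \<le> C * (1 + 1 / X) * exp (X * (MM 0 - \<delta>))) (at_right 0)"
  shows "negl h"
proof -
  have "\<delta> / 2 > 0" using \<delta> by simp
  obtain C' where C': "C' > 0" "\<And>X. X > 0 \<Longrightarrow> (1 + 1 / X) * exp (- (\<delta> / 2 * X)) \<le> C' * X powr (- 3 / 2)"
    using exp_decay_le_powr[OF \<open>\<delta> / 2 > 0\<close>] by blast
  have "eventually (\<lambda>e. \<forall>X. adm X \<longrightarrow>
     cmod (h e X) \<le> C * C' * X powr (- 3 / 2) * exp (X * MM e)) (at_right 0)"
    using ev MM_low[OF \<open>\<delta> / 2 > 0\<close>]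
  proof eventually_elim
    case (elim e)
    show ?case
    proof (intro allI impI)
      fix X assume a: "adm X"
      then have X: "X > 0" by (simp add: adm_def)
      have "cmod (h e X) \<le> C * (1 + 1 / X) * exp (X * (MM 0 - \<delta>))" using elim(1) a by blast
      also have "\<dots> \<le> C * (1 + 1 / X) * exp (- (\<delta> / 2 * X) + X * MM e)"
      proof -
        have "X * (MM 0 - \<delta> / 2) \<le> X * MM e" using X elim(2) by (intro mult_left_mono) auto
        then have "X * (MM 0 - \<delta>) \<le> - (\<delta> / 2 * X) + X * MM e" by (simp add: algebra_simps)
        then show ?thesis using C X by (intro mult_left_mono) auto
      qed
      also have "\<dots> = C * ((1 + 1 / X) * exp (- (\<delta> / 2 * X))) * exp (X * MM e)"
        unfolding exp_add by simp
      also have "\<dots> \<le> C * (C' * X powr (- 3 / 2)) * exp (X * MM e)"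
        using C'(2)[OF X] C by (intro mult_right_mono mult_left_mono) auto
      finally show "cmod (h e X) \<le> C * C' * X powr (- 3 / 2) * exp (X * MM e)" by simp
    qed
  qed
  then show ?thesis unfolding negl_def by blast
qed

definition weight :: "complex \<Rightarrow> complex" where
  "weight z = 1 / (\<i> * z) powi p"

lemma holomorphic_weight': "weight holomorphic_on cut"
  using holomorphic_weight by (simp add: weight_def[abs_def])

lemma F_weight: "F e X z = exp (of_real X * Phi e z) * weight z"
  by (simp add: F_alt weight_def)

definition Omega :: "complex set" where
  "Omega = cut \<inter> {z. Re (Phi 0 z) < MM 0}"

lemma open_Omega: "open Omega"
  unfolding Omega_def
  by (intro open_Int open_cut open_Collect_less continuous_intros continuous_Phi)

text \<open>By compactness the segment has a closed neighbourhood inside \<open>Omega\<close>, on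
  which the phase stays a fixed amount below \<open>MM 0\<close>. The neighbourhood also leaves room
  for end points that move with \<open>e\<close>.\<close>

lemma negl_segment:
  assumes seg: "closed_segment a0 b0 \<subseteq> Omega"
    and a: "(u \<longlongrightarrow> a0) (at_right 0)" and b: "(v \<longlongrightarrow> b0) (at_right 0)"
  shows "negl (\<lambda>e X. H e X (v e) - H e X (u e))"
proof -
  obtain r where r: "r > 0" "(\<Union>x\<in>closed_segment a0 b0. ball x r) \<subseteq> Omega"
    using compact_subset_open_imp_ball_epsilon_subset[OF compact_segment open_Omega seg] by metis
  define r' where "r' = min (r / 2) 1"
  have r': "0 < r'" "r' < r" "r' \<le> 1" using r by (auto simp: r'_def)
  define K where "K = {x + y |x y. x \<in> closed_segment a0 b0 \<and> y \<in> cball 0 r'}"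
  have K: "compact K" unfolding K_def by (intro compact_sums compact_segment compact_cball)
  have KO: "K \<subseteq> Omega"
  proof
    fix z assume "z \<in> K"
    then obtain x y where xy: "x \<in> closed_segment a0 b0" "cmod y \<le> r'" "z = x + y" by (auto simp: K_def)
    then have "z \<in> ball x r" using r' by (simp add: dist_norm)
    then show "z \<in> Omega" using xy r by blast
  qed
  have Kne: "K \<noteq> {}"
  proof -
    have "a0 + 0 \<in> K" unfolding K_def using r' by (intro CollectI exI[of _ a0] exI[of _ 0]) auto
    then show ?thesis by auto
  qed
  obtain w where w: "w \<in> K" "\<And>z. z \<in> K \<Longrightarrow> Re (Phi 0 z) \<le> Re (Phi 0 w)"
    using continuous_attains_sup[OF K Kne, of "\<lambda>z. Re (Phi 0 z)"] continuous_on_Re[OF continuous_Phi(1)] by metis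
  \<comment> \<open>The other half of the gap is given to the perturbation of the phase.\<close>
  define \<delta> where "\<delta> = (MM 0 - Re (Phi 0 w)) / 2"
  have \<delta>: "\<delta> > 0" using w(1) KO by (auto simp: \<delta>_def Omega_def)
  have "continuous_on K weight"
    using KO holomorphic_weight' by (intro holomorphic_on_imp_continuous_on holomorphic_on_subset[OF holomorphic_weight']) (auto simp: Omega_def)
  from compact_imp_bounded[OF compact_continuous_image[OF this K]]
  obtain W where W: "W > 0" "\<And>z. z \<in> K \<Longrightarrow> cmod (weight z) \<le> W"
    unfolding bounded_pos by auto
  obtain R where R: "R > 0" "\<And>z. z \<in> K \<Longrightarrow> cmod z \<le> R"
    using compact_imp_bounded[OF K] unfolding bounded_pos by auto
  have eva: "eventually (\<lambda>e. dist (u e) a0 < r') (at_right 0)" "eventually (\<lambda>e. dist (v e) b0 < r') (at_right 0)"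
    using a b r'(1) by (auto intro: tendstoD)
  show ?thesis
  proof (rule negl_exp[OF \<delta>, of "W * (cmod (b0 - a0) + 2)"])
    show "eventually (\<lambda>e. \<forall>X. adm X \<longrightarrow> cmod (H e X (v e) - H e X (u e))
        \<le> W * (cmod (b0 - a0) + 2) * (1 + 1 / X) * exp (X * (MM 0 - \<delta>))) (at_right 0)"
      using eventually_small[OF \<delta>, of "perturb_const R"] eva
    proof eventually_elim
      case (elim e)
      have sK: "closed_segment (u e) (v e) \<subseteq> K"
      proof
        fix z assume "z \<in> closed_segment (u e) (v e)"
        then obtain k where k: "0 \<le> k" "k \<le> 1" "z = (1 - k) *\<^sub>R u e + k *\<^sub>R v e"
          by (auto simp: closed_segment_def)
        define x where "x = (1 - k) *\<^sub>R a0 + k *\<^sub>R b0"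
        have "z - x = (1 - k) *\<^sub>R (u e - a0) + k *\<^sub>R (v e - b0)" by (simp add: k x_def algebra_simps)
        then have "cmod (z - x) \<le> (1 - k) * cmod (u e - a0) + k * cmod (v e - b0)"
          using norm_triangle_ineq[of "(1 - k) *\<^sub>R (u e - a0)" "k *\<^sub>R (v e - b0)"] k by simp
        also have "\<dots> \<le> (1 - k) * r' + k * r'"
          using elim k by (intro add_mono mult_left_mono) (auto simp: dist_norm)
        finally have "cmod (z - x) \<le> r'" by (simp add: algebra_simps)
        moreover have "x \<in> closed_segment a0 b0" using k by (auto simp: x_def closed_segment_def)
        ultimately show "z \<in> K" unfolding K_def by (intro CollectI exI[of _ x] exI[of _ "z - x"]) auto
      qed
      show ?case
      proof (intro allI impI)
        fix X assume "adm X"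
        then have X: "X > 0" by (simp add: adm_def)
        have "cmod (H e X (v e) - H e X (u e)) \<le> (exp (X * (MM 0 - \<delta>)) * W) * cmod (v e - u e)"
        proof (rule H_segment_bound)
          show "closed_segment (u e) (v e) \<subseteq> cut" using sK KO by (auto simp: Omega_def)
          fix z assume "z \<in> closed_segment (u e) (v e)"
          then have z: "z \<in> K" using sK by auto
          have "cmod (Phi e z - Phi 0 z) \<le> e * perturb_const R"
            using elim R(2)[OF z] by (intro Phi_perturb(1)) auto
          moreover have "e * perturb_const R < \<delta>" using elim by blast
          ultimately have "Re (Phi e z) \<le> Re (Phi 0 z) + \<delta>"
            using abs_Re_le_cmod[of "Phi e z - Phi 0 z"] unfolding minus_complex.sel by linarith
          also have "\<dots> \<le> MM 0 - \<delta>" using w(2)[OF z] by (simp add: \<delta>_def field_simps)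
          finally have "X * Re (Phi e z) \<le> X * (MM 0 - \<delta>)" using X by (intro mult_left_mono) auto
          then show "cmod (F e X z) \<le> exp (X * (MM 0 - \<delta>)) * W"
            unfolding F_weight norm_mult using W(2)[OF z] by (intro mult_mono) auto
        qed
        also have "\<dots> \<le> (exp (X * (MM 0 - \<delta>)) * W) * (cmod (b0 - a0) + 2)"
        proof -
          have "v e - u e = (v e - b0) + (b0 - a0) + (a0 - u e)" by simp
          then have "cmod (v e - u e) \<le> cmod (v e - b0) + cmod (b0 - a0) + cmod (a0 - u e)"
            by (metis norm_triangle_le norm_triangle_ineq add_mono order_refl)
          then have "cmod (v e - u e) \<le> cmod (b0 - a0) + 2"
            using elim r' by (simp add: dist_norm norm_minus_commute)
          then show ?thesis using W by (intro mult_left_mono) auto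
        qed
        also have "\<dots> = W * (cmod (b0 - a0) + 2) * 1 * exp (X * (MM 0 - \<delta>))" by simp
        also have "\<dots> \<le> W * (cmod (b0 - a0) + 2) * (1 + 1 / X) * exp (X * (MM 0 - \<delta>))"
          using X W by (intro mult_right_mono mult_left_mono) auto
        finally show "cmod (H e X (v e) - H e X (u e)) \<le> \<dots>" .
      qed
    qed
  qed (use W in auto)
qed

text \<open>Compactness gives no gap on an unbounded ray. The ray is therefore cut into a segment
  inside \<open>Omega\<close> and a tail that is controlled by the explicit decay on horizontal
  lines.\<close>

lemma negl_far:
  assumes \<tau>: "\<tau> = 1 \<or> \<tau> = -1" and y: "lead \<tau> * Im z1 < 0"
    and ray: "\<And>s. s \<ge> 0 \<Longrightarrow> z1 + of_real (\<tau> * s) \<in> Omega"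
  shows "negl (\<lambda>e X. Hlim \<tau> e X - H e X z1)"
proof -
  obtain S K where SK: "S \<ge> 1" "K \<ge> 0"
    "\<And>e X s. \<lbrakk>0 \<le> e; e \<le> 1; adm X; s \<ge> S\<rbrakk> \<Longrightarrow>
      cmod (Hlim \<tau> e X - H e X (hline \<tau> (Im z1) s)) \<le> K / X * exp (- (X * (\<bar>b n\<bar> * \<bar>Im z1\<bar> / 2) * s))"
    using hline_limit[OF \<tau> y] by metis
  define c where "c = \<bar>b n\<bar> * \<bar>Im z1\<bar> / 2"
  have "Im z1 \<noteq> 0" using y by auto
  then have c: "c > 0" using bn by (simp add: c_def)
  \<comment> \<open>From \<open>(\<bar>MM 0\<bar> + 1) / c\<close> on, the decay
    \<open>exp (- (X * c * s))\<close> is below \<open>exp (X * (MM 0 - 1))\<close>, simultaneously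
    for all \<open>X\<close>.\<close>
  define s1 where "s1 = max S (max ((\<bar>MM 0\<bar> + 1) / c) (\<tau> * Re z1))"
  have s1: "s1 \<ge> S" "s1 \<ge> (\<bar>MM 0\<bar> + 1) / c" "s1 \<ge> \<tau> * Re z1" by (auto simp: s1_def)
  define z2 where "z2 = hline \<tau> (Im z1) s1"
  have z2: "z2 = z1 + of_real (\<tau> * (s1 - \<tau> * Re z1))"
    using \<tau> by (auto simp: z2_def hline_def complex_eq_iff)
  have seg: "closed_segment z1 z2 \<subseteq> Omega"
  proof
    fix z assume "z \<in> closed_segment z1 z2"
    then obtain u where u: "0 \<le> u" "u \<le> 1" "z = (1 - u) *\<^sub>R z1 + u *\<^sub>R z2"
      by (auto simp: closed_segment_def)
    have "z = z1 + of_real (\<tau> * (u * (s1 - \<tau> * Re z1)))"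
      by (simp add: u(3) z2 algebra_simps scaleR_conv_of_real)
    then show "z \<in> Omega" using ray[of "u * (s1 - \<tau> * Re z1)"] u s1 by simp
  qed
  have n1: "negl (\<lambda>e X. H e X z2 - H e X z1)"
    by (rule negl_segment[OF seg]) auto
  have n2: "negl (\<lambda>e X. Hlim \<tau> e X - H e X z2)"
  proof (rule negl_exp[of 1 K])
    show "eventually (\<lambda>e. \<forall>X. adm X \<longrightarrow> cmod (Hlim \<tau> e X - H e X z2) \<le> K * (1 + 1 / X) * exp (X * (MM 0 - 1))) (at_right 0)"
      using eventually_small[of 1 0, OF zero_less_one]
    proof eventually_elim
      case (elim e)
      show ?case
      proof (intro allI impI)
        fix X assume a: "adm X"
        then have X: "X > 0" by (simp add: adm_def)
        have "cmod (Hlim \<tau> e X - H e X z2) \<le> K / X * exp (- (X * c * s1))"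
          unfolding z2_def c_def using elim a s1 by (intro SK(3)) auto
        also have "\<dots> \<le> (K * (1 + 1 / X)) * exp (X * (MM 0 - 1))"
        proof (rule mult_mono)
          have "\<bar>MM 0\<bar> + 1 \<le> c * s1" using s1(2) c by (simp add: field_simps)
          then have "X * (\<bar>MM 0\<bar> + 1) \<le> X * (c * s1)" using X by (intro mult_left_mono) auto
          moreover have "X * (- MM 0 + 1) \<le> X * (\<bar>MM 0\<bar> + 1)" using X by (intro mult_left_mono) auto
          ultimately show "exp (- (X * c * s1)) \<le> exp (X * (MM 0 - 1))" by (simp add: algebra_simps)
        qed (use X SK in \<open>auto simp: field_simps\<close>)
        finally show "cmod (Hlim \<tau> e X - H e X z2) \<le> K * (1 + 1 / X) * exp (X * (MM 0 - 1))" .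
      qed
    qed
  qed (use SK in auto)
  from negl_add[OF n1 n2] show ?thesis by simp
qed

section \<open>The contribution of one stationary point\<close>

text \<open>The unit vector along which the second-order term of the phase is real and negative. Of
  its two signs \<open>csqrt\<close> takes the one with nonnegative real part, which orients the
  path from left to right.\<close>

definition dirn :: "real \<Rightarrow> complex \<Rightarrow> complex" where
  "dirn e z = csqrt (- cnj (ddPhi e z) / of_real (cmod (ddPhi e z)))"

definition mainT :: "real \<Rightarrow> real \<Rightarrow> complex \<Rightarrow> complex" where
  "mainT e X z = exp (of_real X * Phi e z) * dirn e z * weight z * of_real (sqrt (2 * pi / (X * cmod (ddPhi e z))))"

lemma dirn_props:
  assumes "ddPhi e z \<noteq> 0"
  shows "cmod (dirn e z) = 1" "(dirn e z)\<^sup>2 * ddPhi e z = - of_real (cmod (ddPhi e z))" "Re (dirn e z) \<ge> 0"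
proof -
  have sq: "(dirn e z)\<^sup>2 = - cnj (ddPhi e z) / of_real (cmod (ddPhi e z))" by (simp add: dirn_def)
  have "cmod ((dirn e z)\<^sup>2) = 1" unfolding sq using assms by (simp add: norm_divide)
  then show "cmod (dirn e z) = 1" by (simp add: norm_power power2_eq_1_iff) (use norm_ge_zero[of "dirn e z"] in linarith)
  have "cnj (ddPhi e z) * ddPhi e z = of_real (cmod (ddPhi e z)) * of_real (cmod (ddPhi e z))"
    by (metis complex_norm_square mult.commute power2_eq_square of_real_power)
  then show "(dirn e z)\<^sup>2 * ddPhi e z = - of_real (cmod (ddPhi e z))"
    unfolding sq using assms by (simp add: field_simps)
  show "Re (dirn e z) \<ge> 0" unfolding dirn_def
    using csqrt_principal[of "- cnj (ddPhi e z) / of_real (cmod (ddPhi e z))"] by linarith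
qed

text \<open>The argument of the square root is \<open>- \<i> * z / varrho\<close>, which would meet
  the branch cut only for \<open>z\<close> on the negative imaginary axis or at 0. Hence the
  direction is continuous as \<open>e\<close> tends to 0, and its real part is strictly
  positive.\<close>

lemma dirn_0:
  assumes z: "z \<in> Stat 0"
  shows "- cnj (ddPhi 0 z) / of_real (cmod (ddPhi 0 z)) = - \<i> * z / of_real varrho"
    "- \<i> * z / of_real varrho \<notin> \<real>\<^sub>\<le>\<^sub>0" "Re (dirn 0 z) > 0"
proof -
  have z0: "dPhi 0 z = 0" "Im z \<ge> 0" using z by (auto simp: Stat_def)
  note r = root_0[OF z0(1)]
  have zc: "z * cnj z = of_real (varrho\<^sup>2)" using r(2) by (metis complex_norm_square)
  have cz: "1 / cnj z = z / of_real (varrho\<^sup>2)" using zc r(1) varrho_pos by (simp add: field_simps)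
  have n1: "real n - 1 > 0" using n by simp
  define N where "N = real n - 1"
  have N: "N > 0" using n1 by (simp add: N_def)
  have c1: "cmod (ddPhi 0 z) = N / varrho"
    unfolding r(5) N_def[symmetric] using N r(2) by (simp add: norm_mult norm_divide)
  have c2: "cnj (ddPhi 0 z) = \<i> * of_real N * (z / of_real (varrho\<^sup>2))"
    unfolding r(5) N_def[symmetric] cz[symmetric] by simp
  show eq: "- cnj (ddPhi 0 z) / of_real (cmod (ddPhi 0 z)) = - \<i> * z / of_real varrho"
    unfolding c1 c2 using N varrho_pos by (simp add: power2_eq_square)
  show nn: "- \<i> * z / of_real varrho \<notin> \<real>\<^sub>\<le>\<^sub>0"
  proof
    assume "- \<i> * z / of_real varrho \<in> \<real>\<^sub>\<le>\<^sub>0"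
    then have "Im z / varrho \<le> 0" "Re z / varrho = 0" by (auto simp: complex_nonpos_Reals_iff)
    then have "Im z \<le> 0" "Re z = 0" using varrho_pos by (auto simp: divide_le_0_iff)
    then show False using z0 r(1) by (simp add: complex_eq_iff)
  qed
  have "Re (dirn 0 z) \<noteq> 0"
  proof
    assume re: "Re (dirn 0 z) = 0"
    have "(dirn 0 z)\<^sup>2 = - \<i> * z / of_real varrho" unfolding eq[symmetric] by (simp add: dirn_def)
    moreover have "(dirn 0 z)\<^sup>2 = of_real (- (Im (dirn 0 z))\<^sup>2)" using re by (simp add: complex_eq_iff power2_eq_square)
    ultimately have "- \<i> * z / of_real varrho \<in> \<real>\<^sub>\<le>\<^sub>0"
      using nonpos_Reals_of_real_iff[of "- (Im (dirn 0 z))\<^sup>2"] by (metis neg_le_0_iff_le zero_le_power2)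
    then show False using nn by simp
  qed
  then show "Re (dirn 0 z) > 0" using dirn_props(3)[OF r(6)] by simp
qed

lemma dirn_tendsto: "z \<in> Stat 0 \<Longrightarrow> ((\<lambda>e. dirn e (zeta e z)) \<longlongrightarrow> dirn 0 z) (at_right 0)"
proof -
  assume z: "z \<in> Stat 0"
  have nz: "ddPhi 0 z \<noteq> 0" using root_0(6)[of z] z by (simp add: Stat_def)
  have "((\<lambda>e. - cnj (ddPhi e (zeta e z)) / of_real (cmod (ddPhi e (zeta e z))))
      \<longlongrightarrow> - cnj (ddPhi 0 z) / of_real (cmod (ddPhi 0 z))) (at_right 0)"
    using nz by (intro tendsto_intros Phi_tendsto zeta_tendsto z) auto
  then show ?thesis
    unfolding dirn_def
    by (rule isCont_tendsto_compose[OF continuous_at_csqrt, rotated]) (use dirn_0(1,2)[OF z] in simp)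
qed

text \<open>A disc around the fixed point \<open>z0\<close> contains the discs of radius
  \<open>R\<close> around the moving stationary points, so one set of bounds, and thus one constant
  of \<open>saddle_point_uniform\<close>, serves all small \<open>e\<close>.\<close>

lemma saddle_local:
  assumes z0: "z0 \<in> Stat 0"
  obtains \<rho>0 where "\<rho>0 > 0" "\<And>\<rho>. 0 < \<rho> \<Longrightarrow> \<rho> \<le> \<rho>0 \<Longrightarrow>
     negl (\<lambda>e X. H e X (zeta e z0 + of_real \<rho> * dirn e (zeta e z0))
       - H e X (zeta e z0 - of_real \<rho> * dirn e (zeta e z0)) - mainT e X (zeta e z0))"
proof -
  obtain R2 where R2: "R2 > 0" "cball z0 R2 \<subseteq> cut"
    using open_cut Stat_0_cut[OF z0] open_contains_cball by blast
  define R where "R = R2 / 2"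
  have R: "R > 0" using R2 by (simp add: R_def)
  have "continuous_on (cball z0 R2) weight"
    using R2 holomorphic_weight' holomorphic_on_subset holomorphic_on_imp_continuous_on by blast
  from compact_imp_bounded[OF compact_continuous_image[OF this compact_cball]]
  obtain W where W: "W > 0" "\<And>z. z \<in> cball z0 R2 \<Longrightarrow> cmod (weight z) \<le> W"
    unfolding bounded_pos by auto
  from compact_imp_bounded[OF compact_continuous_image[OF continuous_Phi(1)[of "cball z0 R2" 0] compact_cball]]
  obtain B0 where B0: "B0 > 0" "\<And>z. z \<in> cball z0 R2 \<Longrightarrow> cmod (Phi 0 z) \<le> B0"
    unfolding bounded_pos by auto
  define P where "P = perturb_const (cmod z0 + R2)"
  have P: "P \<ge> 0" unfolding P_def using R2 by (intro perturb_const_nonneg) (simp add: add_nonneg_nonneg)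
  define B where "B = B0 + P + W"
  have B: "B \<ge> 0" using B0 P W by (simp add: B_def)
  define A0 where "A0 = cmod (ddPhi 0 z0) / 2"
  have "ddPhi 0 z0 \<noteq> 0" using root_0(6)[of z0] z0 by (simp add: Stat_def)
  then have A0: "A0 > 0" by (simp add: A0_def)
  have tz: "((\<lambda>e. zeta e z0) \<longlongrightarrow> z0) (at_right 0)" by (rule zeta_tendsto[OF z0])
  have "((\<lambda>e. cmod (ddPhi e (zeta e z0))) \<longlongrightarrow> cmod (ddPhi 0 z0)) (at_right 0)"
    by (intro tendsto_norm Phi_tendsto tz)
  then have evA: "eventually (\<lambda>e. A0 < cmod (ddPhi e (zeta e z0))) (at_right 0)"
    using A0 by (intro order_tendstoD) (auto simp: A0_def)
  have evR: "eventually (\<lambda>e. dist (zeta e z0) z0 < R) (at_right 0)"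
    using tz R by (rule tendstoD)
  obtain \<rho>0 where \<rho>0: "\<rho>0 > 0" and sp: "\<And>\<rho>. 0 < \<rho> \<Longrightarrow> \<rho> \<le> \<rho>0 \<Longrightarrow> \<exists>C. \<forall>\<phi> g \<zeta> d X A H.
       \<phi> holomorphic_on ball \<zeta> R \<and> g holomorphic_on ball \<zeta> R \<and>
       (\<forall>u\<in>ball \<zeta> R. cmod (\<phi> u) \<le> B \<and> cmod (g u) \<le> B \<and>
           (H has_field_derivative exp (of_real X * \<phi> u) * g u) (at u)) \<and>
       deriv \<phi> \<zeta> = 0 \<and> cmod d = 1 \<and> d\<^sup>2 * deriv (deriv \<phi>) \<zeta> = - of_real A \<and> A0 \<le> A \<and> X > 0
       \<longrightarrow> cmod (H (\<zeta> + of_real \<rho> * d) - H (\<zeta> - of_real \<rho> * d)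
                - exp (of_real X * \<phi> \<zeta>) * d * g \<zeta> * of_real (sqrt (2 * pi / (X * A))))
            \<le> C * X powr (- 3 / 2) * exp (X * Re (\<phi> \<zeta>))"
    using saddle_point_uniform[OF R A0 B] by metis
  show thesis
  proof (rule that[OF \<rho>0])
    fix \<rho> :: real assume \<rho>: "0 < \<rho>" "\<rho> \<le> \<rho>0"
    obtain C where C: "\<And>\<phi> g \<zeta> d X A H.
       \<phi> holomorphic_on ball \<zeta> R \<and> g holomorphic_on ball \<zeta> R \<and>
       (\<forall>u\<in>ball \<zeta> R. cmod (\<phi> u) \<le> B \<and> cmod (g u) \<le> B \<and>
           (H has_field_derivative exp (of_real X * \<phi> u) * g u) (at u)) \<and>
       deriv \<phi> \<zeta> = 0 \<and> cmod d = 1 \<and> d\<^sup>2 * deriv (deriv \<phi>) \<zeta> = - of_real A \<and> A0 \<le> A \<and> X > 0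
       \<Longrightarrow> cmod (H (\<zeta> + of_real \<rho> * d) - H (\<zeta> - of_real \<rho> * d)
                - exp (of_real X * \<phi> \<zeta>) * d * g \<zeta> * of_real (sqrt (2 * pi / (X * A))))
            \<le> C * X powr (- 3 / 2) * exp (X * Re (\<phi> \<zeta>))"
      using sp[OF \<rho>] by blast
    have "eventually (\<lambda>e. \<forall>X. adm X \<longrightarrow>
        cmod (H e X (zeta e z0 + of_real \<rho> * dirn e (zeta e z0))
       - H e X (zeta e z0 - of_real \<rho> * dirn e (zeta e z0)) - mainT e X (zeta e z0))
        \<le> \<bar>C\<bar> * X powr (- 3 / 2) * exp (X * MM e)) (at_right 0)"
      using evA evR MM_ge zeta_Stat eventually_small[of 1 0, OF zero_less_one]
    proof eventually_elim
      case (elim e)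
      define \<zeta> where "\<zeta> = zeta e z0"
      have \<zeta>S: "\<zeta> \<in> Stat e" using elim(4) z0 by (auto simp: \<zeta>_def)
      have sub: "ball \<zeta> R \<subseteq> cball z0 R2"
      proof
        fix u assume "u \<in> ball \<zeta> R"
        then show "u \<in> cball z0 R2"
          using elim(2) dist_triangle[of z0 u \<zeta>] by (simp add: \<zeta>_def R_def dist_commute)
      qed
      have ddn: "ddPhi e \<zeta> \<noteq> 0" using elim(1) A0 by (auto simp: \<zeta>_def)
      show ?case
      proof (intro allI impI)
        fix X assume "adm X"
        then have X: "X > 0" by (simp add: adm_def)
        have ball: "cmod (Phi e u) \<le> B \<and> cmod (weight u) \<le> B \<and>
           (H e X has_field_derivative exp (of_real X * Phi e u) * weight u) (at u)" if u: "u \<in> ball \<zeta> R" for u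
        proof -
          have uc: "u \<in> cball z0 R2" using sub u by blast
          have "cmod u \<le> cmod z0 + R2" using uc norm_triangle_ineq2[of u z0] by (simp add: dist_norm norm_minus_commute)
          then have "cmod (Phi e u - Phi 0 u) \<le> e * P"
            unfolding P_def using elim(5) by (intro Phi_perturb(1)) auto
          also have "\<dots> \<le> 1 * P" using elim(5) P by (intro mult_right_mono) auto
          finally have "cmod (Phi e u) \<le> B"
            using B0(2)[OF uc] norm_triangle_ineq2[of "Phi e u" "Phi 0 u"] W(1) by (simp add: B_def)
          moreover have "cmod (weight u) \<le> B" using W(2)[OF uc] B0(1) P by (simp add: B_def)
          ultimately show ?thesis using H_deriv[of u e X] R2(2) uc by (auto simp: F_weight)
        qed
        have "cmod (H e X (\<zeta> + of_real \<rho> * dirn e \<zeta>) - H e X (\<zeta> - of_real \<rho> * dirn e \<zeta>)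
                - exp (of_real X * Phi e \<zeta>) * dirn e \<zeta> * weight \<zeta> * of_real (sqrt (2 * pi / (X * cmod (ddPhi e \<zeta>)))))
            \<le> C * X powr (- 3 / 2) * exp (X * Re (Phi e \<zeta>))"
        proof (rule C, intro conjI)
          show "weight holomorphic_on ball \<zeta> R"
            using holomorphic_weight' sub R2(2) holomorphic_on_subset by blast
          show "deriv (Phi e) \<zeta> = 0" using \<zeta>S by (simp add: deriv_Phi Stat_def)
          show "cmod (dirn e \<zeta>) = 1" by (rule dirn_props(1)[OF ddn])
          show "(dirn e \<zeta>)\<^sup>2 * deriv (deriv (Phi e)) \<zeta> = - of_real (cmod (ddPhi e \<zeta>))"
            unfolding deriv_Phi by (rule dirn_props(2)[OF ddn])
          show "A0 \<le> cmod (ddPhi e \<zeta>)" using elim(1) by (simp add: \<zeta>_def)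
        qed (use ball X holomorphic_Phi in auto)
        also have "\<dots> \<le> \<bar>C\<bar> * X powr (- 3 / 2) * exp (X * MM e)"
        proof (intro mult_mono)
          have "X * Re (Phi e \<zeta>) \<le> X * MM e" using elim(3) \<zeta>S X by (intro mult_left_mono) auto
          then show "exp (X * Re (Phi e \<zeta>)) \<le> exp (X * MM e)" by simp
        qed auto
        finally show "cmod (H e X (zeta e z0 + of_real \<rho> * dirn e (zeta e z0))
            - H e X (zeta e z0 - of_real \<rho> * dirn e (zeta e z0)) - mainT e X (zeta e z0))
            \<le> \<bar>C\<bar> * X powr (- 3 / 2) * exp (X * MM e)"
          by (simp add: mainT_def \<zeta>_def)
      qed
    qed
    then show "negl (\<lambda>e X. H e X (zeta e z0 + of_real \<rho> * dirn e (zeta e z0))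
       - H e X (zeta e z0 - of_real \<rho> * dirn e (zeta e z0)) - mainT e X (zeta e z0))"
      unfolding negl_def by blast
  qed
qed

lemma weight_tendsto: "z0 \<in> Stat 0 \<Longrightarrow> ((\<lambda>e. weight (zeta e z0)) \<longlongrightarrow> weight z0) (at_right 0)"
  using holomorphic_on_imp_continuous_on[OF holomorphic_weight'] continuous_on_eq_continuous_at[OF open_cut]
    Stat_0_cut zeta_tendsto isCont_tendsto_compose by blast

lemma norm_mainT:
  assumes "ddPhi e z \<noteq> 0" "X > 0"
  shows "cmod (mainT e X z) = exp (X * Re (Phi e z)) * cmod (weight z) * sqrt (2 * pi / cmod (ddPhi e z)) * X powr (- 1 / 2)"
proof -
  have "sqrt (2 * pi / (X * cmod (ddPhi e z))) = sqrt (2 * pi / cmod (ddPhi e z)) / sqrt X"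
    by (simp add: real_sqrt_divide real_sqrt_mult)
  moreover have "X powr (- 1 / 2) = 1 / sqrt X"
    using assms(2) powr_minus_divide[of X "1 / 2"] by (simp add: powr_half_sqrt)
  ultimately show ?thesis
    using dirn_props(1)[OF assms(1)] assms(2) by (simp add: mainT_def norm_mult norm_divide)
qed

text \<open>A fixed gap at \<open>e = 0\<close> makes the main term exponentially smaller;
  \<open>X powr (- 1 / 2) \<le> 1 + 1 / X\<close> covers small and large \<open>X\<close>
  alike.\<close>

lemma negl_mainT:
  assumes z0: "z0 \<in> Stat 0" and lt: "Re (Phi 0 z0) < MM 0"
  shows "negl (\<lambda>e X. mainT e X (zeta e z0))"
proof -
  define \<delta> where "\<delta> = (MM 0 - Re (Phi 0 z0)) / 2"
  have \<delta>: "\<delta> > 0" using lt by (simp add: \<delta>_def)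
  have nz: "ddPhi 0 z0 \<noteq> 0" using root_0(6)[of z0] z0 by (simp add: Stat_def)
  define W where "W = (cmod (weight z0) + 1) * (sqrt (2 * pi / cmod (ddPhi 0 z0)) + 1)"
  have W: "W \<ge> 0" unfolding W_def by (intro mult_nonneg_nonneg add_nonneg_nonneg) auto
  have "((\<lambda>e. Re (Phi e (zeta e z0))) \<longlongrightarrow> Re (Phi 0 z0)) (at_right 0)"
    by (intro tendsto_intros Phi_tendsto zeta_tendsto z0)
  then have e1: "eventually (\<lambda>e. Re (Phi e (zeta e z0)) < MM 0 - \<delta>) (at_right 0)"
    using \<delta> by (intro order_tendstoD) (auto simp: \<delta>_def field_simps)
  have "((\<lambda>e. cmod (weight (zeta e z0))) \<longlongrightarrow> cmod (weight z0)) (at_right 0)"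
    by (intro tendsto_intros weight_tendsto z0)
  then have e2: "eventually (\<lambda>e. cmod (weight (zeta e z0)) < cmod (weight z0) + 1) (at_right 0)"
    by (intro order_tendstoD) auto
  have "((\<lambda>e. sqrt (2 * pi / cmod (ddPhi e (zeta e z0)))) \<longlongrightarrow> sqrt (2 * pi / cmod (ddPhi 0 z0))) (at_right 0)"
    using nz by (intro tendsto_intros Phi_tendsto zeta_tendsto z0) auto
  then have e3: "eventually (\<lambda>e. sqrt (2 * pi / cmod (ddPhi e (zeta e z0))) < sqrt (2 * pi / cmod (ddPhi 0 z0)) + 1) (at_right 0)"
    by (intro order_tendstoD) auto
  have e4: "eventually (\<lambda>e. ddPhi e (zeta e z0) \<noteq> 0) (at_right 0)"
    using Phi_tendsto(2)[OF zeta_tendsto[OF z0]] nz by (rule tendsto_imp_eventually_ne)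
  show ?thesis
  proof (rule negl_exp[OF \<delta> W])
    show "eventually (\<lambda>e. \<forall>X. adm X \<longrightarrow> cmod (mainT e X (zeta e z0)) \<le> W * (1 + 1 / X) * exp (X * (MM 0 - \<delta>))) (at_right 0)"
      using e1 e2 e3 e4
    proof eventually_elim
      case (elim e)
      show ?case
      proof (intro allI impI)
        fix X assume "adm X"
        then have X: "X > 0" by (simp add: adm_def)
        have xp: "X powr (- 1 / 2) \<le> 1 + 1 / X"
        proof (cases "X \<ge> 1")
          case True
          then have "X powr (- 1 / 2) \<le> X powr 0" by (intro powr_mono) auto
          then show ?thesis using X by simp (use X in \<open>simp add: add_increasing2\<close>)
        next
          case False
          have "X powr (- 1 / 2) \<le> X powr (- 1)" using X False by (intro powr_mono') auto
          also have "\<dots> = 1 / X" using X by (simp add: powr_minus_divide)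
          finally show ?thesis by simp
        qed
        have "X * Re (Phi e (zeta e z0)) \<le> X * (MM 0 - \<delta>)" using X elim(1) by (intro mult_left_mono) auto
        then have "cmod (mainT e X (zeta e z0)) \<le> exp (X * (MM 0 - \<delta>)) * (cmod (weight z0) + 1)
            * (sqrt (2 * pi / cmod (ddPhi 0 z0)) + 1) * (1 + 1 / X)"
          unfolding norm_mainT[OF elim(4) X] using elim X xp
          by (intro mult_mono mult_nonneg_nonneg) auto
        then show "cmod (mainT e X (zeta e z0)) \<le> W * (1 + 1 / X) * exp (X * (MM 0 - \<delta>))"
          by (simp add: W_def mult_ac)
      qed
    qed
  qed
qed

text \<open>A whole cone of directions is covered with a single radius, not only the direction of
  steepest descent; this is needed when the path turns away from that direction close to a
  stationary point.\<close>

lemma local_descent: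
  assumes z0: "z0 \<in> Stat 0" and c: "c > 0"
  obtains \<rho>1 where "\<rho>1 > 0" "\<And>\<rho> w. 0 < \<rho> \<Longrightarrow> \<rho> \<le> \<rho>1 \<Longrightarrow> cmod w \<le> 1 \<Longrightarrow>
     Re (ddPhi 0 z0 * w\<^sup>2) \<le> - c \<Longrightarrow> Re (Phi 0 (z0 + of_real \<rho> * w)) < Re (Phi 0 z0)"
proof -
  from compact_imp_bounded[OF compact_continuous_image[OF continuous_Phi(1)[of "cball z0 1" 0] compact_cball]]
  obtain B where B: "B > 0" "\<And>z. z \<in> cball z0 1 \<Longrightarrow> cmod (Phi 0 z) \<le> B"
    unfolding bounded_pos by auto
  define K where "K = (fact (Suc 2) * B / (1 / 2) ^ Suc 2) / fact 2"
  have K: "K > 0" using B by (simp add: K_def)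
  \<comment> \<open>With \<open>\<rho> \<le> c / (4 * K)\<close> the cubic remainder consumes at
    most half of the quadratic gain \<open>c * \<rho>\<^sup>2 / 2\<close>.\<close>
  define \<rho>1 where "\<rho>1 = min (1 / 4) (c / (4 * K))"
  have \<rho>1: "\<rho>1 > 0" "\<rho>1 \<le> 1 / 4" "\<rho>1 \<le> c / (4 * K)" using c K by (auto simp: \<rho>1_def)
  show thesis
  proof (rule that[OF \<rho>1(1)])
    fix \<rho> :: real and w :: complex
    assume \<rho>: "0 < \<rho>" "\<rho> \<le> \<rho>1" and w: "cmod w \<le> 1" and neg: "Re (ddPhi 0 z0 * w\<^sup>2) \<le> - c"
    have nh: "cmod (of_real \<rho> * w) \<le> \<rho>" using w \<rho> by (simp add: norm_mult mult_left_le)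
    have "cmod (Phi 0 (z0 + of_real \<rho> * w) - (\<Sum>i\<le>2. (deriv ^^ i) (Phi 0) z0 * (of_real \<rho> * w) ^ i / fact i))
        \<le> (fact (Suc 2) * B / (1 / 2) ^ Suc 2) * cmod (of_real \<rho> * w) ^ Suc 2 / fact 2"
      by (rule holomorphic_Taylor_bound[OF holomorphic_Phi(1)]) (use B nh \<rho> \<rho>1 in auto)
    also have "\<dots> = K * cmod (of_real \<rho> * w) ^ 3" by (simp add: K_def)
    also have "\<dots> \<le> K * \<rho> ^ 3" using nh K by (intro mult_left_mono power_mono) auto
    finally have "cmod (Phi 0 (z0 + of_real \<rho> * w) - (\<Sum>i\<le>2. (deriv ^^ i) (Phi 0) z0 * (of_real \<rho> * w) ^ i / fact i))
        \<le> K * \<rho> ^ 3" .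
    moreover have "(\<Sum>i\<le>2. (deriv ^^ i) (Phi 0) z0 * (of_real \<rho> * w) ^ i / fact i)
        = Phi 0 z0 + of_real (\<rho>\<^sup>2 / 2) * (ddPhi 0 z0 * w\<^sup>2)"
      using z0 by (simp add: numeral_2_eq_2 deriv_Phi Stat_def power_mult_distrib)
    ultimately have "Re (Phi 0 (z0 + of_real \<rho> * w)) \<le> Re (Phi 0 z0) + \<rho>\<^sup>2 / 2 * Re (ddPhi 0 z0 * w\<^sup>2) + K * \<rho> ^ 3"
      using abs_Re_le_cmod[of "Phi 0 (z0 + of_real \<rho> * w) - (Phi 0 z0 + of_real (\<rho>\<^sup>2 / 2) * (ddPhi 0 z0 * w\<^sup>2))"]
      by (simp only: minus_complex.sel plus_complex.sel Re_complex_of_real Im_complex_of_real times_complex.sel[of "of_real _"])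
    moreover have "\<rho>\<^sup>2 / 2 * Re (ddPhi 0 z0 * w\<^sup>2) \<le> \<rho>\<^sup>2 / 2 * (- c)" using neg by (intro mult_left_mono) auto
    moreover have "K * \<rho> ^ 3 \<le> \<rho>\<^sup>2 * (c / 4)"
    proof -
      have "K * \<rho> \<le> K * (c / (4 * K))" using \<rho> \<rho>1(3) K by (intro mult_left_mono) auto
      then have "K * \<rho> \<le> c / 4" using K by simp
      then have "\<rho>\<^sup>2 * (K * \<rho>) \<le> \<rho>\<^sup>2 * (c / 4)" by (intro mult_left_mono) auto
      then show ?thesis by (simp add: power2_eq_square power3_eq_cube mult_ac)
    qed
    moreover have "\<rho>\<^sup>2 / 2 * (- c) + \<rho>\<^sup>2 * (c / 4) < 0" using \<rho> c by (simp add: field_simps)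
    ultimately show "Re (Phi 0 (z0 + of_real \<rho> * w)) < Re (Phi 0 z0)" by linarith
  qed
qed

section \<open>Where the unperturbed phase is low\<close>

lemma abs_Im_power_le: "\<bar>Im (z ^ k)\<bar> \<le> real k * cmod z ^ (k - 1) * \<bar>Im z\<bar>"
proof (induction k)
  case (Suc k)
  have Re: "\<bar>Re (z ^ k)\<bar> \<le> cmod z ^ k" by (metis abs_Re_le_cmod norm_power)
  have "\<bar>Im (z ^ Suc k)\<bar> \<le> \<bar>Re z * Im (z ^ k)\<bar> + \<bar>Im z * Re (z ^ k)\<bar>" by simp
  also have "\<dots> \<le> cmod z * (real k * cmod z ^ (k - 1) * \<bar>Im z\<bar>) + \<bar>Im z\<bar> * cmod z ^ k"
    unfolding abs_mult by (intro add_mono mult_mono abs_Re_le_cmod Suc Re) auto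
  also have "\<dots> = real (Suc k) * cmod z ^ (Suc k - 1) * \<bar>Im z\<bar>"
    by (cases k) (simp_all add: algebra_simps)
  finally show ?case .
qed simp

lemma Re_Phi_0: "Re (Phi 0 z) = - Im z + b n * Im (z ^ n)"
  by (simp add: Phi_0)

text \<open>\<open>\<bar>Im (z ^ n)\<bar>\<close> is at most
  \<open>n * cmod z ^ (n - 1) * Im z\<close>, and \<open>varrho\<close> is the radius at which this
  bound times \<open>\<bar>b n\<bar>\<close> equals \<open>Im z\<close>. Inside the circle the
  linear term of the phase wins.\<close>

lemma Re_Phi_0_half_disc:
  assumes "Im z > 0" "cmod z < varrho"
  shows "Re (Phi 0 z) < 0"
proof -
  have "cmod z ^ (n - 1) < varrho ^ (n - 1)" using assms n by (intro power_strict_mono) auto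
  then have "\<bar>b n\<bar> * (real n * cmod z ^ (n - 1)) < \<bar>b n\<bar> * (real n * varrho ^ (n - 1))"
    using bn n by (intro mult_strict_left_mono) auto
  also have "\<dots> = 1" unfolding varrho_power using bn n by simp
  finally have lt: "\<bar>b n\<bar> * (real n * cmod z ^ (n - 1)) < 1" .
  have "b n * Im (z ^ n) \<le> \<bar>b n\<bar> * \<bar>Im (z ^ n)\<bar>" by (metis abs_ge_self abs_mult)
  also have "\<dots> \<le> \<bar>b n\<bar> * (real n * cmod z ^ (n - 1) * \<bar>Im z\<bar>)"
    by (intro mult_left_mono abs_Im_power_le) auto
  also have "\<dots> = (\<bar>b n\<bar> * (real n * cmod z ^ (n - 1))) * Im z" using assms by simp
  also have "\<dots> < 1 * Im z" using lt assms by (intro mult_strict_right_mono)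
  finally show ?thesis by (simp add: Re_Phi_0)
qed

text \<open>Half the angle between neighbouring roots of \<open>dPhi 0\<close>, and the opening of
  the sector above the positive real axis in which \<open>z ^ (n - 1)\<close> has positive imaginary
  part.\<close>

definition \<beta> :: real where "\<beta> = pi / (real n - 1)"

lemma \<beta>_bounds: "0 < \<beta>" "\<beta> \<le> pi" "(real n - 1) * \<beta> = pi" "sin \<beta> \<ge> 0"
proof -
  show *: "0 < \<beta>" "\<beta> \<le> pi" using n by (auto simp: \<beta>_def field_simps)
  show "(real n - 1) * \<beta> = pi" using n by (simp add: \<beta>_def)
  show "sin \<beta> \<ge> 0" using * by (intro sin_ge_zero) auto
qed

text \<open>The second assumption expresses that the argument of \<open>z\<close> is below \<beta>,
  in a form that is linear in \<open>z\<close> and easy to follow along a horizontal line.\<close>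

lemma wedge_power:
  assumes "Im z > 0" "Im (z * cis (- \<beta>)) < 0"
  shows "Im (z ^ (n - 1)) > 0"
proof -
  define a where "a = Arg2pi z"
  define r where "r = cmod z"
  have z: "z = of_real r * cis a" unfolding a_def r_def cis_conv_exp by (rule Arg2pi_eq)
  have r: "r > 0" using assms(1) by (auto simp: r_def)
  have a: "0 < a" "a < pi" using assms(1) Arg2pi_lt_pi[of z] by (simp_all add: a_def)
  have "sin (a - \<beta>) < 0"
    using assms(2) r unfolding z mult.assoc cis_mult by (simp add: mult_less_0_iff)
  then have "a < \<beta>"
    using sin_ge_zero[of "a - \<beta>"] a \<beta>_bounds by (cases "a < \<beta>") auto
  then have "(real n - 1) * a < pi" using n \<beta>_bounds(3) mult_strict_left_mono[of a \<beta> "real n - 1"] by simp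
  moreover have "0 < (real n - 1) * a" using n a by simp
  ultimately have "sin (real (n - 1) * a) > 0" using n by (intro sin_gt_zero) (auto simp: of_nat_diff)
  moreover have "z ^ (n - 1) = of_real (r ^ (n - 1)) * cis (real (n - 1) * a)"
    by (simp only: z power_mult_distrib Complex.DeMoivre of_real_power)
  ultimately show ?thesis using r by (simp del: of_real_power)
qed

lemma Re_Phi_0_hline:
  assumes \<tau>: "\<tau> = 1 \<or> \<tau> = -1"
  shows "Re (Phi 0 (hline \<tau> y s)) = - y + lead \<tau> * Im ((of_real s + \<i> * of_real y) ^ n)"
proof -
  have "\<tau> ^ Suc n = \<tau>\<^sup>2 * \<tau> ^ (n - 1)" using n by (simp flip: power_add)
  then have "\<tau> ^ Suc n = \<tau> ^ (n - 1)" using \<tau> by auto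
  then show ?thesis
    unfolding Re_Phi_0 Im_hline_power[OF \<tau>] lead_def by (simp add: hline_def)
qed

text \<open>The derivative along the line is a multiple of \<open>Im (w ^ (n - 1))\<close>, which
  has constant sign in the sector of opening \<beta> or, for negative height, in its mirror image. A
  horizontal ray pointing outwards never leaves that sector, since
  \<open>sin \<beta> \<ge> 0\<close>.\<close>

lemma hline_decreasing:
  assumes \<tau>: "\<tau> = 1 \<or> \<tau> = -1" and y: "lead \<tau> * y < 0"
    and wedge: "Im ((of_real s0 + \<i> * of_real \<bar>y\<bar>) * cis (- \<beta>)) < 0" and s: "s0 \<le> s"
  shows "Re (Phi 0 (hline \<tau> y s)) \<le> Re (Phi 0 (hline \<tau> y s0))"
proof (rule DERIV_nonpos_imp_nonincreasing[OF s])
  fix u assume u: "s0 \<le> u" "u \<le> s"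
  define w where "w = complex_of_real u + \<i> * of_real y"
  have D: "((\<lambda>s. Im ((complex_of_real s + \<i> * of_real y) ^ n)) has_real_derivative real n * Im (w ^ (n - 1))) (at u)"
  proof -
    have "((\<lambda>z. z ^ n) has_field_derivative of_nat n * w ^ (n - 1)) (at (complex_of_real u + \<i> * of_real y))"
      unfolding w_def by (auto intro!: derivative_eq_intros)
    moreover have "((\<lambda>s. complex_of_real s + \<i> * of_real y) has_vector_derivative 1) (at u)"
      by (auto intro!: derivative_eq_intros simp: has_vector_derivative_def scaleR_conv_of_real)
    ultimately have "((\<lambda>s. (complex_of_real s + \<i> * of_real y) ^ n) has_vector_derivative of_nat n * w ^ (n - 1)) (at u)"
      using field_vector_diff_chain_at by (fastforce simp: o_def)
    then have "((\<lambda>s. Im ((complex_of_real s + \<i> * of_real y) ^ n)) has_vector_derivative Im (of_nat n * w ^ (n - 1))) (at u)"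
      by (rule bounded_linear.has_vector_derivative[OF bounded_linear_Im])
    then show ?thesis by (simp add: has_real_derivative_iff_has_vector_derivative)
  qed
  have der: "((\<lambda>s. Re (Phi 0 (hline \<tau> y s))) has_real_derivative lead \<tau> * (real n * Im (w ^ (n - 1)))) (at u)"
    unfolding Re_Phi_0_hline[OF \<tau>]
    by (rule DERIV_cong[OF DERIV_add[OF DERIV_const DERIV_cmult[OF D]]]) simp
  define v where "v = complex_of_real u + \<i> * of_real \<bar>y\<bar>"
  have "y \<noteq> 0" using y by auto
  have "Im (v * cis (- \<beta>)) = Im ((of_real s0 + \<i> * of_real \<bar>y\<bar>) * cis (- \<beta>)) - (u - s0) * sin \<beta>"
    by (simp add: v_def algebra_simps)
  then have "Im (v * cis (- \<beta>)) < 0" using wedge u \<beta>_bounds(4) mult_nonneg_nonneg[of "u - s0" "sin \<beta>"] by linarith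
  then have pos: "Im (v ^ (n - 1)) > 0" using \<open>y \<noteq> 0\<close> by (intro wedge_power) (auto simp: v_def)
  have "lead \<tau> * Im (w ^ (n - 1)) \<le> 0"
  proof (cases "y > 0")
    case True
    then have "w = v" by (simp add: w_def v_def)
    moreover have "lead \<tau> < 0" using y True by (simp add: mult_less_0_iff)
    ultimately show ?thesis using pos by (simp add: mult_nonpos_nonneg)
  next
    case False
    then have "y < 0" using \<open>y \<noteq> 0\<close> by simp
    then have "w = cnj v" by (simp add: w_def v_def complex_eq_iff)
    then have "Im (w ^ (n - 1)) = - Im (v ^ (n - 1))" by (simp flip: complex_cnj_power)
    moreover have "lead \<tau> > 0" using y \<open>y < 0\<close> by (simp add: mult_less_0_iff)
    ultimately show ?thesis using pos by simp
  qed
  then have "real n * (lead \<tau> * Im (w ^ (n - 1))) \<le> 0" by (rule mult_nonneg_nonpos[OF of_nat_0_le_iff])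
  then show "\<exists>D. ((\<lambda>s. Re (Phi 0 (hline \<tau> y s))) has_real_derivative D) (at u) \<and> D \<le> 0"
    using der by (intro exI conjI) (auto simp: mult_ac)
qed

lemma negl_point:
  assumes "z \<in> Omega" "(u \<longlongrightarrow> z) (at_right 0)" "(v \<longlongrightarrow> z) (at_right 0)"
  shows "negl (\<lambda>e X. H e X (v e) - H e X (u e))"
  by (rule negl_segment[OF _ assms(2,3)]) (use assms(1) in simp)

lemma saddle_end_tendsto:
  assumes "z0 \<in> Stat 0"
  shows "((\<lambda>e. zeta e z0 + of_real r * dirn e (zeta e z0)) \<longlongrightarrow> z0 + of_real r * dirn 0 z0) (at_right 0)"
    and "((\<lambda>e. zeta e z0 - of_real r * dirn e (zeta e z0)) \<longlongrightarrow> z0 - of_real r * dirn 0 z0) (at_right 0)"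
  by (intro tendsto_intros zeta_tendsto dirn_tendsto assms)+

lemma abs_lead: "\<tau> = 1 \<or> \<tau> = -1 \<Longrightarrow> \<bar>lead \<tau>\<bar> = \<bar>b n\<bar>"
  by (auto simp: lead_def abs_mult power_abs)

lemma real_root:
  assumes \<tau>: "\<tau> = 1 \<or> \<tau> = -1" and l: "lead \<tau> > 0"
  shows "of_real (\<tau> * varrho) \<in> Stat 0"
proof -
  have "b n * (real n * (\<tau> * varrho) ^ (n - 1)) = lead \<tau> * (real n * varrho ^ (n - 1))"
    by (simp add: lead_def power_mult_distrib mult_ac)
  also have "\<dots> = 1" unfolding varrho_power using abs_lead[OF \<tau>] l n bn by simp
  finally have "complex_of_real (b n * (real n * (\<tau> * varrho) ^ (n - 1))) = 1" by simp
  then show ?thesis by (simp add: Stat_def dPhi_0_zero_iff)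
qed

lemma Re_Phi_0_Stat: "z \<in> Stat 0 \<Longrightarrow> Re (Phi 0 z) = - (1 - 1 / real n) * Im z"
proof -
  assume "z \<in> Stat 0"
  then have eq: "Phi 0 z = \<i> * of_real (1 - 1 / real n) * z" by (intro root_0(4)) (simp add: Stat_def)
  show ?thesis unfolding eq by (simp add: algebra_simps del: of_real_diff)
qed

lemma MM_0_real:
  assumes "\<tau> = 1 \<or> \<tau> = -1" "lead \<tau> > 0"
  shows "MM 0 = 0"
  unfolding MM_def
proof (rule Max_eqI)
  show "finite ((\<lambda>z. Re (Phi 0 z)) ` Stat 0)" using finite_Stat_0 by simp
  show "0 \<in> (\<lambda>z. Re (Phi 0 z)) ` Stat 0"
    using real_root[OF assms] Re_Phi_0_Stat[OF real_root[OF assms]] by (intro image_eqI) auto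
  fix y assume "y \<in> (\<lambda>z. Re (Phi 0 z)) ` Stat 0"
  then obtain z where z: "z \<in> Stat 0" "y = Re (Phi 0 z)" by auto
  have "0 \<le> 1 - 1 / real n" using n by (simp add: field_simps)
  then show "y \<le> 0" using z Re_Phi_0_Stat[OF z(1)] by (simp add: Stat_def mult_nonpos_nonneg)
qed

text \<open>For \<open>n = 2\<close> the sector is the whole upper half-plane and
  \<open>sin \<beta> = 0\<close>, so that the general choice of \<open>a0\<close> degenerates and
  the case is separate.\<close>

lemma small_wedge:
  obtains a0 where "a0 > 0"
    "\<And>a s. 0 < a \<Longrightarrow> a \<le> a0 \<Longrightarrow> varrho / 2 \<le> s \<Longrightarrow> Im ((of_real s + \<i> * of_real a) * cis (- \<beta>)) < 0"
proof (cases "n = 2")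
  case True
  then have "real n - 1 = 1" by simp
  then have "\<beta> = pi" unfolding \<beta>_def by simp
  then show thesis by (intro that[of 1]) auto
next
  case False
  then have "\<beta> < pi" using n by (simp add: \<beta>_def field_simps)
  then have sb: "sin \<beta> > 0" using \<beta>_bounds by (intro sin_gt_zero) auto
  define a0 where "a0 = varrho * sin \<beta> / 4"
  show thesis
  proof (rule that[of a0])
    show "a0 > 0" using sb varrho_pos by (simp add: a0_def)
    fix a s assume a: "0 < a" "a \<le> a0" "varrho / 2 \<le> s"
    have "a * cos \<beta> \<le> a * 1" using a by (intro mult_left_mono) auto
    moreover have "varrho / 2 * sin \<beta> \<le> s * sin \<beta>" using a sb by (intro mult_right_mono) auto
    moreover have "a0 < varrho / 2 * sin \<beta>" using sb varrho_pos by (simp add: a0_def)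
    ultimately have "a * cos \<beta> - s * sin \<beta> < 0" using a by linarith
    then show "Im ((of_real s + \<i> * of_real a) * cis (- \<beta>)) < 0" by simp
  qed
qed

lemma half_disc_segment:
  assumes M: "MM 0 = 0" and z: "Im z > 0" "cmod z < varrho" and w: "Im w > 0" "cmod w < varrho"
  shows "closed_segment z w \<subseteq> Omega"
proof -
  have "convex (ball 0 varrho \<inter> {z. Im z > 0})"
    by (intro convex_Int convex_ball convex_halfspace_Im_gt)
  then have "closed_segment z w \<subseteq> ball 0 varrho \<inter> {z. Im z > 0}"
    by (rule closed_segment_subset[rotated 2]) (use z w in auto)
  moreover have "ball 0 varrho \<inter> {z. Im z > 0} \<subseteq> Omega"
    using Re_Phi_0_half_disc by (auto simp: Omega_def M intro!: cutI)
  ultimately show ?thesis by (rule order_trans)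
qed

section \<open>Paths through real stationary points\<close>

text \<open>The end \<tau> is reached below the real axis, because \<open>lead \<tau> > 0\<close>,
  while 0 has to be passed above. The path crosses the axis at an angle of 45 degrees in the real
  stationary point on this side; inwards it continues in the upper half disc to the base point
  \<open>\<i> * varrho / 2\<close>, outwards on a horizontal ray.\<close>

lemma real_side_saddle:
  assumes \<tau>: "\<tau> = 1 \<or> \<tau> = -1" and l: "lead \<tau> > 0"
  shows "negl (\<lambda>e X. Hlim \<tau> e X - H e X (\<i> * of_real (varrho / 2))
           - of_real \<tau> * mainT e X (zeta e (of_real (\<tau> * varrho))))"
proof -
  define z0 where "z0 = complex_of_real (\<tau> * varrho)"
  have z0: "z0 \<in> Stat 0" unfolding z0_def by (rule real_root[OF \<tau> l])
  have M: "MM 0 = 0" by (rule MM_0_real[OF \<tau> l])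
  have Rz0: "Re (Phi 0 z0) = 0" using Re_Phi_0_Stat[OF z0] by (simp add: z0_def)
  have \<tau>2: "\<tau> * \<tau> = 1" using \<tau> by auto
  have d0: "dirn 0 z0 = (1 - \<i> * of_real \<tau>) / of_real (sqrt 2)"
  proof -
    have "- \<i> * z0 / of_real varrho = - \<i> * of_real \<tau>" using varrho_pos by (simp add: z0_def)
    moreover have "csqrt (- \<i> * of_real \<tau>) = (1 - \<i> * of_real \<tau>) / of_real (sqrt 2)"
    proof (rule csqrt_unique)
      have "(1 - \<i> * complex_of_real \<tau>)\<^sup>2 = 1 - 2 * \<i> * of_real \<tau> - of_real (\<tau> * \<tau>)"
        by (simp add: power2_eq_square algebra_simps)
      then show "((1 - \<i> * of_real \<tau>) / of_real (sqrt 2))\<^sup>2 = - \<i> * of_real \<tau>"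
        unfolding \<tau>2 by (simp add: power_divide flip: of_real_power)
    qed auto
    ultimately show ?thesis unfolding dirn_def dirn_0(1)[OF z0] by simp
  qed
  obtain \<rho>0 where \<rho>0: "\<rho>0 > 0" "\<And>\<rho>. 0 < \<rho> \<Longrightarrow> \<rho> \<le> \<rho>0 \<Longrightarrow>
     negl (\<lambda>e X. H e X (zeta e z0 + of_real \<rho> * dirn e (zeta e z0))
       - H e X (zeta e z0 - of_real \<rho> * dirn e (zeta e z0)) - mainT e X (zeta e z0))"
    using saddle_local[OF z0] by blast
  have nz: "ddPhi 0 z0 \<noteq> 0" using root_0(6)[of z0] z0 by (simp add: Stat_def)
  then have "cmod (ddPhi 0 z0) > 0" by simp
  then obtain \<rho>1 where \<rho>1: "\<rho>1 > 0" "\<And>\<rho> w. 0 < \<rho> \<Longrightarrow> \<rho> \<le> \<rho>1 \<Longrightarrow> cmod w \<le> 1 \<Longrightarrow>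
     Re (ddPhi 0 z0 * w\<^sup>2) \<le> - cmod (ddPhi 0 z0) \<Longrightarrow> Re (Phi 0 (z0 + of_real \<rho> * w)) < Re (Phi 0 z0)"
    using local_descent[OF z0] by metis
  obtain a0 where a0: "a0 > 0"
    "\<And>a s. 0 < a \<Longrightarrow> a \<le> a0 \<Longrightarrow> varrho / 2 \<le> s \<Longrightarrow> Im ((of_real s + \<i> * of_real a) * cis (- \<beta>)) < 0"
    using small_wedge by blast
  define \<rho> where "\<rho> = min (min \<rho>0 \<rho>1) (min a0 (varrho / 2))"
  have \<rho>: "0 < \<rho>" "\<rho> \<le> \<rho>0" "\<rho> \<le> \<rho>1" "\<rho> \<le> a0" "\<rho> \<le> varrho / 2"
    using \<rho>0 \<rho>1 a0 varrho_pos by (auto simp: \<rho>_def)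
  define a where "a = \<rho> / sqrt 2"
  have "1 \<le> sqrt 2" by simp
  then have a: "0 < a" "a \<le> \<rho>" using \<rho> by (auto simp: a_def divide_le_eq mult_left_le)
  have rd: "of_real (\<tau> * \<rho>) * dirn 0 z0 = hline \<tau> (- a) a"
  proof -
    have "of_real (\<tau> * \<rho>) * dirn 0 z0 = of_real (\<tau> * a) - \<i> * of_real (\<tau> * \<tau> * a)"
      unfolding d0 by (simp add: a_def algebra_simps diff_divide_distrib)
    then show ?thesis unfolding \<tau>2 by (simp add: hline_def)
  qed
  define zo where "zo = hline \<tau> (- a) (varrho + a)"
  define zi where "zi = hline \<tau> a (varrho - a)"
  have zo: "z0 + of_real (\<tau> * \<rho>) * dirn 0 z0 = zo" and zi: "z0 - of_real (\<tau> * \<rho>) * dirn 0 z0 = zi"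
    unfolding rd by (auto simp: zo_def zi_def z0_def hline_def algebra_simps)
  have "Re (Phi 0 (z0 + of_real \<rho> * (of_real \<tau> * dirn 0 z0))) < Re (Phi 0 z0)"
  proof (rule \<rho>1(2)[OF \<rho>(1,3)])
    have t1: "cmod (complex_of_real \<tau>) = 1" "(complex_of_real \<tau>)\<^sup>2 = 1" using \<tau> by auto
    show "cmod (of_real \<tau> * dirn 0 z0) \<le> 1" using dirn_props(1)[OF nz] by (simp add: norm_mult t1(1) del: norm_of_real)
    show "Re (ddPhi 0 z0 * (of_real \<tau> * dirn 0 z0)\<^sup>2) \<le> - cmod (ddPhi 0 z0)"
      unfolding power_mult_distrib t1(2) using dirn_props(2)[OF nz] by (simp add: mult.commute)
  qed
  then have zoneg: "Re (Phi 0 zo) < 0" unfolding zo[symmetric] Rz0 by (simp add: mult_ac)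
  have ray: "hline \<tau> (- a) s \<in> Omega" if s: "s \<ge> varrho + a" for s
  proof -
    have "Re (Phi 0 (hline \<tau> (- a) s)) \<le> Re (Phi 0 (hline \<tau> (- a) (varrho + a)))"
    proof (rule hline_decreasing[OF \<tau> _ _ s])
      show "lead \<tau> * - a < 0" using l a by simp
      show "Im ((of_real (varrho + a) + \<i> * of_real \<bar>- a\<bar>) * cis (- \<beta>)) < 0"
        using a \<rho> varrho_pos a0(2)[of a "varrho + a"] by simp
    qed
    moreover have "hline \<tau> (- a) s \<in> cut" using s a varrho_pos \<tau> by (intro cutI) (auto simp: hline_def)
    ultimately show ?thesis using zoneg by (simp add: Omega_def M zo_def)
  qed
  have N1: "negl (\<lambda>e X. Hlim \<tau> e X - H e X zo)"
  proof (rule negl_far[OF \<tau>])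
    show "lead \<tau> * Im zo < 0" using l a by (simp add: zo_def hline_def)
    fix s :: real assume "s \<ge> 0"
    moreover have "zo + of_real (\<tau> * s) = hline \<tau> (- a) (varrho + a + s)"
      by (simp add: zo_def hline_def algebra_simps)
    ultimately show "zo + of_real (\<tau> * s) \<in> Omega" using ray[of "varrho + a + s"] by simp
  qed
  have N2: "negl (\<lambda>e X. H e X zo - H e X (zeta e z0 + of_real (\<tau> * \<rho>) * dirn e (zeta e z0)))"
  proof (rule negl_point)
    show "zo \<in> Omega" unfolding zo_def by (rule ray) simp
    show "((\<lambda>e. zeta e z0 + of_real (\<tau> * \<rho>) * dirn e (zeta e z0)) \<longlongrightarrow> zo) (at_right 0)"
      unfolding zo[symmetric] by (rule saddle_end_tendsto[OF z0])
  qed auto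
  \<comment> \<open>\<open>dirn\<close> points to the right, so for \<open>\<tau> = -1\<close> the
    outward crossing runs against it and the main term changes sign.\<close>
  have N3: "negl (\<lambda>e X. H e X (zeta e z0 + of_real (\<tau> * \<rho>) * dirn e (zeta e z0))
       - H e X (zeta e z0 - of_real (\<tau> * \<rho>) * dirn e (zeta e z0)) - of_real \<tau> * mainT e X (zeta e z0))"
    using \<tau>
  proof
    assume "\<tau> = 1" then show ?thesis using \<rho>0(2)[OF \<rho>(1,2)] by simp
  next
    assume "\<tau> = -1" then show ?thesis using negl_minus[OF \<rho>0(2)[OF \<rho>(1,2)]] by (simp add: algebra_simps)
  qed
  have N4: "negl (\<lambda>e X. H e X (zeta e z0 - of_real (\<tau> * \<rho>) * dirn e (zeta e z0)) - H e X (\<i> * of_real (varrho / 2)))"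
  proof (rule negl_segment[of "\<i> * of_real (varrho / 2)" zi])
    show "closed_segment (\<i> * of_real (varrho / 2)) zi \<subseteq> Omega"
    proof (rule half_disc_segment[OF M])
      have "(cmod zi)\<^sup>2 = (varrho - a)\<^sup>2 + a\<^sup>2"
        using \<tau>2 by (simp add: zi_def hline_def cmod_power2 power_mult_distrib) (simp add: power2_eq_square)
      also have "\<dots> = varrho\<^sup>2 - 2 * a * (varrho - a)" by (simp add: power2_eq_square algebra_simps)
      also have "\<dots> < varrho\<^sup>2" using a \<rho> varrho_pos by simp
      finally show "cmod zi < varrho" using varrho_pos by (metis less_eq_real_def power2_less_imp_less)
    qed (use varrho_pos a in \<open>auto simp: zi_def hline_def norm_mult\<close>)
    show "((\<lambda>e. zeta e z0 - of_real (\<tau> * \<rho>) * dirn e (zeta e z0)) \<longlongrightarrow> zi) (at_right 0)"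
      unfolding zi[symmetric] by (rule saddle_end_tendsto[OF z0])
  qed auto
  from negl_add[OF negl_add[OF N1 N2] negl_add[OF N3 N4]] show ?thesis
    unfolding z0_def[symmetric] by (simp add: algebra_simps)
qed

text \<open>Here the end \<tau> lies above the axis and no stationary point has to be crossed: a ray
  at small height leaves the half disc directly. The level \<open>MM 0 = 0\<close> is set by a real
  stationary point on the other side.\<close>

lemma real_side_plain:
  assumes \<tau>: "\<tau> = 1 \<or> \<tau> = -1" and l: "lead \<tau> < 0" and M: "MM 0 = 0"
  shows "negl (\<lambda>e X. Hlim \<tau> e X - H e X (\<i> * of_real (varrho / 2)))"
proof -
  obtain a0 where a0: "a0 > 0"
    "\<And>a s. 0 < a \<Longrightarrow> a \<le> a0 \<Longrightarrow> varrho / 2 \<le> s \<Longrightarrow> Im ((of_real s + \<i> * of_real a) * cis (- \<beta>)) < 0"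
    using small_wedge by blast
  define a where "a = min a0 (varrho / 4)"
  have a: "0 < a" "a \<le> a0" "a \<le> varrho / 4" using a0 varrho_pos by (auto simp: a_def)
  define w where "w = hline \<tau> a (varrho / 2)"
  have "cmod w \<le> \<bar>Re w\<bar> + \<bar>Im w\<bar>" by (rule cmod_le)
  then have w: "Im w > 0" "cmod w < varrho" using \<tau> a varrho_pos by (auto simp: w_def hline_def)
  have ray: "hline \<tau> a s \<in> Omega" if s: "s \<ge> varrho / 2" for s
  proof -
    have "Re (Phi 0 (hline \<tau> a s)) \<le> Re (Phi 0 (hline \<tau> a (varrho / 2)))"
    proof (rule hline_decreasing[OF \<tau> _ _ s])
      show "lead \<tau> * a < 0" using l a by (simp add: mult_neg_pos)
      show "Im ((of_real (varrho / 2) + \<i> * of_real \<bar>a\<bar>) * cis (- \<beta>)) < 0"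
        using a a0(2)[of a "varrho / 2"] by simp
    qed
    moreover have "hline \<tau> a s \<in> cut" using a by (intro cutI) (auto simp: hline_def)
    ultimately show ?thesis using Re_Phi_0_half_disc[OF w] by (simp add: Omega_def M w_def)
  qed
  have N1: "negl (\<lambda>e X. Hlim \<tau> e X - H e X w)"
  proof (rule negl_far[OF \<tau>])
    show "lead \<tau> * Im w < 0" using l a by (simp add: w_def hline_def mult_neg_pos)
    fix s :: real assume "s \<ge> 0"
    moreover have "w + of_real (\<tau> * s) = hline \<tau> a (varrho / 2 + s)"
      by (simp add: w_def hline_def algebra_simps)
    ultimately show "w + of_real (\<tau> * s) \<in> Omega" using ray[of "varrho / 2 + s"] by simp
  qed
  have N2: "negl (\<lambda>e X. H e X w - H e X (\<i> * of_real (varrho / 2)))"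
    by (rule negl_segment[OF half_disc_segment[OF M _ _ w]]) (use varrho_pos in \<open>auto simp: norm_mult\<close>)
  from negl_add[OF N1 N2] show ?thesis by simp
qed

text \<open>Both halves of the path start at \<open>\<i> * varrho / 2\<close>, whose contributions
  cancel in the difference. Stationary points off the axis lie strictly below the level 0, so adding
  their main terms changes nothing at the accuracy considered.\<close>

lemma asymptotics_real_case:
  assumes "lead 1 > 0 \<or> lead (- 1) > 0"
  shows "negl (\<lambda>e X. Hlim 1 e X - Hlim (- 1) e X - (\<Sum>z0\<in>Stat 0. mainT e X (zeta e z0)))"
proof -
  have M: "MM 0 = 0" using assms MM_0_real by blast
  define c where "c = (\<lambda>\<tau> e X. if lead \<tau> > 0 then mainT e X (zeta e (of_real (\<tau> * varrho))) else 0)"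
  have side: "negl (\<lambda>e X. Hlim \<tau> e X - H e X (\<i> * of_real (varrho / 2)) - of_real \<tau> * c \<tau> e X)"
    if \<tau>: "\<tau> = 1 \<or> \<tau> = -1" for \<tau>
  proof (cases "lead \<tau> > 0")
    case True
    then show ?thesis using real_side_saddle[OF \<tau>] by (simp add: c_def)
  next
    case False
    then have "lead \<tau> < 0" using lead_nonzero[OF \<tau>] by linarith
    then show ?thesis using real_side_plain[OF \<tau> _ M] False by (simp add: c_def)
  qed
  have N1: "negl (\<lambda>e X. Hlim 1 e X - Hlim (- 1) e X - (c 1 e X + c (- 1) e X))"
    using negl_diff[OF side[of 1] side[of "- 1"]] by (simp add: algebra_simps)
  define D where "D = (\<lambda>\<tau>. complex_of_real (\<tau> * varrho)) ` {\<tau>\<in>{1, - 1}. lead \<tau> > 0}"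
  have D: "D \<subseteq> Stat 0" using real_root by (auto simp: D_def)
  have sumD: "(\<Sum>z0\<in>D. mainT e X (zeta e z0)) = c 1 e X + c (- 1) e X" for e X
  proof -
    have "inj_on (\<lambda>\<tau>. complex_of_real (\<tau> * varrho)) {\<tau>\<in>{1, - 1}. lead \<tau> > 0}"
      using varrho_pos by (auto intro!: inj_onI)
    then have "(\<Sum>z0\<in>D. mainT e X (zeta e z0))
        = (\<Sum>\<tau>\<in>{\<tau>\<in>{1, - 1}. lead \<tau> > 0}. mainT e X (zeta e (of_real (\<tau> * varrho))))"
      unfolding D_def by (subst sum.reindex) auto
    also have "\<dots> = (\<Sum>\<tau>\<in>{1, - 1}. c \<tau> e X)" unfolding c_def by (rule sum.inter_filter) simp
    finally show ?thesis by simp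
  qed
  have rest: "negl (\<lambda>e X. \<Sum>z0\<in>Stat 0 - D. mainT e X (zeta e z0))"
  proof (rule negl_sum)
    fix z assume z: "z \<in> Stat 0 - D"
    have "Im z \<noteq> 0"
    proof
      assume "Im z = 0"
      then have zr: "z = of_real (Re z)" by (simp add: complex_eq_iff)
      have dz: "dPhi 0 z = 0" using z by (simp add: Stat_def)
      have "\<bar>Re z\<bar> = varrho" using root_0(2)[OF dz] zr by (metis norm_of_real)
      then obtain \<tau> where \<tau>: "\<tau> = 1 \<or> \<tau> = -1" "Re z = \<tau> * varrho" using varrho_pos
        by (cases "Re z \<ge> 0") (auto intro: that[of 1] that[of "- 1"])
      have z\<tau>: "z = of_real (\<tau> * varrho)" using zr unfolding \<tau>(2) .
      have "complex_of_real (b n * (real n * (\<tau> * varrho) ^ (n - 1))) = 1"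
        using dz unfolding dPhi_0_zero_iff z\<tau> by simp
      then have "b n * (real n * (\<tau> * varrho) ^ (n - 1)) = 1" by (simp only: of_real_eq_1_iff)
      then have "lead \<tau> * (real n * varrho ^ (n - 1)) = 1"
        by (simp add: lead_def power_mult_distrib mult_ac)
      moreover have "0 \<le> real n * varrho ^ (n - 1)" using varrho_pos by simp
      ultimately have "lead \<tau> > 0"
        using mult_nonpos_nonneg[of "lead \<tau>" "real n * varrho ^ (n - 1)"] by linarith
      then show False using z z\<tau> \<tau>(1) by (auto simp: D_def)
    qed
    then have "Im z > 0" using z by (auto simp: Stat_def)
    moreover have "1 - 1 / real n > 0" using n by (simp add: field_simps)
    ultimately show "negl (\<lambda>e X. mainT e X (zeta e z))"
      using z Re_Phi_0_Stat[of z] by (intro negl_mainT) (auto simp: M mult_neg_pos)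
  qed (use finite_Stat_0 in auto)
  have "(\<Sum>z0\<in>Stat 0. mainT e X (zeta e z0)) = (c 1 e X + c (- 1) e X) + (\<Sum>z0\<in>Stat 0 - D. mainT e X (zeta e z0))" for e X
    unfolding sumD[symmetric] using sum.subset_diff[OF D finite_Stat_0] by (simp add: add.commute)
  then show ?thesis using negl_diff[OF N1 rest] by (simp add: algebra_simps)
qed

section \<open>Paths without real stationary points\<close>

text \<open>
  Without real stationary points the two dominating ones are \<open>zc 1\<close> and \<open>zc (-1)\<close>, which
  coincide for \<open>n = 3\<close>; the contour is the horizontal line through them.
\<close>

definition zc :: "real \<Rightarrow> complex" where
  "zc \<tau> = hline \<tau> (varrho * sin \<beta>) (varrho * cos \<beta>)"

lemma zc_Im: "Im (zc \<tau>) = varrho * sin \<beta>"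
  by (simp add: zc_def hline_def)

text \<open>For even \<open>n\<close> the two ends would have opposite signs, so \<open>n\<close> is
  odd. Then \<open>n \<ge> 3\<close> and \<beta> is at most a right angle, which will put the lowest
  stationary points at the positive height \<open>varrho * sin \<beta>\<close>.\<close>

lemma no_real_root:
  assumes "lead 1 < 0" "lead (- 1) < 0"
  shows "b n < 0" "even (n - 1)" "n \<ge> 3" "\<beta> \<le> pi / 2" "sin \<beta> > 0" "cos \<beta> \<ge> 0"
proof -
  show bneg: "b n < 0" using assms(1) by (simp add: lead_def)
  show ev: "even (n - 1)"
  proof (rule ccontr)
    assume "odd (n - 1)"
    then have "lead (- 1) = - b n" by (simp add: lead_def)
    then show False using assms(2) bneg by simp
  qed
  show "n \<ge> 3" using ev n by (cases "n = 2") auto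
  then show b2: "\<beta> \<le> pi / 2" by (simp add: \<beta>_def field_simps)
  show "sin \<beta> > 0" using \<beta>_bounds(1) b2 pi_gt_zero by (intro sin_gt_zero) linarith+
  show "cos \<beta> \<ge> 0" using \<beta>_bounds(1) b2 by (intro cos_ge_zero) auto
qed

lemma zc_Stat:
  assumes L: "lead 1 < 0" "lead (- 1) < 0" and \<tau>: "\<tau> = 1 \<or> \<tau> = -1"
  shows "zc \<tau> \<in> Stat 0"
proof -
  note nr = no_real_root[OF L]
  define w where "w = of_real varrho * cis \<beta>"
  have "w ^ (n - 1) = of_real (varrho ^ (n - 1)) * cis (real (n - 1) * \<beta>)"
    by (simp only: w_def power_mult_distrib Complex.DeMoivre of_real_power)
  also have "real (n - 1) * \<beta> = pi" using \<beta>_bounds(3) n by (simp add: of_nat_diff)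
  finally have w: "w ^ (n - 1) = of_real (- (varrho ^ (n - 1)))" by simp
  have "zc \<tau> ^ (n - 1) = of_real (- (varrho ^ (n - 1)))"
    using \<tau>
  proof
    assume "\<tau> = 1"
    then have "zc \<tau> = w" by (simp add: zc_def hline_def w_def complex_eq_iff)
    then show ?thesis by (simp only: w)
  next
    assume "\<tau> = -1"
    then have "zc \<tau> = - cnj w" by (simp add: zc_def hline_def w_def complex_eq_iff)
    then have "zc \<tau> ^ (n - 1) = cnj (w ^ (n - 1))" using nr(2) by (simp only: power_minus_even complex_cnj_power)
    then show ?thesis unfolding w by (simp only: complex_cnj_complex_of_real)
  qed
  moreover have "b n * (real n * - (varrho ^ (n - 1))) = 1"
    unfolding varrho_power using nr(1) n by simp
  ultimately have "of_real (b n) * (of_nat n * zc \<tau> ^ (n - 1)) = 1"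
    by (metis of_real_1 of_real_mult of_real_of_nat_eq)
  then show ?thesis
    using nr(5) varrho_pos by (simp add: Stat_def dPhi_0_zero_iff zc_Im)
qed

text \<open>\<open>z ^ (n - 1)\<close> is negative at a stationary point, so the argument of
  \<open>z\<close> and, as \<open>n - 1\<close> is even, also its supplement are at least \<beta>.
  The imaginary part is smallest at the extreme angles, and the height is a negative multiple of
  it.\<close>

lemma MM_0_nonreal:
  assumes L: "lead 1 < 0" "lead (- 1) < 0"
  shows "MM 0 = - (1 - 1 / real n) * (varrho * sin \<beta>)"
    and "z \<in> Stat 0 \<Longrightarrow> z \<noteq> zc 1 \<Longrightarrow> z \<noteq> zc (- 1) \<Longrightarrow> Re (Phi 0 z) < MM 0"
proof -
  note nr = no_real_root[OF L]
  have k: "1 - 1 / real n > 0" using n by (simp add: field_simps)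
  have ang: "z = zc 1 \<or> z = zc (- 1) \<or> Im z > varrho * sin \<beta>" if z: "z \<in> Stat 0" for z
  proof -
    have dz: "dPhi 0 z = 0" "Im z \<ge> 0" using z by (auto simp: Stat_def)
    define a where "a = Arg2pi z"
    have za: "z = of_real varrho * cis a"
      unfolding a_def cis_conv_exp root_0(2)[OF dz(1), symmetric] by (rule Arg2pi_eq)
    have a: "0 \<le> a" "a \<le> pi" using dz(2) Arg2pi_ge_0 Arg2pi_le_pi[of z] by (auto simp: a_def)
    have cosa: "cos (real (n - 1) * a) = -1"
    proof -
      have "z ^ (n - 1) = of_real (varrho ^ (n - 1)) * cis (real (n - 1) * a)"
        by (simp only: za power_mult_distrib Complex.DeMoivre of_real_power)
      then have e1: "of_real (b n * (real n * varrho ^ (n - 1))) * cis (real (n - 1) * a) = 1"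
        using dz(1) unfolding dPhi_0_zero_iff by (simp add: mult.assoc)
      have e2: "b n * (real n * varrho ^ (n - 1)) = -1"
        unfolding varrho_power using nr(1) n by simp
      have "- cis (real (n - 1) * a) = 1" using e1 unfolding e2 by simp
      then have "Re (- cis (real (n - 1) * a)) = Re 1" by simp
      then show ?thesis by simp
    qed
    have ge: "\<beta> \<le> c" if "0 \<le> c" "cos (real (n - 1) * c) = -1" for c
    proof (rule ccontr)
      assume "\<not> \<beta> \<le> c"
      then have "(real n - 1) * c < pi" using n \<beta>_bounds(3) mult_strict_left_mono[of c \<beta> "real n - 1"] by simp
      moreover have "real (n - 1) = real n - 1" using n by (simp add: of_nat_diff)
      moreover have "0 \<le> (real n - 1) * c" using n that by simp
      ultimately have "cos pi < cos (real (n - 1) * c)" by (intro cos_monotone_0_pi) auto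
      then show False using that by simp
    qed
    have a1: "\<beta> \<le> a" by (rule ge[OF a(1) cosa])
    have a2: "\<beta> \<le> pi - a"
    proof (rule ge)
      obtain m where m: "n - 1 = 2 * m" using nr(2) by (elim evenE)
      have "real (n - 1) * (pi - a) = - (real (n - 1) * a) + 2 * real m * pi" unfolding m by (simp add: algebra_simps)
      then have "cos (real (n - 1) * (pi - a)) = cos (- (real (n - 1) * a) + 2 * real m * pi)" by (simp only:)
      also have "\<dots> = cos (real (n - 1) * a)"
        unfolding cos_add by simp
      finally show "cos (real (n - 1) * (pi - a)) = -1" using cosa by simp
    qed (use a in simp)
    consider "a = \<beta>" | "a = pi - \<beta>" | "\<beta> < a" "\<beta> < pi - a" using a1 a2 by linarith
    then show ?thesis
    proof cases
      case 1
      then have "z = zc 1" by (simp add: za zc_def hline_def complex_eq_iff)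
      then show ?thesis by simp
    next
      case 2
      then have "z = zc (- 1)" by (simp add: za zc_def hline_def complex_eq_iff)
      then show ?thesis by simp
    next
      case 3
      have "sin \<beta> < sin a"
      proof (cases "a \<le> pi / 2")
        case True
        then show ?thesis using 3 \<beta>_bounds by (intro sin_monotone_2pi) auto
      next
        case False
        then have "sin \<beta> < sin (pi - a)" using 3 \<beta>_bounds by (intro sin_monotone_2pi) auto
        then show ?thesis by simp
      qed
      then show ?thesis using varrho_pos by (simp add: za)
    qed
  qed
  show M: "MM 0 = - (1 - 1 / real n) * (varrho * sin \<beta>)"
    unfolding MM_def
  proof (rule Max_eqI)
    show "finite ((\<lambda>z. Re (Phi 0 z)) ` Stat 0)" using finite_Stat_0 by simp
    have "zc 1 \<in> Stat 0" using zc_Stat[OF L] by simp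
    then show "- (1 - 1 / real n) * (varrho * sin \<beta>) \<in> (\<lambda>z. Re (Phi 0 z)) ` Stat 0"
      using Re_Phi_0_Stat[of "zc 1"] by (intro image_eqI[of _ _ "zc 1"]) (auto simp: zc_Im)
    fix y assume "y \<in> (\<lambda>z. Re (Phi 0 z)) ` Stat 0"
    then obtain z where z: "z \<in> Stat 0" "y = Re (Phi 0 z)" by auto
    have "varrho * sin \<beta> \<le> Im z" using ang[OF z(1)] by (auto simp: zc_Im)
    then have "(1 - 1 / real n) * (varrho * sin \<beta>) \<le> (1 - 1 / real n) * Im z"
      using k by (intro mult_left_mono) auto
    then show "y \<le> - (1 - 1 / real n) * (varrho * sin \<beta>)"
      unfolding z(2) Re_Phi_0_Stat[OF z(1)] mult_minus_left neg_le_iff_le .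
  qed
  show "Re (Phi 0 z) < MM 0" if z: "z \<in> Stat 0" "z \<noteq> zc 1" "z \<noteq> zc (- 1)"
  proof -
    have "varrho * sin \<beta> < Im z" using ang[OF z(1)] z by auto
    then have "(1 - 1 / real n) * (varrho * sin \<beta>) < (1 - 1 / real n) * Im z"
      using k by (rule mult_strict_left_mono)
    then show ?thesis unfolding M Re_Phi_0_Stat[OF z(1)] mult_minus_left neg_less_iff_less .
  qed
qed

text \<open>
  At an interior maximum on the chord \<open>z^(n-1)\<close> is real, and \<open>\<bar>z\<bar> < varrho\<close> bounds it.
\<close>

lemma chord_Omega:
  assumes L: "lead 1 < 0" "lead (- 1) < 0" and z: "Im z = varrho * sin \<beta>" "\<bar>Re z\<bar> < varrho * cos \<beta>"
  shows "z \<in> Omega"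
proof -
  note nr = no_real_root[OF L]
  define v0 where "v0 = varrho * sin \<beta>"
  define L where "L = varrho * cos \<beta>"
  have v0: "v0 > 0" using nr(5) varrho_pos by (simp add: v0_def)
  define f where "f = (\<lambda>x::real. Re (Phi 0 (hline 1 v0 x)))"
  have Lp: "0 < L" using z(2) by (simp add: L_def)
  have der: "(f has_real_derivative Re (dPhi 0 (hline 1 v0 x))) (at x)" for x
  proof -
    have "((\<lambda>x. hline 1 v0 x) has_vector_derivative 1) (at x)"
      unfolding hline_def
      by (auto intro!: derivative_eq_intros simp: has_vector_derivative_def scaleR_conv_of_real)
    from field_vector_diff_chain_at[OF this Phi_deriv]
    have "((\<lambda>x. Phi 0 (hline 1 v0 x)) has_vector_derivative dPhi 0 (hline 1 v0 x)) (at x)" by (simp add: o_def)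
    from bounded_linear.has_vector_derivative[OF bounded_linear_Re this]
    show ?thesis by (simp add: f_def has_real_derivative_iff_has_vector_derivative)
  qed
  have endp: "f x = MM 0" if "x = L \<or> x = - L" for x
  proof -
    have "hline 1 v0 x = zc 1 \<or> hline 1 v0 x = zc (- 1)" using that by (auto simp: zc_def hline_def v0_def L_def)
    then have "hline 1 v0 x \<in> Stat 0" using zc_Stat[OF assms(1,2)] by auto
    from Re_Phi_0_Stat[OF this] show ?thesis
      by (simp add: f_def MM_0_nonreal(1)[OF assms(1,2)] hline_def v0_def)
  qed
  have crit: "f x < MM 0" if x: "\<bar>x\<bar> < L" and d: "Re (dPhi 0 (hline 1 v0 x)) = 0" for x
  proof -
    define u where "u = hline 1 v0 x"
    have "Im (u ^ (n - 1)) = 0" using d nr(1) n by (simp add: dPhi_0 u_def)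
    then have un: "Im (u ^ n) = v0 * Re (u ^ (n - 1))"
      unfolding power_pred(1)[of u] by (simp add: u_def hline_def)
    have "(cmod u)\<^sup>2 < varrho\<^sup>2"
    proof -
      have "(cmod u)\<^sup>2 = x\<^sup>2 + v0\<^sup>2" by (simp add: u_def hline_def cmod_power2)
      also have "x\<^sup>2 < L\<^sup>2" using x Lp by (metis abs_le_square_iff abs_of_pos not_le)
      also have "L\<^sup>2 + v0\<^sup>2 = varrho\<^sup>2 * ((cos \<beta>)\<^sup>2 + (sin \<beta>)\<^sup>2)"
        by (simp add: L_def v0_def power_mult_distrib algebra_simps del: sin_cos_squared_add2)
      finally show ?thesis by simp
    qed
    then have "cmod u < varrho" using varrho_pos by (metis less_eq_real_def power2_less_imp_less)
    then have "cmod u ^ (n - 1) < varrho ^ (n - 1)" using n by (intro power_strict_mono) auto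
    then have lt: "\<bar>Re (u ^ (n - 1))\<bar> < 1 / (real n * \<bar>b n\<bar>)"
      unfolding varrho_power[symmetric] norm_power[symmetric] using abs_Re_le_cmod by (rule le_less_trans[rotated])
    have "b n * Re (u ^ (n - 1)) \<le> \<bar>b n\<bar> * \<bar>Re (u ^ (n - 1))\<bar>" by (metis abs_ge_self abs_mult)
    also have "\<dots> < \<bar>b n\<bar> * (1 / (real n * \<bar>b n\<bar>))" using lt bn by (intro mult_strict_left_mono) auto
    also have "\<dots> = 1 / real n" using bn by simp
    finally have "v0 * (b n * Re (u ^ (n - 1))) < v0 * (1 / real n)" using v0 by (rule mult_strict_left_mono)
    moreover have "f x = - v0 + v0 * (b n * Re (u ^ (n - 1)))"
      unfolding f_def u_def[symmetric] Re_Phi_0 un by (simp add: u_def hline_def)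
    ultimately show ?thesis unfolding MM_0_nonreal(1)[OF assms(1,2)] v0_def[symmetric] by (simp add: algebra_simps)
  qed
  have zz: "z = hline 1 v0 (Re z)" using z by (simp add: hline_def v0_def complex_eq_iff)
  have "f (Re z) < MM 0"
  proof (rule ccontr)
    assume ge: "\<not> f (Re z) < MM 0"
    have zL: "\<bar>Re z\<bar> < L" using z(2) by (simp add: L_def)
    have "continuous_on {- L..L} f" using der DERIV_isCont continuous_at_imp_continuous_on by blast
    then obtain xm where xm: "xm \<in> {- L..L}" "\<And>y. y \<in> {- L..L} \<Longrightarrow> f y \<le> f xm"
      using continuous_attains_sup[of "{- L..L}" f] Lp by auto
    \<comment> \<open>If the maximum over the chord is attained at an end point, its value is
      \<open>MM 0\<close>; under the assumption to be refuted \<open>Re z\<close> is then an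
      interior maximum as well.\<close>
    define x where "x = (if xm = L \<or> xm = - L then Re z else xm)"
    have x: "\<bar>x\<bar> < L" using zL xm(1) by (auto simp: x_def)
    have fx: "f y \<le> f x" if "y \<in> {- L..L}" for y
      using xm(2)[OF that] endp[of xm] ge by (auto simp: x_def)
    have "Re (dPhi 0 (hline 1 v0 x)) = 0"
    proof (rule DERIV_local_max[OF der])
      show "L - \<bar>x\<bar> > 0" using x by simp
      show "\<forall>y. \<bar>x - y\<bar> < L - \<bar>x\<bar> \<longrightarrow> f y \<le> f x" by (auto intro!: fx)
    qed
    from crit[OF x this] have "f x < MM 0" .
    moreover have "f (Re z) \<le> f x" using zL by (intro fx) auto
    ultimately show False using ge by simp
  qed
  then have "Re (Phi 0 z) < MM 0" unfolding f_def using zz by simp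
  moreover have "z \<in> cut" using z nr(5) varrho_pos by (intro cutI) auto
  ultimately show ?thesis by (simp add: Omega_def)
qed

text \<open>The angle is half the argument \<open>\<beta> - pi / 2\<close> of
  \<open>- \<i> * zc 1\<close>; the left point is the mirror image of the right one and has the
  conjugate direction.\<close>

lemma dirn_zc:
  assumes L: "lead 1 < 0" "lead (- 1) < 0" and \<tau>: "\<tau> = 1 \<or> \<tau> = -1"
  shows "dirn 0 (zc \<tau>) = of_real (cos (\<beta> / 2 - pi / 4)) + \<i> * of_real (\<tau> * sin (\<beta> / 2 - pi / 4))"
    and "cos (\<beta> / 2 - pi / 4) > 0"
proof -
  note nr = no_real_root[OF L]
  define c s where "c = cos (\<beta> / 2 - pi / 4)" and "s = sin (\<beta> / 2 - pi / 4)"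
  show c: "cos (\<beta> / 2 - pi / 4) > 0" using \<beta>_bounds(1) nr(4) by (intro cos_gt_zero_pi) linarith+
  have \<tau>2: "\<tau> * \<tau> = 1" using \<tau> by auto
  have cs: "c\<^sup>2 - s\<^sup>2 = sin \<beta>" "2 * s * c = - cos \<beta>"
  proof -
    have e: "2 * (\<beta> / 2 - pi / 4) = \<beta> - pi / 2" by simp
    have "c\<^sup>2 - s\<^sup>2 = cos (2 * (\<beta> / 2 - pi / 4))" unfolding c_def s_def by (rule cos_double[symmetric])
    then show "c\<^sup>2 - s\<^sup>2 = sin \<beta>" unfolding e by (simp add: cos_diff)
    have "2 * s * c = sin (2 * (\<beta> / 2 - pi / 4))" unfolding c_def s_def by (rule sin_double[symmetric])
    then show "2 * s * c = - cos \<beta>" unfolding e by (simp add: sin_diff)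
  qed
  have "(of_real c + \<i> * of_real (\<tau> * s))\<^sup>2 = of_real (c\<^sup>2 - \<tau> * \<tau> * s\<^sup>2) + \<i> * of_real (\<tau> * (2 * s * c))"
    by (simp add: power2_eq_square algebra_simps)
  also have "\<dots> = of_real (sin \<beta>) - \<i> * of_real (\<tau> * cos \<beta>)" unfolding \<tau>2 cs mult_1 by (simp add: cs)
  also have "\<dots> = - \<i> * zc \<tau> / of_real varrho"
    using varrho_pos by (simp add: zc_def hline_def complex_eq_iff)
  finally have sq: "(of_real c + \<i> * of_real (\<tau> * s))\<^sup>2 = - \<i> * zc \<tau> / of_real varrho" .
  show "dirn 0 (zc \<tau>) = of_real (cos (\<beta> / 2 - pi / 4)) + \<i> * of_real (\<tau> * sin (\<beta> / 2 - pi / 4))"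
    unfolding dirn_def dirn_0(1)[OF zc_Stat[OF L \<tau>]] c_def[symmetric] s_def[symmetric]
    by (rule csqrt_unique[OF sq]) (use c in \<open>simp add: c_def\<close>)
qed

text \<open>\<open>zc 1\<close> lies on the edge of the sector of opening \<beta>, and the direction
  of descent there, of angle \<open>\<beta> / 2 - pi / 4 < \<beta>\<close>, points into it; for
  \<open>zc (- 1)\<close> everything is reflected. From the outer end
  \<open>hline_decreasing\<close> makes the phase fall along the whole horizontal ray.\<close>

lemma nonreal_outer:
  assumes L: "lead 1 < 0" "lead (- 1) < 0" and \<tau>: "\<tau> = 1 \<or> \<tau> = -1"
  obtains \<rho>0 where "\<rho>0 > 0" "\<And>\<rho>. 0 < \<rho> \<Longrightarrow> \<rho> \<le> \<rho>0 \<Longrightarrow>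
    negl (\<lambda>e X. Hlim \<tau> e X - H e X (zeta e (zc \<tau>) + of_real (\<tau> * \<rho>) * dirn e (zeta e (zc \<tau>))))"
proof -
  note nr = no_real_root[OF L]
  note z0 = zc_Stat[OF L \<tau>]
  define c s where "c = cos (\<beta> / 2 - pi / 4)" and "s = sin (\<beta> / 2 - pi / 4)"
  have d: "dirn 0 (zc \<tau>) = of_real c + \<i> * of_real (\<tau> * s)" and c: "c > 0"
    using dirn_zc[OF L \<tau>] by (simp_all add: c_def s_def)
  have \<tau>2: "\<tau> * \<tau> = 1" using \<tau> by auto
  define v0 where "v0 = varrho * sin \<beta>"
  have v0: "v0 > 0" using nr(5) varrho_pos by (simp add: v0_def)
  have Mz: "Re (Phi 0 (zc \<tau>)) = MM 0"
    unfolding Re_Phi_0_Stat[OF z0] MM_0_nonreal(1)[OF L] zc_Im ..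
  have nz: "ddPhi 0 (zc \<tau>) \<noteq> 0" using root_0(6)[of "zc \<tau>"] z0 by (simp add: Stat_def)
  then have "cmod (ddPhi 0 (zc \<tau>)) > 0" by simp
  then obtain \<rho>1 where \<rho>1: "\<rho>1 > 0" "\<And>\<rho> w. 0 < \<rho> \<Longrightarrow> \<rho> \<le> \<rho>1 \<Longrightarrow> cmod w \<le> 1 \<Longrightarrow>
     Re (ddPhi 0 (zc \<tau>) * w\<^sup>2) \<le> - cmod (ddPhi 0 (zc \<tau>)) \<Longrightarrow> Re (Phi 0 (zc \<tau> + of_real \<rho> * w)) < Re (Phi 0 (zc \<tau>))"
    using local_descent[OF z0] by metis
  show thesis
  \<comment> \<open>\<open>v0 / 2\<close> keeps the ray in the upper half-plane, where the integrand
    decays.\<close>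
  proof (rule that[of "min \<rho>1 (v0 / 2)"])
    show "min \<rho>1 (v0 / 2) > 0" using \<rho>1 v0 by simp
    fix \<rho> assume \<rho>: "0 < \<rho>" "\<rho> \<le> min \<rho>1 (v0 / 2)"
    have ys: "v0 + \<rho> * s > 0"
    proof -
      have "\<bar>\<rho> * s\<bar> \<le> \<rho> * 1" unfolding abs_mult using \<rho> by (intro mult_mono) (auto simp: s_def)
      moreover have "\<rho> \<le> v0 / 2" using \<rho> by simp
      ultimately show ?thesis using \<rho>(1) v0 by linarith
    qed
    define x0 where "x0 = varrho * cos \<beta> + \<rho> * c"
    define zo where "zo = hline \<tau> (v0 + \<rho> * s) x0"
    have zo: "zc \<tau> + of_real (\<tau> * \<rho>) * dirn 0 (zc \<tau>) = zo"
    proof -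
      have "of_real (\<tau> * \<rho>) * dirn 0 (zc \<tau>) = of_real (\<tau> * (\<rho> * c)) + \<i> * of_real (\<tau> * \<tau> * (\<rho> * s))"
        unfolding d by (simp add: algebra_simps)
      then show ?thesis unfolding \<tau>2 by (simp add: zo_def zc_def hline_def v0_def x0_def algebra_simps)
    qed
    have "Re (Phi 0 (zc \<tau> + of_real \<rho> * (of_real \<tau> * dirn 0 (zc \<tau>)))) < Re (Phi 0 (zc \<tau>))"
    proof (rule \<rho>1(2))
      have t1: "cmod (complex_of_real \<tau>) = 1" "(complex_of_real \<tau>)\<^sup>2 = 1" using \<tau> by auto
      show "cmod (of_real \<tau> * dirn 0 (zc \<tau>)) \<le> 1" using dirn_props(1)[OF nz] by (simp add: norm_mult t1(1) del: norm_of_real)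
      show "Re (ddPhi 0 (zc \<tau>) * (of_real \<tau> * dirn 0 (zc \<tau>))\<^sup>2) \<le> - cmod (ddPhi 0 (zc \<tau>))"
        unfolding power_mult_distrib t1(2) using dirn_props(2)[OF nz] by (simp add: mult.commute)
    qed (use \<rho> in auto)
    then have zoneg: "Re (Phi 0 zo) < MM 0" unfolding zo[symmetric] Mz by (simp add: mult_ac)
    have lneg: "lead \<tau> < 0" using L \<tau> by auto
    have ray: "hline \<tau> (v0 + \<rho> * s) x \<in> Omega" if x: "x \<ge> x0" for x
    proof -
      have "Re (Phi 0 (hline \<tau> (v0 + \<rho> * s) x)) \<le> Re (Phi 0 (hline \<tau> (v0 + \<rho> * s) x0))"
      proof (rule hline_decreasing[OF \<tau> _ _ x])
        show "lead \<tau> * (v0 + \<rho> * s) < 0" using lneg ys by (rule mult_neg_pos)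
        have "Im ((of_real x0 + \<i> * of_real \<bar>v0 + \<rho> * s\<bar>) * cis (- \<beta>))
            = (v0 + \<rho> * s) * cos \<beta> - x0 * sin \<beta>" using ys by simp
        also have "\<dots> = \<rho> * (s * cos \<beta> - c * sin \<beta>)" by (simp add: v0_def x0_def algebra_simps)
        also have "s * cos \<beta> - c * sin \<beta> = sin ((\<beta> / 2 - pi / 4) - \<beta>)" unfolding c_def s_def by (rule sin_diff[symmetric])
        also have "(\<beta> / 2 - pi / 4) - \<beta> = - (\<beta> / 2 + pi / 4)" by simp
        also have "\<rho> * sin (- (\<beta> / 2 + pi / 4)) < 0"
        proof -
          have "sin (\<beta> / 2 + pi / 4) > 0" using \<beta>_bounds(1) nr(4) pi_gt_zero by (intro sin_gt_zero) linarith+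
          then show ?thesis unfolding sin_minus using \<rho>(1) by simp
        qed
        finally show "Im ((of_real x0 + \<i> * of_real \<bar>v0 + \<rho> * s\<bar>) * cis (- \<beta>)) < 0" .
      qed
      moreover have "hline \<tau> (v0 + \<rho> * s) x \<in> cut" using ys by (intro cutI) (auto simp: hline_def)
      ultimately show ?thesis using zoneg by (simp add: Omega_def zo_def)
    qed
    have N1: "negl (\<lambda>e X. Hlim \<tau> e X - H e X zo)"
    proof (rule negl_far[OF \<tau>])
      show "lead \<tau> * Im zo < 0" using lneg ys by (simp add: zo_def hline_def mult_neg_pos)
      fix x :: real assume "x \<ge> 0"
      moreover have "zo + of_real (\<tau> * x) = hline \<tau> (v0 + \<rho> * s) (x0 + x)"
        by (simp add: zo_def hline_def algebra_simps)
      ultimately show "zo + of_real (\<tau> * x) \<in> Omega" using ray[of "x0 + x"] by simp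
    qed
    have N2: "negl (\<lambda>e X. H e X zo - H e X (zeta e (zc \<tau>) + of_real (\<tau> * \<rho>) * dirn e (zeta e (zc \<tau>))))"
    proof (rule negl_point)
      show "zo \<in> Omega" unfolding zo_def by (rule ray) simp
      show "((\<lambda>e. zeta e (zc \<tau>) + of_real (\<tau> * \<rho>) * dirn e (zeta e (zc \<tau>))) \<longlongrightarrow> zo) (at_right 0)"
        unfolding zo[symmetric] by (rule saddle_end_tendsto[OF z0])
    qed auto
    from negl_add[OF N1 N2]
    show "negl (\<lambda>e X. Hlim \<tau> e X - H e X (zeta e (zc \<tau>) + of_real (\<tau> * \<rho>) * dirn e (zeta e (zc \<tau>))))"
      by simp
  qed
qed

text \<open>The inner end of the saddle is turned to the horizontal direction, where the chord
  between the dominating points begins. All intermediate directions descend: the horizontal one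
  still has second-order coefficient \<open>- A * sin \<beta>\<close>.\<close>

lemma nonreal_inner:
  assumes L: "lead 1 < 0" "lead (- 1) < 0" and \<tau>: "\<tau> = 1 \<or> \<tau> = -1"
  obtains \<rho>0 where "\<rho>0 > 0" "\<And>\<rho>. 0 < \<rho> \<Longrightarrow> \<rho> \<le> \<rho>0 \<Longrightarrow>
    negl (\<lambda>e X. H e X (zeta e (zc \<tau>) - of_real (\<tau> * \<rho>) * dirn e (zeta e (zc \<tau>)))
      - H e X (zc \<tau> - of_real (\<tau> * \<rho>)))"
proof -
  note nr = no_real_root[OF L]
  note z0 = zc_Stat[OF L \<tau>]
  define c s where "c = cos (\<beta> / 2 - pi / 4)" and "s = sin (\<beta> / 2 - pi / 4)"
  define d where "d = dirn 0 (zc \<tau>)"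
  have d: "d = of_real c + \<i> * of_real (\<tau> * s)" and c: "c > 0"
    using dirn_zc[OF L \<tau>] by (simp_all add: c_def s_def d_def)
  have \<tau>2: "\<tau>\<^sup>2 = 1" using \<tau> by auto
  have cs: "c\<^sup>2 - s\<^sup>2 = sin \<beta>"
  proof -
    have e: "2 * (\<beta> / 2 - pi / 4) = \<beta> - pi / 2" by simp
    have "c\<^sup>2 - s\<^sup>2 = cos (2 * (\<beta> / 2 - pi / 4))" unfolding c_def s_def by (rule cos_double[symmetric])
    then show ?thesis unfolding e by (simp add: cos_diff)
  qed
  have Mz: "Re (Phi 0 (zc \<tau>)) = MM 0"
    unfolding Re_Phi_0_Stat[OF z0] MM_0_nonreal(1)[OF L] zc_Im ..
  have nz: "ddPhi 0 (zc \<tau>) \<noteq> 0" using root_0(6)[of "zc \<tau>"] z0 by (simp add: Stat_def)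
  define A where "A = cmod (ddPhi 0 (zc \<tau>))"
  have A: "A > 0" using nz by (simp add: A_def)
  have d1: "cmod d = 1" "d\<^sup>2 * ddPhi 0 (zc \<tau>) = - of_real A"
    using dirn_props[OF nz] by (simp_all add: d_def A_def)
  have dc: "d * cnj d = 1" using d1(1) by (simp flip: complex_norm_square)
  \<comment> \<open>The factor 1/2 is the minimum of \<open>(1 - k)\<^sup>2 + k\<^sup>2\<close> over
    the segment of directions.\<close>
  define c0 where "c0 = A * sin \<beta> / 2"
  have c0: "c0 > 0" using A nr(5) by (simp add: c0_def)
  obtain \<rho>1 where \<rho>1: "\<rho>1 > 0" "\<And>\<rho> w. 0 < \<rho> \<Longrightarrow> \<rho> \<le> \<rho>1 \<Longrightarrow> cmod w \<le> 1 \<Longrightarrow>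
     Re (ddPhi 0 (zc \<tau>) * w\<^sup>2) \<le> - c0 \<Longrightarrow> Re (Phi 0 (zc \<tau> + of_real \<rho> * w)) < Re (Phi 0 (zc \<tau>))"
    using local_descent[OF z0 c0] by metis
  define v0 where "v0 = varrho * sin \<beta>"
  have v0: "v0 > 0" using nr(5) varrho_pos by (simp add: v0_def)
  have cone: "Re (ddPhi 0 (zc \<tau>) * (- of_real \<tau> * ((1 - k) *\<^sub>R d + k *\<^sub>R 1))\<^sup>2) \<le> - c0"
    "cmod (- of_real \<tau> * ((1 - k) *\<^sub>R d + k *\<^sub>R 1)) \<le> 1" if k: "0 \<le> k" "k \<le> 1" for k
  proof -
    \<comment> \<open>Dividing by \<open>d\<close> normalises the second derivative: the quadratic
      form becomes \<open>- A * u\<^sup>2\<close>.\<close>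
    define u where "u = of_real (1 - k) + of_real k * cnj d"
    have du: "(1 - k) *\<^sub>R d + k *\<^sub>R 1 = d * u"
      using dc by (simp add: u_def scaleR_conv_of_real algebra_simps)
    have "ddPhi 0 (zc \<tau>) * (- of_real \<tau> * (d * u))\<^sup>2 = (d\<^sup>2 * ddPhi 0 (zc \<tau>)) * (of_real (\<tau>\<^sup>2) * u\<^sup>2)"
      by (simp add: power_mult_distrib)
    then have e: "ddPhi 0 (zc \<tau>) * (- of_real \<tau> * (d * u))\<^sup>2 = - of_real A * u\<^sup>2"
      unfolding d1(2) \<tau>2 by simp
    have "Re (u\<^sup>2) = ((1 - k) + k * c)\<^sup>2 - (k * (\<tau> * s))\<^sup>2"
      by (simp add: u_def d Re_power2)
    also have "\<dots> = (1 - k)\<^sup>2 + 2 * (1 - k) * k * c + k\<^sup>2 * (c\<^sup>2 - s\<^sup>2)"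
      unfolding power_mult_distrib \<tau>2 by (simp add: power2_eq_square algebra_simps)
    also have "\<dots> \<ge> sin \<beta> / 2"
    proof -
      have "0 \<le> 2 * (1 - k) * k * c" using k c by simp
      moreover have "(1 - k)\<^sup>2 * sin \<beta> \<le> (1 - k)\<^sup>2 * 1" by (intro mult_left_mono) auto
      moreover have "1 / 2 * sin \<beta> \<le> ((1 - k)\<^sup>2 + k\<^sup>2) * sin \<beta>"
      proof (rule mult_right_mono)
        have "0 \<le> (2 * k - 1)\<^sup>2" by simp
        then show "1 / 2 \<le> (1 - k)\<^sup>2 + k\<^sup>2" by (simp add: power2_eq_square algebra_simps)
      qed (use nr(5) in simp)
      ultimately show ?thesis unfolding cs by (simp add: algebra_simps)
    qed
    finally have "A * (sin \<beta> / 2) \<le> A * Re (u\<^sup>2)" using A by (intro mult_left_mono) auto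
    then show "Re (ddPhi 0 (zc \<tau>) * (- of_real \<tau> * ((1 - k) *\<^sub>R d + k *\<^sub>R 1))\<^sup>2) \<le> - c0"
      unfolding du e by (simp add: c0_def)
    have "cmod u \<le> (1 - k) + k * cmod (cnj d)"
      unfolding u_def using norm_triangle_ineq[of "complex_of_real (1 - k)" "of_real k * cnj d"] k
      by (simp add: norm_mult del: of_real_diff)
    then have "cmod u \<le> 1" using d1(1) by simp
    then show "cmod (- of_real \<tau> * ((1 - k) *\<^sub>R d + k *\<^sub>R 1)) \<le> 1"
      unfolding du using \<tau> d1(1) by (auto simp: norm_mult)
  qed
  show thesis
  proof (rule that[of "min \<rho>1 (v0 / 2)"])
    show "min \<rho>1 (v0 / 2) > 0" using \<rho>1 v0 by simp
    fix \<rho> assume \<rho>: "0 < \<rho>" "\<rho> \<le> min \<rho>1 (v0 / 2)"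
    show "negl (\<lambda>e X. H e X (zeta e (zc \<tau>) - of_real (\<tau> * \<rho>) * dirn e (zeta e (zc \<tau>)))
      - H e X (zc \<tau> - of_real (\<tau> * \<rho>)))"
    proof (rule negl_segment[of "zc \<tau> - of_real (\<tau> * \<rho>)" "zc \<tau> - of_real (\<tau> * \<rho>) * d"])
      show "closed_segment (zc \<tau> - of_real (\<tau> * \<rho>)) (zc \<tau> - of_real (\<tau> * \<rho>) * d) \<subseteq> Omega"
      proof
        fix z assume "z \<in> closed_segment (zc \<tau> - of_real (\<tau> * \<rho>)) (zc \<tau> - of_real (\<tau> * \<rho>) * d)"
        then have "z \<in> closed_segment (zc \<tau> - of_real (\<tau> * \<rho>) * d) (zc \<tau> - of_real (\<tau> * \<rho>))"
          by (simp add: closed_segment_commute)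
        then obtain k where k: "0 \<le> k" "k \<le> 1"
          "z = (1 - k) *\<^sub>R (zc \<tau> - of_real (\<tau> * \<rho>) * d) + k *\<^sub>R (zc \<tau> - of_real (\<tau> * \<rho>))"
          by (auto simp: closed_segment_def)
        define w where "w = - of_real \<tau> * ((1 - k) *\<^sub>R d + k *\<^sub>R 1)"
        have zw: "z = zc \<tau> + of_real \<rho> * w"
          by (simp add: k(3) w_def scaleR_conv_of_real algebra_simps)
        have w1: "cmod w \<le> 1" "Re (ddPhi 0 (zc \<tau>) * w\<^sup>2) \<le> - c0" unfolding w_def using cone[OF k(1,2)] by auto
        have "Re (Phi 0 z) < MM 0" unfolding zw Mz[symmetric] using \<rho> w1 by (intro \<rho>1(2)) auto
        moreover have "Im z > 0"
        proof -
          have "\<bar>Im (of_real \<rho> * w)\<bar> \<le> cmod (of_real \<rho> * w)" by (rule abs_Im_le_cmod)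
          also have "\<dots> \<le> \<rho> * 1" unfolding norm_mult using w1 \<rho> by (intro mult_mono) auto
          finally have "\<bar>Im (of_real \<rho> * w)\<bar> \<le> \<rho>" by simp
          moreover have "\<rho> \<le> v0 / 2" using \<rho> by simp
          ultimately have "v0 + Im (of_real \<rho> * w) > 0" using \<rho>(1) v0 by linarith
          then show ?thesis by (simp add: zw zc_Im v0_def)
        qed
        ultimately show "z \<in> Omega" by (auto simp: Omega_def intro: cutI)
      qed
      show "((\<lambda>e. zeta e (zc \<tau>) - of_real (\<tau> * \<rho>) * dirn e (zeta e (zc \<tau>))) \<longlongrightarrow> zc \<tau> - of_real (\<tau> * \<rho>) * d) (at_right 0)"
        unfolding d_def by (rule saddle_end_tendsto[OF z0])
    qed auto
  qed
qed

text \<open>If \<open>cos \<beta> = 0\<close>, the two outer pieces meet in the only dominating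
  saddle. Otherwise the path runs through both saddles, joined by a part of the chord between them
  on which the phase is below their common height.\<close>

lemma asymptotics_nonreal_case:
  assumes L: "lead 1 < 0" "lead (- 1) < 0"
  shows "negl (\<lambda>e X. Hlim 1 e X - Hlim (- 1) e X - (\<Sum>z0\<in>Stat 0. mainT e X (zeta e z0)))"
proof -
  note nr = no_real_root[OF L]
  have S: "zc 1 \<in> Stat 0" "zc (- 1) \<in> Stat 0" using zc_Stat[OF L] by auto
  define D where "D = {zc 1, zc (- 1)}"
  have D: "D \<subseteq> Stat 0" using S by (simp add: D_def)
  obtain r1 where r1: "r1 > 0" "\<And>\<rho>. 0 < \<rho> \<Longrightarrow> \<rho> \<le> r1 \<Longrightarrow>
    negl (\<lambda>e X. Hlim 1 e X - H e X (zeta e (zc 1) + of_real (1 * \<rho>) * dirn e (zeta e (zc 1))))"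
    using nonreal_outer[OF L, of 1] by auto
  obtain r2 where r2: "r2 > 0" "\<And>\<rho>. 0 < \<rho> \<Longrightarrow> \<rho> \<le> r2 \<Longrightarrow>
    negl (\<lambda>e X. Hlim (- 1) e X - H e X (zeta e (zc (- 1)) + of_real (- 1 * \<rho>) * dirn e (zeta e (zc (- 1)))))"
    using nonreal_outer[OF L, of "- 1"] by auto
  obtain r3 where r3: "r3 > 0" "\<And>\<rho>. 0 < \<rho> \<Longrightarrow> \<rho> \<le> r3 \<Longrightarrow>
    negl (\<lambda>e X. H e X (zeta e (zc 1) - of_real (1 * \<rho>) * dirn e (zeta e (zc 1))) - H e X (zc 1 - of_real (1 * \<rho>)))"
    using nonreal_inner[OF L, of 1] by auto
  obtain r4 where r4: "r4 > 0" "\<And>\<rho>. 0 < \<rho> \<Longrightarrow> \<rho> \<le> r4 \<Longrightarrow>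
    negl (\<lambda>e X. H e X (zeta e (zc (- 1)) - of_real (- 1 * \<rho>) * dirn e (zeta e (zc (- 1)))) - H e X (zc (- 1) - of_real (- 1 * \<rho>)))"
    using nonreal_inner[OF L, of "- 1"] by auto
  obtain r5 where r5: "r5 > 0" "\<And>\<rho>. 0 < \<rho> \<Longrightarrow> \<rho> \<le> r5 \<Longrightarrow>
     negl (\<lambda>e X. H e X (zeta e (zc 1) + of_real \<rho> * dirn e (zeta e (zc 1)))
       - H e X (zeta e (zc 1) - of_real \<rho> * dirn e (zeta e (zc 1))) - mainT e X (zeta e (zc 1)))"
    using saddle_local[OF S(1)] by blast
  obtain r6 where r6: "r6 > 0" "\<And>\<rho>. 0 < \<rho> \<Longrightarrow> \<rho> \<le> r6 \<Longrightarrow>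
     negl (\<lambda>e X. H e X (zeta e (zc (- 1)) + of_real \<rho> * dirn e (zeta e (zc (- 1))))
       - H e X (zeta e (zc (- 1)) - of_real \<rho> * dirn e (zeta e (zc (- 1)))) - mainT e X (zeta e (zc (- 1))))"
    using saddle_local[OF S(2)] by blast
  have main: "negl (\<lambda>e X. Hlim 1 e X - Hlim (- 1) e X - (\<Sum>z0\<in>D. mainT e X (zeta e z0)))"
  proof (cases "cos \<beta> = 0")
    case True
    then have eq: "zc (- 1) = zc 1" by (simp add: zc_def hline_def)
    define \<rho> where "\<rho> = min r1 (min r2 r5)"
    have \<rho>: "0 < \<rho>" "\<rho> \<le> r1" "\<rho> \<le> r2" "\<rho> \<le> r5" using r1 r2 r5 by (auto simp: \<rho>_def)
    have "negl (\<lambda>e X. Hlim 1 e X - Hlim (- 1) e X - mainT e X (zeta e (zc 1)))"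
      using negl_add[OF negl_diff[OF r1(2)[OF \<rho>(1,2)] r2(2)[OF \<rho>(1,3)]] r5(2)[OF \<rho>(1,4)]]
      unfolding eq by (simp add: algebra_simps)
    then show ?thesis by (simp add: D_def eq)
  next
    case False
    then have cb: "cos \<beta> > 0" using nr(6) by simp
    \<comment> \<open>The bound \<open>varrho * cos \<beta>\<close> keeps the two inner ends from
      passing each other on the chord.\<close>
    define \<rho> where "\<rho> = min (min (min r1 r2) (min r3 r4)) (min (min r5 r6) (varrho * cos \<beta>))"
    have \<rho>: "0 < \<rho>" "\<rho> \<le> r1" "\<rho> \<le> r2" "\<rho> \<le> r3" "\<rho> \<le> r4" "\<rho> \<le> r5" "\<rho> \<le> r6" "\<rho> \<le> varrho * cos \<beta>"
      using r1 r2 r3 r4 r5 r6 cb varrho_pos by (auto simp: \<rho>_def)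
    have N: "negl (\<lambda>e X. H e X (zc 1 - of_real (1 * \<rho>)) - H e X (zc (- 1) - of_real (- 1 * \<rho>)))"
    proof (rule negl_segment[of "zc (- 1) - of_real (- 1 * \<rho>)" "zc 1 - of_real (1 * \<rho>)"])
      show "closed_segment (zc (- 1) - of_real (- 1 * \<rho>)) (zc 1 - of_real (1 * \<rho>)) \<subseteq> Omega"
      proof
        fix z assume "z \<in> closed_segment (zc (- 1) - of_real (- 1 * \<rho>)) (zc 1 - of_real (1 * \<rho>))"
        then obtain k where k: "0 \<le> k" "k \<le> 1"
          "z = (1 - k) *\<^sub>R (zc (- 1) - of_real (- 1 * \<rho>)) + k *\<^sub>R (zc 1 - of_real (1 * \<rho>))"
          by (auto simp: closed_segment_def)
        define Q where "Q = varrho * cos \<beta> - \<rho>"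
        have Q: "0 \<le> Q" "Q < varrho * cos \<beta>" using \<rho> by (auto simp: Q_def)
        have re: "Re z = (2 * k - 1) * Q"
          by (simp add: k(3) zc_def hline_def Q_def algebra_simps)
        have im: "Im z = varrho * sin \<beta>"
          by (simp add: k(3) zc_Im algebra_simps)
        have "\<bar>Re z\<bar> \<le> 1 * Q" unfolding re abs_mult using k Q by (intro mult_mono) auto
        then show "z \<in> Omega" using Q im by (intro chord_Omega[OF L]) auto
      qed
    qed auto
    have ne: "zc 1 \<noteq> zc (- 1)" using cb varrho_pos by (simp add: zc_def hline_def complex_eq_iff)
    have "negl (\<lambda>e X. Hlim 1 e X - Hlim (- 1) e X - (mainT e X (zeta e (zc 1)) + mainT e X (zeta e (zc (- 1)))))"
      using negl_add[OF negl_add[OF negl_diff[OF r1(2)[OF \<rho>(1,2)] r2(2)[OF \<rho>(1,3)]]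
            negl_add[OF r5(2)[OF \<rho>(1,6)] r6(2)[OF \<rho>(1,7)]]]
          negl_add[OF negl_diff[OF r3(2)[OF \<rho>(1,4)] r4(2)[OF \<rho>(1,5)]] N]]
      by (simp add: algebra_simps)
    then show ?thesis by (simp add: D_def ne)
  qed
  have rest: "negl (\<lambda>e X. \<Sum>z0\<in>Stat 0 - D. mainT e X (zeta e z0))"
    by (rule negl_sum) (use finite_Stat_0 MM_0_nonreal(2)[OF L] in \<open>auto simp: D_def intro!: negl_mainT\<close>)
  have "(\<Sum>z0\<in>Stat 0. mainT e X (zeta e z0)) = (\<Sum>z0\<in>D. mainT e X (zeta e z0)) + (\<Sum>z0\<in>Stat 0 - D. mainT e X (zeta e z0))" for e X
    using sum.subset_diff[OF D finite_Stat_0] by (simp add: add.commute)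
  then show ?thesis using negl_diff[OF main rest] by (simp add: algebra_simps)
qed

theorem asymptotics:
  "negl (\<lambda>e X. Hlim 1 e X - Hlim (- 1) e X - (\<Sum>z\<in>Stat e. mainT e X z))"
proof -
  have "negl (\<lambda>e X. Hlim 1 e X - Hlim (- 1) e X - (\<Sum>z0\<in>Stat 0. mainT e X (zeta e z0)))"
    using asymptotics_real_case asymptotics_nonreal_case lead_nonzero[of 1] lead_nonzero[of "- 1"] by (metis linorder_less_linear)
  then show ?thesis
  proof (rule negl_cong[rotated])
    show "eventually (\<lambda>e. \<forall>X. adm X \<longrightarrow> Hlim 1 e X - Hlim (- 1) e X - (\<Sum>z0\<in>Stat 0. mainT e X (zeta e z0))
        = Hlim 1 e X - Hlim (- 1) e X - (\<Sum>z\<in>Stat e. mainT e X z)) (at_right 0)"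
      using zeta_Stat
    proof eventually_elim
      case (elim e)
      then show ?case by (simp add: sum.reindex)
    qed
  qed
qed

section \<open>Size of the integral\<close>

lemma weight_nonzero: "z \<noteq> 0 \<Longrightarrow> weight z \<noteq> 0"
  by (simp add: weight_def)

lemma eventually_Stat:
  assumes "\<And>z0. z0 \<in> Stat 0 \<Longrightarrow> eventually (\<lambda>e. P e (zeta e z0)) (at_right 0)"
  shows "eventually (\<lambda>e. \<forall>z\<in>Stat e. P e z) (at_right 0)"
proof -
  have "eventually (\<lambda>e. \<forall>z0\<in>Stat 0. P e (zeta e z0)) (at_right 0)"
    using finite_Stat_0 assms by (intro eventually_ball_finite) auto
  then show ?thesis using zeta_Stat by eventually_elim auto
qed

lemma eventually_regular:
  "eventually (\<lambda>e. \<forall>z\<in>Stat e. ddPhi e z \<noteq> 0 \<and> Re (dirn e z) > 0) (at_right 0)"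
proof (rule eventually_Stat)
  fix z0 assume z0: "z0 \<in> Stat 0"
  have nz: "ddPhi 0 z0 \<noteq> 0" using root_0(6)[of z0] z0 by (simp add: Stat_def)
  have "eventually (\<lambda>e. ddPhi e (zeta e z0) \<noteq> 0) (at_right 0)"
    using Phi_tendsto(2)[OF zeta_tendsto[OF z0]] nz by (rule tendsto_imp_eventually_ne)
  moreover have "eventually (\<lambda>e. Re (dirn e (zeta e z0)) > 0) (at_right 0)"
    by (rule order_tendstoD(1)[OF tendsto_Re[OF dirn_tendsto[OF z0]] dirn_0(3)[OF z0]])
  ultimately show "eventually (\<lambda>e. ddPhi e (zeta e z0) \<noteq> 0 \<and> Re (dirn e (zeta e z0)) > 0) (at_right 0)"
    by eventually_elim simp
qed

text \<open>The lower bound is what turns an absolute error into a relative one: the main term of a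
  dominating point is not smaller than its expected size. It holds because the finitely many
  unperturbed points are nonzero and their second derivatives finite.\<close>

lemma amplitude_bounds:
  obtains k1 k2 where "k1 > 0" "eventually (\<lambda>e. \<forall>z\<in>Stat e.
     k1 \<le> cmod (weight z) * sqrt (2 * pi / cmod (ddPhi e z)) \<and>
     cmod (weight z) * sqrt (2 * pi / cmod (ddPhi e z)) \<le> k2) (at_right 0)"
proof -
  define a where "a = (\<lambda>z. cmod (weight z) * sqrt (2 * pi / cmod (ddPhi 0 z)))"
  have apos: "a z > 0" if "z \<in> Stat 0" for z
    using weight_nonzero[OF root_0(1)[of z]] root_0(6)[of z] that by (simp add: a_def Stat_def)
  define k1 where "k1 = Min (a ` Stat 0) / 2"
  define k2 where "k2 = Max (a ` Stat 0) + 1"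
  have "Min (a ` Stat 0) > 0"
    using finite_Stat_0 Stat_0_nonempty apos by (subst Min_gr_iff) auto
  then have k1: "k1 > 0" by (simp add: k1_def)
  show thesis
  proof (rule that[OF k1], rule eventually_Stat)
    fix z0 assume z0: "z0 \<in> Stat 0"
    have nz: "ddPhi 0 z0 \<noteq> 0" using root_0(6)[of z0] z0 by (simp add: Stat_def)
    have t: "((\<lambda>e. cmod (weight (zeta e z0)) * sqrt (2 * pi / cmod (ddPhi e (zeta e z0)))) \<longlongrightarrow> a z0) (at_right 0)"
      unfolding a_def using nz by (intro tendsto_intros weight_tendsto Phi_tendsto zeta_tendsto z0) auto
    have "Min (a ` Stat 0) \<le> a z0" "a z0 \<le> Max (a ` Stat 0)" using finite_Stat_0 z0 by auto
    then have "k1 < a z0" "a z0 < k2" using apos[OF z0] k1 by (auto simp: k1_def k2_def)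
    from order_tendstoD(1)[OF t this(1)] order_tendstoD(2)[OF t this(2)]
    show "eventually (\<lambda>e. k1 \<le> cmod (weight (zeta e z0)) * sqrt (2 * pi / cmod (ddPhi e (zeta e z0))) \<and>
     cmod (weight (zeta e z0)) * sqrt (2 * pi / cmod (ddPhi e (zeta e z0))) \<le> k2) (at_right 0)"
      by eventually_elim simp
  qed
qed

lemma MM_attained: "eventually (\<lambda>e. finite (Stat e) \<and> card (Stat e) \<le> card (Stat 0) \<and>
    (\<exists>z\<in>Stat e. Re (Phi e z) = MM e)) (at_right 0)"
  using zeta_Stat
proof eventually_elim
  case (elim e)
  then have f: "finite (Stat e)" "Stat e \<noteq> {}" using finite_Stat_0 Stat_0_nonempty by auto
  then have "MM e \<in> (\<lambda>z. Re (Phi e z)) ` Stat e" unfolding MM_def by (intro Max_in) auto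
  moreover have "card (Stat e) \<le> card (Stat 0)" using elim finite_Stat_0 card_image_le[of "Stat 0" "zeta e"] by simp
  ultimately show ?case using f by auto
qed

text \<open>Convergence of the heights would not do, since \<open>MM e\<close> gets multiplied by an
  unbounded \<open>X\<close>. Real stationary points stay real, where the phase is purely imaginary,
  and all others have a negative limiting height.\<close>

lemma MM_nonpos: "eventually (\<lambda>e. MM e \<le> 0) (at_right 0)"
proof -
  have "eventually (\<lambda>e. \<forall>z\<in>Stat e. Re (Phi e z) \<le> 0) (at_right 0)"
  proof (rule eventually_Stat)
    fix z0 assume z0: "z0 \<in> Stat 0"
    show "eventually (\<lambda>e. Re (Phi e (zeta e z0)) \<le> 0) (at_right 0)"
    proof (cases "Im z0 = 0")
      case True
      show ?thesis using zeta_real[OF z0 True]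
      proof eventually_elim
        case (elim e)
        then obtain x where x: "zeta e z0 = of_real x" by (metis complex_is_Real_iff Reals_cases)
        have "Phi e (of_real x) = \<i> * of_real (x - (\<Sum>j=2..n. b j * e ^ (n - j) * x ^ j))" by (simp add: Phi_def)
        then show ?case unfolding x by (simp del: of_real_diff)
      qed
    next
      case False
      have "1 - 1 / real n > 0" using n by (simp add: field_simps)
      moreover have "Im z0 > 0" using False z0 by (simp add: Stat_def)
      ultimately have "- (1 - 1 / real n) * Im z0 < 0" unfolding mult_minus_left neg_less_0_iff_less by (rule mult_pos_pos)
      then have "Re (Phi 0 z0) < 0" unfolding Re_Phi_0_Stat[OF z0] .
      from order_tendstoD(2)[OF tendsto_Re[OF Phi_tendsto(1)[OF zeta_tendsto[OF z0]]] this]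
      show ?thesis by eventually_elim simp
    qed
  qed
  then show ?thesis using MM_attained by eventually_elim force
qed

text \<open>The unperturbed level is \<open>- (2 * \<mu>)\<close>; half of it survives for small
  \<open>e\<close>.\<close>

lemma MM_negative:
  assumes L: "lead 1 < 0" "lead (- 1) < 0"
  obtains \<mu> where "\<mu> > 0" "eventually (\<lambda>e. MM e \<le> - \<mu>) (at_right 0)"
proof -
  define \<mu> where "\<mu> = (1 - 1 / real n) * (varrho * sin \<beta>) / 2"
  have "1 - 1 / real n > 0" using n by (simp add: field_simps)
  then have \<mu>: "\<mu> > 0" using no_real_root[OF L] varrho_pos by (simp add: \<mu>_def)
  have M: "MM 0 = - (2 * \<mu>)" unfolding MM_0_nonreal(1)[OF L] \<mu>_def mult_minus_left by simp
  have "eventually (\<lambda>e. \<forall>z\<in>Stat e. Re (Phi e z) \<le> - \<mu>) (at_right 0)"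
  proof (rule eventually_Stat)
    fix z0 assume z0: "z0 \<in> Stat 0"
    have "Re (Phi 0 z0) \<le> MM 0" unfolding MM_def using finite_Stat_0 z0 by (intro Max_ge) auto
    then have "Re (Phi 0 z0) < - \<mu>" using M \<mu> by simp
    from order_tendstoD(2)[OF tendsto_Re[OF Phi_tendsto(1)[OF zeta_tendsto[OF z0]]] this]
    show "eventually (\<lambda>e. Re (Phi e (zeta e z0)) \<le> - \<mu>) (at_right 0)" by eventually_elim simp
  qed
  then have "eventually (\<lambda>e. MM e \<le> - \<mu>) (at_right 0)" using MM_attained by eventually_elim force
  then show thesis using \<mu> that by blast
qed

definition J :: "real \<Rightarrow> real \<Rightarrow> complex" where
  "J e X = Hlim 1 e X - Hlim (- 1) e X"

text \<open>The whole error is absorbed by the factor of a dominating stationary point.\<close>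

lemma J_expansion:
  obtains C where "C \<ge> 0" "eventually (\<lambda>e. \<forall>X. adm X \<longrightarrow> (\<exists>E. (\<forall>z. cmod (E z) \<le> C / X) \<and>
      J e X = (\<Sum>z\<in>Stat e. mainT e X z * (1 + E z)))) (at_right 0)"
proof -
  obtain k1 k2 where k1: "k1 > 0" and ev1: "eventually (\<lambda>e. \<forall>z\<in>Stat e.
     k1 \<le> cmod (weight z) * sqrt (2 * pi / cmod (ddPhi e z)) \<and>
     cmod (weight z) * sqrt (2 * pi / cmod (ddPhi e z)) \<le> k2) (at_right 0)"
    by (rule amplitude_bounds)
  obtain C where C: "eventually (\<lambda>e. \<forall>X. adm X \<longrightarrow>
     cmod (J e X - (\<Sum>z\<in>Stat e. mainT e X z)) \<le> C * X powr (- 3 / 2) * exp (X * MM e)) (at_right 0)"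
    using asymptotics unfolding negl_def J_def by blast
  show thesis
  proof (rule that[of "\<bar>C\<bar> / k1"])
    show "eventually (\<lambda>e. \<forall>X. adm X \<longrightarrow> (\<exists>E. (\<forall>z. cmod (E z) \<le> \<bar>C\<bar> / k1 / X) \<and>
      J e X = (\<Sum>z\<in>Stat e. mainT e X z * (1 + E z)))) (at_right 0)"
      using ev1 C MM_attained eventually_regular
    proof eventually_elim
      case (elim e)
      obtain z1 where z1: "z1 \<in> Stat e" "Re (Phi e z1) = MM e" using elim(3) by blast
      show ?case
      proof (intro allI impI)
        fix X assume a: "adm X"
        then have X: "X > 0" by (simp add: adm_def)
        define err where "err = J e X - (\<Sum>z\<in>Stat e. mainT e X z)"
        have err: "cmod err \<le> \<bar>C\<bar> * X powr (- 3 / 2) * exp (X * MM e)"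
        proof -
          have "cmod err \<le> C * X powr (- 3 / 2) * exp (X * MM e)" unfolding err_def using elim(2) a by blast
          also have "\<dots> \<le> \<bar>C\<bar> * X powr (- 3 / 2) * exp (X * MM e)" by (intro mult_right_mono) simp_all
          finally show ?thesis .
        qed
        have nm: "cmod (mainT e X z1) = (exp (X * MM e) * X powr (- 1 / 2)) * (cmod (weight z1) * sqrt (2 * pi / cmod (ddPhi e z1)))"
          using norm_mainT[of e z1 X] elim(4) z1 X by simp
        have lo: "(exp (X * MM e) * X powr (- 1 / 2)) * k1 \<le> cmod (mainT e X z1)"
          unfolding nm using elim(1) z1(1) by (intro mult_left_mono) auto
        have pos: "(exp (X * MM e) * X powr (- 1 / 2)) * k1 > 0" using X k1 by simp
        then have ne: "mainT e X z1 \<noteq> 0" using lo by auto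
        define E where "E = (\<lambda>z. if z = z1 then err / mainT e X z1 else 0)"
        have "cmod (err / mainT e X z1) \<le> (\<bar>C\<bar> * X powr (- 3 / 2) * exp (X * MM e)) / ((exp (X * MM e) * X powr (- 1 / 2)) * k1)"
          unfolding norm_divide by (intro frac_le err lo pos) auto
        also have "\<dots> = \<bar>C\<bar> / k1 * (X powr (- 3 / 2) / X powr (- 1 / 2))" using k1 by (simp add: field_simps)
        also have "X powr (- 3 / 2) / X powr (- 1 / 2) = 1 / X"
        proof -
          have "X powr (- 3 / 2) / X powr (- 1 / 2) = X powr (- 3 / 2 - - 1 / 2)" by (rule powr_diff[symmetric])
          also have "- 3 / 2 - - 1 / 2 = (- 1 :: real)" by simp
          finally show ?thesis using X by (simp add: powr_minus_divide)
        qed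
        finally have Eb: "cmod (E z) \<le> \<bar>C\<bar> / k1 / X" for z using k1 X by (simp add: E_def)
        have "(\<Sum>z\<in>Stat e. mainT e X z * (1 + E z)) = (\<Sum>z\<in>Stat e. mainT e X z) + (\<Sum>z\<in>Stat e. if z = z1 then err else 0)"
          unfolding sum.distrib[symmetric] by (rule sum.cong) (auto simp: E_def ne field_simps)
        also have "\<dots> = J e X" using elim(3) z1(1) by (simp add: err_def)
        finally show "\<exists>E. (\<forall>z. cmod (E z) \<le> \<bar>C\<bar> / k1 / X) \<and> J e X = (\<Sum>z\<in>Stat e. mainT e X z * (1 + E z))"
          using Eb by metis
      qed
    qed
  qed (use k1 in simp)
qed

lemma J_bound:
  obtains C where "C \<ge> 0" "eventually (\<lambda>e. \<forall>X. X \<ge> 1 \<longrightarrow> cmod (J e X) \<le> C * X powr (- 1 / 2) * exp (X * MM e)) (at_right 0)"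
proof -
  obtain k1 k2 where k1: "k1 > 0" and ev1: "eventually (\<lambda>e. \<forall>z\<in>Stat e.
     k1 \<le> cmod (weight z) * sqrt (2 * pi / cmod (ddPhi e z)) \<and>
     cmod (weight z) * sqrt (2 * pi / cmod (ddPhi e z)) \<le> k2) (at_right 0)"
    by (rule amplitude_bounds)
  obtain C where C: "C \<ge> 0" "eventually (\<lambda>e. \<forall>X. adm X \<longrightarrow> (\<exists>E. (\<forall>z. cmod (E z) \<le> C / X) \<and>
      J e X = (\<Sum>z\<in>Stat e. mainT e X z * (1 + E z)))) (at_right 0)"
    by (rule J_expansion)
  show thesis
  proof (rule that[of "real (card (Stat 0)) * (\<bar>k2\<bar> * (1 + C))"])
    show "eventually (\<lambda>e. \<forall>X. X \<ge> 1 \<longrightarrow> cmod (J e X)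
        \<le> real (card (Stat 0)) * (\<bar>k2\<bar> * (1 + C)) * X powr (- 1 / 2) * exp (X * MM e)) (at_right 0)"
      using ev1 C(2) MM_attained MM_ge eventually_regular
    proof eventually_elim
      case (elim e)
      show ?case
      proof (intro allI impI)
        fix X :: real assume X1: "X \<ge> 1"
        then have a: "adm X" and X: "X > 0" by (auto simp: adm_def)
        obtain E where E: "\<And>z. cmod (E z) \<le> C / X" "J e X = (\<Sum>z\<in>Stat e. mainT e X z * (1 + E z))"
          using elim(2) a by blast
        define T where "T = \<bar>k2\<bar> * (1 + C) * X powr (- 1 / 2) * exp (X * MM e)"
        have T0: "T \<ge> 0" using C by (simp add: T_def)
        have "cmod (mainT e X z * (1 + E z)) \<le> T" if z: "z \<in> Stat e" for z
        proof -
          have "C / X \<le> C / 1" using C(1) X1 by (intro divide_left_mono) auto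
          then have "cmod (E z) \<le> C" using E(1)[of z] by simp
          then have e1: "cmod (1 + E z) \<le> 1 + C" using norm_triangle_ineq[of 1 "E z"] by simp
          have "X * Re (Phi e z) \<le> X * MM e" using elim(4) z X by (intro mult_left_mono) auto
          then have A: "exp (X * Re (Phi e z)) \<le> exp (X * MM e)" by simp
          have "cmod (weight z) * sqrt (2 * pi / cmod (ddPhi e z)) \<le> k2" using elim(1) z by blast
          then have "cmod (weight z) * sqrt (2 * pi / cmod (ddPhi e z)) \<le> \<bar>k2\<bar>" by linarith
          from mult_mono[OF A this] have "exp (X * Re (Phi e z)) * (cmod (weight z) * sqrt (2 * pi / cmod (ddPhi e z))) * X powr (- 1 / 2)
              \<le> exp (X * MM e) * \<bar>k2\<bar> * X powr (- 1 / 2)"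
            by (intro mult_right_mono) simp_all
          moreover have "cmod (mainT e X z) = exp (X * Re (Phi e z)) * (cmod (weight z) * sqrt (2 * pi / cmod (ddPhi e z))) * X powr (- 1 / 2)"
            using norm_mainT[of e z X] elim(5) z X by simp
          ultimately have "cmod (mainT e X z) \<le> exp (X * MM e) * \<bar>k2\<bar> * X powr (- 1 / 2)" by simp
          from mult_mono[OF this e1] have "cmod (mainT e X z) * cmod (1 + E z) \<le> (exp (X * MM e) * \<bar>k2\<bar> * X powr (- 1 / 2)) * (1 + C)"
            by simp
          then show ?thesis by (simp add: norm_mult T_def mult_ac)
        qed
        then have "cmod (J e X) \<le> real (card (Stat e)) * T"
          unfolding E(2) by (rule sum_norm_bound)
        also have "\<dots> \<le> real (card (Stat 0)) * T" using elim(3) T0 by (intro mult_right_mono) auto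
        finally show "cmod (J e X) \<le> real (card (Stat 0)) * (\<bar>k2\<bar> * (1 + C)) * X powr (- 1 / 2) * exp (X * MM e)"
          by (simp add: T_def mult.assoc)
      qed
    qed
  qed (use C in simp)
qed

section \<open>From the primitive to the contour integral\<close>

lemma scaled_primitive:
  assumes s: "s \<noteq> 0" and f: "\<And>z. f (of_real s * z) = c * F e X z" and k: "k / of_real s \<in> cut"
  shows "((\<lambda>k. of_real s * c * H e X (k / of_real s)) has_field_derivative f k) (at k)"
proof -
  have "((\<lambda>k. k / of_real s) has_field_derivative 1 / of_real s) (at k)"
    using s by (auto intro!: derivative_eq_intros)
  from DERIV_chain2[OF H_deriv[OF k] this]
  have "((\<lambda>k. H e X (k / of_real s)) has_field_derivative F e X (k / of_real s) * (1 / of_real s)) (at k)" .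
  from DERIV_cmult[OF this, of "of_real s * c"]
  have "((\<lambda>k. of_real s * c * H e X (k / of_real s)) has_field_derivative c * F e X (k / of_real s)) (at k)"
    using s by (simp add: field_simps)
  then show ?thesis using f[of "k / of_real s"] s by simp
qed

text \<open>The two semicircles make up a full circle around the pole; this is how a path above 0 is
  exchanged for one below it.\<close>

lemma arc_integral_combine:
  assumes hol: "f holomorphic_on UNIV - {0}" and r: "0 < r"
    and U: "(f has_contour_integral U) (part_circlepath 0 r 0 pi)"
    and V: "(f has_contour_integral V) (part_circlepath 0 r pi (2 * pi))"
  shows "U + V = 2 * of_real pi * \<i> * residue f 0"
proof -
  have "((\<lambda>t. f (0 + r * cis t) * r * \<i> * cis t) has_integral U) {0..pi}"
    using U by (subst (asm) has_contour_integral_part_circlepath_iff) auto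
  moreover have "((\<lambda>t. f (0 + r * cis t) * r * \<i> * cis t) has_integral V) {pi..2 * pi}"
    using V by (subst (asm) has_contour_integral_part_circlepath_iff) auto
  ultimately have "((\<lambda>t. f (0 + r * cis t) * r * \<i> * cis t) has_integral U + V) {0..2 * pi}"
    by (intro has_integral_combine[of 0 pi "2 * pi"]) auto
  then have "(f has_contour_integral U + V) (circlepath 0 r)"
    unfolding circlepath_def by (subst has_contour_integral_part_circlepath_iff) auto
  moreover have "(f has_contour_integral 2 * pi * \<i> * residue f 0) (circlepath 0 r)"
    using hol r by (intro base_residue[of UNIV]) auto
  ultimately show ?thesis using has_contour_integral_unique by fastforce
qed

lemma filterlim_scaled_limit:
  assumes \<tau>: "\<tau> = 1 \<or> \<tau> = -1" and p: "p \<ge> 0" and e: "0 \<le> e" "e \<le> 1" and X: "X > 0" and q: "q > 0"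
  shows "((\<lambda>x. H e X (of_real (\<tau> * (x / q)))) \<longlongrightarrow> Hlim \<tau> e X) at_top"
proof -
  have "filterlim (\<lambda>x::real. x / q) at_top at_top" using q by real_asymp
  from filterlim_compose[OF real_axis_limit[OF \<tau> p e X] this] show ?thesis by simp
qed

text \<open>In the variable of the contour the slit is the ray from 0 through
  \<open>- \<i> * s\<close>. For \<open>s < 0\<close> it points upwards and cuts the semicircle of
  the contour, so the arc is replaced by the lower one and the residue appears. The scaled line then
  runs backwards, which turns \<open>s\<close> into \<open>\<bar>s\<bar>\<close>.\<close>

lemma contour_limit:
  assumes s: "s \<noteq> 0" and f: "\<And>z. f (of_real s * z) = c * F e X z"
    and p: "p \<ge> 0" and m: "m = p - 1" and r: "0 < r" and e: "0 \<le> e" "e \<le> 1" and X: "X > 0"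
    and hol: "f holomorphic_on UNIV - {0}" and hol0: "p = 0 \<Longrightarrow> f holomorphic_on UNIV"
  shows "((\<lambda>(a, b). contour_integral (contour r m a b) f) \<longlongrightarrow>
      of_real \<bar>s\<bar> * c * J e X - (if s < 0 then 2 * of_real pi * \<i> * residue f 0 else 0)) (at_top \<times>\<^sub>F at_top)"
proof -
  define G where "G = (\<lambda>k. of_real s * c * H e X (k / of_real s))"
  have G: "(G has_field_derivative f k) (at k)" if "k / of_real s \<in> cut" for k
    unfolding G_def by (rule scaled_primitive[OF s f that])
  define R where "R = (if s < 0 then 2 * of_real pi * \<i> * residue f 0 else 0)"
  have lims: "((\<lambda>x. G (of_real x)) \<longlongrightarrow> of_real s * c * Hlim (sgn s) e X) at_top"
    "((\<lambda>x. G (of_real (- x))) \<longlongrightarrow> of_real s * c * Hlim (- sgn s) e X) at_top"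
  proof -
    have sg: "sgn s = 1 \<or> sgn s = -1" "- sgn s = 1 \<or> - sgn s = -1" "\<bar>s\<bar> > 0" using s by (auto simp: sgn_if)
    have "x / s = sgn s * (x / \<bar>s\<bar>)" "- x / s = - sgn s * (x / \<bar>s\<bar>)" for x using s by (auto simp: sgn_if abs_if)
    then have "of_real x / of_real s = complex_of_real (sgn s * (x / \<bar>s\<bar>))"
      "of_real (- x) / of_real s = complex_of_real (- sgn s * (x / \<bar>s\<bar>))" for x
      unfolding of_real_divide[symmetric] by metis+
    then show "((\<lambda>x. G (of_real x)) \<longlongrightarrow> of_real s * c * Hlim (sgn s) e X) at_top"
      "((\<lambda>x. G (of_real (- x))) \<longlongrightarrow> of_real s * c * Hlim (- sgn s) e X) at_top"
      unfolding G_def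
      using tendsto_mult_left[OF filterlim_scaled_limit[OF sg(1) p e X sg(3)], of "of_real s * c"]
        tendsto_mult_left[OF filterlim_scaled_limit[OF sg(2) p e X sg(3)], of "of_real s * c"]
      by (simp_all del: of_real_mult of_real_divide of_real_minus)
  qed
  have "((\<lambda>x. G (of_real (snd x)) - G (of_real (- fst x)) - R) \<longlongrightarrow>
      of_real s * c * Hlim (sgn s) e X - of_real s * c * Hlim (- sgn s) e X - R) (at_top \<times>\<^sub>F at_top)"
    by (intro tendsto_diff tendsto_const filterlim_compose[OF lims(1) filterlim_snd] filterlim_compose[OF lims(2) filterlim_fst])
  moreover have "of_real s * c * Hlim (sgn s) e X - of_real s * c * Hlim (- sgn s) e X - R = of_real \<bar>s\<bar> * c * J e X - R"
    using s by (auto simp: J_def sgn_if abs_if algebra_simps)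
  ultimately have L: "((\<lambda>x. G (of_real (snd x)) - G (of_real (- fst x)) - R) \<longlongrightarrow> of_real \<bar>s\<bar> * c * J e X - R) (at_top \<times>\<^sub>F at_top)"
    by simp
  have main: "contour_integral (contour r m a d) f = G (of_real d) - G (of_real (- a)) - R" if ad: "a > r" "d > r" for a d
  proof (cases "p = 0")
    case True
    have Gall: "(G has_field_derivative f k) (at k)" for k using True by (intro G cutI) simp
    have "R = 0" using residue_holo[OF open_UNIV UNIV_I hol0[OF True]] by (simp add: R_def)
    moreover have "(f has_contour_integral (G (pathfinish (linepath (of_real (- a)) (of_real d))) - G (pathstart (linepath (of_real (- a)) (of_real d)))))
        (linepath (of_real (- a)) (of_real d))"
      by (rule contour_integral_primitive[where S = UNIV]) (use Gall in auto)
    ultimately show ?thesis using True m by (simp add: contour_def contour_integral_unique)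
  next
    case False
    then have pp: "p > 0" using p by simp
    define l1 l2 where "l1 = linepath (complex_of_real (- a)) (of_real (- r))" and "l2 = linepath (complex_of_real r) (of_real d)"
    have path: "(f has_contour_integral (G (pathfinish g) - G (pathstart g))) g"
      if "valid_path g" "path_image g \<subseteq> {k. k / of_real s \<in> cut}" for g
      by (rule contour_integral_primitive[where S = "{k. k / of_real s \<in> cut}"])
        (use that G in \<open>auto intro: has_field_derivative_at_within\<close>)
    have realcut: "complex_of_real x / of_real s \<in> cut" if "x \<noteq> 0" for x
      using that s by (intro cutI) (simp flip: of_real_divide)
    have i1: "(f has_contour_integral (G (of_real (- r)) - G (of_real (- a)))) l1"
    proof -
      have "path_image l1 \<subseteq> {k. k / of_real s \<in> cut}"
      proof
        fix k assume "k \<in> path_image l1"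
        then have "k \<in> closed_segment (complex_of_real (- a)) (of_real (- r))" by (simp add: l1_def)
        then obtain x where x: "k = of_real x" "x \<in> closed_segment (- a) (- r)"
          unfolding closed_segment_of_real by auto
        then have "x \<noteq> 0" using ad r by (auto simp: closed_segment_eq_real_ivl)
        then show "k \<in> {k. k / of_real s \<in> cut}" using realcut x(1) by simp
      qed
      from path[OF _ this] show ?thesis by (simp add: l1_def)
    qed
    have i2: "(f has_contour_integral (G (of_real d) - G (of_real r))) l2"
    proof -
      have "path_image l2 \<subseteq> {k. k / of_real s \<in> cut}"
      proof
        fix k assume "k \<in> path_image l2"
        then have "k \<in> closed_segment (complex_of_real r) (of_real d)" by (simp add: l2_def)
        then obtain x where x: "k = of_real x" "x \<in> closed_segment r d"
          unfolding closed_segment_of_real by auto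
        then have "x \<noteq> 0" using ad r by (auto simp: closed_segment_eq_real_ivl)
        then show "k \<in> {k. k / of_real s \<in> cut}" using realcut x(1) by simp
      qed
      from path[OF _ this] show ?thesis by (simp add: l2_def)
    qed
    have arc: "path_image (part_circlepath 0 r u v) \<subseteq> {k. k / of_real s \<in> cut}"
      if uv: "u \<le> v" and im: "\<And>x. u \<le> x \<Longrightarrow> x \<le> v \<Longrightarrow> sin x / s \<ge> 0" for u v
    proof
      fix k assume "k \<in> path_image (part_circlepath 0 r u v)"
      then obtain x where x: "u \<le> x" "x \<le> v" "k = of_real r * cis x"
        using uv by (auto simp: path_image_part_circlepath cis_conv_exp mult_ac)
      have re: "Re (k / of_real s) = r * (cos x / s)" and imk: "Im (k / of_real s) = r * (sin x / s)"
        by (simp_all add: x(3) Re_divide_of_real Im_divide_of_real)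
      show "k \<in> {k. k / of_real s \<in> cut}"
      proof (rule CollectI, rule cutI, cases "cos x = 0")
        case True
        then have "sin x \<noteq> 0" using sin_cos_squared_add[of x] by auto
        then have "sin x / s > 0" using im[OF x(1,2)] s by (simp add: less_le)
        then have "0 < Im (k / of_real s)" unfolding imk by (rule mult_pos_pos[OF r])
        then show "p \<le> 0 \<or> Re (k / of_real s) \<noteq> 0 \<or> 0 < Im (k / of_real s)" by blast
      next
        case False
        then have "Re (k / of_real s) \<noteq> 0" unfolding re using r s by simp
        then show "p \<le> 0 \<or> Re (k / of_real s) \<noteq> 0 \<or> 0 < Im (k / of_real s)" by blast
      qed
    qed
    \<comment> \<open>\<open>U\<close> is the integral over the upper semicircle, taken
      anticlockwise. For \<open>s < 0\<close> the primitive gives only the lower semicircle, and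
      \<open>U\<close> follows from it and the residue.\<close>
    obtain U where U: "(f has_contour_integral U) (part_circlepath 0 r 0 pi)"
      "G (of_real d) - G (of_real (- a)) - R = (G (of_real (- r)) - G (of_real (- a))) + (- U + (G (of_real d) - G (of_real r)))"
    proof (cases "s > 0")
      case True
      have "path_image (part_circlepath 0 r 0 pi) \<subseteq> {k. k / of_real s \<in> cut}"
        using True by (intro arc) (auto intro!: sin_ge_zero divide_nonneg_pos)
      from path[OF _ this]
      have "(f has_contour_integral (G (of_real (- r)) - G (of_real r))) (part_circlepath 0 r 0 pi)"
        by (simp add: exp_pi_i')
      then show thesis using True by (intro that) (auto simp: R_def)
    next
      case False
      then have sneg: "s < 0" using s by simp
      have sin_low: "sin x \<le> 0" if "pi \<le> x" "x \<le> 2 * pi" for x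
        using sin_ge_zero[of "x - pi"] that by simp
      have "path_image (part_circlepath 0 r pi (2 * pi)) \<subseteq> {k. k / of_real s \<in> cut}"
        using sneg by (intro arc) (auto intro!: divide_nonpos_neg sin_low)
      from path[OF _ this]
      have V: "(f has_contour_integral (G (of_real r) - G (of_real (- r)))) (part_circlepath 0 r pi (2 * pi))"
        by (simp add: exp_pi_i' exp_two_pi_i' mult_ac)
      have "f contour_integrable_on part_circlepath 0 r 0 pi"
      proof (rule contour_integrable_continuous_part_circlepath)
        have "0 \<notin> path_image (part_circlepath 0 r 0 pi)" using r by (auto simp: path_image_part_circlepath)
        then show "continuous_on (path_image (part_circlepath 0 r 0 pi)) f"
          by (intro holomorphic_on_imp_continuous_on holomorphic_on_subset[OF hol]) auto
      qed
      then obtain U where U: "(f has_contour_integral U) (part_circlepath 0 r 0 pi)"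
        unfolding contour_integrable_on_def by blast
      have "U + (G (of_real r) - G (of_real (- r))) = R"
        using arc_integral_combine[OF hol r U V] sneg by (simp add: R_def)
      then show thesis using U by (intro that) (auto simp: algebra_simps)
    qed
    have iu: "(f has_contour_integral - U) (part_circlepath 0 r pi 0)"
      using has_contour_integral_reversepath[OF _ U(1)] by simp
    have e1: "pathfinish l1 = pathstart (part_circlepath 0 r pi 0 +++ l2)"
      "pathfinish (part_circlepath 0 r pi 0) = pathstart l2"
      by (simp_all add: l1_def l2_def exp_pi_i')
    have "(f has_contour_integral (G (of_real (- r)) - G (of_real (- a))) + (- U + (G (of_real d) - G (of_real r))))
        (l1 +++ part_circlepath 0 r pi 0 +++ l2)"
      by (intro has_contour_integral_join i1 iu i2) (auto simp: l1_def l2_def e1 exp_pi_i')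
    then show ?thesis
      unfolding U(2) using pp m by (simp add: contour_def l1_def l2_def contour_integral_unique)
  qed
  have "eventually (\<lambda>x. fst x > r \<and> snd x > r) (at_top \<times>\<^sub>F at_top)"
    unfolding eventually_prod_filter
    by (intro exI[of _ "\<lambda>x. x > r"]) (auto simp: eventually_gt_at_top)
  then have "eventually (\<lambda>x. G (of_real (snd x)) - G (of_real (- fst x)) - R
      = (case x of (a, b) \<Rightarrow> contour_integral (contour r m a b) f)) (at_top \<times>\<^sub>F at_top)"
    by eventually_elim (auto simp: main)
  from Lim_transform_eventually[OF L this] show ?thesis by (simp add: R_def)
qed

end

section \<open>Return to the variables x and t\<close>

definition kappa :: "nat \<Rightarrow> real \<Rightarrow> real \<Rightarrow> real" where
  "kappa n x t = (\<bar>x\<bar> / t) powr (1 / (real n - 1))"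

lemma kappa_props:
  assumes "n \<ge> 2" "t > 0" "x \<noteq> 0"
  shows "kappa n x t > 0" "kappa n x t ^ (n - 1) = \<bar>x\<bar> / t" "large_param n x t = \<bar>x\<bar> * kappa n x t"
proof -
  show "kappa n x t > 0" using assms by (simp add: kappa_def)
  have "kappa n x t ^ (n - 1) = (\<bar>x\<bar> / t) powr (1 / (real n - 1) * real (n - 1))"
    using assms unfolding kappa_def by (simp add: powr_powr flip: powr_realpow)
  also have "1 / (real n - 1) * real (n - 1) = 1" using assms by (simp add: of_nat_diff)
  finally show "kappa n x t ^ (n - 1) = \<bar>x\<bar> / t" using assms by simp
  show "large_param n x t = \<bar>x\<bar> * kappa n x t" by (simp add: large_param_def kappa_def)
qed

locale scaled_phase = phase_family n "\<lambda>j. w j * \<sigma> ^ j" p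
  for n :: nat and w :: "nat \<Rightarrow> real" and \<sigma> :: real and p :: int +
  assumes \<sigma>: "\<sigma> = 1 \<or> \<sigma> = -1"
begin

lemma phase_eq_Phi:
  assumes t: "t > 0" and x: "x \<noteq> 0" and s: "sgn x = \<sigma>"
  shows "phase w n x t = Phi (1 / kappa n x t)"
proof
  fix z :: complex
  define k where "k = kappa n x t"
  have k: "k > 0" unfolding k_def by (rule kappa_props[OF n t x])
  have pw: "(\<bar>x\<bar> / t) powr ((real j - real n) / (real n - 1)) = (1 / k) ^ (n - j)" if "j \<le> n" for j
  proof -
    have "(1 / k) ^ (n - j) = k powr (- real (n - j))" using k by (simp add: powr_minus powr_realpow power_one_over inverse_eq_divide)
    also have "\<dots> = (\<bar>x\<bar> / t) powr (1 / (real n - 1) * (- real (n - j)))" unfolding k_def kappa_def by (simp add: powr_powr)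
    also have "1 / (real n - 1) * (- real (n - j)) = (real j - real n) / (real n - 1)" using that by (simp add: of_nat_diff)
    finally show ?thesis ..
  qed
  have "{2..n} = insert n {2..n-1}" using n by auto
  then have "(\<Sum>j=2..n. of_real (w j * \<sigma> ^ j * (1 / k) ^ (n - j)) * z ^ j)
      = of_real (w n * \<sigma> ^ n) * z ^ n + (\<Sum>j=2..n-1. of_real (w j * \<sigma> ^ j * (1 / k) ^ (n - j)) * z ^ j)"
    using n by (subst \<open>{2..n} = _\<close>, subst sum.insert) auto
  also have "(\<Sum>j=2..n-1. of_real (w j * \<sigma> ^ j * (1 / k) ^ (n - j)) * z ^ j) = phase_rest w n x t z"
    unfolding phase_rest_def s
    by (rule sum.cong) (auto simp: pw power_mult_distrib)
  finally show "phase w n x t z = Phi (1 / kappa n x t) z"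
    unfolding phase_def Phi_def k_def[symmetric] s by (simp add: algebra_simps)
qed

lemma exponent_scaling:
  assumes t: "t > 0" and x: "x \<noteq> 0" and s: "sgn x = \<sigma>"
  shows "\<i> * (of_real (\<sigma> * kappa n x t) * z) * of_real x - \<i> * dispersion w n (of_real (\<sigma> * kappa n x t) * z) * of_real t
    = of_real (\<bar>x\<bar> * kappa n x t) * Phi (1 / kappa n x t) z"
proof -
  define k where "k = kappa n x t"
  have k: "k > 0" "k ^ (n - 1) = \<bar>x\<bar> / t" unfolding k_def using kappa_props[OF n t x] by auto
  have sx: "\<sigma> * x = \<bar>x\<bar>" using s by (metis abs_sgn mult.commute)
  \<comment> \<open>The reason for the choice of the scale: the linear and the top term of the
    exponent become equally large.\<close>
  have xt: "\<bar>x\<bar> * k = t * k ^ n" using k t unfolding power_pred(1)[of k] by simp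
  have tm: "\<bar>x\<bar> * k * (w j * \<sigma> ^ j * (1 / k) ^ (n - j)) = t * (w j * (\<sigma> * k) ^ j)" if "j \<in> {2..n}" for j
  proof -
    have "k ^ n = k ^ j * k ^ (n - j)" using that by (simp flip: power_add)
    then have "\<bar>x\<bar> * k * (1 / k) ^ (n - j) = t * k ^ j" unfolding xt using k by (simp add: power_one_over)
    then have "(w j * \<sigma> ^ j) * (\<bar>x\<bar> * k * (1 / k) ^ (n - j)) = (w j * \<sigma> ^ j) * (t * k ^ j)" by simp
    then show ?thesis by (simp add: power_mult_distrib mult_ac)
  qed
  have "of_real (\<bar>x\<bar> * k) * (\<Sum>j=2..n. of_real (w j * \<sigma> ^ j * (1 / k) ^ (n - j)) * z ^ j)
      = (\<Sum>j=2..n. of_real (t * (w j * (\<sigma> * k) ^ j)) * z ^ j)"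
    unfolding sum_distrib_left
    by (rule sum.cong[OF refl]) (simp only: tm[symmetric] of_real_mult mult.assoc)
  also have "\<dots> = of_real t * dispersion w n (of_real (\<sigma> * k) * z)"
    unfolding dispersion_def sum_distrib_left by (simp add: power_mult_distrib mult_ac)
  finally have S: "of_real (\<bar>x\<bar> * k) * (\<Sum>j=2..n. of_real (w j * \<sigma> ^ j * (1 / k) ^ (n - j)) * z ^ j)
      = of_real t * dispersion w n (of_real (\<sigma> * k) * z)" .
  have P: "of_real (\<bar>x\<bar> * k) * Phi (1 / k) z
      = \<i> * (of_real (\<bar>x\<bar> * k) * z - of_real t * dispersion w n (of_real (\<sigma> * k) * z))"
    unfolding S[symmetric] Phi_def by (simp add: algebra_simps)
  have "complex_of_real \<bar>x\<bar> = of_real \<sigma> * of_real x" unfolding sx[symmetric] by simp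
  then show ?thesis unfolding k_def[symmetric] P by (simp add: algebra_simps)
qed

lemma integrand_scaling:
  assumes t: "t > 0" and x: "x \<noteq> 0" and s: "sgn x = \<sigma>" and m: "m = p - 1"
  shows "integrand w n m x t (of_real (\<sigma> * kappa n x t) * z)
    = 1 / of_real (\<sigma> * kappa n x t) powi p * F (1 / kappa n x t) (\<bar>x\<bar> * kappa n x t) z"
proof -
  have "(\<i> * (of_real (\<sigma> * kappa n x t) * z)) powi p = of_real (\<sigma> * kappa n x t) powi p * (\<i> * z) powi p"
    by (simp only: power_int_mult_distrib[symmetric] mult_ac)
  then show ?thesis
    unfolding integrand_def exponent_scaling[OF t x s] F_def m by simp
qed

text \<open>An admissible angle exists by the construction of the descent curve. The directions of
  any two admissible angles have equal squares, and the orientation condition fixes the sign. The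
  factor \<sigma> reflects that the scaled line runs backwards for \<open>x < 0\<close>.\<close>

lemma descent_angle_eq:
  assumes t: "t > 0" and x: "x \<noteq> 0" and s: "sgn x = \<sigma>" and e: "e = 1 / kappa n x t"
    and z: "z \<in> Stat e" and nz: "ddPhi e z \<noteq> 0" and pos: "Re (dirn e z) > 0"
  shows "cis (descent_angle w n x t z) = of_real \<sigma> * dirn e z"
proof -
  have ph: "phase w n x t = Phi e" unfolding e by (rule phase_eq_Phi[OF t x s])
  have \<sigma>2: "(complex_of_real \<sigma>)\<^sup>2 = 1" "\<sigma> * \<sigma> = 1" using \<sigma> by auto
  have crit: "deriv (Phi e) z = 0" using z by (simp add: deriv_Phi Stat_def)
  define d where "d = of_real \<sigma> * dirn e z"
  have d1: "cmod d = 1" using dirn_props(1)[OF nz] \<sigma> by (auto simp: d_def norm_mult)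
  have dd: "d\<^sup>2 * ddPhi e z = - of_real (cmod (ddPhi e z))"
    using dirn_props(2)[OF nz] by (simp add: d_def power_mult_distrib \<sigma>2)
  have cd: "cis (Arg d) = d"
  proof -
    have "d \<noteq> 0" using d1 by auto
    then show ?thesis using d1 cis_Arg[of d] by (simp add: sgn_div_norm)
  qed
  have sre: "\<sigma> * Re d = Re (dirn e z)" using \<sigma>2(2) by (simp add: d_def)
  have "leaves_at_angle (Phi e) z (Arg d)"
    by (rule descent_imp_leaves_at_angle[OF holomorphic_Phi(1) crit, where A = "cmod (ddPhi e z)"])
      (use dd cd nz in \<open>simp_all add: deriv_Phi\<close>)
  moreover have "sgn x * cos (Arg d) > 0"
    using pos sre cd unfolding s by (metis cis.sel(1))
  ultimately have "\<exists>\<theta>. leaves_at_angle (phase w n x t) z \<theta> \<and> sgn x * cos \<theta> > 0" unfolding ph by blast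
  from someI_ex[OF this]
  have "leaves_at_angle (phase w n x t) z (descent_angle w n x t z) \<and> sgn x * cos (descent_angle w n x t z) > 0"
    unfolding descent_angle_def .
  then have \<theta>: "leaves_at_angle (Phi e) z (descent_angle w n x t z)" "\<sigma> * cos (descent_angle w n x t z) > 0"
    unfolding ph s by auto
  have "(cis (descent_angle w n x t z))\<^sup>2 * ddPhi e z = - of_real (cmod (ddPhi e z))"
    using leaves_at_angle_imp_descent[OF holomorphic_Phi(1) crit _ \<theta>(1)] nz by (simp add: deriv_Phi)
  then have "(cis (descent_angle w n x t z))\<^sup>2 * ddPhi e z = d\<^sup>2 * ddPhi e z" unfolding dd .
  then have "(cis (descent_angle w n x t z))\<^sup>2 = d\<^sup>2" using nz by simp
  then have "cis (descent_angle w n x t z) = d \<or> cis (descent_angle w n x t z) = - d" by (simp only: power2_eq_iff)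
  moreover have "cis (descent_angle w n x t z) \<noteq> - d"
  proof
    assume "cis (descent_angle w n x t z) = - d"
    then have "cos (descent_angle w n x t z) = - Re d" by (metis cis.sel(1) uminus_complex.sel(1))
    then show False using \<theta>(2) sre pos by simp
  qed
  ultimately show ?thesis by (simp add: d_def)
qed

lemma osc_integral_eq_J:
  assumes t: "t > 0" and x: "x \<noteq> 0" and s: "sgn x = \<sigma>" and m: "m = p - 1" and p: "p \<ge> 0"
    and r: "0 < r" and k1: "kappa n x t \<ge> 1"
  shows "osc_integral w n r m x t = residue_term w n m x t +
    of_real (kappa n x t / (2 * pi)) / of_real (\<sigma> * kappa n x t) powi p * J (1 / kappa n x t) (\<bar>x\<bar> * kappa n x t)"
proof -
  define k where "k = kappa n x t"
  define f where "f = integrand w n m x t"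
  have k: "k \<ge> 1" using k1 by (simp add: k_def)
  have e: "0 \<le> 1 / k" "1 / k \<le> 1" and X: "\<bar>x\<bar> * k > 0" using k x by auto
  have f: "f (of_real (\<sigma> * k) * z) = 1 / of_real (\<sigma> * k) powi p * F (1 / k) (\<bar>x\<bar> * k) z" for z
    unfolding f_def k_def by (rule integrand_scaling[OF t x s m])
  have hol: "f holomorphic_on UNIV - {0}" "p = 0 \<Longrightarrow> f holomorphic_on UNIV"
    unfolding f_def integrand_def m dispersion_def by (intro holomorphic_intros; auto)+
  have sk: "\<sigma> * k \<noteq> 0" "\<bar>\<sigma> * k\<bar> = k" "\<sigma> * k < 0 \<longleftrightarrow> x < 0" using \<sigma> k s by (auto simp: sgn_if split: if_splits)
  have lim: "((\<lambda>(a, b). contour_integral (contour r m a b) f) \<longlongrightarrow>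
      of_real k * (1 / of_real (\<sigma> * k) powi p) * J (1 / k) (\<bar>x\<bar> * k) - (if x < 0 then 2 * of_real pi * \<i> * residue f 0 else 0))
      (at_top \<times>\<^sub>F at_top)"
    using contour_limit[OF sk(1) f p m r e X hol] unfolding sk(2,3) .
  have "(at_top \<times>\<^sub>F at_top :: (real \<times> real) filter) \<noteq> bot" by (simp add: prod_filter_eq_bot)
  from tendsto_Lim[OF this lim] show ?thesis
    unfolding osc_integral_def residue_term_def f_def[symmetric] k_def[symmetric]
    by (auto simp: indicator_def field_simps)
qed

end

lemma Im_reflected_power:
  assumes "\<tau> = 1 \<or> \<tau> = -1"
  shows "Im ((of_real (\<tau> * s) + \<i> * of_real y) ^ j) = \<tau> ^ (Suc j) * Im ((of_real s + \<i> * of_real y) ^ j)"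
proof (cases "\<tau> = 1")
  case False
  then have \<tau>: "\<tau> = -1" using assms by simp
  define z where "z = complex_of_real s + \<i> * of_real y"
  have "of_real (\<tau> * s) + \<i> * of_real y = - cnj z" by (simp add: \<tau> z_def)
  then have "(of_real (\<tau> * s) + \<i> * of_real y) ^ j = of_real ((- 1) ^ j) * cnj (z ^ j)"
    by (simp add: power_minus[of "cnj z"])
  then show ?thesis unfolding z_def[symmetric] \<tau> by (simp del: of_real_power complex_cnj_power)
qed simp

section \<open>The kernel and its derivatives\<close>

text \<open>
  The \<open>m\<close>-th derivative of the kernel is the integral of \<open>deriv_kernel m\<close> over a contour whose
  ends are the horizontal half-lines \<open>decay_line \<tau>\<close>, where the integrand decays exponentially.
\<close>

locale dispersive =
  fixes n :: nat and w :: "nat \<Rightarrow> real" and t :: real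
  assumes n: "2 \<le> n" and wn: "w n \<noteq> 0" and t: "t > 0"
begin

definition expo :: "real \<Rightarrow> complex \<Rightarrow> complex" where
  "expo x k = exp (\<i> * k * of_real x - \<i> * dispersion w n k * of_real t)"

definition deriv_kernel :: "nat \<Rightarrow> real \<Rightarrow> complex \<Rightarrow> complex" where
  "deriv_kernel q x k = (\<i> * k) ^ q * expo x k"

text \<open>The sign is dictated by the top term of the dispersion relation alone, so the same
  half-lines serve every \<open>x\<close>; this allows differentiation with respect to
  \<open>x\<close>.\<close>

definition height :: "real \<Rightarrow> real" where
  "height \<tau> = - sgn (w n * \<tau> ^ (n - 1))"

definition decay_line :: "real \<Rightarrow> real \<Rightarrow> complex" where
  "decay_line \<tau> s = of_real (\<tau> * s) + \<i> * of_real (height \<tau>)"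

definition eta :: real where "eta = t * \<bar>w n\<bar>"

lemma eta_pos: "eta > 0"
  using t wn by (simp add: eta_def)

lemma abs_height: "\<tau> = 1 \<or> \<tau> = -1 \<Longrightarrow> \<bar>height \<tau>\<bar> = 1"
  using wn by (auto simp: height_def sgn_if)

text \<open>The parameter \<open>v\<close> runs from the real axis to the half-line of exponential
  decay. \<open>x\<close> enters only through the linear coefficient of the exponent, so one
  \<open>S\<close> serves all bounded \<open>x\<close>.\<close>

lemma expo_decay:
  assumes \<tau>: "\<tau> = 1 \<or> \<tau> = -1" and B: "B \<ge> 0"
  obtains S where "S \<ge> 1" "\<And>x s v. \<lbrakk>\<bar>x\<bar> \<le> B; s \<ge> S; 0 \<le> v; v \<le> 1\<rbrakk> \<Longrightarrow>
     cmod (expo x (of_real (\<tau> * s) + \<i> * of_real (v * height \<tau>))) \<le> exp (- (eta * v * s))"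
proof -
  define B' where "B' = B + t * (\<Sum>j=2..n. \<bar>w j\<bar>)"
  have B': "B' \<ge> 0" using B t by (simp add: B'_def sum_nonneg)
  have absp: "\<bar>\<tau> ^ j\<bar> = 1" for j using \<tau> by (auto simp: power_abs)
  obtain S where S: "S \<ge> 1" "S \<ge> 1" "\<And>d s y. \<lbrakk>\<And>j. j \<le> n \<Longrightarrow> \<bar>d j\<bar> \<le> B'; eta \<le> \<bar>d n\<bar>; s \<ge> S; \<bar>y\<bar> \<le> 1; 0 \<le> d n * y\<rbrakk>
    \<Longrightarrow> Im (\<Sum>j\<le>n. of_real (d j) * (of_real s + \<i> * of_real y) ^ j) \<ge> eta * \<bar>y\<bar> * s"
    using Im_real_poly_growth[OF n eta_pos B', of 1] by auto
  show thesis
  proof (rule that[OF S(1)])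
    fix x s v :: real assume x: "\<bar>x\<bar> \<le> B" and s: "s \<ge> S" and v: "0 \<le> v" "v \<le> 1"
    define y where "y = v * height \<tau>"
    have ay: "\<bar>y\<bar> = v" using v abs_height[OF \<tau>] by (simp add: y_def abs_mult)
    \<comment> \<open>Coefficients after reflection to the right half-plane, with \<open>x\<close>
      as the linear one; the imaginary part of the resulting polynomial is minus the real part of
      the exponent.\<close>
    define d where "d = (\<lambda>j. if j = 0 then 0 else if j = 1 then x else - (t * w j * \<tau> ^ Suc j))"
    have dn: "d n = - (t * (w n * \<tau> ^ (n - 1)))"
    proof -
      have "\<tau> ^ Suc n = \<tau> ^ 2 * \<tau> ^ (n - 1)" using n by (simp flip: power_add)
      then show ?thesis using n \<tau> by (auto simp: d_def)
    qed
    have db: "\<bar>d j\<bar> \<le> B'" if j: "j \<le> n" for j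
    proof -
      have "j = 0 \<or> j = 1 \<or> j \<in> {2..n}" using j by auto
      then consider "j = 0" | "j = 1" | "j \<in> {2..n}" by blast
      then show ?thesis
      proof cases
        case 3
        have "\<bar>d j\<bar> = t * \<bar>w j\<bar>" using 3 absp[of "Suc j"] t by (simp add: d_def abs_mult del: power_Suc)
        also have "\<dots> \<le> t * (\<Sum>j=2..n. \<bar>w j\<bar>)"
          using t 3 member_le_sum[of j "{2..n}" "\<lambda>j. \<bar>w j\<bar>"] by (intro mult_left_mono) auto
        finally show ?thesis using B by (simp add: B'_def)
      next
        case 2
        have "0 \<le> t * (\<Sum>j=2..n. \<bar>w j\<bar>)" using t by (simp add: sum_nonneg)
        then show ?thesis using 2 x by (simp add: d_def B'_def)
      qed (use B' in \<open>simp add: d_def\<close>)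
    qed
    have "eta * \<bar>y\<bar> * s \<le> Im (\<Sum>j\<le>n. of_real (d j) * (of_real s + \<i> * of_real y) ^ j)"
    proof (rule S(3)[OF db _ s])
      show "\<bar>y\<bar> \<le> 1" unfolding ay by (rule v(2))
      show "eta \<le> \<bar>d n\<bar>" unfolding dn eta_def using t absp[of "n - 1"] by (simp add: abs_mult)
      have "d n * y = t * v * ((w n * \<tau> ^ (n - 1)) * sgn (w n * \<tau> ^ (n - 1)))"
        unfolding dn y_def height_def by simp
      also have "\<dots> = t * v * \<bar>w n * \<tau> ^ (n - 1)\<bar>" by (metis abs_sgn)
      also have "\<dots> \<ge> 0" using t v by simp
      finally show "0 \<le> d n * y" .
    qed
    also have "\<dots> = (\<Sum>j\<le>n. d j * Im ((of_real s + \<i> * of_real y) ^ j))" by simp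
    also have "\<dots> = x * y + (\<Sum>j=2..n. d j * Im ((of_real s + \<i> * of_real y) ^ j))"
    proof -
      have "{..n} = insert 0 (insert 1 {2..n})" using n by auto
      then show ?thesis by (simp add: d_def)
    qed
    also have "(\<Sum>j=2..n. d j * Im ((of_real s + \<i> * of_real y) ^ j))
        = - (t * (\<Sum>j=2..n. w j * Im ((of_real (\<tau> * s) + \<i> * of_real y) ^ j)))"
      unfolding Im_reflected_power[OF \<tau>] sum_distrib_left sum_negf[symmetric]
      by (rule sum.cong) (auto simp: d_def)
    finally have "Re (\<i> * (of_real (\<tau> * s) + \<i> * of_real y) * of_real x
        - \<i> * dispersion w n (of_real (\<tau> * s) + \<i> * of_real y) * of_real t) \<le> - (eta * v * s)"
      unfolding dispersion_def ay by (simp add: algebra_simps del: of_real_mult)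
    then show "cmod (expo x (of_real (\<tau> * s) + \<i> * of_real (v * height \<tau>))) \<le> exp (- (eta * v * s))"
      unfolding expo_def norm_exp_eq_Re y_def by simp
  qed
qed

text \<open>Half of the exponential decay absorbs the power \<open>(\<i> * k) ^ q\<close>.\<close>

lemma deriv_kernel_decay:
  assumes \<tau>: "\<tau> = 1 \<or> \<tau> = -1" and B: "B \<ge> 0"
  obtains S M where "S \<ge> 1" "M \<ge> 0" "\<And>x s. \<lbrakk>\<bar>x\<bar> \<le> B; s \<ge> S\<rbrakk> \<Longrightarrow>
     cmod (deriv_kernel q x (decay_line \<tau> s)) \<le> M * exp (- (eta / 2 * s))"
proof -
  obtain S where S: "S \<ge> 1" "\<And>x s v. \<lbrakk>\<bar>x\<bar> \<le> B; s \<ge> S; 0 \<le> v; v \<le> 1\<rbrakk> \<Longrightarrow>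
     cmod (expo x (of_real (\<tau> * s) + \<i> * of_real (v * height \<tau>))) \<le> exp (- (eta * v * s))"
    using expo_decay[OF \<tau> B] by metis
  define c where "c = eta / 2"
  have c: "c > 0" using eta_pos by (simp add: c_def)
  show thesis
  proof (rule that[OF S(1), of "(2 / c) ^ q * fact q"])
    show "0 \<le> (2 / c) ^ q * fact q" using c by simp
    fix x s assume x: "\<bar>x\<bar> \<le> B" and s: "s \<ge> S"
    have s1: "s \<ge> 1" using s S by simp
    have "cmod (decay_line \<tau> s) \<le> \<bar>Re (decay_line \<tau> s)\<bar> + \<bar>Im (decay_line \<tau> s)\<bar>" by (rule cmod_le)
    also have "\<dots> \<le> 2 * s" using abs_height[OF \<tau>] \<tau> s1 by (auto simp: decay_line_def)
    finally have "cmod (\<i> * decay_line \<tau> s) ^ q \<le> (2 * s) ^ q" by (intro power_mono) (auto simp: norm_mult)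
    also have "\<dots> = (2 / c) ^ q * (c * s) ^ q" unfolding power_mult_distrib[symmetric] using c by simp
    also have "\<dots> \<le> (2 / c) ^ q * (fact q * exp (c * s))"
      using c s1 by (intro mult_left_mono power_le_fact_exp) auto
    finally have 1: "cmod (\<i> * decay_line \<tau> s) ^ q \<le> (2 / c) ^ q * (fact q * exp (c * s))" .
    have 2: "cmod (expo x (decay_line \<tau> s)) \<le> exp (- (2 * c * s))"
      using S(2)[OF x s, of 1] by (simp add: decay_line_def c_def)
    have "cmod (deriv_kernel q x (decay_line \<tau> s)) \<le> ((2 / c) ^ q * (fact q * exp (c * s))) * exp (- (2 * c * s))"
      unfolding deriv_kernel_def norm_mult[of "_ ^ q"] norm_power using c by (intro mult_mono 1 2) auto
    also have "\<dots> = (2 / c) ^ q * fact q * (exp (c * s) * exp (- (2 * c * s)))" by simp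
    also have "exp (c * s) * exp (- (2 * c * s)) = exp (- (c * s))" by (simp flip: exp_add)
    finally show "cmod (deriv_kernel q x (decay_line \<tau> s)) \<le> (2 / c) ^ q * fact q * exp (- (eta / 2 * s))"
      by (simp add: c_def)
  qed
qed

lemma deriv_kernel_primitive:
  obtains h where "\<And>k. (h has_field_derivative deriv_kernel q x k) (at k)"
proof -
  have "deriv_kernel q x holomorphic_on UNIV"
    unfolding deriv_kernel_def expo_def dispersion_def by (intro holomorphic_intros)
  from holomorphic_convex_primitive'[OF convex_UNIV open_UNIV this] show thesis
    using that by (metis UNIV_I)
qed

text \<open>The integrand is entire, so between end points on the two half-lines a straight segment
  is as good as any other path.\<close>

definition trunc :: "nat \<Rightarrow> real \<Rightarrow> real \<Rightarrow> complex" where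
  "trunc q N x = contour_integral (linepath (decay_line (- 1) N) (decay_line 1 N)) (deriv_kernel q x)"

lemma contour_integral_linepath_entire:
  assumes "\<And>k. (h has_field_derivative f k) (at k)"
  shows "contour_integral (linepath a b) f = h b - h a"
  using contour_integral_primitive[of UNIV h f "linepath a b"] assms
  by (simp add: contour_integral_unique)

lemma trunc_eq:
  assumes "\<And>k. (h has_field_derivative deriv_kernel q x k) (at k)"
  shows "trunc q N x = h (decay_line 1 N) - h (decay_line (- 1) N)"
  unfolding trunc_def by (rule contour_integral_linepath_entire[OF assms])

lemma decay_line_deriv:
  assumes "\<And>k. (h has_field_derivative f k) (at k)"
  shows "((\<lambda>s. h (decay_line \<tau> s)) has_vector_derivative of_real \<tau> * f (decay_line \<tau> s)) (at s)"
proof -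
  have "((\<lambda>s. decay_line \<tau> s) has_vector_derivative of_real \<tau>) (at s)"
    unfolding decay_line_def
    by (auto intro!: derivative_eq_intros simp: has_vector_derivative_def scaleR_conv_of_real mult_ac)
  from field_vector_diff_chain_at[OF this assms] show ?thesis by (simp add: o_def)
qed

definition limit_kernel :: "nat \<Rightarrow> real \<Rightarrow> complex" where
  "limit_kernel q x = lim (\<lambda>N. trunc q (real N) x)"

lemma primitive_limit:
  assumes \<tau>: "\<tau> = 1 \<or> \<tau> = -1" and B: "B \<ge> 0"
  obtains S K where "S \<ge> 1" "K \<ge> 0" "\<And>x h. \<bar>x\<bar> \<le> B \<Longrightarrow> (\<And>k. (h has_field_derivative deriv_kernel q x k) (at k)) \<Longrightarrow>
    \<exists>L. ((\<lambda>s. h (decay_line \<tau> s)) \<longlongrightarrow> L) at_top \<and> (\<forall>s\<ge>S. cmod (L - h (decay_line \<tau> s)) \<le> K * exp (- (eta / 2 * s)))"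
proof -
  obtain S M where SM: "S \<ge> 1" "M \<ge> 0" "\<And>x s. \<lbrakk>\<bar>x\<bar> \<le> B; s \<ge> S\<rbrakk> \<Longrightarrow>
     cmod (deriv_kernel q x (decay_line \<tau> s)) \<le> M * exp (- (eta / 2 * s))"
    using deriv_kernel_decay[OF \<tau> B, of q] by metis
  have c: "eta / 2 > 0" using eta_pos by simp
  show thesis
  proof (rule that[OF SM(1), of "M / (eta / 2)"])
    show "0 \<le> M / (eta / 2)" using SM c by simp
    fix x h assume x: "\<bar>x\<bar> \<le> B" and h: "\<And>k. (h has_field_derivative deriv_kernel q x k) (at k)"
    obtain L where "((\<lambda>s. h (decay_line \<tau> s)) \<longlongrightarrow> L) at_top"
      "\<And>s. s \<ge> S \<Longrightarrow> cmod (L - h (decay_line \<tau> s)) \<le> M / (eta / 2) * exp (- (eta / 2 * s))"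
    proof (rule primitive_decay[where h = "\<lambda>s. h (decay_line \<tau> s)" and S = S and K = M and c = "eta / 2"])
      fix s assume s: "S \<le> s"
      show "((\<lambda>s. h (decay_line \<tau> s)) has_vector_derivative of_real \<tau> * deriv_kernel q x (decay_line \<tau> s)) (at s)"
        by (rule decay_line_deriv[OF h])
      show "cmod (of_real \<tau> * deriv_kernel q x (decay_line \<tau> s)) \<le> M * exp (- (eta / 2 * s))"
        using SM(3)[OF x s] \<tau> by (auto simp: norm_mult)
    qed (use c in auto)
    then show "\<exists>L. ((\<lambda>s. h (decay_line \<tau> s)) \<longlongrightarrow> L) at_top \<and>
        (\<forall>s\<ge>S. cmod (L - h (decay_line \<tau> s)) \<le> M / (eta / 2) * exp (- (eta / 2 * s)))"
      by blast
  qed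
qed

text \<open>The rate of convergence is common to all bounded \<open>x\<close>; this is what allows
  the limit to be differentiated.\<close>

lemma trunc_uniform:
  assumes B: "B \<ge> 0"
  obtains S K where "S \<ge> 1" "K \<ge> 0"
    "\<And>x N. \<lbrakk>\<bar>x\<bar> \<le> B; real N \<ge> S\<rbrakk> \<Longrightarrow> cmod (limit_kernel q x - trunc q (real N) x) \<le> K * exp (- (eta / 2 * real N))"
    "\<And>x. \<bar>x\<bar> \<le> B \<Longrightarrow> (\<lambda>N. trunc q (real N) x) \<longlonglongrightarrow> limit_kernel q x"
proof -
  obtain S1 K1 where 1: "S1 \<ge> 1" "K1 \<ge> 0" "\<And>x h. \<bar>x\<bar> \<le> B \<Longrightarrow> (\<And>k. (h has_field_derivative deriv_kernel q x k) (at k)) \<Longrightarrow>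
    \<exists>L. ((\<lambda>s. h (decay_line 1 s)) \<longlongrightarrow> L) at_top \<and> (\<forall>s\<ge>S1. cmod (L - h (decay_line 1 s)) \<le> K1 * exp (- (eta / 2 * s)))"
    using primitive_limit[OF disjI1[OF refl] B, of q] by metis
  obtain S2 K2 where 2: "S2 \<ge> 1" "K2 \<ge> 0" "\<And>x h. \<bar>x\<bar> \<le> B \<Longrightarrow> (\<And>k. (h has_field_derivative deriv_kernel q x k) (at k)) \<Longrightarrow>
    \<exists>L. ((\<lambda>s. h (decay_line (- 1) s)) \<longlongrightarrow> L) at_top \<and> (\<forall>s\<ge>S2. cmod (L - h (decay_line (- 1) s)) \<le> K2 * exp (- (eta / 2 * s)))"
    using primitive_limit[OF disjI2[OF refl] B, of q] by metis
  have main: "(\<lambda>N. trunc q (real N) x) \<longlonglongrightarrow> limit_kernel q x \<and>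
      (\<forall>N. real N \<ge> max S1 S2 \<longrightarrow> cmod (limit_kernel q x - trunc q (real N) x) \<le> (K1 + K2) * exp (- (eta / 2 * real N)))"
    if x: "\<bar>x\<bar> \<le> B" for x
  proof -
    obtain h where h: "\<And>k. (h has_field_derivative deriv_kernel q x k) (at k)"
      using deriv_kernel_primitive by metis
    obtain L1 where L1: "((\<lambda>s. h (decay_line 1 s)) \<longlongrightarrow> L1) at_top"
      "\<And>s. s\<ge>S1 \<Longrightarrow> cmod (L1 - h (decay_line 1 s)) \<le> K1 * exp (- (eta / 2 * s))"
      using 1(3)[OF x h] by blast
    obtain L2 where L2: "((\<lambda>s. h (decay_line (- 1) s)) \<longlongrightarrow> L2) at_top"
      "\<And>s. s\<ge>S2 \<Longrightarrow> cmod (L2 - h (decay_line (- 1) s)) \<le> K2 * exp (- (eta / 2 * s))"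
      using 2(3)[OF x h] by blast
    have T: "(\<lambda>N. trunc q (real N) x) \<longlonglongrightarrow> L1 - L2"
      unfolding trunc_eq[OF h]
      by (intro tendsto_diff filterlim_compose[OF L1(1) filterlim_real_sequentially]
          filterlim_compose[OF L2(1) filterlim_real_sequentially])
    from this have LK: "limit_kernel q x = L1 - L2" unfolding limit_kernel_def by (rule limI)
    have "cmod (limit_kernel q x - trunc q (real N) x) \<le> (K1 + K2) * exp (- (eta / 2 * real N))"
      if N: "real N \<ge> max S1 S2" for N
    proof -
      have "limit_kernel q x - trunc q (real N) x = (L1 - h (decay_line 1 (real N))) - (L2 - h (decay_line (- 1) (real N)))"
        unfolding LK trunc_eq[OF h] by simp
      then have "cmod (limit_kernel q x - trunc q (real N) x)
          \<le> cmod (L1 - h (decay_line 1 (real N))) + cmod (L2 - h (decay_line (- 1) (real N)))"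
        by (metis norm_triangle_ineq4)
      also have "\<dots> \<le> K1 * exp (- (eta / 2 * real N)) + K2 * exp (- (eta / 2 * real N))"
        using N by (intro add_mono L1(2) L2(2)) auto
      finally show ?thesis by (simp add: distrib_right)
    qed
    then show ?thesis using T unfolding LK by blast
  qed
  show thesis
    by (rule that[of "max S1 S2" "K1 + K2"]) (use main 1(1,2) 2(2) in auto)
qed

lemma trunc_deriv: "(trunc q N has_vector_derivative trunc (Suc q) N x) (at x)"
proof -
  define a c where "a = decay_line (- 1) N" and "c = decay_line 1 N"
  have tr: "trunc q N x = integral (cbox 0 1) (\<lambda>u. deriv_kernel q x (linepath a c u) * (c - a))" for q x
    unfolding trunc_def a_def[symmetric] c_def[symmetric] by (simp add: contour_integral_integral)
  have "((\<lambda>x. integral (cbox 0 1) (\<lambda>u. deriv_kernel q x (linepath a c u) * (c - a))) has_vector_derivative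
      integral (cbox 0 1) (\<lambda>u. deriv_kernel (Suc q) x (linepath a c u) * (c - a))) (at x within UNIV)"
  proof (rule leibniz_rule_vector_derivative)
    fix x u :: real
    have "((\<lambda>x. expo x k) has_vector_derivative \<i> * k * expo x k) (at x)" for k
    proof -
      have "((\<lambda>x. exp (\<i> * k * x - \<i> * dispersion w n k * of_real t)) has_field_derivative \<i> * k * expo x k) (at (of_real x))"
        unfolding expo_def by (auto intro!: derivative_eq_intros)
      from has_vector_derivative_real_field[OF this] show ?thesis unfolding expo_def .
    qed
    from has_vector_derivative_mult_right[OF this, of "(\<i> * linepath a c u) ^ q * (c - a)" "linepath a c u"]
    show "((\<lambda>x. deriv_kernel q x (linepath a c u) * (c - a)) has_vector_derivative
        deriv_kernel (Suc q) x (linepath a c u) * (c - a)) (at x within UNIV)"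
      by (simp add: deriv_kernel_def mult_ac)
  next
    fix x :: real
    show "(\<lambda>u. deriv_kernel q x (linepath a c u) * (c - a)) integrable_on cbox 0 1"
      unfolding deriv_kernel_def expo_def dispersion_def linepath_def
      by (intro integrable_continuous continuous_intros)
    show "continuous_on (UNIV \<times> cbox 0 1) (\<lambda>(x, u). deriv_kernel (Suc q) x (linepath a c u) * (c - a))"
      unfolding deriv_kernel_def expo_def dispersion_def linepath_def split_beta
      by (intro continuous_intros)
  qed auto
  then show ?thesis by (simp add: tr[abs_def])
qed

text \<open>On the real line the differentiated integrals need not converge. With ends on the
  decaying half-lines, the derivatives of the truncations converge locally uniformly, so limit and
  derivative may be exchanged; since the derivative is of the same kind, this can be
  iterated.\<close>

lemma limit_kernel_deriv: "(limit_kernel q has_vector_derivative limit_kernel (Suc q) x) (at x)"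
proof -
  define B where "B = \<bar>x\<bar> + 1"
  have B: "B \<ge> 0" by (simp add: B_def)
  let ?S = "{- B<..<B}"
  have xS: "x \<in> ?S" by (auto simp: B_def)
  obtain S1 K1 where 1: "\<And>x N. \<lbrakk>\<bar>x\<bar> \<le> B; real N \<ge> S1\<rbrakk> \<Longrightarrow> cmod (limit_kernel (Suc q) x - trunc (Suc q) (real N) x) \<le> K1 * exp (- (eta / 2 * real N))"
    using trunc_uniform[OF B, of "Suc q"] by metis
  have lim0: "(\<lambda>N. trunc q (real N) x) \<longlonglongrightarrow> limit_kernel q x" if "\<bar>x\<bar> \<le> B" for x
    using trunc_uniform[OF B, of q] that by metis
  have "\<exists>g. \<forall>x\<in>?S. (\<lambda>N. trunc q (real N) x) \<longlonglongrightarrow> g x \<and>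
      (g has_derivative (\<lambda>h. h *\<^sub>R limit_kernel (Suc q) x)) (at x within ?S)"
  proof (rule has_derivative_sequence)
    show "convex ?S" by simp
    show "(trunc q (real N) has_derivative (\<lambda>h. h *\<^sub>R trunc (Suc q) (real N) x)) (at x within ?S)" for N x
      using trunc_deriv[of q "real N" x] unfolding has_vector_derivative_def
      by (rule has_derivative_at_withinI)
    show "x \<in> ?S" by (rule xS)
    show "(\<lambda>N. trunc q (real N) x) \<longlonglongrightarrow> limit_kernel q x" by (rule lim0) (simp add: B_def)
    fix \<epsilon> :: real assume \<epsilon>: "\<epsilon> > 0"
    have "((\<lambda>N. K1 * exp (- (c * real N))) \<longlongrightarrow> 0) sequentially" if "c > 0" for c
      using that by real_asymp
    from this[of "eta / 2"] have "((\<lambda>N. K1 * exp (- (eta / 2 * real N))) \<longlongrightarrow> 0) sequentially"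
      using eta_pos by simp
    then have "eventually (\<lambda>N. K1 * exp (- (eta / 2 * real N)) < \<epsilon>) sequentially"
      using \<epsilon> by (rule order_tendstoD)
    moreover have "eventually (\<lambda>N. real N \<ge> S1) sequentially"
      using filterlim_real_sequentially eventually_ge_at_top filterlim_iff by blast
    ultimately show "\<forall>\<^sub>F N in sequentially. \<forall>x\<in>?S. \<forall>h.
        norm (h *\<^sub>R trunc (Suc q) (real N) x - h *\<^sub>R limit_kernel (Suc q) x) \<le> \<epsilon> * norm h"
    proof eventually_elim
      case (elim N)
      show ?case
      proof (intro ballI allI)
        fix x h assume "x \<in> ?S"
        then have "\<bar>x\<bar> \<le> B" by auto
        from 1[OF this elim(2)] elim(1)
        have "cmod (trunc (Suc q) (real N) x - limit_kernel (Suc q) x) \<le> \<epsilon>" by (simp add: norm_minus_commute)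
        then show "norm (h *\<^sub>R trunc (Suc q) (real N) x - h *\<^sub>R limit_kernel (Suc q) x) \<le> \<epsilon> * norm h"
          unfolding scaleR_diff_right[symmetric] norm_scaleR by (simp add: mult.commute[of \<epsilon>] mult_left_mono)
      qed
    qed
  qed
  then obtain g where g: "\<And>x. x \<in> ?S \<Longrightarrow> (\<lambda>N. trunc q (real N) x) \<longlonglongrightarrow> g x"
    "\<And>x. x \<in> ?S \<Longrightarrow> (g has_derivative (\<lambda>h. h *\<^sub>R limit_kernel (Suc q) x)) (at x within ?S)" by blast
  have gl: "g y = limit_kernel q y" if "y \<in> ?S" for y
    using g(1)[OF that] lim0[of y] that by (intro LIMSEQ_unique[of "\<lambda>N. trunc q (real N) y"]) auto
  have "(g has_derivative (\<lambda>h. h *\<^sub>R limit_kernel (Suc q) x)) (at x)"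
    using g(2)[OF xS] unfolding at_within_open[OF xS open_greaterThanLessThan] .
  then have "(limit_kernel q has_derivative (\<lambda>h. h *\<^sub>R limit_kernel (Suc q) x)) (at x)"
    by (rule has_derivative_transform_within_open[OF _ _ xS]) (auto simp: gl)
  then show ?thesis by (simp add: has_vector_derivative_def)
qed

text \<open>The vertical comparison of \<open>real_axis_limit\<close>, here in the original variable
  and for every \<open>x\<close>, including small \<open>\<bar>x\<bar> / t\<close> and
  \<open>x = 0\<close>, which the scaling does not reach.\<close>

lemma real_line_limit:
  assumes \<tau>: "\<tau> = 1 \<or> \<tau> = -1" and h: "\<And>k. (h has_field_derivative deriv_kernel 0 x k) (at k)"
    and L: "((\<lambda>s. h (decay_line \<tau> s)) \<longlongrightarrow> L) at_top"
  shows "((\<lambda>s. h (of_real (\<tau> * s))) \<longlongrightarrow> L) at_top"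
proof -
  obtain S where S: "S \<ge> 1" "\<And>y s v. \<lbrakk>\<bar>y\<bar> \<le> \<bar>x\<bar>; s \<ge> S; 0 \<le> v; v \<le> 1\<rbrakk> \<Longrightarrow>
     cmod (expo y (of_real (\<tau> * s) + \<i> * of_real (v * height \<tau>))) \<le> exp (- (eta * v * s))"
    using expo_decay[OF \<tau> abs_ge_zero] by metis
  have "((\<lambda>s. h (decay_line \<tau> s) - h (of_real (\<tau> * s))) \<longlongrightarrow> 0) at_top"
  proof (rule Lim_null_comparison)
    show "eventually (\<lambda>s. cmod (h (decay_line \<tau> s) - h (of_real (\<tau> * s))) \<le> 1 / (eta * s)) at_top"
      using eventually_ge_at_top[of S]
    proof eventually_elim
      case (elim s)
      define k where "k = eta * s"
      have k: "k > 0" using eta_pos elim S by (simp add: k_def)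
      define g where "g = (\<lambda>v. of_real (\<tau> * s) + \<i> * complex_of_real (v * height \<tau>))"
      have der: "((\<lambda>v. h (g v)) has_vector_derivative \<i> * of_real (height \<tau>) * deriv_kernel 0 x (g v)) (at v)" for v
      proof -
        have "(g has_vector_derivative \<i> * of_real (height \<tau>)) (at v)"
          unfolding g_def
          by (auto intro!: derivative_eq_intros simp: has_vector_derivative_def scaleR_conv_of_real mult_ac)
        from field_vector_diff_chain_at[OF this h] show ?thesis by (simp add: o_def)
      qed
      have "cmod (h (g 1) - h (g 0)) \<le> (- exp (- (k * 1)) / k) - (- exp (- (k * 0)) / k)"
      proof (rule differentiable_bound_general[where f = "\<lambda>v. h (g v)" and \<phi>' = "\<lambda>v. exp (- (k * v))"])
        show "continuous_on {0..1} (\<lambda>v. h (g v))"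
          by (intro continuous_at_imp_continuous_on ballI has_vector_derivative_continuous[OF der])
        show "continuous_on {0..1} (\<lambda>v. - exp (- (k * v)) / k)" using k by (intro continuous_intros) auto
        fix v :: real assume v: "0 < v" "v < 1"
        show "((\<lambda>v. - exp (- (k * v)) / k) has_vector_derivative exp (- (k * v))) (at v)"
          using k by (auto intro!: derivative_eq_intros simp flip: has_real_derivative_iff_has_vector_derivative)
        show "((\<lambda>v. h (g v)) has_vector_derivative \<i> * of_real (height \<tau>) * deriv_kernel 0 x (g v)) (at v)"
          by (rule der)
        have "cmod (\<i> * of_real (height \<tau>)) = 1" using abs_height[OF \<tau>] by (simp add: norm_mult)
        moreover have "cmod (deriv_kernel 0 x (g v)) \<le> exp (- (k * v))"
          using S(2)[of x s v] elim v by (simp add: deriv_kernel_def g_def k_def mult_ac)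
        ultimately show "cmod (\<i> * of_real (height \<tau>) * deriv_kernel 0 x (g v)) \<le> exp (- (k * v))"
          by (simp only: norm_mult[of "\<i> * of_real (height \<tau>)"] mult_1)
      qed auto
      also have "\<dots> \<le> 1 / k" using k by simp
      finally show ?case by (simp add: k_def g_def decay_line_def)
    qed
    have "((\<lambda>s. 1 / (c * s)) \<longlongrightarrow> 0) at_top" if "c > 0" for c :: real using that by real_asymp
    from this[OF eta_pos] show "((\<lambda>s. 1 / (eta * s)) \<longlongrightarrow> 0) at_top" .
  qed
  from tendsto_diff[OF L this] show ?thesis by simp
qed

lemma solution_kernel_eq: "solution_kernel w n t x = limit_kernel 0 x / (2 * of_real pi)"
proof -
  obtain h where h: "\<And>k. (h has_field_derivative deriv_kernel 0 x k) (at k)"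
    using deriv_kernel_primitive by metis
  obtain L1 where L1: "((\<lambda>s. h (decay_line 1 s)) \<longlongrightarrow> L1) at_top"
    using primitive_limit[OF disjI1[OF refl] abs_ge_zero[of x], of 0] h by (metis order_refl)
  obtain L2 where L2: "((\<lambda>s. h (decay_line (- 1) s)) \<longlongrightarrow> L2) at_top"
    using primitive_limit[OF disjI2[OF refl] abs_ge_zero[of x], of 0] h by (metis order_refl)
  have "(\<lambda>N. trunc 0 (real N) x) \<longlonglongrightarrow> L1 - L2"
    unfolding trunc_eq[OF h]
    by (intro tendsto_diff filterlim_compose[OF L1(1) filterlim_real_sequentially]
        filterlim_compose[OF L2(1) filterlim_real_sequentially])
  then have LK: "limit_kernel 0 x = L1 - L2" unfolding limit_kernel_def by (rule limI)
  have f: "(\<lambda>k. exp (\<i> * k * of_real x - \<i> * dispersion w n k * of_real t)) = deriv_kernel 0 x"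
    by (simp add: fun_eq_iff deriv_kernel_def expo_def)
  have "((\<lambda>s. h (of_real (snd s)) - h (of_real (- fst s))) \<longlongrightarrow> L1 - L2) (at_top \<times>\<^sub>F at_top)"
    using real_line_limit[OF _ h L1] real_line_limit[OF _ h L2]
    by (intro tendsto_diff filterlim_compose[OF _ filterlim_snd] filterlim_compose[OF _ filterlim_fst]) auto
  then have lim: "((\<lambda>(a, b). contour_integral (linepath (of_real (- a)) (of_real b)) (deriv_kernel 0 x)) \<longlongrightarrow> L1 - L2) (at_top \<times>\<^sub>F at_top)"
    unfolding contour_integral_linepath_entire[OF h] by (simp add: case_prod_beta')
  have "(at_top \<times>\<^sub>F at_top :: (real \<times> real) filter) \<noteq> bot" by (simp add: prod_filter_eq_bot)
  from tendsto_Lim[OF this lim] show ?thesis unfolding solution_kernel_def f LK by simp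
qed

text \<open>\<open>vector_derivative\<close> is meaningful only at points of differentiability,
  which \<open>limit_kernel_deriv\<close> supplies at every stage of the iteration.\<close>

lemma iterated_vderiv_eq:
  "iterated_vderiv m (solution_kernel w n t) = (\<lambda>x. limit_kernel m x / (2 * of_real pi))"
proof (induction m)
  case 0
  then show ?case by (simp add: iterated_vderiv_def solution_kernel_eq fun_eq_iff)
next
  case (Suc m)
  have "iterated_vderiv (Suc m) (solution_kernel w n t)
      = (\<lambda>y. vector_derivative (iterated_vderiv m (solution_kernel w n t)) (at y))"
    by (simp add: iterated_vderiv_def)
  also have "\<dots> = (\<lambda>y. limit_kernel (Suc m) y / (2 * of_real pi))"
    unfolding Suc by (intro ext vector_derivative_at has_vector_derivative_divide limit_kernel_deriv)
  finally show ?case .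
qed

lemma iterated_vderiv_differentiable: "iterated_vderiv m (solution_kernel w n t) differentiable at x"
  unfolding iterated_vderiv_eq
  by (rule differentiableI_vector[OF has_vector_derivative_divide[OF limit_kernel_deriv]])

end

section \<open>Expansion and bounds for a fixed sign of x\<close>

lemma kappa_ge:
  assumes "n \<ge> 2" "t > 0" "x \<noteq> 0" "K \<ge> 0" "\<bar>x\<bar> / t \<ge> K ^ (n - 1)"
  shows "kappa n x t \<ge> K"
proof -
  have "K ^ Suc (n - 2) \<le> kappa n x t ^ Suc (n - 2)"
    using assms kappa_props(2)[OF assms(1-3)] by (simp add: numeral_2_eq_2 Suc_diff_Suc)
  then show ?thesis by (rule power_le_imp_le_base) (use kappa_props(1)[OF assms(1-3)] in simp)
qed

lemma kappa_powr:
  assumes "n \<ge> 2" "t > 0" "x \<noteq> 0"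
  shows "kappa n x t powr a = \<bar>x\<bar> powr (a / (real n - 1)) * t powr (- (a / (real n - 1)))"
proof -
  have "kappa n x t powr a = (\<bar>x\<bar> / t) powr (a / (real n - 1))" by (simp add: kappa_def powr_powr)
  also have "\<dots> = \<bar>x\<bar> powr (a / (real n - 1)) / t powr (a / (real n - 1))" using assms by (simp add: powr_divide)
  finally show ?thesis by (simp add: powr_minus_divide)
qed

context scaled_phase
begin

text \<open>Division by \<open>\<sigma> * k\<close> maps the half-lines of the kernel to horizontal
  lines at height \<open>\<sigma> * height / k\<close>, exchanging the ends for
  \<open>\<sigma> = -1\<close>. Since this height varies with \<open>k\<close>,
  \<open>hline_limit\<close> has to admit all heights on the decaying side.\<close>

lemma limit_kernel_eq_J:
  assumes t: "t > 0" and x: "x \<noteq> 0" and s: "sgn x = \<sigma>" and p: "p = - int q"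
    and k1: "kappa n x t \<ge> 1" and a: "adm (\<bar>x\<bar> * kappa n x t)"
  shows "dispersive.limit_kernel n w t q x =
    of_real (kappa n x t) / of_real (\<sigma> * kappa n x t) powi p * J (1 / kappa n x t) (\<bar>x\<bar> * kappa n x t)"
proof -
  have wn: "w n \<noteq> 0" using bn by auto
  interpret D: dispersive n w t by unfold_locales (use n wn t in auto)
  define k where "k = kappa n x t"
  have k: "k \<ge> 1" using k1 by (simp add: k_def)
  have e: "0 \<le> 1 / k" "1 / k \<le> 1" using k by auto
  have \<sigma>2: "\<sigma> * \<sigma> = 1" using \<sigma> by auto
  have sk: "\<sigma> * k \<noteq> 0" using \<sigma> k by auto
  define c where "c = 1 / complex_of_real (\<sigma> * k) powi p"
  define X where "X = \<bar>x\<bar> * k"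
  have X: "adm X" using a by (simp add: X_def k_def)
  have cut: "z \<in> cut" for z using p by (intro cutI) simp
  have dk: "D.deriv_kernel q x u = integrand w n (p - 1) x t u" for u
  proof -
    have "E / z powi (- int q) = z ^ q * E" for E z :: complex
      by (simp only: power_int_minus power_int_of_nat divide_inverse inverse_inverse_eq mult.commute)
    then show ?thesis unfolding D.deriv_kernel_def D.expo_def integrand_def p by (simp only: diff_add_cancel)
  qed
  have f: "D.deriv_kernel q x (of_real (\<sigma> * k) * z) = c * F (1 / k) X z" for z
    unfolding dk k_def c_def X_def by (rule integrand_scaling[OF t x s refl])
  define G where "G = (\<lambda>u. of_real (\<sigma> * k) * c * H (1 / k) X (u / of_real (\<sigma> * k)))"
  have G: "(G has_field_derivative D.deriv_kernel q x u) (at u)" for u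
    unfolding G_def by (rule scaled_primitive[OF sk f cut])
  have lim: "(\<lambda>N. G (D.decay_line \<tau> (real N))) \<longlonglongrightarrow> of_real (\<sigma> * k) * c * Hlim (\<sigma> * \<tau>) (1 / k) X"
    if \<tau>: "\<tau> = 1 \<or> \<tau> = -1" for \<tau>
  proof -
    have st: "\<sigma> * \<tau> = 1 \<or> \<sigma> * \<tau> = -1" using \<tau> \<sigma> by auto
    define y where "y = \<sigma> * D.height \<tau> / k"
    have "lead (\<sigma> * \<tau>) = \<sigma> * (w n * \<tau> ^ (n - 1))"
    proof -
      have "\<sigma> ^ n * \<sigma> ^ (n - 1) = \<sigma> * (\<sigma> * \<sigma>) ^ (n - 1)" unfolding power_pred(1)[of \<sigma>] by (simp add: power_mult_distrib)
      then have "\<sigma> ^ n * \<sigma> ^ (n - 1) = \<sigma>" using \<sigma>2 by simp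
      then have "w n * (\<sigma> ^ n * \<sigma> ^ (n - 1)) * \<tau> ^ (n - 1) = w n * \<sigma> * \<tau> ^ (n - 1)" by simp
      then show ?thesis unfolding lead_def by (simp add: power_mult_distrib mult_ac)
    qed
    then have "lead (\<sigma> * \<tau>) * y = (\<sigma> * \<sigma>) * (w n * \<tau> ^ (n - 1)) * D.height \<tau> / k" by (simp add: y_def mult_ac)
    also have "\<dots> = - ((w n * \<tau> ^ (n - 1)) * sgn (w n * \<tau> ^ (n - 1))) / k" unfolding \<sigma>2 by (simp add: D.height_def)
    also have "(w n * \<tau> ^ (n - 1)) * sgn (w n * \<tau> ^ (n - 1)) = \<bar>w n * \<tau> ^ (n - 1)\<bar>" by (metis abs_sgn)
    also have "- \<bar>w n * \<tau> ^ (n - 1)\<bar> / k < 0" using wn \<tau> k by (auto simp: divide_less_0_iff)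
    finally have yl: "lead (\<sigma> * \<tau>) * y < 0" .
    obtain L: "((\<lambda>s. H (1 / k) X (hline (\<sigma> * \<tau>) y s)) \<longlongrightarrow> Hlim (\<sigma> * \<tau>) (1 / k) X) at_top"
      using hline_limit[OF st yl] e X by metis
    have "filterlim (\<lambda>N. real N / k) at_top sequentially"
    proof -
      have "k > 0" using k by simp
      then show ?thesis by real_asymp
    qed
    from filterlim_compose[OF L this]
    have "(\<lambda>N. H (1 / k) X (hline (\<sigma> * \<tau>) y (real N / k))) \<longlonglongrightarrow> Hlim (\<sigma> * \<tau>) (1 / k) X" .
    moreover have "hline (\<sigma> * \<tau>) y (s / k) = D.decay_line \<tau> s / of_real (\<sigma> * k)" for s
    proof -
      have "hline (\<sigma> * \<tau>) y (s / k) * of_real (\<sigma> * k) = of_real ((\<sigma> * \<sigma>) * \<tau> * s) + \<i> * of_real ((\<sigma> * \<sigma>) * D.height \<tau>)"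
        using k by (simp add: hline_def y_def field_simps)
      also have "\<dots> = D.decay_line \<tau> s" unfolding \<sigma>2 by (simp add: D.decay_line_def)
      finally show ?thesis using sk by (metis nonzero_mult_div_cancel_right of_real_eq_0_iff)
    qed
    ultimately show ?thesis unfolding G_def by (intro tendsto_mult_left) simp
  qed
  have "(\<lambda>N. D.trunc q (real N) x) \<longlonglongrightarrow> of_real (\<sigma> * k) * c * Hlim (\<sigma> * 1) (1 / k) X - of_real (\<sigma> * k) * c * Hlim (\<sigma> * - 1) (1 / k) X"
    unfolding D.trunc_eq[OF G] by (intro tendsto_diff lim) auto
  then have "D.limit_kernel q x = of_real (\<sigma> * k) * c * Hlim (\<sigma> * 1) (1 / k) X - of_real (\<sigma> * k) * c * Hlim (\<sigma> * - 1) (1 / k) X"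
    unfolding D.limit_kernel_def by (rule limI)
  also have "\<dots> = of_real k * c * J (1 / k) X"
    using \<sigma> by (auto simp: J_def algebra_simps)
  finally show ?thesis by (simp add: c_def k_def X_def)
qed

lemma amplitude_bound:
  obtains C k0 where "C \<ge> 0" "k0 \<ge> 1" "\<And>k a. k \<ge> k0 \<Longrightarrow> a > 0 \<Longrightarrow> a * k \<ge> 1 \<Longrightarrow>
    cmod (of_real k / of_real (\<sigma> * k) powi p * J (1 / k) (a * k))
      \<le> C * (k powr (1 / 2 - of_int p) * a powr (- 1 / 2)) * exp (a * k * MM (1 / k)) \<and> MM (1 / k) \<le> 0"
proof -
  obtain C where C: "C \<ge> 0" "eventually (\<lambda>e. \<forall>X. X \<ge> 1 \<longrightarrow> cmod (J e X) \<le> C * X powr (- 1 / 2) * exp (X * MM e)) (at_right 0)"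
    by (rule J_bound)
  obtain e0 where e0: "e0 > 0" "\<And>e. 0 < e \<Longrightarrow> e < e0 \<Longrightarrow>
      (\<forall>X. X \<ge> 1 \<longrightarrow> cmod (J e X) \<le> C * X powr (- 1 / 2) * exp (X * MM e)) \<and> MM e \<le> 0"
    using eventually_conj[OF C(2) MM_nonpos] unfolding eventually_at_right_field by blast
  define k0 where "k0 = max 1 (2 / e0)"
  show thesis
  proof (rule that[OF C(1)])
    show "k0 \<ge> 1" by (simp add: k0_def)
    fix k a :: real assume k: "k \<ge> k0" and a: "a > 0" and ak: "a * k \<ge> 1"
    have k1: "k \<ge> 1" "2 / e0 \<le> k" using k by (auto simp: k0_def)
    have "1 / k < e0"
    proof -
      have "2 \<le> k * e0" using k1 e0(1) by (simp add: divide_le_eq)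
      then have "1 < k * e0" by simp
      then show ?thesis using k1 by (simp add: divide_less_eq mult.commute)
    qed
    then have eb: "cmod (J (1 / k) (a * k)) \<le> C * (a * k) powr (- 1 / 2) * exp (a * k * MM (1 / k))" "MM (1 / k) \<le> 0"
      using e0(2)[of "1 / k"] k1 ak by auto
    have "cmod (complex_of_real (\<sigma> * k)) = k" using \<sigma> k1 by auto
    then have "cmod (of_real k / of_real (\<sigma> * k) powi p :: complex) = k / k powi p"
      using k1 by (simp add: norm_divide norm_power_int del: of_real_mult)
    also have "\<dots> = k powr (1 - of_int p)"
      using k1 by (simp add: powr_diff powr_real_of_int')
    finally have n1: "cmod (of_real k / of_real (\<sigma> * k) powi p :: complex) = k powr (1 - of_int p)" .
    have "cmod (of_real k / of_real (\<sigma> * k) powi p * J (1 / k) (a * k))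
        \<le> k powr (1 - of_int p) * (C * (a * k) powr (- 1 / 2) * exp (a * k * MM (1 / k)))"
      unfolding norm_mult n1 using eb(1) by (intro mult_left_mono) auto
    also have "\<dots> = C * (k powr (1 - of_int p) * k powr (- 1 / 2) * a powr (- 1 / 2)) * exp (a * k * MM (1 / k))"
      using a k1 by (simp add: powr_mult mult_ac)
    also have "k powr (1 - of_int p) * k powr (- 1 / 2) = k powr (1 / 2 - of_int p)"
      unfolding powr_add[symmetric] by simp
    finally show "cmod (of_real k / of_real (\<sigma> * k) powi p * J (1 / k) (a * k))
      \<le> C * (k powr (1 / 2 - of_int p) * a powr (- 1 / 2)) * exp (a * k * MM (1 / k)) \<and> MM (1 / k) \<le> 0"
      using eb(2) by simp
  qed
qed

text \<open>Collects the powers of the scale, using that \<sigma> is its own inverse. The isolated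
  factor \<sigma> on the right is the one that turns \<open>dirn\<close> into the unit vector of
  \<open>descent_angle\<close>.\<close>

lemma prefactor:
  fixes k a D :: real and m :: int
  assumes k: "k > 0" and a: "a > 0" and D: "D > 0"
  shows "k / (2 * pi) / (\<sigma> * k) powi (m + 1) * sqrt (2 * pi / (a * k * D))
    = \<sigma> powi m * a powr (- 1 / 2) / sqrt (2 * pi) * k powr (- (of_int m + 1 / 2)) * \<sigma> * (1 / D powr (1 / 2))"
proof -
  have s1: "(\<sigma> * k) powi (m + 1) = \<sigma> powi m * \<sigma> * (k powi m * k)"
    using \<sigma> k by (auto simp: power_int_mult_distrib power_int_add)
  have s2: "1 / (\<sigma> powi m * \<sigma>) = \<sigma> powi m * \<sigma>"
    using \<sigma> by (auto simp: power_int_minus_one_minus power_int_minus_left)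
  have s3: "k powr (- (of_int m + 1 / 2)) = 1 / k powi m * (1 / sqrt k)"
  proof -
    have "k powr (- (of_int m + 1 / 2)) = k powr (- of_int m) * k powr (- (1 / 2))" by (simp add: powr_add[symmetric])
    also have "k powr (- of_int m) = 1 / k powi m" using k powr_real_of_int'[of k m] by (simp add: powr_minus_divide)
    also have "k powr (- (1 / 2)) = 1 / sqrt k" using k by (simp only: powr_minus_divide powr_half_sqrt less_imp_le)
    finally show ?thesis .
  qed
  have s4: "a powr (- 1 / 2) = 1 / sqrt a" using a powr_minus_divide[of a "1 / 2"] by (simp add: powr_half_sqrt)
  have s5: "D powr (1 / 2) = sqrt D" using D by (simp add: powr_half_sqrt)
  have s6: "sqrt (2 * pi / (a * k * D)) / (2 * pi) = 1 / sqrt (2 * pi) * (1 / sqrt a) * (1 / sqrt k) * (1 / sqrt D)"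
  proof -
    define d where "d = sqrt (2 * pi)"
    have d: "d > 0" "2 * pi = d * d" by (simp_all add: d_def)
    have "sqrt (2 * pi / (a * k * D)) / (2 * pi) = d / (sqrt a * sqrt k * sqrt D) / (d * d)"
      unfolding d(2)[symmetric] by (simp add: real_sqrt_divide real_sqrt_mult d_def)
    also have "\<dots> = 1 / d * (1 / sqrt a) * (1 / sqrt k) * (1 / sqrt D)" using d(1) by simp
    finally show ?thesis unfolding d_def .
  qed
  have "k / (2 * pi) / (\<sigma> * k) powi (m + 1) * sqrt (2 * pi / (a * k * D))
      = (1 / (\<sigma> powi m * \<sigma>)) * (1 / k powi m) * (k / k) * (sqrt (2 * pi / (a * k * D)) / (2 * pi))"
    unfolding s1 by simp
  also have "\<dots> = (\<sigma> powi m * \<sigma>) * (1 / k powi m) * (1 / sqrt (2 * pi) * (1 / sqrt a) * (1 / sqrt k) * (1 / sqrt D))"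
    unfolding s2 s6 using k by simp
  finally show ?thesis unfolding s3 s4 s5 by (simp add: mult_ac)
qed

lemma osc_integral_expansion:
  assumes m: "m = p - 1" and p: "p \<ge> 0" and r: "0 < r"
  shows "\<exists>C S. S > 0 \<and> (\<forall>x t. t > 0 \<and> \<bar>x / t\<bar> \<ge> S \<and> sgn x = \<sigma> \<longrightarrow>
          (\<exists>E :: complex \<Rightarrow> complex.
            (\<forall>z\<in>stationary_points w n x t.
               cmod (E z) \<le> C * (\<bar>x\<bar> powr (-1) * (\<bar>x\<bar> / t) powr (- 1 / (real n - 1)))) \<and>
            osc_integral w n r m x t =
              residue_term w n m x t +
              of_real (sgn x powi m * \<bar>x\<bar> powr (- 1 / 2) / sqrt (2 * pi)
                        * (\<bar>x\<bar> / t) powr (- ((of_int m + 1 / 2) / (real n - 1)))) *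
              (\<Sum>z\<in>stationary_points w n x t.
                 exp (of_real (large_param n x t) * phase w n x t z
                        + \<i> * of_real (descent_angle w n x t z))
                   / (\<i> * z) powi (m + 1)
                   * of_real (1 / cmod (deriv (deriv (phase w n x t)) z) powr (1 / 2))
                   * (1 + E z))))"
proof -
  obtain C where C: "C \<ge> 0" "eventually (\<lambda>e. \<forall>X. adm X \<longrightarrow> (\<exists>E. (\<forall>z. cmod (E z) \<le> C / X) \<and>
      J e X = (\<Sum>z\<in>Stat e. mainT e X z * (1 + E z)))) (at_right 0)"
    by (rule J_expansion)
  obtain e0 where e0: "e0 > 0" "\<And>e. 0 < e \<Longrightarrow> e < e0 \<Longrightarrow>
      (\<forall>X. adm X \<longrightarrow> (\<exists>E. (\<forall>z. cmod (E z) \<le> C / X) \<and> J e X = (\<Sum>z\<in>Stat e. mainT e X z * (1 + E z)))) \<and>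
      (\<forall>z\<in>Stat e. ddPhi e z \<noteq> 0 \<and> Re (dirn e z) > 0)"
    using eventually_conj[OF C(2) eventually_regular] unfolding eventually_at_right_field by blast
  \<comment> \<open>\<open>2 / e0\<close> instead of \<open>1 / e0\<close> makes the inequality
    \<open>1 / k < e0\<close> strict.\<close>
  define k0 where "k0 = max 1 (2 / e0)"
  have k0: "k0 \<ge> 1" by (simp add: k0_def)
  show ?thesis
  proof (rule exI[of _ C], rule exI[of _ "k0 ^ (n - 1)"], intro conjI allI impI)
    show "k0 ^ (n - 1) > 0" using k0 by simp
  next
    fix x t :: real
    assume "t > 0 \<and> \<bar>x / t\<bar> \<ge> k0 ^ (n - 1) \<and> sgn x = \<sigma>"
    then have t: "t > 0" and big: "\<bar>x / t\<bar> \<ge> k0 ^ (n - 1)" and s: "sgn x = \<sigma>" by auto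
    have x: "x \<noteq> 0" using s \<sigma> by auto
    define k where "k = kappa n x t"
    have "k \<ge> k0" unfolding k_def using big t k0 by (intro kappa_ge[OF n t x]) auto
    then have k: "k \<ge> 1" "2 / e0 \<le> k" by (auto simp: k0_def)
    have "1 / k < e0"
    proof -
      have "2 \<le> k * e0" using k e0(1) by (simp add: divide_le_eq)
      then have "1 < k * e0" by simp
      then show ?thesis using k by (simp add: divide_less_eq mult.commute)
    qed
    then have ev: "\<And>X. adm X \<Longrightarrow> \<exists>E. (\<forall>z. cmod (E z) \<le> C / X) \<and> J (1 / k) X = (\<Sum>z\<in>Stat (1 / k). mainT (1 / k) X z * (1 + E z))"
      and reg: "\<And>z. z \<in> Stat (1 / k) \<Longrightarrow> ddPhi (1 / k) z \<noteq> 0 \<and> Re (dirn (1 / k) z) > 0"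
      using e0(2)[of "1 / k"] k by auto
    define X where "X = \<bar>x\<bar> * k"
    have X: "X > 0" using x k by (simp add: X_def)
    then have "adm X" using p by (simp add: adm_def)
    from ev[OF this] obtain E where E: "\<And>z. cmod (E z) \<le> C / X"
      "J (1 / k) X = (\<Sum>z\<in>Stat (1 / k). mainT (1 / k) X z * (1 + E z))" by blast
    have ph: "phase w n x t = Phi (1 / k)" unfolding k_def by (rule phase_eq_Phi[OF t x s])
    have st: "stationary_points w n x t = Stat (1 / k)"
      by (simp add: stationary_points_def Stat_def ph deriv_Phi)
    have kp: "(\<bar>x\<bar> / t) powr (- (a / (real n - 1))) = k powr (- a)" for a
      by (simp add: k_def kappa_def powr_powr)
    have err: "C / X = C * (\<bar>x\<bar> powr (-1) * (\<bar>x\<bar> / t) powr (- 1 / (real n - 1)))"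
      using kp[of 1] x k by (simp add: X_def powr_minus_divide)
    have tm: "of_real (k / (2 * pi)) / of_real (\<sigma> * k) powi p * mainT (1 / k) X z
       = of_real (sgn x powi m * \<bar>x\<bar> powr (- 1 / 2) / sqrt (2 * pi) * (\<bar>x\<bar> / t) powr (- ((of_int m + 1 / 2) / (real n - 1)))) *
         (exp (of_real (large_param n x t) * phase w n x t z + \<i> * of_real (descent_angle w n x t z))
                   / (\<i> * z) powi (m + 1)
                   * of_real (1 / cmod (deriv (deriv (phase w n x t)) z) powr (1 / 2)))"
      if z: "z \<in> Stat (1 / k)" for z
    proof -
      define D where "D = cmod (ddPhi (1 / k) z)"
      have D: "D > 0" using reg[OF z] by (simp add: D_def)
      have ang: "cis (descent_angle w n x t z) = of_real \<sigma> * dirn (1 / k) z"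
        using reg[OF z] by (intro descent_angle_eq[OF t x s _ z]) (auto simp: k_def)
      have ex: "exp (of_real (large_param n x t) * phase w n x t z + \<i> * of_real (descent_angle w n x t z))
          = exp (of_real X * Phi (1 / k) z) * (of_real \<sigma> * dirn (1 / k) z)"
      proof -
        have "large_param n x t = X" unfolding X_def k_def by (rule kappa_props(3)[OF n t x])
        then show ?thesis unfolding ph by (simp only: exp_add ang[symmetric] cis_conv_exp)
      qed
      have dd: "cmod (deriv (deriv (phase w n x t)) z) = D" unfolding ph deriv_Phi D_def ..
      have "complex_of_real (k / (2 * pi)) / of_real (\<sigma> * k) powi p * of_real (sqrt (2 * pi / (X * D)))
          = of_real (k / (2 * pi) / (\<sigma> * k) powi (m + 1) * sqrt (2 * pi / (\<bar>x\<bar> * k * D)))"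
        unfolding X_def m by (simp del: of_real_mult add: of_real_mult[symmetric] of_real_divide[symmetric] of_real_power_int[symmetric] del: of_real_divide of_real_power_int)
      also have "\<dots> = of_real (\<sigma> powi m * \<bar>x\<bar> powr (- 1 / 2) / sqrt (2 * pi) * k powr (- (of_int m + 1 / 2)) * \<sigma> * (1 / D powr (1 / 2)))"
        using prefactor[of k "\<bar>x\<bar>" D m] k x D by simp
      finally have pre: "complex_of_real (k / (2 * pi)) / of_real (\<sigma> * k) powi p * of_real (sqrt (2 * pi / (X * D)))
          = of_real (\<sigma> powi m * \<bar>x\<bar> powr (- 1 / 2) / sqrt (2 * pi) * k powr (- (of_int m + 1 / 2)))
            * of_real \<sigma> * of_real (1 / D powr (1 / 2))" by (simp only: of_real_mult)
      have "of_real (k / (2 * pi)) / of_real (\<sigma> * k) powi p * mainT (1 / k) X z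
          = (complex_of_real (k / (2 * pi)) / of_real (\<sigma> * k) powi p * of_real (sqrt (2 * pi / (X * D))))
            * (exp (of_real X * Phi (1 / k) z) * dirn (1 / k) z * weight z)"
        unfolding mainT_def D_def by (simp only: mult_ac)
      also have "\<dots> = of_real (\<sigma> powi m * \<bar>x\<bar> powr (- 1 / 2) / sqrt (2 * pi) * k powr (- (of_int m + 1 / 2)))
          * (exp (of_real X * Phi (1 / k) z) * (of_real \<sigma> * dirn (1 / k) z) / (\<i> * z) powi (m + 1) * of_real (1 / D powr (1 / 2)))"
        unfolding pre weight_def m by (simp add: mult_ac)
      finally show ?thesis unfolding ex dd kp s .
    qed
    show "\<exists>E. (\<forall>z\<in>stationary_points w n x t. cmod (E z) \<le> C * (\<bar>x\<bar> powr (-1) * (\<bar>x\<bar> / t) powr (- 1 / (real n - 1)))) \<and>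
            osc_integral w n r m x t =
              residue_term w n m x t +
              of_real (sgn x powi m * \<bar>x\<bar> powr (- 1 / 2) / sqrt (2 * pi)
                        * (\<bar>x\<bar> / t) powr (- ((of_int m + 1 / 2) / (real n - 1)))) *
              (\<Sum>z\<in>stationary_points w n x t.
                 exp (of_real (large_param n x t) * phase w n x t z
                        + \<i> * of_real (descent_angle w n x t z))
                   / (\<i> * z) powi (m + 1)
                   * of_real (1 / cmod (deriv (deriv (phase w n x t)) z) powr (1 / 2))
                   * (1 + E z))"
    proof (intro exI[of _ E] conjI ballI)
      show "cmod (E z) \<le> C * (\<bar>x\<bar> powr (-1) * (\<bar>x\<bar> / t) powr (- 1 / (real n - 1)))" for z
        using E(1)[of z] unfolding err .
      have "osc_integral w n r m x t = residue_term w n m x t + of_real (k / (2 * pi)) / of_real (\<sigma> * k) powi p * J (1 / k) X"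
        unfolding k_def X_def using k by (intro osc_integral_eq_J[OF t x s m p r]) (simp add: k_def)
      also have "of_real (k / (2 * pi)) / of_real (\<sigma> * k) powi p * J (1 / k) X
          = (\<Sum>z\<in>Stat (1 / k). (of_real (k / (2 * pi)) / of_real (\<sigma> * k) powi p * mainT (1 / k) X z) * (1 + E z))"
        unfolding E(2) sum_distrib_left by (simp only: mult.assoc)
      also have "\<dots> = (\<Sum>z\<in>Stat (1 / k). of_real (sgn x powi m * \<bar>x\<bar> powr (- 1 / 2) / sqrt (2 * pi) * (\<bar>x\<bar> / t) powr (- ((of_int m + 1 / 2) / (real n - 1)))) *
         (exp (of_real (large_param n x t) * phase w n x t z + \<i> * of_real (descent_angle w n x t z))
                   / (\<i> * z) powi (m + 1)
                   * of_real (1 / cmod (deriv (deriv (phase w n x t)) z) powr (1 / 2)) * (1 + E z)))"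
        by (rule sum.cong[OF refl]) (simp only: tm mult.assoc)
      finally show "osc_integral w n r m x t =
              residue_term w n m x t +
              of_real (sgn x powi m * \<bar>x\<bar> powr (- 1 / 2) / sqrt (2 * pi)
                        * (\<bar>x\<bar> / t) powr (- ((of_int m + 1 / 2) / (real n - 1)))) *
              (\<Sum>z\<in>stationary_points w n x t.
                 exp (of_real (large_param n x t) * phase w n x t z
                        + \<i> * of_real (descent_angle w n x t z))
                   / (\<i> * z) powi (m + 1)
                   * of_real (1 / cmod (deriv (deriv (phase w n x t)) z) powr (1 / 2))
                   * (1 + E z))"
        unfolding st sum_distrib_left .
    qed
  qed
qed

lemma osc_integral_bound:
  assumes m: "m = p - 1" and p: "p \<ge> 0" and r: "0 < r"
  shows "\<exists>C k0. C \<ge> 0 \<and> k0 \<ge> 1 \<and> (\<forall>x t. t > 0 \<and> sgn x = \<sigma> \<and> kappa n x t \<ge> k0 \<and> \<bar>x\<bar> * kappa n x t \<ge> 1 \<longrightarrow>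
      cmod (osc_integral w n r m x t - residue_term w n m x t)
        \<le> C * (kappa n x t powr (- (of_int m + 1 / 2)) * \<bar>x\<bar> powr (- 1 / 2)))"
proof -
  obtain C k0 where C: "C \<ge> 0" "k0 \<ge> 1" "\<And>k a. k \<ge> k0 \<Longrightarrow> a > 0 \<Longrightarrow> a * k \<ge> 1 \<Longrightarrow>
    cmod (of_real k / of_real (\<sigma> * k) powi p * J (1 / k) (a * k))
      \<le> C * (k powr (1 / 2 - of_int p) * a powr (- 1 / 2)) * exp (a * k * MM (1 / k)) \<and> MM (1 / k) \<le> 0"
    by (rule amplitude_bound, rule that, assumption, assumption, blast)
  show ?thesis
  proof (rule exI[of _ C], rule exI[of _ k0], intro conjI allI impI)
    show "C \<ge> 0" "k0 \<ge> 1" by (rule C)+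
  next
    fix x t :: real
    assume "t > 0 \<and> sgn x = \<sigma> \<and> kappa n x t \<ge> k0 \<and> \<bar>x\<bar> * kappa n x t \<ge> 1"
    then have t: "t > 0" and s: "sgn x = \<sigma>" and k: "kappa n x t \<ge> k0" and X: "\<bar>x\<bar> * kappa n x t \<ge> 1" by auto
    have x: "x \<noteq> 0" using s \<sigma> by auto
    define V where "V = of_real (kappa n x t) / of_real (\<sigma> * kappa n x t) powi p * J (1 / kappa n x t) (\<bar>x\<bar> * kappa n x t)"
    have V: "cmod V \<le> C * (kappa n x t powr (1 / 2 - of_int p) * \<bar>x\<bar> powr (- 1 / 2)) * exp (\<bar>x\<bar> * kappa n x t * MM (1 / kappa n x t))"
      "MM (1 / kappa n x t) \<le> 0"
      using C(3)[OF k, of "\<bar>x\<bar>"] X x by (auto simp: V_def)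
    have "exp (\<bar>x\<bar> * kappa n x t * MM (1 / kappa n x t)) \<le> 1"
      using V(2) X by (simp add: mult_nonneg_nonpos)
    then have "C * (kappa n x t powr (1 / 2 - of_int p) * \<bar>x\<bar> powr (- 1 / 2)) * exp (\<bar>x\<bar> * kappa n x t * MM (1 / kappa n x t))
        \<le> C * (kappa n x t powr (1 / 2 - of_int p) * \<bar>x\<bar> powr (- 1 / 2)) * 1"
      using C(1) by (intro mult_left_mono) auto
    then have V1: "cmod V \<le> C * (kappa n x t powr (1 / 2 - of_int p) * \<bar>x\<bar> powr (- 1 / 2))" using V(1) by simp
    have "osc_integral w n r m x t - residue_term w n m x t = of_real (1 / (2 * pi)) * V"
      using osc_integral_eq_J[OF t x s m p r] k C(2) by (simp add: V_def)
    then have "cmod (osc_integral w n r m x t - residue_term w n m x t) = 1 / (2 * pi) * cmod V"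
      by (simp add: norm_mult norm_divide)
    also have "\<dots> \<le> 1 * cmod V" using pi_ge_two by (intro mult_right_mono) auto
    also have "\<dots> \<le> C * (kappa n x t powr (1 / 2 - of_int p) * \<bar>x\<bar> powr (- 1 / 2))" using V1 by simp
    also have "1 / 2 - of_int p = - (of_int m + 1 / 2 :: real)" by (simp add: m)
    finally show "cmod (osc_integral w n r m x t - residue_term w n m x t)
        \<le> C * (kappa n x t powr (- (of_int m + 1 / 2)) * \<bar>x\<bar> powr (- 1 / 2))" .
  qed
qed

text \<open>When the level is at most \<open>- \<mu>\<close>, the exponent
  \<open>\<bar>x\<bar> * kappa * MM\<close> is at most \<open>- \<mu> * \<bar>x\<bar>\<close>
  because \<open>kappa \<ge> 1\<close>; this is enough for decay faster than any power.\<close>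

lemma kernel_deriv_bound:
  assumes t: "t > 0" and p: "p = - int q"
  obtains C x0 where "C \<ge> 0" "\<And>x. sgn x = \<sigma> \<Longrightarrow> \<bar>x\<bar> \<ge> x0 \<Longrightarrow>
      cmod (iterated_vderiv q (solution_kernel w n t) x) \<le> C * (kappa n x t powr (real q + 1 / 2) * \<bar>x\<bar> powr (- 1 / 2))"
    "\<lbrakk>lead 1 < 0; lead (- 1) < 0\<rbrakk> \<Longrightarrow> \<exists>\<mu>>0. \<exists>x1. \<forall>x. sgn x = \<sigma> \<and> \<bar>x\<bar> \<ge> x1 \<longrightarrow>
      cmod (iterated_vderiv q (solution_kernel w n t) x)
        \<le> C * (kappa n x t powr (real q + 1 / 2) * \<bar>x\<bar> powr (- 1 / 2)) * exp (- (\<mu> * \<bar>x\<bar>))"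
proof -
  have wn: "w n \<noteq> 0" using bn by auto
  interpret D: dispersive n w t by unfold_locales (use n wn t in auto)
  obtain C k0 where C: "C \<ge> 0" "k0 \<ge> 1" "\<And>k a. k \<ge> k0 \<Longrightarrow> a > 0 \<Longrightarrow> a * k \<ge> 1 \<Longrightarrow>
    cmod (of_real k / of_real (\<sigma> * k) powi p * J (1 / k) (a * k))
      \<le> C * (k powr (1 / 2 - of_int p) * a powr (- 1 / 2)) * exp (a * k * MM (1 / k)) \<and> MM (1 / k) \<le> 0"
    by (rule amplitude_bound, rule that, assumption, assumption, blast)
  have main: "kappa n x t \<ge> K \<and> cmod (iterated_vderiv q (solution_kernel w n t) x)
      \<le> C * (kappa n x t powr (real q + 1 / 2) * \<bar>x\<bar> powr (- 1 / 2)) * exp (\<bar>x\<bar> * kappa n x t * MM (1 / kappa n x t))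
      \<and> MM (1 / kappa n x t) \<le> 0"
    if s: "sgn x = \<sigma>" and x1: "\<bar>x\<bar> \<ge> max 1 (t * K ^ (n - 1))" and K: "K \<ge> k0" for x K
  proof -
    have x: "x \<noteq> 0" using s \<sigma> by auto
    define k where "k = kappa n x t"
    have kK: "k \<ge> K" unfolding k_def
    proof (rule kappa_ge[OF n t x])
      show "0 \<le> K" using K C(2) by simp
      show "K ^ (n - 1) \<le> \<bar>x\<bar> / t" using x1 t by (simp add: field_simps)
    qed
    then have k: "k \<ge> k0" "k \<ge> 1" using K C(2) by auto
    have "1 * 1 \<le> \<bar>x\<bar> * k" using x1 k by (intro mult_mono) auto
    then have X: "\<bar>x\<bar> * k \<ge> 1" by simp
    then have adm: "adm (\<bar>x\<bar> * kappa n x t)" by (simp add: adm_def k_def)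
    define V where "V = of_real k / of_real (\<sigma> * k) powi p * J (1 / k) (\<bar>x\<bar> * k)"
    have V: "cmod V \<le> C * (k powr (1 / 2 - of_int p) * \<bar>x\<bar> powr (- 1 / 2)) * exp (\<bar>x\<bar> * k * MM (1 / k))" "MM (1 / k) \<le> 0"
      using C(3)[OF k(1), of "\<bar>x\<bar>"] X x by (auto simp: V_def)
    have "iterated_vderiv q (solution_kernel w n t) x = V / (2 * of_real pi)"
      unfolding D.iterated_vderiv_eq V_def k_def using k
      by (subst limit_kernel_eq_J[OF t x s p _ adm]) (auto simp: k_def)
    then have "cmod (iterated_vderiv q (solution_kernel w n t) x) = 1 / (2 * pi) * cmod V"
      by (simp add: norm_divide norm_mult)
    also have "\<dots> \<le> 1 * cmod V" using pi_ge_two by (intro mult_right_mono) auto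
    also have "\<dots> \<le> C * (k powr (1 / 2 - of_int p) * \<bar>x\<bar> powr (- 1 / 2)) * exp (\<bar>x\<bar> * k * MM (1 / k))" using V by simp
    also have "1 / 2 - of_int p = real q + (1 / 2 :: real)" by (simp add: p)
    finally show ?thesis using V(2) kK by (simp add: k_def)
  qed
  show thesis
  proof (rule that[OF C(1)])
    fix x assume s: "sgn x = \<sigma>" and x1: "\<bar>x\<bar> \<ge> max 1 (t * k0 ^ (n - 1))"
    note M = main[OF s x1 order_refl]
    have "kappa n x t \<ge> 0" using M C(2) by linarith
    then have "exp (\<bar>x\<bar> * kappa n x t * MM (1 / kappa n x t)) \<le> 1"
      using M by (simp add: mult_nonneg_nonpos)
    then have "C * (kappa n x t powr (real q + 1 / 2) * \<bar>x\<bar> powr (- 1 / 2)) * exp (\<bar>x\<bar> * kappa n x t * MM (1 / kappa n x t))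
        \<le> C * (kappa n x t powr (real q + 1 / 2) * \<bar>x\<bar> powr (- 1 / 2)) * 1"
      using C(1) by (intro mult_left_mono) auto
    then show "cmod (iterated_vderiv q (solution_kernel w n t) x) \<le> C * (kappa n x t powr (real q + 1 / 2) * \<bar>x\<bar> powr (- 1 / 2))"
      using M by simp
  next
    assume L: "lead 1 < 0" "lead (- 1) < 0"
    obtain \<mu> where \<mu>: "\<mu> > 0" "eventually (\<lambda>e. MM e \<le> - \<mu>) (at_right 0)"
      using MM_negative[OF L] by blast
    obtain e0 where e0: "e0 > 0" "\<And>e. 0 < e \<Longrightarrow> e < e0 \<Longrightarrow> MM e \<le> - \<mu>"
      using \<mu>(2) unfolding eventually_at_right_field by blast
    define K where "K = max k0 (2 / e0)"
    show "\<exists>\<mu>>0. \<exists>x1. \<forall>x. sgn x = \<sigma> \<and> \<bar>x\<bar> \<ge> x1 \<longrightarrow>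
      cmod (iterated_vderiv q (solution_kernel w n t) x)
        \<le> C * (kappa n x t powr (real q + 1 / 2) * \<bar>x\<bar> powr (- 1 / 2)) * exp (- (\<mu> * \<bar>x\<bar>))"
    proof (rule exI[of _ \<mu>], intro conjI, rule \<mu>(1), rule exI[of _ "max 1 (t * K ^ (n - 1))"], intro allI impI)
      fix x assume "sgn x = \<sigma> \<and> \<bar>x\<bar> \<ge> max 1 (t * K ^ (n - 1))"
      then have s: "sgn x = \<sigma>" and x1: "\<bar>x\<bar> \<ge> max 1 (t * K ^ (n - 1))" by auto
      have "K \<ge> k0" by (simp add: K_def)
      note M = main[OF s x1 this]
      define k where "k = kappa n x t"
      have k: "k \<ge> 1" "2 / e0 \<le> k" using M C(2) by (auto simp: K_def k_def)
      have "1 / k < e0"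
      proof -
        have "2 \<le> k * e0" using k e0(1) by (simp add: divide_le_eq)
        then have "1 < k * e0" by simp
        then show ?thesis using k by (simp add: divide_less_eq mult.commute)
      qed
      then have "MM (1 / k) \<le> - \<mu>" using k by (intro e0(2)) auto
      then have "\<bar>x\<bar> * k * MM (1 / k) \<le> \<bar>x\<bar> * k * - \<mu>" using k by (intro mult_left_mono) auto
      also have "\<dots> \<le> \<bar>x\<bar> * 1 * - \<mu>" using k \<mu>(1) by (intro mult_right_mono_neg mult_left_mono) auto
      finally have "exp (\<bar>x\<bar> * k * MM (1 / k)) \<le> exp (- (\<mu> * \<bar>x\<bar>))" by (simp add: mult.commute)
      then have "C * (k powr (real q + 1 / 2) * \<bar>x\<bar> powr (- 1 / 2)) * exp (\<bar>x\<bar> * k * MM (1 / k))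
          \<le> C * (k powr (real q + 1 / 2) * \<bar>x\<bar> powr (- 1 / 2)) * exp (- (\<mu> * \<bar>x\<bar>))"
        using C(1) by (intro mult_left_mono) auto
      then show "cmod (iterated_vderiv q (solution_kernel w n t) x)
        \<le> C * (kappa n x t powr (real q + 1 / 2) * \<bar>x\<bar> powr (- 1 / 2)) * exp (- (\<mu> * \<bar>x\<bar>))"
        using M by (simp add: k_def)
    qed
  qed
qed

end

section \<open>Both signs of x, and the theorem\<close>

text \<open>\<open>a = m + 1 / 2\<close> gives the exponents for the derivatives of the kernel,
  \<open>a = - (m + 1 / 2)\<close> those for small times.\<close>

lemma kappa_powr_half:
  assumes "n \<ge> 2" "t > 0" "x \<noteq> 0"
  shows "kappa n x t powr a * \<bar>x\<bar> powr (- 1 / 2) =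
    t powr (- (a / (real n - 1))) * \<bar>x\<bar> powr ((2 * a - real n + 1) / (2 * (real n - 1)))"
proof -
  have "a / (real n - 1) + - 1 / 2 = (2 * a - real n + 1) / (2 * (real n - 1))"
    using assms(1) by (simp add: field_simps)
  then have "\<bar>x\<bar> powr (a / (real n - 1)) * \<bar>x\<bar> powr (- 1 / 2) = \<bar>x\<bar> powr ((2 * a - real n + 1) / (2 * (real n - 1)))"
    unfolding powr_add[symmetric] by (rule arg_cong)
  then show ?thesis unfolding kappa_powr[OF assms] by (simp add: mult_ac)
qed

lemma powr_exp_decay:
  fixes B M \<mu> :: real
  assumes "\<mu> > 0"
  shows "eventually (\<lambda>y. y powr B * exp (- (\<mu> * y)) \<le> y powr (- M)) at_top"
proof -
  have "((\<lambda>y. y powr (B + M) * exp (- (\<mu> * y))) \<longlongrightarrow> 0) at_top" using assms by real_asymp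
  then have "eventually (\<lambda>y. y powr (B + M) * exp (- (\<mu> * y)) < 1) at_top"
    by (rule order_tendstoD) simp
  then show ?thesis using eventually_gt_at_top[of 0]
  proof eventually_elim
    case (elim y)
    have "y powr B * exp (- (\<mu> * y)) = y powr (B + M) * exp (- (\<mu> * y)) * y powr (- M)"
      using elim(2) by (simp add: powr_add powr_minus field_simps)
    also have "\<dots> \<le> 1 * y powr (- M)" using elim(1) by (intro mult_right_mono) auto
    finally show ?case by simp
  qed
qed

text \<open>The constant for both signs is the maximum of two, hence the monotonicity of
  \<open>Q\<close>; \<open>S > 0\<close> excludes \<open>x = 0\<close>.\<close>

lemma combine_signs:
  fixes Q :: "real \<Rightarrow> real \<Rightarrow> real \<Rightarrow> bool"
  assumes Q: "\<And>\<sigma>::real. \<sigma> = 1 \<or> \<sigma> = -1 \<Longrightarrow>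
      \<exists>C S. S > 0 \<and> (\<forall>x t. t > 0 \<and> \<bar>x / t\<bar> \<ge> S \<and> sgn x = \<sigma> \<longrightarrow> Q C x t)"
    and mono: "\<And>C C' x t. Q C x t \<Longrightarrow> C \<le> C' \<Longrightarrow> Q C' x t"
  shows "\<exists>C S. \<forall>x t. t > 0 \<and> \<bar>x / t\<bar> \<ge> S \<longrightarrow> Q C x t"
proof -
  obtain C1 S1 where 1: "S1 > 0" "\<And>x t. t > 0 \<Longrightarrow> \<bar>x / t\<bar> \<ge> S1 \<Longrightarrow> sgn x = 1 \<Longrightarrow> Q C1 x t"
    using Q[of 1] by blast
  obtain C2 S2 where 2: "S2 > 0" "\<And>x t. t > 0 \<Longrightarrow> \<bar>x / t\<bar> \<ge> S2 \<Longrightarrow> sgn x = -1 \<Longrightarrow> Q C2 x t"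
    using Q[of "-1"] by blast
  show ?thesis
  proof (rule exI[of _ "max C1 C2"], rule exI[of _ "max S1 S2"], intro allI impI)
    fix x t :: real assume a: "t > 0 \<and> \<bar>x / t\<bar> \<ge> max S1 S2"
    then have "x \<noteq> 0" using 1(1) by auto
    then have "sgn x = 1 \<or> sgn x = -1" by (auto simp: sgn_if)
    then show "Q (max C1 C2) x t"
      using 1(2)[of t x] 2(2)[of t x] a mono[of C1 x t "max C1 C2"] mono[of C2 x t "max C1 C2"] by auto
  qed
qed

lemma scaled_phaseI:
  assumes "n \<ge> 2" "w n \<noteq> 0" "\<sigma> = 1 \<or> \<sigma> = -1"
  shows "scaled_phase n w \<sigma>"
  using assms by unfold_locales auto

context scaled_phase
begin

lemma kernel_deriv_side_bound:
  assumes t: "t > 0" and p: "p = - int q"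
  defines "A \<equiv> (2 * real q - real n + 2) / (2 * (real n - 1))"
  shows "\<exists>C x0. C \<ge> 0 \<and>
    (\<forall>x. sgn x = \<sigma> \<and> \<bar>x\<bar> \<ge> x0 \<longrightarrow> cmod (iterated_vderiv q (solution_kernel w n t) x) \<le> C * \<bar>x\<bar> powr A) \<and>
    (odd n \<and> w n * \<sigma> < 0 \<longrightarrow> (\<exists>\<mu>>0. \<exists>x1. \<forall>x. sgn x = \<sigma> \<and> \<bar>x\<bar> \<ge> x1 \<longrightarrow>
      cmod (iterated_vderiv q (solution_kernel w n t) x) \<le> C * (\<bar>x\<bar> powr A * exp (- (\<mu> * \<bar>x\<bar>)))))"
proof -
  obtain C x0 where C: "C \<ge> 0" "\<And>x. sgn x = \<sigma> \<Longrightarrow> \<bar>x\<bar> \<ge> x0 \<Longrightarrow>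
      cmod (iterated_vderiv q (solution_kernel w n t) x) \<le> C * (kappa n x t powr (real q + 1 / 2) * \<bar>x\<bar> powr (- 1 / 2))"
    "\<lbrakk>lead 1 < 0; lead (- 1) < 0\<rbrakk> \<Longrightarrow> \<exists>\<mu>>0. \<exists>x1. \<forall>x. sgn x = \<sigma> \<and> \<bar>x\<bar> \<ge> x1 \<longrightarrow>
      cmod (iterated_vderiv q (solution_kernel w n t) x)
        \<le> C * (kappa n x t powr (real q + 1 / 2) * \<bar>x\<bar> powr (- 1 / 2)) * exp (- (\<mu> * \<bar>x\<bar>))"
    by (rule kernel_deriv_bound[OF t p], rule that, assumption, blast, blast)
  define T where "T = t powr (- ((real q + 1 / 2) / (real n - 1)))"
  have kp: "kappa n x t powr (real q + 1 / 2) * \<bar>x\<bar> powr (- 1 / 2) = T * \<bar>x\<bar> powr A" if "sgn x = \<sigma>" for x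
  proof -
    have "x \<noteq> 0" using that \<sigma> by auto
    moreover have "2 * (real q + 1 / 2) - real n + 1 = 2 * real q - real n + 2" by simp
    ultimately show ?thesis using kappa_powr_half[OF n t, of x "real q + 1 / 2"] unfolding T_def A_def by metis
  qed
  show ?thesis
  proof (rule exI[of _ "C * T"], rule exI[of _ x0], intro conjI allI impI)
    show "0 \<le> C * T" using C(1) by (simp add: T_def)
  next
    fix x assume "sgn x = \<sigma> \<and> x0 \<le> \<bar>x\<bar>"
    then show "cmod (iterated_vderiv q (solution_kernel w n t) x) \<le> C * T * \<bar>x\<bar> powr A"
      using C(2)[of x] kp[of x] by (simp add: mult_ac)
  next
    assume o: "odd n \<and> w n * \<sigma> < 0"
    then have "\<sigma> ^ n = \<sigma>" "even (n - 1)" using \<sigma> by auto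
    then have "lead 1 < 0" "lead (- 1) < 0" using o by (simp_all add: lead_def)
    from C(3)[OF this] obtain \<mu> x1 where \<mu>: "\<mu> > 0" "\<And>x. sgn x = \<sigma> \<Longrightarrow> \<bar>x\<bar> \<ge> x1 \<Longrightarrow>
      cmod (iterated_vderiv q (solution_kernel w n t) x)
        \<le> C * (kappa n x t powr (real q + 1 / 2) * \<bar>x\<bar> powr (- 1 / 2)) * exp (- (\<mu> * \<bar>x\<bar>))" by blast
    show "\<exists>\<mu>>0. \<exists>x1. \<forall>x. sgn x = \<sigma> \<and> \<bar>x\<bar> \<ge> x1 \<longrightarrow>
      cmod (iterated_vderiv q (solution_kernel w n t) x) \<le> C * T * (\<bar>x\<bar> powr A * exp (- (\<mu> * \<bar>x\<bar>)))"
    proof (rule exI[of _ \<mu>], intro conjI, rule \<mu>(1), rule exI[of _ x1], intro allI impI)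
      fix x assume "sgn x = \<sigma> \<and> x1 \<le> \<bar>x\<bar>"
      then show "cmod (iterated_vderiv q (solution_kernel w n t) x) \<le> C * T * (\<bar>x\<bar> powr A * exp (- (\<mu> * \<bar>x\<bar>)))"
        using \<mu>(2)[of x] kp[of x] by (simp add: mult_ac)
    qed
  qed
qed

text \<open>Exponential decay beats every power from some point on. That point depends on
  \<open>M\<close>, and therefore the constant need not.\<close>

lemma kernel_deriv_side_asymptotics:
  assumes t: "t > 0" and p: "p = - int q"
  shows "\<exists>C\<ge>0.
    (\<forall>\<^sub>F x in at_infinity. sgn x = \<sigma> \<longrightarrow> cmod (iterated_vderiv q (solution_kernel w n t) x)
        \<le> C * \<bar>x\<bar> powr ((2 * real q - real n + 2) / (2 * (real n - 1)))) \<and>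
    (odd n \<and> w n * \<sigma> < 0 \<longrightarrow> (\<forall>M. \<forall>\<^sub>F x in at_infinity. sgn x = \<sigma> \<longrightarrow>
      cmod (iterated_vderiv q (solution_kernel w n t) x) \<le> C * \<bar>x\<bar> powr (- M)))"
proof -
  define A where "A = (2 * real q - real n + 2) / (2 * (real n - 1))"
  define K where "K = iterated_vderiv q (solution_kernel w n t)"
  obtain C x0 where C: "C \<ge> 0" "\<And>x. sgn x = \<sigma> \<Longrightarrow> \<bar>x\<bar> \<ge> x0 \<Longrightarrow> cmod (K x) \<le> C * \<bar>x\<bar> powr A"
    "odd n \<and> w n * \<sigma> < 0 \<Longrightarrow> \<exists>\<mu>>0. \<exists>x1. \<forall>x. sgn x = \<sigma> \<and> \<bar>x\<bar> \<ge> x1 \<longrightarrow>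
      cmod (K x) \<le> C * (\<bar>x\<bar> powr A * exp (- (\<mu> * \<bar>x\<bar>)))"
    using kernel_deriv_side_bound[OF t p] unfolding K_def A_def by blast
  have "\<forall>\<^sub>F x in at_infinity. sgn x = \<sigma> \<longrightarrow> cmod (K x) \<le> C * \<bar>x\<bar> powr A"
    unfolding eventually_at_infinity using C(2) by auto
  moreover have "\<forall>\<^sub>F x in at_infinity. sgn x = \<sigma> \<longrightarrow> cmod (K x) \<le> C * \<bar>x\<bar> powr (- M)" if o: "odd n \<and> w n * \<sigma> < 0" for M
  proof -
    obtain \<mu> x1 where \<mu>: "\<mu> > 0" "\<And>x. sgn x = \<sigma> \<Longrightarrow> \<bar>x\<bar> \<ge> x1 \<Longrightarrow> cmod (K x) \<le> C * (\<bar>x\<bar> powr A * exp (- (\<mu> * \<bar>x\<bar>)))"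
      using C(3)[OF o] by blast
    obtain y0 where y0: "\<And>y. y \<ge> y0 \<Longrightarrow> y powr A * exp (- (\<mu> * y)) \<le> y powr (- M)"
      using powr_exp_decay[OF \<mu>(1), of A M] unfolding eventually_at_top_linorder by blast
    show ?thesis unfolding eventually_at_infinity
    proof (rule exI[of _ "max x1 y0"], intro allI impI)
      fix x :: real assume x: "max x1 y0 \<le> norm x" and s: "sgn x = \<sigma>"
      have "cmod (K x) \<le> C * (\<bar>x\<bar> powr A * exp (- (\<mu> * \<bar>x\<bar>)))" using x s by (intro \<mu>(2)) auto
      also have "\<dots> \<le> C * \<bar>x\<bar> powr (- M)" using x C(1) by (intro mult_left_mono y0) auto
      finally show "cmod (K x) \<le> C * \<bar>x\<bar> powr (- M)" .
    qed
  qed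
  ultimately show ?thesis using C(1) unfolding K_def A_def by blast
qed

end

lemma kernel_deriv_asymptotics:
  assumes n: "n \<ge> 2" and wn: "w n \<noteq> 0" and t: "t > 0"
  shows "\<exists>c.
    (\<forall>\<^sub>F x in at_infinity. even n \<or> (odd n \<and> w n * x > 0) \<longrightarrow>
       cmod (iterated_vderiv m (solution_kernel w n t) x)
         \<le> c * \<bar>x\<bar> powr ((2 * real m - real n + 2) / (2 * (real n - 1)))) \<and>
    (\<forall>M::real. M > 0 \<longrightarrow>
       (\<forall>\<^sub>F x in at_infinity. odd n \<and> w n * x < 0 \<longrightarrow>
          cmod (iterated_vderiv m (solution_kernel w n t) x) \<le> c * \<bar>x\<bar> powr (- M)))"
proof -
  define K where "K = iterated_vderiv m (solution_kernel w n t)"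
  let ?A = "(2 * real m - real n + 2) / (2 * (real n - 1))"
  have "\<exists>C\<ge>0. (\<forall>\<^sub>F x in at_infinity. sgn x = \<sigma> \<longrightarrow> cmod (K x) \<le> C * \<bar>x\<bar> powr ?A) \<and>
    (odd n \<and> w n * \<sigma> < 0 \<longrightarrow> (\<forall>M. \<forall>\<^sub>F x in at_infinity. sgn x = \<sigma> \<longrightarrow> cmod (K x) \<le> C * \<bar>x\<bar> powr (- M)))"
    if "\<sigma> = 1 \<or> \<sigma> = -1" for \<sigma>
    unfolding K_def by (rule scaled_phase.kernel_deriv_side_asymptotics[OF scaled_phaseI[OF n _ that, of w] t refl, OF wn])
  from this[of 1] this[of "-1"] obtain C1 C2 where
    1: "C1 \<ge> 0" "\<forall>\<^sub>F x in at_infinity. sgn x = 1 \<longrightarrow> cmod (K x) \<le> C1 * \<bar>x\<bar> powr ?A"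
      "\<And>M. odd n \<Longrightarrow> w n < 0 \<Longrightarrow> \<forall>\<^sub>F x in at_infinity. sgn x = 1 \<longrightarrow> cmod (K x) \<le> C1 * \<bar>x\<bar> powr (- M)"
    and 2: "C2 \<ge> 0" "\<forall>\<^sub>F x in at_infinity. sgn x = -1 \<longrightarrow> cmod (K x) \<le> C2 * \<bar>x\<bar> powr ?A"
      "\<And>M. odd n \<Longrightarrow> w n > 0 \<Longrightarrow> \<forall>\<^sub>F x in at_infinity. sgn x = -1 \<longrightarrow> cmod (K x) \<le> C2 * \<bar>x\<bar> powr (- M)"
    by auto
  define c where "c = C1 + C2"
  have c: "C1 * y \<le> c * y" "C2 * y \<le> c * y" if "y \<ge> 0" for y
    using that 1(1) 2(1) by (auto simp: c_def algebra_simps)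
  have nz: "\<forall>\<^sub>F x::real in at_infinity. x \<noteq> 0"
    unfolding eventually_at_infinity by (rule exI[of _ 1]) auto
  have A: "\<forall>\<^sub>F x in at_infinity. cmod (K x) \<le> c * \<bar>x\<bar> powr ?A"
    using 1(2) 2(2) nz
  proof eventually_elim
    case (elim x)
    then have "cmod (K x) \<le> C1 * \<bar>x\<bar> powr ?A \<or> cmod (K x) \<le> C2 * \<bar>x\<bar> powr ?A"
      by (cases "x > 0") auto
    then show ?case using c[of "\<bar>x\<bar> powr ?A"] by fastforce
  qed
  have B: "\<forall>\<^sub>F x in at_infinity. odd n \<and> w n * x < 0 \<longrightarrow> cmod (K x) \<le> c * \<bar>x\<bar> powr (- M)" for M
  proof (cases "odd n")
    case True
    consider "w n < 0" | "w n > 0" using wn by linarith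
    then show ?thesis
    proof cases
      case 1
      from \<open>\<And>M. odd n \<Longrightarrow> w n < 0 \<Longrightarrow> \<forall>\<^sub>F x in at_infinity. sgn x = 1 \<longrightarrow> cmod (K x) \<le> C1 * \<bar>x\<bar> powr (- M)\<close>[OF True 1, of M]
      show ?thesis
      proof eventually_elim
        case (elim x)
        then show ?case using 1 order_trans[OF _ c(1)[of "\<bar>x\<bar> powr (- M)"]] by (auto simp: mult_less_0_iff)
      qed
    next
      case 2
      from \<open>\<And>M. odd n \<Longrightarrow> w n > 0 \<Longrightarrow> \<forall>\<^sub>F x in at_infinity. sgn x = -1 \<longrightarrow> cmod (K x) \<le> C2 * \<bar>x\<bar> powr (- M)\<close>[OF True 2, of M]
      show ?thesis
      proof eventually_elim
        case (elim x)
        then show ?case using 2 order_trans[OF _ c(2)[of "\<bar>x\<bar> powr (- M)"]] by (auto simp: mult_less_0_iff)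
      qed
    qed
  qed auto
  show ?thesis
  proof (rule exI[of _ c], intro conjI allI impI)
    show "\<forall>\<^sub>F x in at_infinity. even n \<or> (odd n \<and> w n * x > 0) \<longrightarrow>
       cmod (iterated_vderiv m (solution_kernel w n t) x) \<le> c * \<bar>x\<bar> powr ?A"
      using A unfolding K_def by eventually_elim simp
  next
    fix M :: real
    show "\<forall>\<^sub>F x in at_infinity. odd n \<and> w n * x < 0 \<longrightarrow>
          cmod (iterated_vderiv m (solution_kernel w n t) x) \<le> c * \<bar>x\<bar> powr (- M)"
      using B[of M] unfolding K_def .
  qed
qed

lemma osc_integral_small_time:
  assumes n: "n \<ge> 2" and wn: "w n \<noteq> 0" and r: "0 < r" and m: "m \<ge> 0" and \<delta>: "\<delta> > 0"
  shows "\<exists>C\<ge>0. \<forall>\<^sub>F t in at_right 0. \<forall>x. \<bar>x\<bar> \<ge> \<delta> \<longrightarrow>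
     cmod (osc_integral w n r m x t - residue_term w n m x t)
       \<le> C * (t powr ((of_int m + 1 / 2) / (real n - 1))
              * \<bar>x\<bar> powr (- ((2 * of_int m + real n) / (2 * (real n - 1)))))"
proof -
  have "\<exists>C k0. C \<ge> 0 \<and> k0 \<ge> 1 \<and> (\<forall>x t. t > 0 \<and> sgn x = \<sigma> \<and> kappa n x t \<ge> k0 \<and> \<bar>x\<bar> * kappa n x t \<ge> 1 \<longrightarrow>
      cmod (osc_integral w n r m x t - residue_term w n m x t)
        \<le> C * (kappa n x t powr (- (of_int m + 1 / 2)) * \<bar>x\<bar> powr (- 1 / 2)))"
    if "\<sigma> = 1 \<or> \<sigma> = -1" for \<sigma>
    by (rule scaled_phase.osc_integral_bound[OF scaled_phaseI[where w = w and n = n and \<sigma> = \<sigma>], where p = "m + 1"]) (use n wn r m that in auto)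
  from this[of 1] this[of "-1"] obtain C1 k1 C2 k2 where
    1: "C1 \<ge> 0" "k1 \<ge> 1" "\<And>x t. t > 0 \<Longrightarrow> sgn x = 1 \<Longrightarrow> kappa n x t \<ge> k1 \<Longrightarrow> \<bar>x\<bar> * kappa n x t \<ge> 1 \<Longrightarrow>
      cmod (osc_integral w n r m x t - residue_term w n m x t)
        \<le> C1 * (kappa n x t powr (- (of_int m + 1 / 2)) * \<bar>x\<bar> powr (- 1 / 2))" and
    2: "C2 \<ge> 0" "k2 \<ge> 1" "\<And>x t. t > 0 \<Longrightarrow> sgn x = -1 \<Longrightarrow> kappa n x t \<ge> k2 \<Longrightarrow> \<bar>x\<bar> * kappa n x t \<ge> 1 \<Longrightarrow>
      cmod (osc_integral w n r m x t - residue_term w n m x t)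
        \<le> C2 * (kappa n x t powr (- (of_int m + 1 / 2)) * \<bar>x\<bar> powr (- 1 / 2))"
    by metis
  \<comment> \<open>\<open>1 / \<delta>\<close> makes \<open>\<bar>x\<bar> * kappa\<close> at least
    1 for \<open>\<bar>x\<bar> \<ge> \<delta>\<close>, and \<open>k1\<close>, \<open>k2\<close> make
    the scale large enough for either sign. All of this holds once
    \<open>t * k ^ (n - 1) < \<delta>\<close>, uniformly in \<open>x\<close>.\<close>
  define k where "k = max (max k1 k2) (1 / \<delta>)"
  have k: "k \<ge> k1" "k \<ge> k2" "k \<ge> 1 / \<delta>" "k \<ge> 1" using 1(2) by (auto simp: k_def)
  define C where "C = C1 + C2"
  have "\<delta> / k ^ (n - 1) > 0" using \<delta> k(4) by simp
  from eventually_at_right_real[OF this]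
  have "\<forall>\<^sub>F t in at_right 0. \<forall>x. \<bar>x\<bar> \<ge> \<delta> \<longrightarrow>
     cmod (osc_integral w n r m x t - residue_term w n m x t)
       \<le> C * (t powr ((of_int m + 1 / 2) / (real n - 1))
              * \<bar>x\<bar> powr (- ((2 * of_int m + real n) / (2 * (real n - 1)))))"
  proof eventually_elim
    case (elim t)
    then have t: "t > 0" "t * k ^ (n - 1) < \<delta>" using k(4) by (auto simp: less_divide_eq)
    show ?case
    proof (intro allI impI)
      fix x assume x: "\<delta> \<le> \<bar>x\<bar>"
      then have x0: "x \<noteq> 0" using \<delta> by auto
      define B where "B = kappa n x t powr (- (of_int m + 1 / 2)) * \<bar>x\<bar> powr (- 1 / 2)"
      have "k ^ (n - 1) \<le> \<bar>x\<bar> / t" using t x by (simp add: le_divide_eq mult.commute)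
      from kappa_ge[OF n t(1) x0 _ this] have kk: "kappa n x t \<ge> k" using k(4) by simp
      have "\<delta> * (1 / \<delta>) \<le> \<bar>x\<bar> * kappa n x t" using x kk k \<delta> by (intro mult_mono) auto
      then have X: "\<bar>x\<bar> * kappa n x t \<ge> 1" using \<delta> by simp
      have "sgn x = 1 \<or> sgn x = -1" using x0 by (auto simp: sgn_if)
      then have "cmod (osc_integral w n r m x t - residue_term w n m x t) \<le> C1 * B \<or>
        cmod (osc_integral w n r m x t - residue_term w n m x t) \<le> C2 * B"
        using 1(3)[OF t(1) _ _ X] 2(3)[OF t(1) _ _ X] kk k unfolding B_def by force
      moreover have "B \<ge> 0" by (simp add: B_def)
      then have "C1 * B \<le> C * B" "C2 * B \<le> C * B" using 1(1) 2(1) by (auto simp: C_def algebra_simps)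
      ultimately have "cmod (osc_integral w n r m x t - residue_term w n m x t) \<le> C * B" by linarith
      moreover have "B = t powr ((of_int m + 1 / 2) / (real n - 1))
              * \<bar>x\<bar> powr (- ((2 * of_int m + real n) / (2 * (real n - 1))))"
      proof -
        have "2 * (- (of_int m + 1 / 2)) - real n + 1 = - (2 * of_int m + real n)" by simp
        then show ?thesis using kappa_powr_half[OF n t(1) x0, of "- (of_int m + 1 / 2)"]
          unfolding B_def by (simp only: minus_divide_left minus_minus)
      qed
      ultimately show "cmod (osc_integral w n r m x t - residue_term w n m x t)
       \<le> C * (t powr ((of_int m + 1 / 2) / (real n - 1))
              * \<bar>x\<bar> powr (- ((2 * of_int m + real n) / (2 * (real n - 1)))))" by simp
    qed
  qed
  moreover have "C \<ge> 0" using 1(1) 2(1) by (simp add: C_def)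
  ultimately show ?thesis by blast
qed

text \<open>The errors \<open>E z\<close> are relative, one for each stationary point. Since
  \<open>vector_derivative\<close> is a choice, the differentiability clause is what makes
  \<open>iterated_vderiv m\<close> the m-th derivative. For small times,
  \<open>\<bar>x\<bar> powr (- 1 / 2)\<close> times the power of \<open>\<bar>x\<bar> / t\<close>
  has exponent \<open>- (2 * m + n) / (2 * (n - 1))\<close> in \<open>\<bar>x\<bar>\<close>, and
  this rate is uniform on \<open>\<bar>x\<bar> \<ge> \<delta>\<close>; the exponent with
  \<open>2 * n\<close> is smaller and is asserted on bounded sets.\<close>

theorem mainTheorem6:
  fixes n :: nat and w :: "nat \<Rightarrow> real" and r :: real
  assumes "n \<ge> 2" and "w n \<noteq> 0" and "0 < r" and "r < 1"
  shows
    "(\<forall>m::int. m \<ge> -1 \<longrightarrow>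
        (\<exists>C S::real. \<forall>x t::real. t > 0 \<and> \<bar>x / t\<bar> \<ge> S \<longrightarrow>
          (\<exists>E :: complex \<Rightarrow> complex.
            (\<forall>z\<in>stationary_points w n x t.
               cmod (E z) \<le> C * (\<bar>x\<bar> powr (-1) * (\<bar>x\<bar> / t) powr (- 1 / (real n - 1)))) \<and>
            osc_integral w n r m x t =
              residue_term w n m x t +
              of_real (sgn x powi m * \<bar>x\<bar> powr (- 1 / 2) / sqrt (2 * pi)
                        * (\<bar>x\<bar> / t) powr (- ((of_int m + 1 / 2) / (real n - 1)))) *
              (\<Sum>z\<in>stationary_points w n x t.
                 exp (of_real (large_param n x t) * phase w n x t z
                        + \<i> * of_real (descent_angle w n x t z))
                   / (\<i> * z) powi (m + 1)
                   * of_real (1 / cmod (deriv (deriv (phase w n x t)) z) powr (1 / 2))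
                   * (1 + E z)))))
   \<and> (\<forall>(t::real) (m::nat). t > 0 \<longrightarrow>
        (\<forall>j<m. \<forall>x. iterated_vderiv j (solution_kernel w n t) differentiable at x) \<and>
        (\<exists>c::real.
          (\<forall>\<^sub>F x in at_infinity. even n \<or> (odd n \<and> w n * x > 0) \<longrightarrow>
             cmod (iterated_vderiv m (solution_kernel w n t) x)
               \<le> c * \<bar>x\<bar> powr ((2 * real m - real n + 2) / (2 * (real n - 1)))) \<and>
          (\<forall>M::real. M > 0 \<longrightarrow>
             (\<forall>\<^sub>F x in at_infinity. odd n \<and> w n * x < 0 \<longrightarrow>
                cmod (iterated_vderiv m (solution_kernel w n t) x) \<le> c * \<bar>x\<bar> powr (- M)))))
   \<and> (\<forall>(m::int) (\<delta>::real). m \<ge> 0 \<and> \<delta> > 0 \<longrightarrow>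
        (\<exists>C::real. \<forall>\<^sub>F t in at_right 0. \<forall>x. \<bar>x\<bar> \<ge> \<delta> \<longrightarrow>
           cmod (osc_integral w n r m x t - residue_term w n m x t)
             \<le> C * (t powr ((of_int m + 1 / 2) / (real n - 1))
                    * \<bar>x\<bar> powr (- ((2 * of_int m + real n) / (2 * (real n - 1)))))) \<and>
        (\<forall>L::real. \<exists>C::real. \<forall>\<^sub>F t in at_right 0. \<forall>x. \<delta> \<le> \<bar>x\<bar> \<and> \<bar>x\<bar> \<le> L \<longrightarrow>
           cmod (osc_integral w n r m x t - residue_term w n m x t)
             \<le> C * (t powr ((of_int m + 1 / 2) / (real n - 1))
                    * \<bar>x\<bar> powr (- ((2 * of_int m + 2 * real n) / (2 * (real n - 1)))))))"
proof (intro conjI allI impI)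
  fix m :: int assume m: "m \<ge> -1"
  show "\<exists>C S::real. \<forall>x t::real. t > 0 \<and> \<bar>x / t\<bar> \<ge> S \<longrightarrow>
          (\<exists>E :: complex \<Rightarrow> complex.
            (\<forall>z\<in>stationary_points w n x t.
               cmod (E z) \<le> C * (\<bar>x\<bar> powr (-1) * (\<bar>x\<bar> / t) powr (- 1 / (real n - 1)))) \<and>
            osc_integral w n r m x t =
              residue_term w n m x t +
              of_real (sgn x powi m * \<bar>x\<bar> powr (- 1 / 2) / sqrt (2 * pi)
                        * (\<bar>x\<bar> / t) powr (- ((of_int m + 1 / 2) / (real n - 1)))) *
              (\<Sum>z\<in>stationary_points w n x t.
                 exp (of_real (large_param n x t) * phase w n x t z
                        + \<i> * of_real (descent_angle w n x t z))
                   / (\<i> * z) powi (m + 1)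
                   * of_real (1 / cmod (deriv (deriv (phase w n x t)) z) powr (1 / 2))
                   * (1 + E z)))"
    (is "\<exists>C S. \<forall>x t. _ \<longrightarrow> (\<exists>E. (\<forall>z\<in>_. cmod (E z) \<le> C * ?B x t) \<and> ?R x t E)")
  proof (rule combine_signs)
    fix \<sigma> :: real assume "\<sigma> = 1 \<or> \<sigma> = -1"
    then have "scaled_phase n w \<sigma>" using assms by (intro scaled_phaseI) auto
    from scaled_phase.osc_integral_expansion[OF this, where p = "m + 1" and m = m and r = r]
    show "\<exists>C S. S > 0 \<and> (\<forall>x t. t > 0 \<and> \<bar>x / t\<bar> \<ge> S \<and> sgn x = \<sigma> \<longrightarrow>
        (\<exists>E. (\<forall>z\<in>stationary_points w n x t. cmod (E z) \<le> C * ?B x t) \<and> ?R x t E))"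
      using m assms(3) by simp
  next
    fix C C' x t :: real
    assume E: "\<exists>E. (\<forall>z\<in>stationary_points w n x t. cmod (E z) \<le> C * ?B x t) \<and> ?R x t E" and "C \<le> C'"
    have "C * ?B x t \<le> C' * ?B x t" using \<open>C \<le> C'\<close> by (intro mult_right_mono) auto
    with E show "\<exists>E. (\<forall>z\<in>stationary_points w n x t. cmod (E z) \<le> C' * ?B x t) \<and> ?R x t E"
      by (meson order_trans)
  qed
next
  fix t :: real and m j :: nat and x :: real
  assume "t > 0"
  then interpret dispersive n w t by unfold_locales (use assms in auto)
  show "iterated_vderiv j (solution_kernel w n t) differentiable at x"
    by (rule iterated_vderiv_differentiable)
next
  fix t :: real and m :: nat
  assume "t > 0"
  then show "\<exists>c::real.
          (\<forall>\<^sub>F x in at_infinity. even n \<or> (odd n \<and> w n * x > 0) \<longrightarrow>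
             cmod (iterated_vderiv m (solution_kernel w n t) x)
               \<le> c * \<bar>x\<bar> powr ((2 * real m - real n + 2) / (2 * (real n - 1)))) \<and>
          (\<forall>M::real. M > 0 \<longrightarrow>
             (\<forall>\<^sub>F x in at_infinity. odd n \<and> w n * x < 0 \<longrightarrow>
                cmod (iterated_vderiv m (solution_kernel w n t) x) \<le> c * \<bar>x\<bar> powr (- M)))"
    by (intro kernel_deriv_asymptotics assms)
next
  fix m :: int and \<delta> :: real
  assume "m \<ge> 0 \<and> \<delta> > 0"
  then show "\<exists>C::real. \<forall>\<^sub>F t in at_right 0. \<forall>x. \<bar>x\<bar> \<ge> \<delta> \<longrightarrow>
           cmod (osc_integral w n r m x t - residue_term w n m x t)
             \<le> C * (t powr ((of_int m + 1 / 2) / (real n - 1))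
                    * \<bar>x\<bar> powr (- ((2 * of_int m + real n) / (2 * (real n - 1)))))"
    using osc_integral_small_time[of n w r m \<delta>] assms by blast
next
  fix m :: int and \<delta> L :: real
  assume md: "m \<ge> 0 \<and> \<delta> > 0"
  \<comment> \<open>The two exponents differ by \<beta>, and
    \<open>\<bar>x\<bar> powr \<beta> \<le> L powr \<beta>\<close> on the bounded set; the constant
    therefore depends on \<open>L\<close>.\<close>
  define \<beta> where "\<beta> = real n / (2 * (real n - 1))"
  have \<beta>: "\<beta> \<ge> 0" using assms(1) by (simp add: \<beta>_def)
  have ex: "- ((2 * of_int m + real n) / (2 * (real n - 1))) = \<beta> + - ((2 * of_int m + 2 * real n) / (2 * (real n - 1)))"
    unfolding \<beta>_def minus_divide_left add_divide_distrib[symmetric] by simp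
  obtain C where C: "C \<ge> 0" "\<forall>\<^sub>F t in at_right 0. \<forall>x. \<bar>x\<bar> \<ge> \<delta> \<longrightarrow>
           cmod (osc_integral w n r m x t - residue_term w n m x t)
             \<le> C * (t powr ((of_int m + 1 / 2) / (real n - 1))
                    * \<bar>x\<bar> powr (- ((2 * of_int m + real n) / (2 * (real n - 1)))))"
    using osc_integral_small_time[of n w r m \<delta>] assms md by blast
  show "\<exists>C::real. \<forall>\<^sub>F t in at_right 0. \<forall>x. \<delta> \<le> \<bar>x\<bar> \<and> \<bar>x\<bar> \<le> L \<longrightarrow>
           cmod (osc_integral w n r m x t - residue_term w n m x t)
             \<le> C * (t powr ((of_int m + 1 / 2) / (real n - 1))
                    * \<bar>x\<bar> powr (- ((2 * of_int m + 2 * real n) / (2 * (real n - 1)))))"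
  proof (rule exI[of _ "C * L powr \<beta>"], rule eventually_mono[OF C(2)], intro allI impI)
    fix t x :: real
    let ?D = "cmod (osc_integral w n r m x t - residue_term w n m x t)"
    let ?T = "t powr ((of_int m + 1 / 2) / (real n - 1))"
    let ?P = "\<bar>x\<bar> powr (- ((2 * of_int m + 2 * real n) / (2 * (real n - 1))))"
    assume b: "\<forall>x. \<bar>x\<bar> \<ge> \<delta> \<longrightarrow> cmod (osc_integral w n r m x t - residue_term w n m x t)
             \<le> C * (t powr ((of_int m + 1 / 2) / (real n - 1))
                    * \<bar>x\<bar> powr (- ((2 * of_int m + real n) / (2 * (real n - 1)))))"
      and x: "\<delta> \<le> \<bar>x\<bar> \<and> \<bar>x\<bar> \<le> L"
    have "?D \<le> C * (?T * (\<bar>x\<bar> powr \<beta> * ?P))" using b x unfolding ex powr_add by blast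
    also have "\<dots> \<le> C * (?T * (L powr \<beta> * ?P))"
      using C(1) \<beta> x by (intro mult_left_mono mult_right_mono powr_mono2) auto
    finally show "?D \<le> C * L powr \<beta> * (?T * ?P)" by (simp only: mult_ac)
  qed
qed

end
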